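(* There is an algorithm which, given the rank $n$ of a free group $F$ with free basis $\mathcal{B}$ and a finite list of words $w_1,\dots,w_r$ in $F$ generating a malnormal family of cyclic subgroups, with associated decomposition space $\mathcal{D}$, determines a (finite) presentation for the right $F$-module $\check{\mathrm{H}}^1(\mathcal{D},\mathbb{Z})$.
   Context: $F$ is a free group of finite rank $n$ with free basis $\mathcal{B}$, and $\mathcal{T}$ is the Cayley graph of $F$ with respect to $\mathcal{B}$ (a tree, on which $F$ acts on the left by isometries); $\partial_\infty F=\partial_\infty\mathcal{T}$ is its Gromov boundary. The family $\langle w_1\rangle,\dots,\langle w_r\rangle$ is malnormal: each $w_i\neq 1$, and if $g\langle w_i\rangle g^{-1}\cap\langle w_j\rangle\neq 1$ for some $g\in F$ then $i=j$ and $g\in\langle w_i\rangle$. The line pattern $\mathcal{L}$ is the set of lines $\{g w_i^k\}_{k\in\mathbb{Z}}$, $g\in F$, $1\le i\le r$, each identified with the bi-infinite geodesic of $\mathcal{T}$ with end points $\lim_{k\to\pm\infty} g w_i^{k}$. The decomposition space $\mathcal{D}$ is the quotient of $\partial_\infty F$ by the equivalence relation identifying the two end points of each line in $\mathcal{L}$, with the quotient topology. $\check{\mathrm{H}}^*(\mathcal{D},\mathbb{Z})$ is Čech cohomology: the direct limit, over open covers ordered by refinement, of the cohomology of the nerve. The action of $F$ on $\partial_\infty F$ descends to an action on $\mathcal{D}$ by homeomorphisms, and pullback $[\sigma]\cdot g=g^*[\sigma]$ makes $\check{\mathrm{H}}^*(\mathcal{D},\mathbb{Z})$ a right $F$-module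 (i.e. a right $\mathbb{Z}F$-module). Determining a finite presentation of a right $F$-module $M$ means outputting $k\in\mathbb{N}$ and a finite list of elements of $\mathbb{Z}F^k$ such that $M$ is isomorphic to the quotient of the free right module $\mathbb{Z}F^k$ by the submodule generated by that list. *)

theory Defs
  imports
    "HOL-Analysis.Abstract_Topology"
    "HOL-Algebra.Free_Abelian_Groups"
    "HOL-Algebra.AbelCoset"
    "HOL-Library.Nat_Bijection"
begin

section \<open>Partial recursive functions\<close>

datatype recfn =
    Zero
  | Succ
  | Proj nat
  | Comp recfn "recfn list"
  | Prec recfn recfn
  | Mu recfn

text \<open>\<open>computes f xs y\<close>: the program \<open>f\<close> halts on the argument tuple \<open>xs\<close> with value \<open>y\<close>.\<close>

inductive computes :: "recfn \<Rightarrow> nat list \<Rightarrow> nat \<Rightarrow> bool" where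
  zero: "computes Zero xs 0"
| succ: "computes Succ [x] (Suc x)"
| proj: "i < length xs \<Longrightarrow> computes (Proj i) xs (xs ! i)"
| comp: "list_all2 (\<lambda>g y. computes g xs y) gs ys \<Longrightarrow> computes f ys z
    \<Longrightarrow> computes (Comp f gs) xs z"
| prec_0: "computes f xs y \<Longrightarrow> computes (Prec f g) (0 # xs) y"
| prec_Suc: "computes (Prec f g) (m # xs) y \<Longrightarrow> computes g (y # m # xs) z
    \<Longrightarrow> computes (Prec f g) (Suc m # xs) z"
| mu: "computes f (m # xs) 0 \<Longrightarrow> \<forall>l<m. \<exists>y>0. computes f (l # xs) y
    \<Longrightarrow> computes (Mu f) xs m"

lemma computes_deterministic:
  "computes f xs y \<Longrightarrow> computes f xs z \<Longrightarrow> y = z"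
proof (induction arbitrary: z rule: computes.induct)
  case (comp xs gs ys f z z')
  from comp.prems obtain ys' where
    ys': "list_all2 (\<lambda>g y. computes g xs y) gs ys'" "computes f ys' z'"
    by (auto elim: computes.cases)
  have "ys = ys'"
    using comp.IH(1) ys'(1) by (auto simp: list_all2_conv_all_nth intro!: nth_equalityI)
  then show ?case using comp.IH ys' by auto
next
  case (prec_0 f xs y g)
  from prec_0.prems have "computes f xs z" by (auto elim: computes.cases)
  then show ?case by (rule prec_0.IH)
next
  case (prec_Suc f g m xs y z z')
  from prec_Suc.prems obtain y' where "computes (Prec f g) (m # xs) y'" "computes g (y' # m # xs) z'"
    by (auto elim: computes.cases)
  then show ?case using prec_Suc.IH by auto
next
  case (mu f m xs m')
  from mu.prems have m': "computes f (m' # xs) 0" "\<forall>l<m'. \<exists>y>0. computes f (l # xs) y"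
    by (auto elim: computes.cases)
  then show ?case using mu.IH
    by (metis less_numeral_extra(3) linorder_neqE_nat)
qed (auto elim: computes.cases)


section \<open>Free groups\<close>

text \<open>The letter \<open>(i, False)\<close> is the \<open>i\<close>-th basis element and \<open>(i, True)\<close> is its inverse.\<close>

type_synonym letter = "nat \<times> bool"
type_synonym word = "letter list"

definition inv_letter :: "letter \<Rightarrow> letter" where
  "inv_letter x = (fst x, \<not> snd x)"

definition words :: "nat \<Rightarrow> word set" where
  "words n = lists ({..<n} \<times> UNIV)"

definition reduced :: "word \<Rightarrow> bool" where
  "reduced w \<longleftrightarrow> successively (\<lambda>x y. y \<noteq> inv_letter x) w"

fun cancel_cons :: "letter \<Rightarrow> word \<Rightarrow> word" where
  "cancel_cons x [] = [x]"
| "cancel_cons x (y # w) = (if y = inv_letter x then w else x # y # w)"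

definition reduce :: "word \<Rightarrow> word" where
  "reduce w = foldr cancel_cons w []"

definition free_group :: "nat \<Rightarrow> word monoid" where
  "free_group n =
    \<lparr>carrier = {w \<in> words n. reduced w}, mult = (\<lambda>u v. reduce (u @ v)), one = []\<rparr>"

definition free_basis :: "nat \<Rightarrow> word set" where
  "free_basis n = (\<lambda>i. [(i, False)]) ` {..<n}"

lemma inv_letter_inv_letter [simp]: "inv_letter (inv_letter x) = x"
  by (simp add: inv_letter_def)

lemma reduced_cancel_cons: "reduced w \<Longrightarrow> reduced (cancel_cons x w)"
  by (cases w) (auto simp: reduced_def successively_Cons)

lemma reduced_foldr: "reduced v \<Longrightarrow> reduced (foldr cancel_cons u v)"
  by (induction u) (auto simp: reduced_cancel_cons)

lemma reduced_reduce: "reduced (reduce w)"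
  unfolding reduce_def by (rule reduced_foldr) (simp add: reduced_def)

lemma reduce_reduced: "reduced w \<Longrightarrow> reduce w = w"
proof (induction w)
  case (Cons x w)
  then show ?case
    by (cases w) (auto simp: reduce_def reduced_def)
qed (simp add: reduce_def)

lemma cancel_cons_inv_letter:
  assumes "reduced w"
  shows "cancel_cons x (cancel_cons (inv_letter x) w) = w"
proof (cases w)
  case (Cons y v)
  with assms show ?thesis by (cases v) (auto simp: reduced_def)
qed simp

lemma foldr_cancel_cons:
  assumes "reduced z"
  shows "foldr cancel_cons (cancel_cons x w) z = cancel_cons x (foldr cancel_cons w z)"
  using cancel_cons_inv_letter [OF reduced_foldr [OF assms]] by (cases w) auto

lemma reduce_append_left: "reduce (reduce u @ v) = reduce (u @ v)"
proof (induction u)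
  case (Cons x u)
  have "reduce (reduce (x # u) @ v) = foldr cancel_cons (cancel_cons x (reduce u)) (reduce v)"
    by (simp add: reduce_def)
  also have "\<dots> = cancel_cons x (reduce (reduce u @ v))"
    by (subst foldr_cancel_cons) (auto simp: reduced_reduce, simp add: reduce_def)
  also have "\<dots> = reduce ((x # u) @ v)"
    by (simp only: Cons.IH) (simp add: reduce_def)
  finally show ?case .
qed (simp add: reduce_def)

lemma reduce_append_right: "reduce (u @ reduce v) = reduce (u @ v)"
  using reduce_reduced [OF reduced_reduce [of v]] by (simp add: reduce_def)

lemma reduce_inv_append: "reduce (map inv_letter (rev w) @ w) = []"
proof (induction w)
  case (Cons x w)
  have *: "cancel_cons (inv_letter x) (cancel_cons x (reduce w)) = reduce w"
    using cancel_cons_inv_letter [OF reduced_reduce, of "inv_letter x"] by simp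
  have "reduce (map inv_letter (rev (x # w)) @ x # w)
      = foldr cancel_cons (map inv_letter (rev w))
          (cancel_cons (inv_letter x) (cancel_cons x (reduce w)))"
    by (simp add: reduce_def)
  also have "\<dots> = []"
    using Cons unfolding * by (simp add: reduce_def)
  finally show ?case .
qed (simp add: reduce_def)

lemma cancel_cons_words: "cancel_cons x w \<in> words n" if "[x] \<in> words n" "w \<in> words n"
  using that by (cases w) (auto simp: words_def)

lemma reduce_words: "w \<in> words n \<Longrightarrow> reduce w \<in> words n"
proof (induction w)
  case (Cons x w)
  then have "cancel_cons x (reduce w) \<in> words n"
    by (intro cancel_cons_words) (auto simp: words_def)
  then show ?case by (simp add: reduce_def)
qed (simp add: reduce_def)

lemma group_free_group: "group (free_group n)"
proof (rule groupI)
  fix x y z assume "x \<in> carrier (free_group n)" "y \<in> carrier (free_group n)"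
    "z \<in> carrier (free_group n)"
  then show "x \<otimes>\<^bsub>free_group n\<^esub> y \<otimes>\<^bsub>free_group n\<^esub> z =
      x \<otimes>\<^bsub>free_group n\<^esub> (y \<otimes>\<^bsub>free_group n\<^esub> z)"
    by (simp add: free_group_def reduce_append_left reduce_append_right)
next
  fix x y assume "x \<in> carrier (free_group n)" "y \<in> carrier (free_group n)"
  then show "x \<otimes>\<^bsub>free_group n\<^esub> y \<in> carrier (free_group n)"
    using reduce_words [of "x @ y" n] by (auto simp: free_group_def reduced_reduce words_def)
next
  show "\<one>\<^bsub>free_group n\<^esub> \<in> carrier (free_group n)"
    by (simp add: free_group_def words_def reduced_def)
next
  fix x assume x: "x \<in> carrier (free_group n)"
  then show "\<one>\<^bsub>free_group n\<^esub> \<otimes>\<^bsub>free_group n\<^esub> x = x"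
    by (simp add: free_group_def reduce_reduced)
  let ?y = "reduce (map inv_letter (rev x))"
  have "map inv_letter (rev x) \<in> words n"
    using x by (fastforce simp: free_group_def words_def inv_letter_def)
  then have "?y \<in> carrier (free_group n)"
    using reduce_words by (simp add: free_group_def reduced_reduce)
  moreover have "?y \<otimes>\<^bsub>free_group n\<^esub> x = \<one>\<^bsub>free_group n\<^esub>"
    by (simp add: free_group_def reduce_append_left reduce_inv_append)
  ultimately show "\<exists>y\<in>carrier (free_group n). y \<otimes>\<^bsub>free_group n\<^esub> x = \<one>\<^bsub>free_group n\<^esub>"
    by blast
qed

definition malnormal_family :: "('g, 'm) monoid_scheme \<Rightarrow> 'g list \<Rightarrow> bool" where
  "malnormal_family G ws \<longleftrightarrow>
    set ws \<subseteq> carrier G - {\<one>\<^bsub>G\<^esub>} \<and>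
    (\<forall>g\<in>carrier G. \<forall>i<length ws. \<forall>j<length ws.
      ((g <#\<^bsub>G\<^esub> generate G {ws ! i}) #>\<^bsub>G\<^esub> inv\<^bsub>G\<^esub> g) \<inter> generate G {ws ! j} \<noteq> {\<one>\<^bsub>G\<^esub>}
      \<longrightarrow> i = j \<and> g \<in> generate G {ws ! i})"


section \<open>Cayley graphs and Gromov boundaries\<close>

definition cayley_edges :: "('g, 'm) monoid_scheme \<Rightarrow> 'g set \<Rightarrow> ('g \<times> 'g) set" where
  "cayley_edges G S =
    {(g, g \<otimes>\<^bsub>G\<^esub> s) | g s. g \<in> carrier G \<and> (s \<in> S \<or> (\<exists>t\<in>S. s = inv\<^bsub>G\<^esub> t))}"

definition cayley_dist :: "('g, 'm) monoid_scheme \<Rightarrow> 'g set \<Rightarrow> 'g \<Rightarrow> 'g \<Rightarrow> real" where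
  "cayley_dist G S g h = real (LEAST k. (g, h) \<in> cayley_edges G S ^^ k)"

definition gromov_product :: "('a \<Rightarrow> 'a \<Rightarrow> real) \<Rightarrow> 'a \<Rightarrow> 'a \<Rightarrow> 'a \<Rightarrow> real" where
  "gromov_product d p x y = (d x p + d y p - d x y) / 2"

text \<open>The boundary consists of the classes of sequences converging at infinity. For a Cayley graph
  sequences of vertices suffice, as each point is at distance at most \<open>1/2\<close> from a vertex.\<close>

definition tends_to_same_end ::
    "('a \<Rightarrow> 'a \<Rightarrow> real) \<Rightarrow> 'a \<Rightarrow> (nat \<Rightarrow> 'a) \<Rightarrow> (nat \<Rightarrow> 'a) \<Rightarrow> bool" where
  "tends_to_same_end d p x y \<longleftrightarrow>
    filterlim (\<lambda>(i, j). gromov_product d p (x i) (y j)) at_top (sequentially \<times>\<^sub>F sequentially)"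

definition gromov_sequences :: "'a set \<Rightarrow> ('a \<Rightarrow> 'a \<Rightarrow> real) \<Rightarrow> 'a \<Rightarrow> (nat \<Rightarrow> 'a) set" where
  "gromov_sequences M d p = {x. range x \<subseteq> M \<and> tends_to_same_end d p x x}"

definition limit_at_infinity ::
    "'a set \<Rightarrow> ('a \<Rightarrow> 'a \<Rightarrow> real) \<Rightarrow> 'a \<Rightarrow> (nat \<Rightarrow> 'a) \<Rightarrow> (nat \<Rightarrow> 'a) set" where
  "limit_at_infinity M d p x = {y \<in> gromov_sequences M d p. tends_to_same_end d p x y}"

definition gromov_boundary ::
    "'a set \<Rightarrow> ('a \<Rightarrow> 'a \<Rightarrow> real) \<Rightarrow> 'a \<Rightarrow> (nat \<Rightarrow> 'a) set set" where
  "gromov_boundary M d p = limit_at_infinity M d p ` gromov_sequences M d p"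

text \<open>The usual basic neighbourhoods
  \<open>{\<eta>. liminf (x\<^sub>i | y\<^sub>j) \<ge> r for some x \<in> \<xi> and y \<in> \<eta>}\<close> of \<open>\<xi>\<close>; Gromov products of vertices are
  half-integers, so that the limit inferior is at least \<open>r\<close> iff the products eventually are.\<close>

definition boundary_nbhd ::
    "'a set \<Rightarrow> ('a \<Rightarrow> 'a \<Rightarrow> real) \<Rightarrow> 'a \<Rightarrow> (nat \<Rightarrow> 'a) set \<Rightarrow> real \<Rightarrow> (nat \<Rightarrow> 'a) set set" where
  "boundary_nbhd M d p \<xi> r = {\<eta> \<in> gromov_boundary M d p. \<exists>x\<in>\<xi>. \<exists>y\<in>\<eta>.
    \<forall>\<^sub>F (i, j) in sequentially \<times>\<^sub>F sequentially. r \<le> gromov_product d p (x i) (y j)}"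

definition boundary_topology ::
    "'a set \<Rightarrow> ('a \<Rightarrow> 'a \<Rightarrow> real) \<Rightarrow> 'a \<Rightarrow> (nat \<Rightarrow> 'a) set topology" where
  "boundary_topology M d p = topology (\<lambda>U. U \<subseteq> gromov_boundary M d p \<and>
    (\<forall>\<xi>\<in>U. \<exists>r. boundary_nbhd M d p \<xi> r \<subseteq> U))"

lemma boundary_nbhd_antimono: "r \<le> s \<Longrightarrow> boundary_nbhd M d p \<xi> s \<subseteq> boundary_nbhd M d p \<xi> r"
  unfolding boundary_nbhd_def
  by (intro Collect_mono impI) (elim conjE bexE, intro conjI bexI, assumption,
    erule eventually_mono, auto)

lemma openin_boundary_topology:
  "openin (boundary_topology M d p) U \<longleftrightarrow>
    U \<subseteq> gromov_boundary M d p \<and> (\<forall>\<xi>\<in>U. \<exists>r. boundary_nbhd M d p \<xi> r \<subseteq> U)"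
proof -
  let ?L = "\<lambda>U. U \<subseteq> gromov_boundary M d p \<and> (\<forall>\<xi>\<in>U. \<exists>r. boundary_nbhd M d p \<xi> r \<subseteq> U)"
  have "?L (S \<inter> T)" if S: "?L S" and T: "?L T" for S T
  proof (intro conjI ballI)
    fix \<xi> assume "\<xi> \<in> S \<inter> T"
    with S T obtain r s where "boundary_nbhd M d p \<xi> r \<subseteq> S" "boundary_nbhd M d p \<xi> s \<subseteq> T"
      by blast
    then have "boundary_nbhd M d p \<xi> (max r s) \<subseteq> S \<inter> T"
      using boundary_nbhd_antimono [of r "max r s" M d p \<xi>]
        boundary_nbhd_antimono [of s "max r s" M d p \<xi>] by auto
    then show "\<exists>r. boundary_nbhd M d p \<xi> r \<subseteq> S \<inter> T" ..
  qed (use S in blast)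
  moreover have "?L (\<Union>\<K>)" if "\<forall>K\<in>\<K>. ?L K" for \<K>
    using that by (meson Sup_least Union_iff Sup_upper subset_trans)
  ultimately have "istopology ?L"
    unfolding istopology_def by blast
  then show ?thesis
    by (simp add: boundary_topology_def)
qed

lemma topspace_boundary_topology [simp]:
  "topspace (boundary_topology M d p) = gromov_boundary M d p"
proof -
  have "openin (boundary_topology M d p) (gromov_boundary M d p)"
    by (auto simp: openin_boundary_topology boundary_nbhd_def)
  moreover have "topspace (boundary_topology M d p) \<subseteq> gromov_boundary M d p"
    using openin_topspace [of "boundary_topology M d p"] unfolding openin_boundary_topology
    by (elim conjE)
  ultimately show ?thesis
    by (meson openin_subset subset_antisym)
qed

definition quotient_topology :: "'a topology \<Rightarrow> ('a \<times> 'a) set \<Rightarrow> 'a set topology" where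
  "quotient_topology X R =
    topology (\<lambda>U. U \<subseteq> topspace X // R \<and> openin X {x \<in> topspace X. R `` {x} \<in> U})"

lemma openin_quotient_topology:
  "openin (quotient_topology X R) U \<longleftrightarrow>
    U \<subseteq> topspace X // R \<and> openin X {x \<in> topspace X. R `` {x} \<in> U}"
proof -
  let ?pre = "\<lambda>U. {x \<in> topspace X. R `` {x} \<in> U}"
  have "?pre (S \<inter> T) = ?pre S \<inter> ?pre T" for S T by auto
  moreover have "?pre (\<Union>\<K>) = \<Union>(?pre ` \<K>)" for \<K> by auto
  ultimately have "istopology (\<lambda>U. U \<subseteq> topspace X // R \<and> openin X (?pre U))"
    unfolding istopology_def by (simp only:) (auto intro!: openin_Int openin_Union)
  then show ?thesis
    by (simp add: quotient_topology_def)
qed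

lemma topspace_quotient_topology [simp]: "topspace (quotient_topology X R) = topspace X // R"
proof -
  have "{x \<in> topspace X. R `` {x} \<in> topspace X // R} = topspace X"
    by (auto intro: quotientI)
  then have "openin (quotient_topology X R) (topspace X // R)"
    by (simp add: openin_quotient_topology)
  moreover have "topspace (quotient_topology X R) \<subseteq> topspace X // R"
    using openin_topspace [of "quotient_topology X R"] unfolding openin_quotient_topology
    by (elim conjE)
  ultimately show ?thesis
    by (meson openin_subset subset_antisym)
qed

lemma quotient_map_quotient_topology:
  "quotient_map X (quotient_topology X R) (\<lambda>x. R `` {x})"
  by (auto simp: quotient_map_def openin_quotient_topology quotient_def)


section \<open>The decomposition space\<close>

type_synonym bpoint = "(nat \<Rightarrow> word) set"

definition free_dist :: "nat \<Rightarrow> word \<Rightarrow> word \<Rightarrow> real" where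
  "free_dist n = cayley_dist (free_group n) (free_basis n)"

definition free_boundary :: "nat \<Rightarrow> bpoint topology" where
  "free_boundary n = boundary_topology (carrier (free_group n)) (free_dist n) \<one>\<^bsub>free_group n\<^esub>"

definition free_limit :: "nat \<Rightarrow> (nat \<Rightarrow> word) \<Rightarrow> bpoint" where
  "free_limit n = limit_at_infinity (carrier (free_group n)) (free_dist n) \<one>\<^bsub>free_group n\<^esub>"

text \<open>A line \<open>{g w\<^sup>k | k}\<close> is represented by the pair of its end points.\<close>

definition line_pattern :: "nat \<Rightarrow> word list \<Rightarrow> (bpoint \<times> bpoint) set" where
  "line_pattern n ws =
    {(free_limit n (\<lambda>k. g \<otimes>\<^bsub>free_group n\<^esub> w [^]\<^bsub>free_group n\<^esub> int k),
      free_limit n (\<lambda>k. g \<otimes>\<^bsub>free_group n\<^esub> w [^]\<^bsub>free_group n\<^esub> (- int k))) | g w.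
     g \<in> carrier (free_group n) \<and> w \<in> set ws}"

definition decomposition_rel :: "nat \<Rightarrow> word list \<Rightarrow> (bpoint \<times> bpoint) set" where
  "decomposition_rel n ws =
    Restr ((line_pattern n ws \<union> (line_pattern n ws)\<inverse>)\<^sup>*) (topspace (free_boundary n))"

lemma equiv_decomposition_rel: "equiv (topspace (free_boundary n)) (decomposition_rel n ws)"
proof (rule equivI)
  have "sym ((line_pattern n ws \<union> (line_pattern n ws)\<inverse>)\<^sup>*)"
    by (intro sym_rtrancl sym_Un_converse)
  then show "sym (decomposition_rel n ws)"
    unfolding decomposition_rel_def by (auto simp: sym_def)
  show "trans (decomposition_rel n ws)"
    unfolding decomposition_rel_def by (auto intro!: transI intro: rtrancl_trans)
qed (auto simp: decomposition_rel_def refl_on_def)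

definition decomposition_space :: "nat \<Rightarrow> word list \<Rightarrow> bpoint set topology" where
  "decomposition_space n ws = quotient_topology (free_boundary n) (decomposition_rel n ws)"

definition translate_bpoint :: "nat \<Rightarrow> word \<Rightarrow> bpoint \<Rightarrow> bpoint" where
  "translate_bpoint n g \<xi> = (\<lambda>x k. g \<otimes>\<^bsub>free_group n\<^esub> x k) ` \<xi>"

definition translate :: "nat \<Rightarrow> word \<Rightarrow> bpoint set \<Rightarrow> bpoint set" where
  "translate n g P = translate_bpoint n g ` P"


section \<open>Cohomology of simplicial complexes\<close>

text \<open>A simplicial complex is given by the set \<open>K\<close> of its (finite nonempty) simplices. A cochain is
  a function on the ordered simplices, vertices possibly repeated, extended by \<open>0\<close> to all lists.\<close>

definition cochains :: "'v set set \<Rightarrow> nat \<Rightarrow> ('v list \<Rightarrow> int) set" where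
  "cochains K p = {c. \<forall>vs. \<not> (length vs = Suc p \<and> set vs \<in> K) \<longrightarrow> c vs = 0}"

definition coboundary :: "'v set set \<Rightarrow> ('v list \<Rightarrow> int) \<Rightarrow> 'v list \<Rightarrow> int" where
  "coboundary K c vs =
    (if set vs \<in> K then \<Sum>i<length vs. (- 1) ^ i * c (take i vs @ drop (Suc i) vs) else 0)"

definition cocycle_group :: "'v set set \<Rightarrow> nat \<Rightarrow> ('v list \<Rightarrow> int) monoid" where
  "cocycle_group K p =
    \<lparr>carrier = {c \<in> cochains K p. coboundary K c = (\<lambda>_. 0)},
     mult = (\<lambda>a b vs. a vs + b vs), one = (\<lambda>_. 0)\<rparr>"

definition coboundaries :: "'v set set \<Rightarrow> nat \<Rightarrow> ('v list \<Rightarrow> int) set" where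
  "coboundaries K p = (case p of 0 \<Rightarrow> {\<lambda>_. 0} | Suc q \<Rightarrow> coboundary K ` cochains K q)"

definition cohomology :: "'v set set \<Rightarrow> nat \<Rightarrow> ('v list \<Rightarrow> int) set monoid" where
  "cohomology K p = cocycle_group K p Mod coboundaries K p"

definition cochain_pullback ::
    "'v set set \<Rightarrow> ('v \<Rightarrow> 'u) \<Rightarrow> ('u list \<Rightarrow> int) \<Rightarrow> 'v list \<Rightarrow> int" where
  "cochain_pullback K \<phi> c vs = (if set vs \<in> K then c (map \<phi> vs) else 0)"

text \<open>The map induced on cohomology by a simplicial map \<open>\<phi>\<close> from \<open>K\<close> to another complex: all the
  cosets in the union agree.\<close>

definition cohomology_pullback ::
    "'v set set \<Rightarrow> nat \<Rightarrow> ('v \<Rightarrow> 'u) \<Rightarrow> ('u list \<Rightarrow> int) set \<Rightarrow> ('v list \<Rightarrow> int) set" where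
  "cohomology_pullback K p \<phi> a =
    (\<Union>c\<in>a. coboundaries K p #>\<^bsub>cocycle_group K p\<^esub> cochain_pullback K \<phi> c)"


section \<open>Cech cohomology\<close>

definition open_cover :: "'a topology \<Rightarrow> 'a set set \<Rightarrow> bool" where
  "open_cover X \<U> \<longleftrightarrow> (\<forall>U\<in>\<U>. openin X U) \<and> \<Union>\<U> = topspace X"

definition nerve :: "'a set set \<Rightarrow> 'a set set set" where
  "nerve \<U> = {\<sigma>. finite \<sigma> \<and> \<sigma> \<noteq> {} \<and> \<sigma> \<subseteq> \<U> \<and> \<Inter>\<sigma> \<noteq> {}}"

text \<open>For \<open>f = id\<close> this says that \<open>\<V>\<close> refines \<open>\<U>\<close>, with refinement projection \<open>\<phi>\<close>.\<close>

definition refines_along ::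
    "('a \<Rightarrow> 'b) \<Rightarrow> 'a set set \<Rightarrow> 'b set set \<Rightarrow> ('a set \<Rightarrow> 'b set) \<Rightarrow> bool" where
  "refines_along f \<V> \<U> \<phi> \<longleftrightarrow> (\<forall>V\<in>\<V>. \<phi> V \<in> \<U> \<and> f ` V \<subseteq> \<phi> V)"

type_synonym 'a cech_elem = "'a set set \<times> ('a set list \<Rightarrow> int) set"

definition cech_elems :: "nat \<Rightarrow> 'a topology \<Rightarrow> 'a cech_elem set" where
  "cech_elems p X = {(\<U>, a). open_cover X \<U> \<and> a \<in> carrier (cohomology (nerve \<U>) p)}"

definition cech_rel :: "nat \<Rightarrow> 'a topology \<Rightarrow> ('a cech_elem \<times> 'a cech_elem) set" where
  "cech_rel p X = {((\<U>, a), (\<V>, b)). (\<U>, a) \<in> cech_elems p X \<and> (\<V>, b) \<in> cech_elems p X \<and>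
    (\<exists>\<W> \<phi> \<psi>. open_cover X \<W> \<and> refines_along id \<W> \<U> \<phi> \<and> refines_along id \<W> \<V> \<psi> \<and>
      cohomology_pullback (nerve \<W>) p \<phi> a = cohomology_pullback (nerve \<W>) p \<psi> b)}"

text \<open>The direct limit. Any two classes have representatives over a common cover, and the product
  of two classes is the class of the product of such representatives.\<close>

definition cech_cohomology :: "nat \<Rightarrow> 'a topology \<Rightarrow> 'a cech_elem set monoid" where
  "cech_cohomology p X =
    \<lparr>carrier = cech_elems p X // cech_rel p X,
     mult = (\<lambda>A B. cech_rel p X ``
       {(\<U>, a \<otimes>\<^bsub>cohomology (nerve \<U>) p\<^esub> b) | \<U> a b. (\<U>, a) \<in> A \<and> (\<U>, b) \<in> B}),
     one = cech_rel p X `` {(\<U>, \<one>\<^bsub>cohomology (nerve \<U>) p\<^esub>) | \<U>. open_cover X \<U>}\<rparr>"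

text \<open>The homomorphism induced by a continuous map \<open>f\<close> from \<open>X\<close> to another space.\<close>

definition cech_pullback ::
    "nat \<Rightarrow> 'a topology \<Rightarrow> ('a \<Rightarrow> 'b) \<Rightarrow> 'b cech_elem set \<Rightarrow> 'a cech_elem set" where
  "cech_pullback p X f A = cech_rel p X ``
    {(\<V>, cohomology_pullback (nerve \<V>) p \<phi> a) | \<V> \<phi> \<U> a.
      (\<U>, a) \<in> A \<and> open_cover X \<V> \<and> refines_along f \<V> \<U> \<phi>}"


section \<open>Right modules\<close>

text \<open>As for the library's record of left modules, the fields \<open>mult\<close> and \<open>one\<close> are irrelevant.\<close>

record ('a, 'b) right_module = "'b ring" +
  rsmult :: "'b \<Rightarrow> 'a \<Rightarrow> 'b" (infixl \<open>\<odot>\<^sub>r\<index>\<close> 70)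

definition right_submodule ::
    "('a, 'm) ring_scheme \<Rightarrow> ('a, 'b, 'n) right_module_scheme \<Rightarrow> 'b set \<Rightarrow> bool" where
  "right_submodule R M N \<longleftrightarrow> additive_subgroup N M \<and>
    (\<forall>x\<in>N. \<forall>a\<in>carrier R. x \<odot>\<^sub>r\<^bsub>M\<^esub> a \<in> N)"

definition generated_submodule ::
    "('a, 'm) ring_scheme \<Rightarrow> ('a, 'b, 'n) right_module_scheme \<Rightarrow> 'b set \<Rightarrow> 'b set" where
  "generated_submodule R M S = right_submodule R M hull S"

definition quotient_module ::
    "('a, 'b, 'n) right_module_scheme \<Rightarrow> 'b set \<Rightarrow> ('a, 'b set) right_module" where
  "quotient_module M N =
    \<lparr>carrier = a_rcosets\<^bsub>M\<^esub> N, mult = undefined, one = undefined, zero = N,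
     add = (\<lambda>A B. A <+>\<^bsub>M\<^esub> B), rsmult = (\<lambda>A a. N <+>\<^bsub>M\<^esub> ((\<lambda>x. x \<odot>\<^sub>r\<^bsub>M\<^esub> a) ` A))\<rparr>"

definition free_right_module ::
    "('a, 'm) ring_scheme \<Rightarrow> nat \<Rightarrow> ('a, nat \<Rightarrow> 'a) right_module" where
  "free_right_module R k =
    \<lparr>carrier = {..<k} \<rightarrow>\<^sub>E carrier R, mult = undefined, one = undefined,
     zero = (\<lambda>i\<in>{..<k}. \<zero>\<^bsub>R\<^esub>), add = (\<lambda>x y. \<lambda>i\<in>{..<k}. x i \<oplus>\<^bsub>R\<^esub> y i),
     rsmult = (\<lambda>x a. \<lambda>i\<in>{..<k}. x i \<otimes>\<^bsub>R\<^esub> a)\<rparr>"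

definition right_module_isomorphic ::
    "('a, 'm) ring_scheme \<Rightarrow> ('a, 'b, 'n) right_module_scheme
      \<Rightarrow> ('a, 'c, 'k) right_module_scheme \<Rightarrow> bool" where
  "right_module_isomorphic R M N \<longleftrightarrow>
    (\<exists>h. bij_betw h (carrier M) (carrier N) \<and>
      (\<forall>x\<in>carrier M. \<forall>y\<in>carrier M. h (x \<oplus>\<^bsub>M\<^esub> y) = h x \<oplus>\<^bsub>N\<^esub> h y) \<and>
      (\<forall>x\<in>carrier M. \<forall>a\<in>carrier R. h (x \<odot>\<^sub>r\<^bsub>M\<^esub> a) = h x \<odot>\<^sub>r\<^bsub>N\<^esub> a))"

definition group_ring :: "('g, 'm) monoid_scheme \<Rightarrow> ('g \<Rightarrow>\<^sub>0 int) ring" where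
  "group_ring G =
    \<lparr>carrier = {a. Poly_Mapping.keys a \<subseteq> carrier G},
     mult = (\<lambda>a b. frag_extend (\<lambda>g. frag_extend (\<lambda>h. frag_of (g \<otimes>\<^bsub>G\<^esub> h)) b) a),
     one = frag_of \<one>\<^bsub>G\<^esub>, zero = 0, add = (+)\<rparr>"

text \<open>The right module over the integral group ring given by a (multiplicatively written) abelian
  group \<open>C\<close> with a right action \<open>act\<close> of the group.\<close>

definition group_ring_module ::
    "('b, 'm) monoid_scheme \<Rightarrow> ('b \<Rightarrow> 'g \<Rightarrow> 'b) \<Rightarrow> ('g \<Rightarrow>\<^sub>0 int, 'b) right_module" where
  "group_ring_module C act =
    \<lparr>carrier = carrier C, mult = undefined, one = undefined, zero = \<one>\<^bsub>C\<^esub>,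
     add = (\<lambda>x y. x \<otimes>\<^bsub>C\<^esub> y),
     rsmult = (\<lambda>x a. finprod C (\<lambda>g. act x g [^]\<^bsub>C\<^esub> Poly_Mapping.lookup a g)
       (Poly_Mapping.keys a))\<rparr>"

definition decomposition_H1 ::
    "nat \<Rightarrow> word list \<Rightarrow> (word \<Rightarrow>\<^sub>0 int, bpoint set cech_elem set) right_module" where
  "decomposition_H1 n ws =
    group_ring_module (cech_cohomology 1 (decomposition_space n ws))
      (\<lambda>x g. cech_pullback 1 (decomposition_space n ws) (translate n g) x)"


section \<open>Finite presentations and their encodings\<close>

text \<open>An element of the group ring is written down as a list of coefficients and words, and an
  element of its \<open>k\<close>-th power as a list of \<open>k\<close> such elements.\<close>

type_synonym formal_sum = "(int \<times> word) list"

definition eval_sum :: "formal_sum \<Rightarrow> word \<Rightarrow>\<^sub>0 int" where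
  "eval_sum s = (\<Sum>(c, w)\<leftarrow>s. frag_cmul c (frag_of (reduce w)))"

definition eval_vector :: "formal_sum list \<Rightarrow> nat \<Rightarrow> word \<Rightarrow>\<^sub>0 int" where
  "eval_vector v = (\<lambda>i\<in>{..<length v}. eval_sum (v ! i))"

definition is_presentation ::
    "nat \<Rightarrow> nat \<Rightarrow> formal_sum list list \<Rightarrow> (word \<Rightarrow>\<^sub>0 int, 'b, 'n) right_module_scheme \<Rightarrow> bool" where
  "is_presentation n k rels M \<longleftrightarrow>
    (\<forall>v\<in>set rels. length v = k \<and> (\<forall>s\<in>set v. snd ` set s \<subseteq> words n)) \<and>
    (let R = group_ring (free_group n); L = free_right_module R k in
      right_module_isomorphic R M
        (quotient_module L (generated_submodule R L (eval_vector ` set rels))))"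

definition encode_word :: "word \<Rightarrow> nat" where
  "encode_word w = list_encode (map (\<lambda>(i, b). prod_encode (i, of_bool b)) w)"

definition encode_input :: "nat \<Rightarrow> word list \<Rightarrow> nat" where
  "encode_input n ws = prod_encode (n, list_encode (map encode_word ws))"

definition encode_sum :: "formal_sum \<Rightarrow> nat" where
  "encode_sum s = list_encode (map (\<lambda>(c, w). prod_encode (int_encode c, encode_word w)) s)"

definition encode_presentation :: "nat \<Rightarrow> formal_sum list list \<Rightarrow> nat" where
  "encode_presentation k rels =
    prod_encode (k, list_encode (map (\<lambda>v. list_encode (map encode_sum v)) rels))"

end

theory Submission
  imports Defs
begin

text \<open>
  Only finitely many lines of the pattern have their two ends separated by a given clopen set of
  ends.  Let \<open>c\<close> be a cocycle on an open cover of \<open>\<D>\<close> and \<open>u\<close> a locally constant choice, for each end,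
  of a member of the cover containing its image.  The jump of \<open>c\<close> across a line \<open>(a, b)\<close> is
  \<open>c (u b, u a)\<close>; it vanishes on almost all lines.  Because the space of ends is zero-dimensional,
  the class of \<open>c\<close> is trivial exactly if its jumps are the differences \<open>f a - f b\<close> of a locally constant
  function \<open>f\<close>, and each finitely supported function on the lines is a jump.  So the first Cech cohomology
  group is the free abelian group on the lines modulo the jumps of locally constant functions.

  By malnormality the translates of the axis of \<open>w\<^sub>i\<close> are in bijection with the cosets of the subgroup
  generated by \<open>w\<^sub>i\<close>, so the free abelian group on the lines has generators \<open>e\<^sub>i\<close> and relations
  \<open>e\<^sub>i (w\<^sub>i - 1)\<close>.  The locally constant functions are generated, as a module, by the constants and the
  indicators of the cylinders of single letters, and the jump of the cylinder of \<open>x\<close> across the lines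
  is given by the Fox derivatives \<open>\<partial>w\<^sub>i / \<partial>x\<close>.  These additional relations are recursive in the words.
\<close>

section \<open>Recursive functions on encoded data\<close>

text \<open>Malnormality is a hypothesis of correctness only: the algorithm writes the relations
  down without testing anything, and the words need not even be reduced. No cover of \<D> is
  computed either. A class in the direct limit is recognised by its jumps modulo those of locally
  constant functions, an invariant that refinement does not change, so no cofinal system of covers
  has to be chosen.

  F acts on lines from the left, while pullback gives a right module. Hence the group element h in
  coordinate i stands for the translate of the axis of w_i by the inverse of h, and inverses appear
  wherever lines meet the group ring.

  Fox derivatives enter geometrically. The coefficient of the inverse of h in the derivative of w by
  x counts, with sign, how often the path labelled w that starts at h runs through the edge from 1
  to x. Summed over a coset of the subgroup generated by w this counts the passages of a whole axis,
  that is, the difference of the values of the indicator of the cylinder of x at the two ends.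
  Backtracking contributes opposite signs, so unreduced words do no harm.\<close>

definition rec_fun :: "nat \<Rightarrow> (nat list \<Rightarrow> nat) \<Rightarrow> bool" where
  "rec_fun k F \<longleftrightarrow> (\<exists>A. \<forall>xs. length xs = k \<longrightarrow> computes A xs (F xs))"

lemma rec_fun_const: "rec_fun k (\<lambda>_. c)"
proof (induction c)
  case 0
  show ?case unfolding rec_fun_def using zero by blast
next
  case (Suc c)
  then obtain A where A: "\<And>xs. length xs = k \<Longrightarrow> computes A xs c"
    unfolding rec_fun_def by blast
  have "computes (Comp Succ [A]) xs (Suc c)" if "length xs = k" for xs
    by (rule comp [where ys = "[c]"]) (auto simp: A that intro: succ)
  then show ?case unfolding rec_fun_def by blast
qed

lemma rec_fun_proj: "i < k \<Longrightarrow> rec_fun k (\<lambda>xs. xs ! i)"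
  unfolding rec_fun_def using proj by metis

lemma rec_fun_Suc: "rec_fun 1 (\<lambda>xs. Suc (xs ! 0))"
proof -
  have "computes Succ xs (Suc (xs ! 0))" if "length xs = 1" for xs
    using that succ by (cases xs) auto
  then show ?thesis unfolding rec_fun_def by blast
qed

lemma rec_fun_comp:
  assumes "rec_fun m F" "length Gs = m" "\<And>G. G \<in> set Gs \<Longrightarrow> rec_fun k G"
  shows "rec_fun k (\<lambda>xs. F (map (\<lambda>G. G xs) Gs))"
proof -
  from assms(1) obtain A where A: "\<And>xs. length xs = m \<Longrightarrow> computes A xs (F xs)"
    unfolding rec_fun_def by blast
  from assms(3) have "\<forall>G\<in>set Gs. \<exists>B. \<forall>xs. length xs = k \<longrightarrow> computes B xs (G xs)"
    unfolding rec_fun_def by blast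
  then obtain B where B: "\<And>G xs. G \<in> set Gs \<Longrightarrow> length xs = k \<Longrightarrow> computes (B G) xs (G xs)"
    by metis
  have "computes (Comp A (map B Gs)) xs (F (map (\<lambda>G. G xs) Gs))" if "length xs = k" for xs
    by (rule comp [where ys = "map (\<lambda>G. G xs) Gs"])
      (auto simp: list_all2_conv_all_nth assms(2) that intro!: A B)
  then show ?thesis unfolding rec_fun_def by blast
qed

lemma rec_fun_comp1: "rec_fun 1 F \<Longrightarrow> rec_fun k G \<Longrightarrow> rec_fun k (\<lambda>xs. F [G xs])"
  using rec_fun_comp [of 1 F "[G]" k] by auto

lemma rec_fun_comp2:
  "rec_fun 2 F \<Longrightarrow> rec_fun k G \<Longrightarrow> rec_fun k H \<Longrightarrow> rec_fun k (\<lambda>xs. F [G xs, H xs])"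
  using rec_fun_comp [of 2 F "[G, H]" k] by auto

lemma rec_fun_rec:
  assumes F: "rec_fun k F" and G: "rec_fun (Suc (Suc k)) G"
  shows "rec_fun (Suc k) (\<lambda>xs. rec_nat (F (tl xs)) (\<lambda>m y. G (y # m # tl xs)) (hd xs))"
proof -
  from F obtain A where A: "\<And>xs. length xs = k \<Longrightarrow> computes A xs (F xs)"
    unfolding rec_fun_def by blast
  from G obtain B where B: "\<And>xs. length xs = Suc (Suc k) \<Longrightarrow> computes B xs (G xs)"
    unfolding rec_fun_def by blast
  have *: "computes (Prec A B) (n # xs) (rec_nat (F xs) (\<lambda>m y. G (y # m # xs)) n)"
    if "length xs = k" for n xs
    by (induction n) (simp_all add: that A B computes.prec_0 computes.prec_Suc)
  have "computes (Prec A B) xs (rec_nat (F (tl xs)) (\<lambda>m y. G (y # m # tl xs)) (hd xs))"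
    if "length xs = Suc k" for xs
    using that * [of "tl xs" "hd xs"] by (cases xs) auto
  then show ?thesis unfolding rec_fun_def by blast
qed

section \<open>Unary and binary recursive functions\<close>

definition rec1 :: "(nat \<Rightarrow> nat) \<Rightarrow> bool" where
  "rec1 f \<longleftrightarrow> rec_fun 1 (\<lambda>xs. f (xs ! 0))"

definition rec2 :: "(nat \<Rightarrow> nat \<Rightarrow> nat) \<Rightarrow> bool" where
  "rec2 f \<longleftrightarrow> rec_fun 2 (\<lambda>xs. f (xs ! 0) (xs ! 1))"

lemma rec_fun_rec1: "rec1 f \<Longrightarrow> rec_fun k G \<Longrightarrow> rec_fun k (\<lambda>xs. f (G xs))"
  unfolding rec1_def by (drule (1) rec_fun_comp1) simp

lemma rec_fun_rec2:
  "rec2 f \<Longrightarrow> rec_fun k G \<Longrightarrow> rec_fun k H \<Longrightarrow> rec_fun k (\<lambda>xs. f (G xs) (H xs))"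
  unfolding rec2_def by (drule (2) rec_fun_comp2) simp

lemma rec1_rec:
  assumes "rec2 g" "\<And>n. f n = rec_nat c (\<lambda>m y. g y m) n"
  shows "rec1 f"
proof -
  have "rec_fun (Suc 0) (\<lambda>xs. rec_nat c (\<lambda>m y. (\<lambda>zs. g (zs ! 0) (zs ! 1)) (y # m # tl xs)) (hd xs))"
    using assms(1) unfolding rec2_def numeral_2_eq_2
    by (intro rec_fun_rec [where F = "\<lambda>_. c"] rec_fun_const)
  then obtain A where
    A: "\<And>xs. length xs = Suc 0 \<Longrightarrow> computes A xs (rec_nat c (\<lambda>m y. g y m) (hd xs))"
    unfolding rec_fun_def by auto
  have "computes A xs (f (xs ! 0))" if "length xs = 1" for xs
    using A [of xs] that by (cases xs) (auto simp: assms(2))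
  then show ?thesis unfolding rec1_def rec_fun_def by blast
qed

lemma rec2_rec:
  assumes "rec1 h" "rec2 g" "\<And>n x. f n x = rec_nat (h x) (\<lambda>m y. g y x) n"
  shows "rec2 f"
proof -
  have "rec_fun (Suc 1) (\<lambda>xs. rec_nat ((\<lambda>zs. h (zs ! 0)) (tl xs))
      (\<lambda>m y. (\<lambda>zs. g (zs ! 0) (zs ! 2)) (y # m # tl xs)) (hd xs))"
  proof (rule rec_fun_rec)
    show "rec_fun 1 (\<lambda>zs. h (zs ! 0))" using assms(1) unfolding rec1_def .
    show "rec_fun (Suc (Suc 1)) (\<lambda>zs. g (zs ! 0) (zs ! 2))"
      by (rule rec_fun_rec2 [OF assms(2)]) (rule rec_fun_proj, simp)+
  qed
  then obtain A where
    A: "\<And>xs. length xs = 2 \<Longrightarrow> computes A xs (rec_nat (h (tl xs ! 0)) (\<lambda>m y. g y (tl xs ! 0)) (hd xs))"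
    unfolding rec_fun_def by (auto simp: numeral_2_eq_2)
  have "computes A xs (f (xs ! 0) (xs ! 1))" if "length xs = 2" for xs
    using A [of xs] that by (cases xs; cases "tl xs") (auto simp: assms(3))
  then show ?thesis unfolding rec2_def rec_fun_def by blast
qed

lemma rec1_const: "rec1 (\<lambda>_. c)"
  and rec1_id: "rec1 (\<lambda>n. n)"
  and rec1_Suc: "rec1 Suc"
  unfolding rec1_def by (intro rec_fun_const rec_fun_proj rec_fun_Suc zero_less_one)+

lemma rec2_fst: "rec2 (\<lambda>m n. m)" and rec2_snd: "rec2 (\<lambda>m n. n)"
  unfolding rec2_def by (auto intro: rec_fun_proj)

lemma rec2_const: "rec2 (\<lambda>_ _. c)"
  unfolding rec2_def by (rule rec_fun_const)

lemma rec1_comp1: "rec1 f \<Longrightarrow> rec1 g \<Longrightarrow> rec1 (\<lambda>n. f (g n))"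
  unfolding rec1_def [of g] rec1_def [of "\<lambda>n. f (g n)"] by (rule rec_fun_rec1)

lemma rec1_comp2: "rec2 f \<Longrightarrow> rec1 g \<Longrightarrow> rec1 h \<Longrightarrow> rec1 (\<lambda>n. f (g n) (h n))"
  unfolding rec1_def [of g] rec1_def [of h] rec1_def [of "\<lambda>n. f (g n) (h n)"]
  by (rule rec_fun_rec2)

lemma rec2_comp1: "rec1 f \<Longrightarrow> rec2 g \<Longrightarrow> rec2 (\<lambda>m n. f (g m n))"
  unfolding rec2_def by (rule rec_fun_rec1)

lemma rec2_comp2: "rec2 f \<Longrightarrow> rec2 g \<Longrightarrow> rec2 h \<Longrightarrow> rec2 (\<lambda>m n. f (g m n) (h m n))"
  unfolding rec2_def [of g] rec2_def [of h] rec2_def [of "\<lambda>m n. f (g m n) (h m n)"]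
  by (rule rec_fun_rec2)

lemma rec2_add: "rec2 (+)"
proof (rule rec2_rec [where h = "\<lambda>n. n" and g = "\<lambda>y _. Suc y"])
  show "m + n = rec_nat n (\<lambda>_ y. Suc y) m" for m n :: nat by (induction m) auto
qed (intro rec1_id rec2_comp1 [OF rec1_Suc] rec2_fst)+

lemma rec1_pred: "rec1 (\<lambda>n. n - 1)"
proof (rule rec1_rec [where c = 0 and g = "\<lambda>_ m. m"])
  show "n - 1 = rec_nat 0 (\<lambda>m _. m) n" for n :: nat by (cases n) auto
qed (rule rec2_snd)

lemma rec2_diff: "rec2 (-)"
proof -
  \<comment> \<open>Recursion runs on the first argument, so subtraction is obtained with its
    arguments exchanged.\<close>
  have "rec2 (\<lambda>m n. n - m)"
  proof (rule rec2_rec [where h = "\<lambda>n. n" and g = "\<lambda>y _. y - 1"])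
    show "n - m = rec_nat n (\<lambda>_ y. y - 1) m" for m n :: nat by (induction m) auto
  qed (intro rec1_id rec2_comp1 [OF rec1_pred] rec2_fst)+
  from rec2_comp2 [OF this rec2_snd rec2_fst] show ?thesis .
qed

lemma rec1_triangle: "rec1 triangle"
proof (rule rec1_rec [where c = 0 and g = "\<lambda>y m. y + Suc m"])
  show "triangle n = rec_nat 0 (\<lambda>m y. y + Suc m) n" for n by (induction n) auto
qed (intro rec2_comp2 [OF rec2_add] rec2_fst rec2_comp1 [OF rec1_Suc] rec2_snd)

lemma rec2_prod_encode: "rec2 (\<lambda>m n. prod_encode (m, n))"
  unfolding prod_encode_def split_conv
  by (intro rec2_comp2 [OF rec2_add] rec2_comp1 [OF rec1_triangle] rec2_fst rec2_snd)

text \<open>The pairing function enumerates the diagonals of the plane. Once the index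
  \<open>d z\<close> of the diagonal through \<open>z\<close> is computable, so are both components:
  the first is the offset of \<open>z\<close> from the triangular number of \<open>d z\<close>, the
  second is the rest of the diagonal.\<close>

lemma rec1_prod_decode:
  shows rec1_fst: "rec1 (\<lambda>z. fst (prod_decode z))"
    and rec1_snd: "rec1 (\<lambda>z. snd (prod_decode z))"
proof -
  define d where "d z = fst (prod_decode z) + snd (prod_decode z)" for z
  have z: "z = triangle (d z) + fst (prod_decode z)" for z
    using prod_decode_inverse [of z] unfolding d_def prod_encode_def
    by (simp add: case_prod_beta)
  have le: "fst (prod_decode z) \<le> d z" for z by (simp add: d_def)
  have mono: "m \<le> n \<Longrightarrow> triangle m \<le> triangle n" for m n by (induction n) (auto simp: le_Suc_eq)
  \<comment> \<open>The truncated difference is the indicator of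
    \<open>triangle (Suc (d z)) \<le> Suc z\<close>: the index grows by one exactly when the next
    diagonal begins.\<close>
  have d_Suc: "d (Suc z) = d z + (1 - (triangle (Suc (d z)) - Suc z))" for z
  proof (cases "triangle (Suc (d z)) \<le> Suc z")
    case True
    have "d (Suc z) = Suc (d z)"
    proof (rule antisym)
      show "d (Suc z) \<le> Suc (d z)"
        using z [of z] z [of "Suc z"] le [of z] mono [of "Suc (Suc (d z))" "d (Suc z)"]
        by (intro leI notI) auto
      show "Suc (d z) \<le> d (Suc z)"
        using z [of "Suc z"] le [of "Suc z"] True mono [of "Suc (d (Suc z))" "Suc (d z)"]
        by (intro leI notI) auto
    qed
    then show ?thesis using True by simp
  next
    case False
    have "d (Suc z) = d z"
    proof (rule antisym)
      show "d (Suc z) \<le> d z"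
        using z [of "Suc z"] False mono [of "Suc (d z)" "d (Suc z)"] by (intro leI notI) auto
      show "d z \<le> d (Suc z)"
        using z [of z] z [of "Suc z"] le [of "Suc z"] mono [of "Suc (d (Suc z))" "d z"]
        by (intro leI notI) auto
    qed
    then show ?thesis using False by simp
  qed
  have d: "rec1 d"
  proof (rule rec1_rec [where c = 0 and g = "\<lambda>y m. y + (1 - (triangle (Suc y) - Suc m))"])
    show "d z = rec_nat 0 (\<lambda>m y. y + (1 - (triangle (Suc y) - Suc m))) z" for z
    proof (induction z)
      case 0
      show ?case using z [of 0] by (simp add: d_def prod_decode_def prod_decode_aux.simps)
    qed (simp add: d_Suc)
  qed (intro rec2_comp2 [OF rec2_add] rec2_comp2 [OF rec2_diff] rec2_comp1 [OF rec1_triangle]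
      rec2_comp1 [OF rec1_Suc] rec2_const rec2_fst rec2_snd)
  have "fst (prod_decode z) = z - triangle (d z)" for z using z [of z] by linarith
  then show f: "rec1 (\<lambda>z. fst (prod_decode z))"
    by (simp only:) (intro rec1_comp2 [OF rec2_diff] rec1_id rec1_comp1 [OF rec1_triangle] d)
  have "snd (prod_decode z) = d z - fst (prod_decode z)" for z by (simp add: d_def)
  then show "rec1 (\<lambda>z. snd (prod_decode z))"
    by (simp only:) (intro rec1_comp2 [OF rec2_diff] f d)
qed

section \<open>Computability of maps between encoded types\<close>

class encodable =
  fixes enc :: "'a \<Rightarrow> nat"

instantiation nat :: encodable
begin
definition enc_nat :: "nat \<Rightarrow> nat" where [simp]: "enc_nat n = n"
instance ..
end

instantiation bool :: encodable
begin
definition enc_bool :: "bool \<Rightarrow> nat" where [simp]: "enc_bool b = of_bool b"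
instance ..
end

instantiation int :: encodable
begin
definition enc_int :: "int \<Rightarrow> nat" where [simp]: "enc_int i = int_encode i"
instance ..
end

instantiation prod :: (encodable, encodable) encodable
begin
definition enc_prod :: "'a \<times> 'b \<Rightarrow> nat" where
  [simp]: "enc_prod p = prod_encode (enc (fst p), enc (snd p))"
instance ..
end

instantiation list :: (encodable) encodable
begin
definition enc_list :: "'a list \<Rightarrow> nat" where "enc_list xs = list_encode (map enc xs)"
instance ..
end

lemma enc_Nil [simp]: "enc [] = 0"
  and enc_Cons [simp]: "enc (x # xs) = Suc (prod_encode (enc x, enc xs))"
  by (auto simp: enc_list_def)

definition computable :: "('a::encodable \<Rightarrow> 'b::encodable) \<Rightarrow> bool" where
  "computable f \<longleftrightarrow> (\<exists>A. \<forall>x. computes A [enc x] (enc (f x)))"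

lemma computes_Comp1: "computes g xs y \<Longrightarrow> computes f [y] z \<Longrightarrow> computes (Comp f [g]) xs z"
  by (rule comp [where ys = "[y]"]) auto

lemma computable_id: "computable (\<lambda>x. x)"
proof -
  have "computes (Proj 0) [enc x] (enc x)" for x :: 'a
    using proj [of 0 "[enc x]"] by simp
  then show ?thesis unfolding computable_def by blast
qed

lemma computable_rec2:
  assumes h: "rec2 h" and f: "computable f" and g: "computable g"
    and k: "\<And>x. enc (k x) = h (enc (f x)) (enc (g x))"
  shows "computable k"
proof -
  obtain H where H: "\<And>xs. length xs = 2 \<Longrightarrow> computes H xs (h (xs ! 0) (xs ! 1))"
    using h unfolding rec2_def rec_fun_def by blast
  obtain F where F: "\<And>x. computes F [enc x] (enc (f x))" using f unfolding computable_def by blast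
  obtain G where G: "\<And>x. computes G [enc x] (enc (g x))" using g unfolding computable_def by blast
  have "computes (Comp H [F, G]) [enc x] (enc (k x))" for x
    by (rule comp [where ys = "[enc (f x), enc (g x)]"])
      (use H [of "[enc (f x), enc (g x)]"] F G in \<open>auto simp: k\<close>)
  then show ?thesis unfolding computable_def by blast
qed

lemma computable_rec1:
  assumes "rec1 h" "computable f" "\<And>x. enc (k x) = h (enc (f x))"
  shows "computable k"
  using computable_rec2 [of "\<lambda>m _. h m" f f k] assms rec2_comp1 [OF assms(1) rec2_fst] by simp

lemma computable_const: "computable (\<lambda>_. c)"
  by (rule computable_rec1 [OF rec1_const computable_id]) simp

lemma computable_comp:
  assumes "computable f" "computable g"
  shows "computable (\<lambda>x. f (g x))"
proof -
  obtain F where F: "\<And>x. computes F [enc x] (enc (f x))"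
    using assms(1) unfolding computable_def by blast
  obtain G where G: "\<And>x. computes G [enc x] (enc (g x))"
    using assms(2) unfolding computable_def by blast
  have "computes (Comp F [G]) [enc x] (enc (f (g x)))" for x
    by (rule computes_Comp1 [OF G F])
  then show ?thesis unfolding computable_def by blast
qed

lemma computable_Pair: "computable f \<Longrightarrow> computable g \<Longrightarrow> computable (\<lambda>x. (f x, g x))"
  by (rule computable_rec2 [OF rec2_prod_encode]) auto

lemma computable_fst: "computable f \<Longrightarrow> computable (\<lambda>x. fst (f x))"
  by (rule computable_rec1 [OF rec1_fst]) auto

lemma computable_snd: "computable f \<Longrightarrow> computable (\<lambda>x. snd (f x))"
  by (rule computable_rec1 [OF rec1_snd]) auto

lemma computable_Suc: "computable f \<Longrightarrow> computable (\<lambda>x. Suc (f x))"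
  by (rule computable_rec1 [OF rec1_Suc]) auto

lemma computable_enc: "computable f \<Longrightarrow> computable (\<lambda>x. enc (f x))"
  by (rule computable_rec1 [OF rec1_id]) auto

lemma computable_Not: "computable f \<Longrightarrow> computable (\<lambda>x. \<not> f x)"
  by (rule computable_rec1 [OF rec1_comp2 [OF rec2_diff rec1_const [of 1] rec1_id]]) auto

lemma computable_eq_nat:
  assumes "computable f" "computable g"
  shows "computable (\<lambda>x. f x = (g x :: nat))"
proof (rule computable_rec2 [OF _ assms])
  show "rec2 (\<lambda>m n. 1 - ((m - n) + (n - m)))"
    by (intro rec2_comp2 [OF rec2_diff] rec2_comp2 [OF rec2_add] rec2_const
        rec2_fst rec2_snd)
qed auto

lemma computable_eq:
  assumes "computable f" "computable g" "\<And>x. enc (f x) = enc (g x) \<longleftrightarrow> f x = g x"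
  shows "computable (\<lambda>x. f x = g x)"
  using computable_eq_nat [OF computable_enc [OF assms(1)] computable_enc [OF assms(2)]]
  by (simp add: assms(3))

lemma computable_Cons: "computable f \<Longrightarrow> computable g \<Longrightarrow> computable (\<lambda>x. f x # g x)"
  by (rule computable_rec2 [OF rec2_comp1 [OF rec1_Suc rec2_prod_encode]]) auto

text \<open>Composition is strict and programs may diverge on numbers that encode nothing of the right
  type. The cons branch is thus the step of a recursion whose length is \<open>0\<close> or \<open>1\<close>.\<close>

lemma computable_case_list:
  assumes l: "computable l" and f: "computable f"
    and g: "computable (\<lambda>p. g (fst p) (fst (snd p)) (snd (snd p)))"
  shows "computable (\<lambda>x. case l x of [] \<Rightarrow> f x | y # ys \<Rightarrow> g x y ys)"
proof -
  obtain L where L: "\<And>x. computes L [enc x] (enc (l x))" using l unfolding computable_def by blast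
  obtain F where F: "\<And>x. computes F [enc x] (enc (f x))" using f unfolding computable_def by blast
  obtain G where G: "\<And>x y ys. computes G [prod_encode (enc x, prod_encode (enc y, enc ys))] (enc (g x y ys))"
    using g unfolding computable_def by auto
  \<comment> \<open>Only \<open>[]\<close> has code 0, so the first function tells it from a cons;
    the second turns the code of a cons into the code of the pair of its head and tail.\<close>
  have "rec1 (\<lambda>m. 1 - (1 - m))" "rec1 (\<lambda>m. m - 1)"
    by (intro rec1_comp2 [OF rec2_diff] rec1_const rec1_id)+
  then obtain S P
    where S: "\<And>m. computes S [m] (1 - (1 - m))" and P: "\<And>m. computes P [m] (m - 1)"
    unfolding rec1_def rec_fun_def by (metis One_nat_def length_Cons list.size(3) nth_Cons_0)
  obtain Q where Q: "\<And>m n. computes Q [m, n] (prod_encode (m, n))"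
    using rec2_prod_encode unfolding rec2_def rec_fun_def
    by (metis One_nat_def Suc_1 length_Cons list.size(3) nth_Cons_0 nth_Cons_Suc)
  \<comment> \<open>The parameters are the code of head and tail and the code of the input. In the
    recursion step, value and counter occupy places 0 and 1, which moves the parameters to places 2
    and 3.\<close>
  define A where "A = Prec (Comp F [Proj 1]) (Comp G [Comp Q [Proj 3, Proj 2]])"
  have 0: "computes A [0, p, enc x] (enc (f x))" for p x
    unfolding A_def by (intro prec_0 comp [OF _ F]) (auto simp: proj [of 1 "[p, enc x]", simplified])
  have 1: "computes A [Suc 0, prod_encode (enc y, enc ys), enc x] (enc (g x y ys))" for x y ys
    unfolding A_def
  proof (rule prec_Suc)
    show "computes (Prec (Comp F [Proj 1]) (Comp G [Comp Q [Proj 3, Proj 2]]))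
        [0, prod_encode (enc y, enc ys), enc x] (enc (f x))"
      using 0 unfolding A_def .
    let ?zs = "[enc (f x), 0, prod_encode (enc y, enc ys), enc x]"
    have "computes (Comp Q [Proj 3, Proj 2]) ?zs (prod_encode (enc x, prod_encode (enc y, enc ys)))"
      by (rule comp [OF _ Q]) (use proj [of 3 ?zs] proj [of 2 ?zs] in auto)
    then show "computes (Comp G [Comp Q [Proj 3, Proj 2]]) ?zs (enc (g x y ys))"
      by (intro comp [OF _ G]) auto
  qed
  have "computes (Comp A [Comp S [L], Comp P [L], Proj 0]) [enc x]
      (enc (case l x of [] \<Rightarrow> f x | y # ys \<Rightarrow> g x y ys))" for x
  proof (rule comp)
    show "list_all2 (\<lambda>g y. computes g [enc x] y) [Comp S [L], Comp P [L], Proj 0]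
        [1 - (1 - enc (l x)), enc (l x) - 1, enc x]"
      using proj [of 0 "[enc x]"] computes_Comp1 [OF L S] computes_Comp1 [OF L P] by simp
    show "computes A [1 - (1 - enc (l x)), enc (l x) - 1, enc x]
        (enc (case l x of [] \<Rightarrow> f x | y # ys \<Rightarrow> g x y ys))"
      by (cases "l x") (use 0 1 in auto)
  qed
  then show ?thesis unfolding computable_def by blast
qed

lemma computable_If:
  assumes b: "computable b" and f: "computable f" and g: "computable g"
  shows "computable (\<lambda>x. if b x then f x else g x)"
proof -
  \<comment> \<open>The lists \<open>[0]\<close> and \<open>[]\<close> have the codes 1 and 0, the
    same as the two truth values, so a conditional is a case distinction on a list.\<close>
  have b': "computable (\<lambda>x. if b x then [0 :: nat] else [])"
  proof (rule computable_rec1 [OF _ b])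
    show "rec1 (\<lambda>m. m)" by (rule rec1_id)
  qed (simp add: prod_encode_def)
  have "computable (\<lambda>x. case (if b x then [0 :: nat] else []) of [] \<Rightarrow> g x | _ # _ \<Rightarrow> f x)"
    by (rule computable_case_list [OF b' g]) (intro computable_comp [OF f] computable_fst computable_id)
  moreover have "(case (if b x then [0 :: nat] else []) of [] \<Rightarrow> g x | _ # _ \<Rightarrow> f x) =
      (if b x then f x else g x)" for x by simp
  ultimately show ?thesis by simp
qed

lemma computable_funpow:
  fixes t :: "'b::encodable \<Rightarrow> 'b"
  assumes n: "computable n" and z: "computable z" and t: "computable t"
  shows "computable (\<lambda>x. (t ^^ n x) (z x))"
proof -
  obtain N where N: "\<And>x. computes N [enc x] (n x)" using n unfolding computable_def by auto
  obtain Z where Z: "\<And>x. computes Z [enc x] (enc (z x))" using z unfolding computable_def by blast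
  obtain T where T: "\<And>x. computes T [enc x] (enc (t x))" using t unfolding computable_def by blast
  have *: "computes (Prec Z (Comp T [Proj 0])) [m, enc x] (enc ((t ^^ m) (z x)))" for m x
  proof (induction m)
    case (Suc m)
    show ?case
    proof (rule prec_Suc [OF Suc.IH])
      have "computes (Comp T [Proj 0]) [enc ((t ^^ m) (z x)), m, enc x] (enc (t ((t ^^ m) (z x))))"
        using proj [of 0 "[enc ((t ^^ m) (z x)), m, enc x]"] by (intro computes_Comp1 [OF _ T]) simp
      then show "computes (Comp T [Proj 0]) [enc ((t ^^ m) (z x)), m, enc x] (enc ((t ^^ Suc m) (z x)))"
        by simp
    qed
  qed (simp add: prec_0 Z)
  have "computes (Comp (Prec Z (Comp T [Proj 0])) [N, Proj 0]) [enc x] (enc ((t ^^ n x) (z x)))" for x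
    by (rule comp [OF _ *]) (use N proj [of 0 "[enc x]"] in auto)
  then show ?thesis unfolding computable_def by blast
qed

text \<open>The code of a list is at hand as a number and bounds its length. It can therefore serve
  as the number of iterations in a traversal of the list, provided that surplus iterations are
  idle.\<close>

lemma length_le_enc: "length xs \<le> enc xs"
proof (induction xs)
  case (Cons x xs)
  then show ?case using le_prod_encode_2 [of "enc xs" "enc x"] by simp
qed simp

lemma computable_foldl:
  assumes l: "computable l" and z: "computable z"
    and s: "computable (\<lambda>p. s (fst p) (fst (snd p)) (snd (snd p)))"
  shows "computable (\<lambda>x. foldl (\<lambda>a y. s x a y) (z x) (l x))"
proof -
  \<comment> \<open>\<open>computable_funpow\<close> iterates a fixed function, so the parameter
    \<open>x\<close> travels in the state beside the accumulator and the remaining list. On an empty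
    remainder the state stands still.\<close>
  define t where "t p = (case snd (snd p) of [] \<Rightarrow> p
    | y # ys \<Rightarrow> (fst p, s (fst p) (fst (snd p)) y, ys))" for p
  have s': "computable (\<lambda>p. s (f p) (g p) (h p))" if "computable f" "computable g" "computable h"
    for f :: "'d::encodable \<Rightarrow> 'a" and g h
    using computable_comp [OF s computable_Pair [OF that(1) computable_Pair [OF that(2,3)]]] by simp
  have t: "computable t"
    unfolding t_def
    by (intro computable_case_list computable_Pair s' computable_fst computable_snd computable_id)
  have "(t ^^ m) (x, a, ys) = (x, foldl (\<lambda>a y. s x a y) a ys, [])" if "length ys \<le> m" for m x a ys
    using that
  proof (induction m arbitrary: a ys)
    case (Suc m)
    then show ?case by (cases ys) (auto simp: funpow_Suc_right t_def simp del: funpow.simps)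
  qed simp
  then have "foldl (\<lambda>a y. s x a y) (z x) (l x) = fst (snd ((t ^^ enc (l x)) (x, z x, l x)))" for x
    by (simp add: length_le_enc)
  moreover have "computable (\<lambda>x. fst (snd ((t ^^ enc (l x)) (x, z x, l x))))"
    by (intro computable_fst computable_snd computable_funpow computable_enc computable_Pair
        computable_id l z t)
  ultimately show ?thesis by simp
qed

lemma computable_rev: "computable l \<Longrightarrow> computable (\<lambda>x. rev (l x))"
proof -
  assume l: "computable l"
  have "rev xs = foldl (\<lambda>a y. y # a) [] xs" for xs :: "'b list"
    by (induction xs rule: rev_induct) auto
  then show ?thesis
    by (simp only:) (intro computable_foldl l computable_const computable_Cons computable_fst
        computable_snd computable_id)
qed

lemma computable_foldr:
  assumes l: "computable l" and z: "computable z"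
    and s: "computable (\<lambda>p. s (fst p) (fst (snd p)) (snd (snd p)))"
  shows "computable (\<lambda>x. foldr (\<lambda>y a. s x y a) (l x) (z x))"
proof -
  have "computable (\<lambda>p. (\<lambda>p. s (fst p) (fst (snd p)) (snd (snd p))) (fst p, snd (snd p), fst (snd p)))"
    by (intro computable_comp [OF s] computable_Pair computable_fst computable_snd computable_id)
  then have "computable (\<lambda>p. s (fst p) (snd (snd p)) (fst (snd p)))" by simp
  then have "computable (\<lambda>x. foldl (\<lambda>a y. s x y a) (z x) (rev (l x)))"
    by (intro computable_foldl computable_rev l z)
  then show ?thesis by (simp add: foldl_conv_foldr)
qed

lemma computable_append: "computable f \<Longrightarrow> computable g \<Longrightarrow> computable (\<lambda>x. f x @ g x)"
proof -
  assume fg: "computable f" "computable g"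
  have "xs @ ys = foldr (\<lambda>y a. y # a) xs ys" for xs ys :: "'b list" by (induction xs) auto
  then show ?thesis
    by (simp only:) (intro computable_foldr fg computable_Cons computable_fst
        computable_snd computable_id)
qed

lemma computable_map:
  assumes l: "computable l" and f: "computable (\<lambda>p. f (fst p) (snd p))"
  shows "computable (\<lambda>x. map (\<lambda>y. f x y) (l x))"
proof -
  have "computable (\<lambda>p. (\<lambda>p. f (fst p) (snd p)) (fst p, fst (snd p)))"
    by (intro computable_comp [OF f] computable_Pair computable_fst computable_snd computable_id)
  then have f': "computable (\<lambda>p. f (fst p) (fst (snd p)))" by simp
  have "map g xs = foldr (\<lambda>y a. g y # a) xs []" for xs and g :: "'b \<Rightarrow> 'c" by (induction xs) auto
  then show ?thesis
    by (simp only:) (intro computable_foldr l f' computable_const computable_Cons computable_fst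
        computable_snd computable_id)
qed

lemma computable_enumerate: "computable l \<Longrightarrow> computable (\<lambda>x. List.enumerate 0 (l x))"
proof -
  assume l: "computable l"
  have "foldl (\<lambda>a y. (Suc (fst a), snd a @ [(fst a, y)])) (0, []) xs = (length xs, List.enumerate 0 xs)"
    for xs :: "'b list"
    by (induction xs rule: rev_induct) (auto simp: enumerate_append_eq)
  then have "List.enumerate 0 xs = snd (foldl (\<lambda>a y. (Suc (fst a), snd a @ [(fst a, y)])) (0, []) xs)"
    for xs :: "'b list" by simp
  then show ?thesis
    by (simp only:) (intro computable_foldl l computable_const computable_Cons computable_fst
        computable_snd computable_id computable_Pair computable_append computable_Suc)
qed

lemma computable_upt: "computable n \<Longrightarrow> computable (\<lambda>x. [0..<n x])"
proof -
  assume n: "computable n"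
  have "((\<lambda>a. (Suc (fst a), snd a @ [fst a])) ^^ m) (0, []) = (m, [0..<m])" for m
    by (induction m) auto
  then have "[0..<m] = snd (((\<lambda>a. (Suc (fst a), snd a @ [fst a])) ^^ m) (0, []))" for m by simp
  then show ?thesis
    by (simp only:) (intro computable_funpow n computable_const computable_Cons computable_fst
        computable_snd computable_id computable_Pair computable_append computable_Suc)
qed

lemmas computable_intros = computable_id computable_const computable_Pair computable_fst
  computable_snd computable_Suc computable_Not computable_Cons computable_append computable_rev
  computable_map computable_foldl computable_upt computable_enumerate computable_If
  computable_eq_nat


section \<open>The algorithm\<close>

text \<open>The rule D(w y) = D w + w D y of Fox calculus: a letter \<open>x\<close> contributes the
  prefix before it, an inverse of \<open>x\<close> contributes minus the prefix that includes it.
  Here \<open>x\<close> may itself be an inverse letter.\<close>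

definition fox_step :: "letter \<Rightarrow> word \<Rightarrow> letter \<Rightarrow> formal_sum" where
  "fox_step x w y = (if y = x then [(1, w)] else if y = inv_letter x then [(-1, w @ [y])] else [])"

definition fox :: "letter \<Rightarrow> word \<Rightarrow> formal_sum" where
  "fox x w = snd (foldl (\<lambda>a y. (fst a @ [y], snd a @ fox_step x (fst a) y)) ([], []) w)"

lemma fox_Nil: "fox x [] = []"
  by (simp add: fox_def)

lemma fox_snoc: "fox x (w @ [y]) = fox x w @ fox_step x w y"
proof -
  have "fst (foldl (\<lambda>a y. (fst a @ [y], snd a @ fox_step x (fst a) y)) ([], []) w) = w"
    by (induction w rule: rev_induct) auto
  then show ?thesis by (simp add: fox_def)
qed

text \<open>The first block consists of the vectors e_i (w_i - 1); the other two are the jump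
  vectors of the cylinders of the 2n letters. The derivatives are taken along the words as given,
  and their terms are reduced only by \<open>eval_sum\<close>.\<close>

definition h1_relations :: "nat \<Rightarrow> word list \<Rightarrow> formal_sum list list" where
  "h1_relations n ws =
    map (\<lambda>i. map (\<lambda>p. if fst p = i then [(1, snd p), (-1, [])] else []) (List.enumerate 0 ws)) [0..<length ws]
    @ map (\<lambda>x. map (fox (x, False)) ws) [0..<n] @ map (\<lambda>x. map (fox (x, True)) ws) [0..<n]"

text \<open>Injectivity of \<open>enc\<close> is not part of the class \<open>encodable\<close>;
  this instance lets letters be compared through their codes.\<close>

lemma enc_letter_eq: "enc x = enc y \<longleftrightarrow> x = (y :: letter)"
  by (cases x; cases y) (auto split: if_splits)

lemma computable_eq_letter:
  "computable f \<Longrightarrow> computable g \<Longrightarrow> computable (\<lambda>x. f x = (g x :: letter))"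
  by (intro computable_eq) (auto simp del: enc_prod_def simp: enc_letter_eq)

lemma computable_fox: "computable f \<Longrightarrow> computable g \<Longrightarrow> computable (\<lambda>x. fox (f x) (g x))"
proof -
  assume fg: "computable f" "computable g"
  have "computable (\<lambda>p :: letter \<times> word. fox (fst p) (snd p))"
    unfolding fox_def fox_step_def inv_letter_def
    by (intro computable_intros computable_eq_letter)
  from computable_comp [OF this computable_Pair [OF fg]] show ?thesis by simp
qed

lemma computable_length: "computable l \<Longrightarrow> computable (\<lambda>x. length (l x))"
proof -
  assume l: "computable l"
  have "length xs = foldl (\<lambda>a y. Suc a) 0 xs" for xs :: "'b list"
    by (induction xs rule: rev_induct) auto
  then show ?thesis
    by (simp only:) (intro computable_intros l)
qed

lemma computable_h1_relations: "computable (\<lambda>p. (length (snd p), h1_relations (fst p) (snd p)))"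
  unfolding h1_relations_def
  by (intro computable_intros computable_fox computable_length)

lemma encode_eq_enc:
  "encode_input n ws = enc (n, ws)" "encode_presentation k rels = enc (k, rels)"
proof -
  have w: "encode_word = enc"
    by (auto simp: encode_word_def enc_list_def fun_eq_iff intro!: arg_cong [where f = list_encode])
  then show "encode_input n ws = enc (n, ws)"
    by (simp add: encode_input_def enc_list_def [of ws])
  have s: "encode_sum = enc"
    by (auto simp: encode_sum_def enc_list_def fun_eq_iff w intro!: arg_cong [where f = list_encode])
  have v: "(\<lambda>v. list_encode (map encode_sum v)) = enc"
    by (simp add: s enc_list_def fun_eq_iff)
  show "encode_presentation k rels = enc (k, rels)"
    by (simp add: encode_presentation_def v enc_list_def [of rels])
qed

lemma computes_h1_relations:
  "\<exists>A. \<forall>n ws. computes A [encode_input n ws]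
    (encode_presentation (length ws) (h1_relations n ws))"
  using computable_h1_relations unfolding computable_def encode_eq_enc
  by (metis fst_conv snd_conv)


section \<open>Ends of the tree as infinite reduced words\<close>

lemma mult_free_group: "x \<otimes>\<^bsub>free_group n\<^esub> y = reduce (x @ y)"
  and one_free_group: "\<one>\<^bsub>free_group n\<^esub> = []"
  and carrier_free_group: "x \<in> carrier (free_group n) \<longleftrightarrow> x \<in> words n \<and> reduced x"
  by (simp_all add: free_group_def)

lemma words_append [simp]: "x @ y \<in> words n \<longleftrightarrow> x \<in> words n \<and> y \<in> words n"
  and words_Cons [simp]: "a # x \<in> words n \<longleftrightarrow> fst a < n \<and> x \<in> words n"
  and words_Nil [simp]: "[] \<in> words n"
  by (auto simp: words_def mem_Times_iff)

lemma reduced_Nil [simp]: "reduced []"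
  and reduced_single [simp]: "reduced [a]"
  by (auto simp: reduced_def)

lemma reduced_appendD: "reduced (x @ y) \<Longrightarrow> reduced x" "reduced (x @ y) \<Longrightarrow> reduced y"
  by (auto simp: reduced_def successively_append_iff)

lemma fst_inv_letter [simp]: "fst (inv_letter a) = fst a"
  by (simp add: inv_letter_def)

lemma inv_letter_neq [simp]: "inv_letter a \<noteq> a" "a \<noteq> inv_letter a"
  by (cases a; simp add: inv_letter_def)+

lemma inv_letter_eq_iff: "inv_letter a = b \<longleftrightarrow> a = inv_letter b"
  by auto

lemma reduced_snoc: "reduced (x @ [a]) \<longleftrightarrow> reduced x \<and> (x \<noteq> [] \<longrightarrow> last x \<noteq> inv_letter a)"
  by (auto simp: reduced_def successively_append_iff)

lemma reduce_Nil [simp]: "reduce [] = []"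
  by (simp add: reduce_def)

lemma reduce_snoc:
  assumes "reduced x"
  shows "reduce (x @ [a]) = (if x \<noteq> [] \<and> last x = inv_letter a then butlast x else x @ [a])"
proof (cases "x \<noteq> [] \<and> last x = inv_letter a")
  case True
  then have x: "x = butlast x @ [inv_letter a]" by (metis append_butlast_last_id)
  have "reduce (x @ [a]) = reduce (butlast x @ reduce [inv_letter a, a])"
    by (subst x) (simp add: reduce_append_right)
  also have "reduce [inv_letter a, a] = []" by (simp add: reduce_def)
  also have "reduce (butlast x @ []) = butlast x"
    using assms x reduced_appendD(1) [of "butlast x" "[inv_letter a]"] by (simp add: reduce_reduced)
  finally show ?thesis using True by simp
next
  case False
  then have "reduced (x @ [a])" using assms by (auto simp: reduced_snoc)
  from reduce_reduced [OF this] show ?thesis using False by (simp only: if_False)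
qed

lemma carrier_prefix: "x @ y \<in> carrier (free_group n) \<Longrightarrow> x \<in> carrier (free_group n)"
  by (auto simp: carrier_free_group dest: reduced_appendD)

lemma reduce_in_carrier: "w \<in> words n \<Longrightarrow> reduce w \<in> carrier (free_group n)"
  by (simp add: carrier_free_group reduce_words reduced_reduce)

lemma inv_generator:
  assumes "fst a < n"
  shows "inv\<^bsub>free_group n\<^esub> [a] = [inv_letter a]"
proof -
  interpret group "free_group n" by (rule group_free_group)
  show ?thesis
    by (rule inv_equality)
      (use assms in \<open>auto simp: carrier_free_group mult_free_group one_free_group reduce_def\<close>)
qed

lemma cayley_edges_iff:
  "(g, h) \<in> cayley_edges (free_group n) (free_basis n) \<longleftrightarrow>
    g \<in> carrier (free_group n) \<and> (\<exists>a. fst a < n \<and> h = reduce (g @ [a]))"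
proof -
  have "s \<in> free_basis n \<or> (\<exists>t\<in>free_basis n. s = inv\<^bsub>free_group n\<^esub> t) \<longleftrightarrow> (\<exists>a. fst a < n \<and> s = [a])"
    for s
  proof
    assume "s \<in> free_basis n \<or> (\<exists>t\<in>free_basis n. s = inv\<^bsub>free_group n\<^esub> t)"
    then show "\<exists>a. fst a < n \<and> s = [a]"
      by (auto simp: free_basis_def inv_generator inv_letter_def)
  next
    assume "\<exists>a. fst a < n \<and> s = [a]"
    then obtain i b where "i < n" "s = [(i, b)]" by auto
    then show "s \<in> free_basis n \<or> (\<exists>t\<in>free_basis n. s = inv\<^bsub>free_group n\<^esub> t)"
      by (cases b) (auto simp: free_basis_def inv_generator inv_letter_def)
  qed
  then show ?thesis
    unfolding cayley_edges_def mem_Collect_eq mult_free_group by auto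
qed

section \<open>Word metric and Gromov product in terms of common prefixes\<close>

fun lcp :: "'a list \<Rightarrow> 'a list \<Rightarrow> nat" where
  "lcp (x # xs) (y # ys) = (if x = y then Suc (lcp xs ys) else 0)"
| "lcp _ _ = 0"

lemma le_lcp_iff: "N \<le> lcp xs ys \<longleftrightarrow> N \<le> length xs \<and> take N xs = take N ys"
proof (induction xs ys arbitrary: N rule: lcp.induct)
  case (1 x xs y ys)
  then show ?case by (cases N) auto
qed (auto simp: take_Cons')

lemma lcp_le: "lcp xs ys \<le> length xs" "lcp xs ys \<le> length ys"
  by (induction xs ys rule: lcp.induct) auto

lemma lcp_Nil [simp]: "lcp xs [] = 0"
  by (cases xs) auto

lemma lcp_single [simp]: "lcp xs [y] \<le> Suc 0"
  by (cases xs) auto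

lemma lcp_snoc: "lcp xs ys \<le> lcp xs (ys @ [y])" "lcp xs (ys @ [y]) \<le> Suc (lcp xs ys)"
  by (induction xs ys rule: lcp.induct) (auto simp: neq_Nil_conv split: list.splits)

text \<open>The lower bound for distances. Appending a letter lengthens the endpoint by one and does
  not shrink the prefix shared with \<open>g\<close>; cancelling a letter shortens the endpoint by
  one and loses at most one shared letter. Either way \<open>length h - 2 * lcp g h\<close> grows by
  at most one.\<close>

lemma cayley_path_length:
  assumes "(g, h) \<in> cayley_edges (free_group n) (free_basis n) ^^ k" "g \<in> carrier (free_group n)"
  shows "length g + length h \<le> k + 2 * lcp g h" "h \<in> carrier (free_group n)"
proof -
  have "length g + length h \<le> k + 2 * lcp g h \<and> h \<in> carrier (free_group n)"
    using assms(1)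
  proof (induction k arbitrary: h)
    case 0
    have "length g \<le> lcp g g" by (simp add: le_lcp_iff)
    then show ?case using 0 assms(2) by auto
  next
    case (Suc k)
    then obtain y where y: "(g, y) \<in> cayley_edges (free_group n) (free_basis n) ^^ k"
      "(y, h) \<in> cayley_edges (free_group n) (free_basis n)" by auto
    from y(2) obtain a where a: "y \<in> carrier (free_group n)" "fst a < n" "h = reduce (y @ [a])"
      by (auto simp: cayley_edges_iff)
    have h: "h \<in> carrier (free_group n)"
      unfolding a(3) by (rule reduce_in_carrier) (use a in \<open>auto simp: carrier_free_group\<close>)
    have IH: "length g + length y \<le> k + 2 * lcp g y" using Suc.IH [OF y(1)] by simp
    show ?case
    proof (cases "y \<noteq> [] \<and> last y = inv_letter a")
      case True
      with a have "y = h @ [inv_letter a]"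
        by (metis append_butlast_last_id carrier_free_group reduce_snoc)
      then show ?thesis
        using IH lcp_snoc(2) [of g h "inv_letter a"] h by simp
    next
      case False
      with a have "h = y @ [a]" by (auto simp: reduce_snoc carrier_free_group)
      then show ?thesis using IH lcp_snoc(1) [of g y a] h by simp
    qed
  qed
  then show "length g + length h \<le> k + 2 * lcp g h" "h \<in> carrier (free_group n)" by auto
qed

lemma cayley_path:
  assumes "g @ u \<in> carrier (free_group n)"
  shows "(g, g @ u) \<in> cayley_edges (free_group n) (free_basis n) ^^ length u"
    and "(g @ u, g) \<in> cayley_edges (free_group n) (free_basis n) ^^ length u"
proof -
  let ?E = "cayley_edges (free_group n) (free_basis n)"
  have "(g, g @ u) \<in> ?E ^^ length u \<and> (g @ u, g) \<in> ?E ^^ length u"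
    using assms
  proof (induction u rule: rev_induct)
    case (snoc a u)
    then have gu: "g @ u \<in> carrier (free_group n)" using carrier_prefix [of "g @ u" "[a]"] by simp
    have red: "reduced ((g @ u) @ [a])" and a: "fst a < n"
      using snoc.prems by (auto simp: carrier_free_group)
    have "reduce ((g @ u) @ [a]) = g @ u @ [a]" using reduce_reduced [OF red] by simp
    moreover have "reduce ((g @ u @ [a]) @ [inv_letter a]) = g @ u"
      using reduce_snoc [of "g @ u @ [a]" "inv_letter a"] red by (simp add: butlast_append)
    ultimately have "(g @ u, g @ u @ [a]) \<in> ?E" "(g @ u @ [a], g @ u) \<in> ?E"
      unfolding cayley_edges_iff using gu snoc.prems a fst_inv_letter by metis+
    then show ?case
      using snoc.IH [OF gu] relpow_Suc_I2 [of "g @ u @ [a]" "g @ u" ?E] by auto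
  qed simp
  then show "(g, g @ u) \<in> ?E ^^ length u" "(g @ u, g) \<in> ?E ^^ length u" by auto
qed

lemma free_dist:
  assumes "g \<in> carrier (free_group n)" "h \<in> carrier (free_group n)"
  shows "free_dist n g h = real (length g) + real (length h) - 2 * real (lcp g h)"
proof -
  let ?E = "cayley_edges (free_group n) (free_basis n)" and ?l = "lcp g h"
  have t: "take ?l g = take ?l h" using le_lcp_iff [of ?l g h] by simp
  \<comment> \<open>The geodesic descends from \<open>g\<close> to the longest common prefix and
    climbs from there to \<open>h\<close>.\<close>
  have "(g, take ?l g) \<in> ?E ^^ (length g - ?l)"
    using cayley_path(2) [of "take ?l g" "drop ?l g" n] assms by simp
  moreover have "(take ?l g, h) \<in> ?E ^^ (length h - ?l)"
    unfolding t using cayley_path(1) [of "take ?l h" "drop ?l h" n] assms by simp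
  ultimately have "(g, h) \<in> ?E ^^ ((length g - ?l) + (length h - ?l))"
    unfolding relpow_add by blast
  moreover have "(length g - ?l) + (length h - ?l) \<le> k" if "(g, h) \<in> ?E ^^ k" for k
    using cayley_path_length(1) [OF that assms(1)] lcp_le [of g h] by simp
  ultimately have "(LEAST k. (g, h) \<in> ?E ^^ k) = (length g - ?l) + (length h - ?l)"
    by (intro Least_equality)
  then show ?thesis
    using lcp_le [of g h] by (simp add: free_dist_def cayley_dist_def of_nat_diff)
qed

lemma gromov_product_free:
  assumes "g \<in> carrier (free_group n)" "h \<in> carrier (free_group n)"
  shows "gromov_product (free_dist n) [] g h = real (lcp g h)"
proof -
  have "[] \<in> carrier (free_group n)" by (simp add: carrier_free_group)
  then show ?thesis using assms by (simp add: gromov_product_def free_dist)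
qed

section \<open>Infinite words and the topology of the space of ends\<close>

definition pre :: "(nat \<Rightarrow> 'a) \<Rightarrow> nat \<Rightarrow> 'a list" where
  "pre \<omega> k = map \<omega> [0..<k]"

lemma length_pre [simp]: "length (pre \<omega> k) = k"
  and pre_0 [simp]: "pre \<omega> 0 = []"
  and nth_pre [simp]: "i < k \<Longrightarrow> pre \<omega> k ! i = \<omega> i"
  and pre_Suc: "pre \<omega> (Suc k) = pre \<omega> k @ [\<omega> k]"
  by (simp_all add: pre_def)

lemma take_pre: "take k (pre \<omega> m) = pre \<omega> (min k m)"
  by (rule nth_equalityI) auto

lemma take_eq_pre_length: "take N xs = pre \<omega> N \<Longrightarrow> N \<le> length xs"
  by (metis length_pre length_take min.cobounded1)

lemma pre_Suc_Cons: "pre \<omega> (Suc k) = \<omega> 0 # pre (\<lambda>i. \<omega> (Suc i)) k"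
  by (induction k) (auto simp: pre_Suc)

lemma pre_eq_mono: "pre \<omega> m = pre \<eta> m \<Longrightarrow> k \<le> m \<Longrightarrow> pre \<omega> k = pre \<eta> k"
  by (metis min_def take_pre)

lemma pre_eqI: "(\<And>k. pre \<omega> k = pre \<eta> k) \<Longrightarrow> \<omega> = \<eta>"
  by (metis ext lessI nth_pre)

definition ends :: "nat \<Rightarrow> (nat \<Rightarrow> letter) set" where
  "ends n = {\<omega>. \<forall>k. pre \<omega> k \<in> carrier (free_group n)}"

definition conv :: "(nat \<Rightarrow> word) \<Rightarrow> (nat \<Rightarrow> letter) \<Rightarrow> bool" where
  "conv x \<omega> \<longleftrightarrow> (\<forall>N. \<forall>\<^sub>F i in sequentially. take N (x i) = pre \<omega> N)"

text \<open>The class of sequences that is the boundary point of the ray \<open>\<omega>\<close>. It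
  makes the Gromov boundary explicit as the set of infinite reduced words.\<close>

definition pt :: "nat \<Rightarrow> (nat \<Rightarrow> letter) \<Rightarrow> bpoint" where
  "pt n \<omega> = {x. range x \<subseteq> carrier (free_group n) \<and> conv x \<omega>}"

lemma conv_unique: "conv x \<omega> \<Longrightarrow> conv x \<eta> \<Longrightarrow> \<omega> = \<eta>"
proof (rule pre_eqI)
  fix k assume "conv x \<omega>" "conv x \<eta>"
  then have "\<forall>\<^sub>F i in sequentially. take k (x i) = pre \<omega> k \<and> take k (x i) = pre \<eta> k"
    by (simp add: conv_def eventually_conj)
  then have "\<forall>\<^sub>F i in sequentially. pre \<omega> k = pre \<eta> k"
    by (rule eventually_mono) metis
  then show "pre \<omega> k = pre \<eta> k" by simp
qed

lemma conv_pre: "conv (pre \<omega>) \<omega>"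
  unfolding conv_def
proof
  fix N show "\<forall>\<^sub>F i in sequentially. take N (pre \<omega> i) = pre \<omega> N"
    by (rule eventually_sequentiallyI [of N]) (simp add: take_pre min_def)
qed

lemma pre_in_pt: "\<omega> \<in> ends n \<Longrightarrow> pre \<omega> \<in> pt n \<omega>"
  by (auto simp: pt_def ends_def conv_pre)

lemma pt_eq_iff: "\<omega> \<in> ends n \<Longrightarrow> pt n \<omega> = pt n \<eta> \<longleftrightarrow> \<omega> = \<eta>"
  by (metis (mono_tags, lifting) conv_pre conv_unique mem_Collect_eq pre_in_pt pt_def)

lemma tends_to_same_end_free_iff:
  assumes "range x \<subseteq> carrier (free_group n)" "range y \<subseteq> carrier (free_group n)"
  shows "tends_to_same_end (free_dist n) [] x y \<longleftrightarrow> (\<forall>N. \<exists>K. \<forall>i\<ge>K. \<forall>j\<ge>K. N \<le> lcp (x i) (y j))"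
proof -
  have g: "gromov_product (free_dist n) [] (x i) (y j) = real (lcp (x i) (y j))" for i j
    using assms by (intro gromov_product_free) auto
  have "tends_to_same_end (free_dist n) [] x y \<longleftrightarrow>
      (\<forall>Z. \<exists>K. \<forall>i\<ge>K. \<forall>j\<ge>K. Z \<le> real (lcp (x j) (y i)))"
    unfolding tends_to_same_end_def filterlim_at_top eventually_prod_sequentially
    by (simp add: g)
  also have "\<dots> \<longleftrightarrow> (\<forall>N. \<exists>K. \<forall>i\<ge>K. \<forall>j\<ge>K. N \<le> lcp (x i) (y j))"
  proof safe
    fix N assume "\<forall>Z. \<exists>K. \<forall>i\<ge>K. \<forall>j\<ge>K. Z \<le> real (lcp (x j) (y i))"
    then have "\<exists>K. \<forall>i\<ge>K. \<forall>j\<ge>K. real N \<le> real (lcp (x j) (y i))" by blast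
    then show "\<exists>K. \<forall>i\<ge>K. \<forall>j\<ge>K. N \<le> lcp (x i) (y j)" unfolding of_nat_le_iff by blast
  next
    fix Z :: real assume "\<forall>N. \<exists>K. \<forall>i\<ge>K. \<forall>j\<ge>K. N \<le> lcp (x i) (y j)"
    then obtain K where "\<forall>i\<ge>K. \<forall>j\<ge>K. nat \<lceil>Z\<rceil> \<le> lcp (x i) (y j)" by blast
    then show "\<exists>K. \<forall>i\<ge>K. \<forall>j\<ge>K. Z \<le> real (lcp (x j) (y i))"
      by (intro exI [of _ K]) (simp add: nat_ceiling_le_eq)
  qed
  finally show ?thesis .
qed

lemma tends_to_same_end_conv_iff:
  assumes xy: "range x \<subseteq> carrier (free_group n)" "range y \<subseteq> carrier (free_group n)"
    and x: "conv x \<omega>"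
  shows "tends_to_same_end (free_dist n) [] x y \<longleftrightarrow> conv y \<omega>"
proof
  assume *: "tends_to_same_end (free_dist n) [] x y"
  show "conv y \<omega>"
    unfolding conv_def
  proof
    fix N
    from * obtain K where K: "\<And>i j. i \<ge> K \<Longrightarrow> j \<ge> K \<Longrightarrow> N \<le> lcp (x i) (y j)"
      unfolding tends_to_same_end_free_iff [OF xy] by blast
    from x obtain M where M: "\<And>i. i \<ge> M \<Longrightarrow> take N (x i) = pre \<omega> N"
      unfolding conv_def eventually_sequentially by blast
    show "\<forall>\<^sub>F j in sequentially. take N (y j) = pre \<omega> N"
    proof (rule eventually_sequentiallyI)
      fix j assume "K \<le> j"
      then show "take N (y j) = pre \<omega> N"
        using K [of "max K M" j] M [of "max K M"] by (simp add: le_lcp_iff)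
    qed
  qed
next
  assume y: "conv y \<omega>"
  show "tends_to_same_end (free_dist n) [] x y"
    unfolding tends_to_same_end_free_iff [OF xy]
  proof
    fix N
    from x obtain M where M: "\<And>i. i \<ge> M \<Longrightarrow> take N (x i) = pre \<omega> N"
      unfolding conv_def eventually_sequentially by blast
    from y obtain K where K: "\<And>i. i \<ge> K \<Longrightarrow> take N (y i) = pre \<omega> N"
      unfolding conv_def eventually_sequentially by blast
    have "N \<le> lcp (x i) (y j)" if "max M K \<le> i" "max M K \<le> j" for i j
    proof -
      have "take N (x i) = pre \<omega> N" "take N (y j) = pre \<omega> N" using M K that by auto
      then show ?thesis using take_eq_pre_length [of N "x i"] by (simp add: le_lcp_iff)
    qed
    then show "\<exists>K. \<forall>i\<ge>K. \<forall>j\<ge>K. N \<le> lcp (x i) (y j)" by blast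
  qed
qed

lemma conv_in_ends:
  assumes "range x \<subseteq> carrier (free_group n)" "conv x \<omega>"
  shows "\<omega> \<in> ends n"
  unfolding ends_def
proof safe
  fix k
  from assms(2) obtain i where "take k (x i) = pre \<omega> k"
    unfolding conv_def eventually_sequentially by blast
  moreover have "take k (x i) @ drop k (x i) \<in> carrier (free_group n)" using assms(1) by auto
  ultimately show "pre \<omega> k \<in> carrier (free_group n)" by (metis carrier_prefix)
qed

lemma gromov_sequence_conv:
  assumes "range x \<subseteq> carrier (free_group n)" "tends_to_same_end (free_dist n) [] x x"
  shows "\<exists>\<omega>. conv x \<omega>"
proof -
  have "\<forall>N. \<exists>K. \<forall>i\<ge>K. \<forall>j\<ge>K. N \<le> lcp (x i) (x j)"
    using assms(2) unfolding tends_to_same_end_free_iff [OF assms(1,1)] .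
  then obtain K where K: "\<And>N i j. K N \<le> i \<Longrightarrow> K N \<le> j \<Longrightarrow> N \<le> lcp (x i) (x j)" by metis
  \<comment> \<open>Letter number k is read off a term so late that it shares \<open>Suc k\<close>
    letters with all later terms.\<close>
  define \<omega> where "\<omega> k = x (K (Suc k)) ! k" for k
  have "take N (x i) = pre \<omega> N" if "K N \<le> i" for N i
  proof (rule nth_equalityI)
    have len: "N \<le> length (x i)" using K [OF that that] by (simp add: le_lcp_iff)
    then show "length (take N (x i)) = length (pre \<omega> N)" by simp
    fix k assume "k < length (take N (x i))"
    with len have k: "k < N" by simp
    define j where "j = max (K N) (K (Suc k))"
    have "take N (x i) = take N (x j)" using K [of N i j] that by (simp add: le_lcp_iff j_def)
    moreover have "take (Suc k) (x (K (Suc k))) = take (Suc k) (x j)"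
      using K [of "Suc k" "K (Suc k)" j] by (simp add: le_lcp_iff j_def)
    ultimately show "take N (x i) ! k = pre \<omega> N ! k"
      using k nth_take [of k "Suc k" "x j"] nth_take [of k "Suc k" "x (K (Suc k))"]
      by (simp add: \<omega>_def)
  qed
  then show ?thesis
    unfolding conv_def by (intro exI allI) (rule eventually_sequentiallyI)
qed

lemma gromov_sequences_free:
  "x \<in> gromov_sequences (carrier (free_group n)) (free_dist n) [] \<longleftrightarrow>
    range x \<subseteq> carrier (free_group n) \<and> (\<exists>\<omega>\<in>ends n. conv x \<omega>)"
  unfolding gromov_sequences_def mem_Collect_eq
  using gromov_sequence_conv [of x n] conv_in_ends [of x n]
    tends_to_same_end_conv_iff [of x n x] by blast

lemma limit_at_infinity_free:
  assumes "range x \<subseteq> carrier (free_group n)" "conv x \<omega>"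
  shows "limit_at_infinity (carrier (free_group n)) (free_dist n) [] x = pt n \<omega>"
  unfolding limit_at_infinity_def pt_def
  using gromov_sequences_free [of _ n] tends_to_same_end_conv_iff [OF assms(1) _ assms(2)]
    conv_in_ends [of _ n \<omega>] by blast

lemma gromov_boundary_free: "gromov_boundary (carrier (free_group n)) (free_dist n) [] = pt n ` ends n"
proof
  show "gromov_boundary (carrier (free_group n)) (free_dist n) [] \<subseteq> pt n ` ends n"
    unfolding gromov_boundary_def by (auto simp: gromov_sequences_free limit_at_infinity_free)
  show "pt n ` ends n \<subseteq> gromov_boundary (carrier (free_group n)) (free_dist n) []"
  proof
    fix \<xi> assume "\<xi> \<in> pt n ` ends n"
    then obtain \<omega> where \<omega>: "\<omega> \<in> ends n" "\<xi> = pt n \<omega>" by blast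
    have r: "range (pre \<omega>) \<subseteq> carrier (free_group n)" using \<omega> by (auto simp: ends_def)
    show "\<xi> \<in> gromov_boundary (carrier (free_group n)) (free_dist n) []"
      unfolding gromov_boundary_def \<omega>(2) limit_at_infinity_free [OF r conv_pre, symmetric]
      by (rule imageI) (use r \<omega> conv_pre in \<open>auto simp: gromov_sequences_free\<close>)
  qed
qed

lemma topspace_free_boundary: "topspace (free_boundary n) = pt n ` ends n"
  by (simp add: free_boundary_def one_free_group gromov_boundary_free)

text \<open>Gromov products are lengths of common prefixes, so a basic neighbourhood of integral
  radius is a cylinder; the sequences of prefixes witness the existential quantifiers over
  representatives.\<close>

lemma boundary_nbhd_free:
  assumes "\<omega> \<in> ends n"
  shows "boundary_nbhd (carrier (free_group n)) (free_dist n) [] (pt n \<omega>) (real N) =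
    pt n ` {\<eta> \<in> ends n. pre \<eta> N = pre \<omega> N}"
proof -
  have *: "(\<exists>x\<in>pt n \<omega>. \<exists>y\<in>pt n \<eta>. \<forall>\<^sub>F (i, j) in sequentially \<times>\<^sub>F sequentially.
      real N \<le> gromov_product (free_dist n) [] (x i) (y j)) \<longleftrightarrow> pre \<eta> N = pre \<omega> N"
    (is "?L \<longleftrightarrow> _") if \<eta>: "\<eta> \<in> ends n" for \<eta>
  proof
    assume ?L
    then obtain x y where xy: "x \<in> pt n \<omega>" "y \<in> pt n \<eta>"
      and ev: "\<forall>\<^sub>F (i, j) in sequentially \<times>\<^sub>F sequentially.
        real N \<le> gromov_product (free_dist n) [] (x i) (y j)" by blast
    from ev obtain K where K: "\<And>i j. K \<le> i \<Longrightarrow> K \<le> j \<Longrightarrow>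
        real N \<le> gromov_product (free_dist n) [] (x i) (y j)"
      unfolding eventually_prod_sequentially by auto
    from xy obtain M M' where "\<And>i. i \<ge> M \<Longrightarrow> take N (x i) = pre \<omega> N" "\<And>i. i \<ge> M' \<Longrightarrow> take N (y i) = pre \<eta> N"
      unfolding pt_def conv_def eventually_sequentially by blast
    moreover define i where "i = max K (max M M')"
    ultimately have "take N (x i) = pre \<omega> N" "take N (y i) = pre \<eta> N"
        "real N \<le> gromov_product (free_dist n) [] (x i) (y i)"
      using K by auto
    moreover have "gromov_product (free_dist n) [] (x i) (y i) = real (lcp (x i) (y i))"
      using xy by (intro gromov_product_free) (auto simp: pt_def)
    ultimately show "pre \<eta> N = pre \<omega> N" by (simp add: le_lcp_iff)
  next
    assume eq: "pre \<eta> N = pre \<omega> N"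
    have "\<forall>\<^sub>F (i, j) in sequentially \<times>\<^sub>F sequentially.
        real N \<le> gromov_product (free_dist n) [] (pre \<omega> i) (pre \<eta> j)"
      unfolding eventually_prod_sequentially
    proof (intro exI allI impI)
      fix i j assume ij: "N \<le> i" "N \<le> j"
      have "gromov_product (free_dist n) [] (pre \<omega> j) (pre \<eta> i) = real (lcp (pre \<omega> j) (pre \<eta> i))"
        using \<eta> assms by (intro gromov_product_free) (auto simp: ends_def)
      moreover have "N \<le> lcp (pre \<omega> j) (pre \<eta> i)"
        using ij eq by (simp add: le_lcp_iff take_pre min_def)
      ultimately show "case (j, i) of (i, j) \<Rightarrow>
          real N \<le> gromov_product (free_dist n) [] (pre \<omega> i) (pre \<eta> j)" by simp
    qed
    then show ?L using pre_in_pt assms \<eta> by blast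
  qed
  then show ?thesis
    unfolding boundary_nbhd_def gromov_boundary_free by auto
qed

lemma openin_free_boundary:
  "openin (free_boundary n) U \<longleftrightarrow> U \<subseteq> pt n ` ends n \<and>
    (\<forall>\<omega>\<in>ends n. pt n \<omega> \<in> U \<longrightarrow> (\<exists>N. \<forall>\<eta>\<in>ends n. pre \<eta> N = pre \<omega> N \<longrightarrow> pt n \<eta> \<in> U))"
proof -
  have *: "(\<exists>r. boundary_nbhd (carrier (free_group n)) (free_dist n) [] (pt n \<omega>) r \<subseteq> U) \<longleftrightarrow>
      (\<exists>N. \<forall>\<eta>\<in>ends n. pre \<eta> N = pre \<omega> N \<longrightarrow> pt n \<eta> \<in> U)" if \<omega>: "\<omega> \<in> ends n" for \<omega>
  proof
    assume "\<exists>r. boundary_nbhd (carrier (free_group n)) (free_dist n) [] (pt n \<omega>) r \<subseteq> U"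
    then obtain r where r: "boundary_nbhd (carrier (free_group n)) (free_dist n) [] (pt n \<omega>) r \<subseteq> U" ..
    have "r \<le> real (nat \<lceil>r\<rceil>)" by linarith
    from order_trans [OF boundary_nbhd_antimono [OF this] r]
    show "\<exists>N. \<forall>\<eta>\<in>ends n. pre \<eta> N = pre \<omega> N \<longrightarrow> pt n \<eta> \<in> U"
      unfolding boundary_nbhd_free [OF \<omega>] by blast
  next
    assume "\<exists>N. \<forall>\<eta>\<in>ends n. pre \<eta> N = pre \<omega> N \<longrightarrow> pt n \<eta> \<in> U"
    then obtain N where "boundary_nbhd (carrier (free_group n)) (free_dist n) [] (pt n \<omega>) (real N) \<subseteq> U"
      unfolding boundary_nbhd_free [OF \<omega>] by blast
    then show "\<exists>r. boundary_nbhd (carrier (free_group n)) (free_dist n) [] (pt n \<omega>) r \<subseteq> U" ..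
  qed
  have image: "(\<forall>\<xi>\<in>U. P \<xi>) \<longleftrightarrow> (\<forall>\<omega>\<in>ends n. pt n \<omega> \<in> U \<longrightarrow> P (pt n \<omega>))"
    if "U \<subseteq> pt n ` ends n" for P
    using that by blast
  show ?thesis
    unfolding free_boundary_def one_free_group openin_boundary_topology gromov_boundary_free
    by (intro conj_cong refl) (simp only: image * cong: ball_cong)
qed

text \<open>A compactness principle for trees. If \<open>P\<close> failed at the root,
  \<open>step\<close> would let the failure descend along an infinite branch; the branch is an end,
  and on it \<open>bar\<close> provides a prefix with \<open>P\<close>. Finiteness of the branching
  enters when \<open>step\<close> is verified.\<close>

lemma bar_induction:
  assumes bar: "\<And>\<omega>. \<omega> \<in> ends n \<Longrightarrow> \<exists>N. P (pre \<omega> N)"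
    and step: "\<And>p. p \<in> carrier (free_group n) \<Longrightarrow>
      (\<And>a. p @ [a] \<in> carrier (free_group n) \<Longrightarrow> P (p @ [a])) \<Longrightarrow> P p"
  shows "P []"
proof (rule ccontr)
  assume neg: "\<not> P []"
  have "\<exists>f. \<forall>k :: nat. (f k \<in> carrier (free_group n) \<and> \<not> P (f k) \<and> length (f k) = k) \<and>
      (\<exists>a. f (Suc k) = f k @ [a])"
  proof (rule dependent_nat_choice)
    show "\<exists>p. p \<in> carrier (free_group n) \<and> \<not> P p \<and> length p = 0"
      using neg by (auto simp: carrier_free_group)
  next
    fix p and k :: nat assume "p \<in> carrier (free_group n) \<and> \<not> P p \<and> length p = k"
    then show "\<exists>q. (q \<in> carrier (free_group n) \<and> \<not> P q \<and> length q = Suc k) \<and> (\<exists>a. q = p @ [a])"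
      using step [of p] by (metis length_append_singleton)
  qed
  then obtain f where f: "\<And>k. f k \<in> carrier (free_group n)" "\<And>k. \<not> P (f k)"
    "\<And>k. length (f k) = k" "\<And>k. \<exists>a. f (Suc k) = f k @ [a]" by blast
  have pre: "pre (\<lambda>k. last (f (Suc k))) k = f k" for k
  proof (induction k)
    case (Suc k)
    then show ?case using f(4) [of k] by (auto simp: pre_Suc)
  qed (use f(3) [of 0] in simp)
  then have "(\<lambda>k. last (f (Suc k))) \<in> ends n" using f(1) by (simp add: ends_def)
  from bar [OF this] show False using f(2) by (simp add: pre)
qed

definition cyl :: "nat \<Rightarrow> word \<Rightarrow> bpoint set" where
  "cyl n p = pt n ` {\<eta> \<in> ends n. pre \<eta> (length p) = p}"

lemma cyl_Nil: "cyl n [] = topspace (free_boundary n)"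
  by (auto simp: cyl_def topspace_free_boundary)

lemma pt_in_cyl: "\<omega> \<in> ends n \<Longrightarrow> pt n \<omega> \<in> cyl n p \<longleftrightarrow> pre \<omega> (length p) = p"
  by (auto simp: cyl_def pt_eq_iff)

lemma cyl_subset: "cyl n p \<subseteq> topspace (free_boundary n)"
  by (auto simp: cyl_def topspace_free_boundary)

lemma cyl_children: "\<xi> \<in> cyl n p \<Longrightarrow>
  \<exists>a. p @ [a] \<in> carrier (free_group n) \<and> \<xi> \<in> cyl n (p @ [a])"
proof -
  assume "\<xi> \<in> cyl n p"
  then obtain \<omega> where \<omega>: "\<omega> \<in> ends n" "\<xi> = pt n \<omega>" "pre \<omega> (length p) = p" by (auto simp: cyl_def)
  then have "pre \<omega> (Suc (length p)) = p @ [\<omega> (length p)]" by (simp add: pre_Suc)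
  moreover from this have "p @ [\<omega> (length p)] \<in> carrier (free_group n)"
    using \<omega>(1) unfolding ends_def by (metis (mono_tags) mem_Collect_eq)
  ultimately show ?thesis
    using \<omega> by (intro exI [of _ "\<omega> (length p)"]) (simp add: pt_in_cyl)
qed

lemma finite_letters: "finite {a :: letter. fst a < n}"
proof -
  have "{a :: letter. fst a < n} = {..<n} \<times> UNIV" by auto
  then show ?thesis by simp
qed

lemma finite_children: "finite {a. p @ [a] \<in> carrier (free_group n)}"
  by (rule finite_subset [OF _ finite_letters [of n]]) (auto simp: carrier_free_group)

lemma openin_cyl: "openin (free_boundary n) (cyl n p)"
  unfolding openin_free_boundary
proof (intro conjI ballI impI)
  fix \<omega> assume "\<omega> \<in> ends n" "pt n \<omega> \<in> cyl n p"
  then have "pre \<omega> (length p) = p" by (simp only: pt_in_cyl)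
  then show "\<exists>N. \<forall>\<eta>\<in>ends n. pre \<eta> N = pre \<omega> N \<longrightarrow> pt n \<eta> \<in> cyl n p"
    by (intro exI [of _ "length p"] ballI impI) (simp only: pt_in_cyl)
next
  show "cyl n p \<subseteq> pt n ` ends n" unfolding cyl_def by blast
qed

lemma openin_free_boundary_cyl:
  assumes "openin (free_boundary n) U" "\<omega> \<in> ends n" "pt n \<omega> \<in> U"
  shows "\<exists>N. cyl n (pre \<omega> N) \<subseteq> U"
proof -
  from assms obtain N where "\<forall>\<eta>\<in>ends n. pre \<eta> N = pre \<omega> N \<longrightarrow> pt n \<eta> \<in> U"
    unfolding openin_free_boundary by blast
  then have "cyl n (pre \<omega> N) \<subseteq> U" by (auto simp: cyl_def)
  then show ?thesis ..
qed

lemma closedin_cyl: "closedin (free_boundary n) (cyl n p)"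
proof -
  have "openin (free_boundary n) (topspace (free_boundary n) - cyl n p)"
    unfolding openin_free_boundary
  proof (intro conjI ballI impI)
    fix \<omega> assume "\<omega> \<in> ends n" "pt n \<omega> \<in> topspace (free_boundary n) - cyl n p"
    then have "pre \<omega> (length p) \<noteq> p" by (simp only: pt_in_cyl Diff_iff simp_thms)
    then show "\<exists>N. \<forall>\<eta>\<in>ends n. pre \<eta> N = pre \<omega> N \<longrightarrow> pt n \<eta> \<in> topspace (free_boundary n) - cyl n p"
      by (intro exI [of _ "length p"] ballI impI)
        (simp only: pt_in_cyl Diff_iff topspace_free_boundary imageI simp_thms)
  next
    show "topspace (free_boundary n) - cyl n p \<subseteq> pt n ` ends n"
      unfolding topspace_free_boundary by blast
  qed
  then show ?thesis by (simp add: closedin_def cyl_subset)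
qed

text \<open>Bar induction on the property that the cylinder of p has a finite subcover. Openness
  settles sufficiently long prefixes of each end, and the subcovers of the finitely many children
  combine.\<close>

lemma compact_free_boundary: "compact_space (free_boundary n)"
  unfolding compact_space_alt
proof (intro allI impI, elim conjE)
  fix \<U> assume op: "\<forall>U\<in>\<U>. openin (free_boundary n) U" and cov: "topspace (free_boundary n) \<subseteq> \<Union>\<U>"
  have "\<exists>\<F>. finite \<F> \<and> \<F> \<subseteq> \<U> \<and> cyl n [] \<subseteq> \<Union>\<F>"
  proof (rule bar_induction [where n = n])
    fix \<omega> assume \<omega>: "\<omega> \<in> ends n"
    with cov obtain U where "U \<in> \<U>" "pt n \<omega> \<in> U" by (auto simp: topspace_free_boundary)
    then obtain N where "cyl n (pre \<omega> N) \<subseteq> U" using openin_free_boundary_cyl \<omega> op by blast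
    then show "\<exists>N \<F>. finite \<F> \<and> \<F> \<subseteq> \<U> \<and> cyl n (pre \<omega> N) \<subseteq> \<Union>\<F>"
      using \<open>U \<in> \<U>\<close> by (intro exI [of _ N] exI [of _ "{U}"]) auto
  next
    fix p assume "\<And>a. p @ [a] \<in> carrier (free_group n) \<Longrightarrow>
      \<exists>\<F>. finite \<F> \<and> \<F> \<subseteq> \<U> \<and> cyl n (p @ [a]) \<subseteq> \<Union>\<F>"
    then obtain \<F> where \<F>: "\<And>a. p @ [a] \<in> carrier (free_group n) \<Longrightarrow>
      finite (\<F> a) \<and> \<F> a \<subseteq> \<U> \<and> cyl n (p @ [a]) \<subseteq> \<Union>(\<F> a)" by metis
    let ?\<F> = "\<Union>a\<in>{a. p @ [a] \<in> carrier (free_group n)}. \<F> a"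
    have "finite ?\<F>" using \<F> finite_children by blast
    moreover have "?\<F> \<subseteq> \<U>" using \<F> by blast
    moreover have "cyl n p \<subseteq> \<Union>?\<F>"
    proof
      fix \<xi> assume "\<xi> \<in> cyl n p"
      from cyl_children [OF this] obtain a where
        a: "p @ [a] \<in> carrier (free_group n)" "\<xi> \<in> cyl n (p @ [a])" by blast
      then show "\<xi> \<in> \<Union>?\<F>" using \<F> [OF a(1)] by blast
    qed
    ultimately show "\<exists>\<F>. finite \<F> \<and> \<F> \<subseteq> \<U> \<and> cyl n p \<subseteq> \<Union>\<F>" by blast
  qed
  then show "\<exists>\<F>. finite \<F> \<and> \<F> \<subseteq> \<U> \<and> topspace (free_boundary n) \<subseteq> \<Union>\<F>"
    by (simp add: cyl_Nil)
qed

text \<open>Uniform local constancy, again by bar induction: a function that is constant on deep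
  cylinders around each end depends on prefixes of one fixed length.\<close>

lemma locally_constant_depth:
  assumes "\<And>c. openin (free_boundary n) {\<xi> \<in> topspace (free_boundary n). f \<xi> = c}"
  obtains N where "\<And>\<omega> \<eta>. \<omega> \<in> ends n \<Longrightarrow> \<eta> \<in> ends n \<Longrightarrow> pre \<omega> N = pre \<eta> N \<Longrightarrow> f (pt n \<omega>) = f (pt n \<eta>)"
proof -
  have "\<exists>N. \<forall>\<omega>\<in>ends n. \<forall>\<eta>\<in>ends n. pt n \<omega> \<in> cyl n [] \<longrightarrow> pt n \<eta> \<in> cyl n [] \<longrightarrow>
      pre \<omega> N = pre \<eta> N \<longrightarrow> f (pt n \<omega>) = f (pt n \<eta>)"
  proof (rule bar_induction [where n = n])
    fix \<omega> assume \<omega>: "\<omega> \<in> ends n"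
    let ?U = "{\<xi> \<in> topspace (free_boundary n). f \<xi> = f (pt n \<omega>)}"
    have "pt n \<omega> \<in> ?U" using \<omega> by (simp add: topspace_free_boundary)
    from openin_free_boundary_cyl [OF assms \<omega> this] obtain N where "cyl n (pre \<omega> N) \<subseteq> ?U" ..
    then have c: "f \<xi> = f (pt n \<omega>)" if "\<xi> \<in> cyl n (pre \<omega> N)" for \<xi> using that by blast
    show "\<exists>N M. \<forall>\<zeta>\<in>ends n. \<forall>\<eta>\<in>ends n. pt n \<zeta> \<in> cyl n (pre \<omega> N) \<longrightarrow> pt n \<eta> \<in> cyl n (pre \<omega> N) \<longrightarrow>
        pre \<zeta> M = pre \<eta> M \<longrightarrow> f (pt n \<zeta>) = f (pt n \<eta>)"
      by (intro exI [of _ N] exI [of _ 0] ballI impI) (simp only: c)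
  next
    fix p assume "\<And>a. p @ [a] \<in> carrier (free_group n) \<Longrightarrow>
      \<exists>N. \<forall>\<omega>\<in>ends n. \<forall>\<eta>\<in>ends n. pt n \<omega> \<in> cyl n (p @ [a]) \<longrightarrow> pt n \<eta> \<in> cyl n (p @ [a]) \<longrightarrow>
        pre \<omega> N = pre \<eta> N \<longrightarrow> f (pt n \<omega>) = f (pt n \<eta>)"
    then obtain N where N: "\<And>a \<omega> \<eta>. p @ [a] \<in> carrier (free_group n) \<Longrightarrow> \<omega> \<in> ends n \<Longrightarrow> \<eta> \<in> ends n \<Longrightarrow>
      pt n \<omega> \<in> cyl n (p @ [a]) \<Longrightarrow> pt n \<eta> \<in> cyl n (p @ [a]) \<Longrightarrow>
        pre \<omega> (N a) = pre \<eta> (N a) \<Longrightarrow> f (pt n \<omega>) = f (pt n \<eta>)" by metis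
    \<comment> \<open>\<open>Suc (length p)\<close> is included so that ends with the same prefix of
      length \<open>M\<close> lie below the same child of \<open>p\<close>; the remaining entries
      then provide the depth required there.\<close>
    define M where "M = Max (insert (Suc (length p)) (N ` {a. p @ [a] \<in> carrier (free_group n)}))"
    have M: "N a \<le> M" "Suc (length p) \<le> M" if "p @ [a] \<in> carrier (free_group n)" for a
      unfolding M_def using that finite_children [of p n] by (auto intro!: Max_ge)
    have "f (pt n \<omega>) = f (pt n \<eta>)" if *: "\<omega> \<in> ends n" "\<eta> \<in> ends n" "pt n \<omega> \<in> cyl n p" "pre \<omega> M = pre \<eta> M"
      for \<omega> \<eta>
    proof -
      from cyl_children [OF *(3)] obtain a where
        a: "p @ [a] \<in> carrier (free_group n)" "pt n \<omega> \<in> cyl n (p @ [a])" by blast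
      then have "pt n \<eta> \<in> cyl n (p @ [a])"
        using pre_eq_mono [OF *(4) M(2)] * by (simp add: pt_in_cyl)
      then show ?thesis using N [OF a(1) *(1,2) a(2)] pre_eq_mono [OF *(4) M(1)] a by blast
    qed
    then show "\<exists>N. \<forall>\<omega>\<in>ends n. \<forall>\<eta>\<in>ends n. pt n \<omega> \<in> cyl n p \<longrightarrow> pt n \<eta> \<in> cyl n p \<longrightarrow>
        pre \<omega> N = pre \<eta> N \<longrightarrow> f (pt n \<omega>) = f (pt n \<eta>)" by blast
  qed
  then obtain N where "\<And>\<omega> \<eta>. \<omega> \<in> ends n \<Longrightarrow> \<eta> \<in> ends n \<Longrightarrow> pre \<omega> N = pre \<eta> N \<Longrightarrow>
      f (pt n \<omega>) = f (pt n \<eta>)" by (auto simp: pt_in_cyl)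
  then show thesis by (rule that)
qed


section \<open>The action on ends\<close>

abbreviation FG :: "nat \<Rightarrow> word monoid" where "FG n \<equiv> free_group n"

interpretation fg: group "free_group n" for n
  by (rule group_free_group)

lemma ends_pre: "\<omega> \<in> ends n \<Longrightarrow> pre \<omega> k \<in> carrier (FG n)"
  by (simp add: ends_def)

text \<open>Left multiplication of an infinite reduced word by a letter: cancel against the first
  letter or prepend.\<close>

definition act1 :: "letter \<Rightarrow> (nat \<Rightarrow> letter) \<Rightarrow> nat \<Rightarrow> letter" where
  "act1 a \<omega> = (if \<omega> 0 = inv_letter a then (\<lambda>k. \<omega> (Suc k)) else case_nat a \<omega>)"

definition act :: "word \<Rightarrow> (nat \<Rightarrow> letter) \<Rightarrow> nat \<Rightarrow> letter" where
  "act g \<omega> = foldr act1 g \<omega>"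

lemma pre_case_nat: "pre (case_nat a \<omega>) (Suc k) = a # pre \<omega> k"
  by (simp add: pre_Suc_Cons)

lemma reduced_Cons_Cons: "reduced (a # b # w) \<longleftrightarrow> b \<noteq> inv_letter a \<and> reduced (b # w)"
  by (simp add: reduced_def)

lemma act1_ends:
  assumes "fst a < n" "\<omega> \<in> ends n"
  shows "act1 a \<omega> \<in> ends n"
  unfolding ends_def
proof safe
  fix k
  show "pre (act1 a \<omega>) k \<in> carrier (FG n)"
  proof (cases "\<omega> 0 = inv_letter a")
    case True
    have "[\<omega> 0] @ pre (\<lambda>k. \<omega> (Suc k)) k \<in> carrier (FG n)"
      using ends_pre [OF assms(2), of "Suc k"] by (simp add: pre_Suc_Cons)
    then show ?thesis
      using True reduced_appendD(2) [of "[\<omega> 0]"] unfolding act1_def carrier_free_group by simp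
  next
    case False
    show ?thesis
    proof (cases k)
      case (Suc j)
      have "reduced (a # pre \<omega> j)"
      proof (cases j)
        case (Suc i)
        then show ?thesis
          using False ends_pre [OF assms(2), of j]
          by (simp add: pre_Suc_Cons reduced_Cons_Cons carrier_free_group)
      qed simp
      then show ?thesis
        using False Suc assms(1) ends_pre [OF assms(2), of j]
        by (simp add: act1_def pre_case_nat carrier_free_group)
    qed (simp add: carrier_free_group)
  qed
qed

lemma act_ends:
  assumes "g \<in> words n" "\<omega> \<in> ends n"
  shows "act g \<omega> \<in> ends n"
  using assms by (induction g) (auto simp: act_def intro: act1_ends)

lemma conv_act1:
  assumes "conv x \<omega>"
  shows "conv (\<lambda>i. cancel_cons a (x i)) (act1 a \<omega>)"
  unfolding conv_def
proof
  fix N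
  \<comment> \<open>One letter more than asked for has to be known, because the first one may be
    cancelled.\<close>
  have "\<forall>\<^sub>F i in sequentially. take (Suc N) (x i) = pre \<omega> (Suc N)"
    using assms by (simp add: conv_def)
  then show "\<forall>\<^sub>F i in sequentially. take N (cancel_cons a (x i)) = pre (act1 a \<omega>) N"
  proof (rule eventually_mono)
    fix i assume *: "take (Suc N) (x i) = pre \<omega> (Suc N)"
    then obtain zs where zs: "x i = \<omega> 0 # zs" "take N zs = pre (\<lambda>k. \<omega> (Suc k)) N"
      by (cases "x i") (auto simp: pre_Suc_Cons)
    show "take N (cancel_cons a (x i)) = pre (act1 a \<omega>) N"
    proof (cases "\<omega> 0 = inv_letter a")
      case False
      then show ?thesis
      proof (cases N)
        case (Suc M)
        have "take M (x i) = pre \<omega> M"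
          using * Suc by (metis le_SucI le_refl min.absorb1 take_pre take_take)
        then show ?thesis using False Suc zs by (simp add: act1_def pre_case_nat)
      qed simp
    qed (use zs in \<open>simp add: act1_def\<close>)
  qed
qed

lemma reduce_append_foldr: "reduced x \<Longrightarrow> reduce (g @ x) = foldr cancel_cons g x"
  using reduce_reduced [of x] by (simp add: reduce_def)

lemma conv_act:
  assumes "conv x \<omega>" "\<And>i. reduced (x i)"
  shows "conv (\<lambda>i. reduce (g @ x i)) (act g \<omega>)"
proof -
  have "conv (\<lambda>i. foldr cancel_cons g (x i)) (act g \<omega>)"
    by (induction g) (auto simp: act_def assms(1) intro: conv_act1)
  then show ?thesis by (simp add: reduce_append_foldr assms(2))
qed

lemma range_translate:
  assumes "g \<in> carrier (FG n)" "range x \<subseteq> carrier (FG n)"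
  shows "range (\<lambda>k. g \<otimes>\<^bsub>FG n\<^esub> x k) \<subseteq> carrier (FG n)"
  using assms by auto

lemma conv_translate:
  assumes "range x \<subseteq> carrier (FG n)" "conv x \<omega>"
  shows "conv (\<lambda>k. g \<otimes>\<^bsub>FG n\<^esub> x k) (act g \<omega>)"
  unfolding mult_free_group
  by (rule conv_act [OF assms(2)]) (use assms(1) carrier_free_group in blast)

text \<open>Associativity is inherited from the group: both sides are limits of the same sequence of
  words.\<close>

lemma act_mult:
  assumes g: "g \<in> carrier (FG n)" and h: "h \<in> carrier (FG n)" and \<omega>: "\<omega> \<in> ends n"
  shows "act (g \<otimes>\<^bsub>FG n\<^esub> h) \<omega> = act g (act h \<omega>)"
proof (rule conv_unique)
  have r: "range (pre \<omega>) \<subseteq> carrier (FG n)" using ends_pre [OF \<omega>] by auto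
  show "conv (\<lambda>k. g \<otimes>\<^bsub>FG n\<^esub> h \<otimes>\<^bsub>FG n\<^esub> pre \<omega> k) (act (g \<otimes>\<^bsub>FG n\<^esub> h) \<omega>)"
    by (rule conv_translate [OF r conv_pre])
  have "conv (\<lambda>k. g \<otimes>\<^bsub>FG n\<^esub> (h \<otimes>\<^bsub>FG n\<^esub> pre \<omega> k)) (act g (act h \<omega>))"
    by (intro conv_translate range_translate h r conv_pre)
  then show "conv (\<lambda>k. g \<otimes>\<^bsub>FG n\<^esub> h \<otimes>\<^bsub>FG n\<^esub> pre \<omega> k) (act g (act h \<omega>))"
    using g h ends_pre [OF \<omega>] by (simp add: fg.m_assoc)
qed

lemma act_one [simp]: "act [] \<omega> = \<omega>"
  by (simp add: act_def)

lemma act_inv_act: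
  assumes "g \<in> carrier (FG n)" "\<omega> \<in> ends n"
  shows "act (inv\<^bsub>FG n\<^esub> g) (act g \<omega>) = \<omega>" "act g (act (inv\<^bsub>FG n\<^esub> g) \<omega>) = \<omega>"
  using act_mult [of "inv\<^bsub>FG n\<^esub> g" n g \<omega>] act_mult [of g n "inv\<^bsub>FG n\<^esub> g" \<omega>] assms
    one_free_group [of n] by auto

lemma translate_mult:
  assumes "g \<in> carrier (FG n)" "h \<in> carrier (FG n)" "\<xi> \<in> topspace (free_boundary n)"
  shows "translate_bpoint n (g \<otimes>\<^bsub>FG n\<^esub> h) \<xi> = translate_bpoint n g (translate_bpoint n h \<xi>)"
proof -
  have "g \<otimes>\<^bsub>FG n\<^esub> h \<otimes>\<^bsub>FG n\<^esub> x k = g \<otimes>\<^bsub>FG n\<^esub> (h \<otimes>\<^bsub>FG n\<^esub> x k)" if "x \<in> \<xi>" for x k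
  proof -
    have "x k \<in> carrier (FG n)" using that assms(3) by (auto simp: topspace_free_boundary pt_def)
    then show ?thesis using assms by (simp add: fg.m_assoc)
  qed
  then show ?thesis unfolding translate_bpoint_def image_image by (intro image_cong refl) auto
qed

lemma translate_one:
  assumes "\<xi> \<in> topspace (free_boundary n)"
  shows "translate_bpoint n [] \<xi> = \<xi>"
proof -
  have "reduce (x k) = x k" if "x \<in> \<xi>" for x k
  proof -
    have "x k \<in> carrier (FG n)" using that assms by (auto simp: topspace_free_boundary pt_def)
    then show ?thesis by (simp add: carrier_free_group reduce_reduced)
  qed
  then show ?thesis by (simp add: translate_bpoint_def mult_free_group)
qed

lemma translate_pt:
  assumes g: "g \<in> carrier (FG n)" and \<omega>: "\<omega> \<in> ends n"
  shows "translate_bpoint n g (pt n \<omega>) = pt n (act g \<omega>)"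
proof -
  have sub: "translate_bpoint n h (pt n \<eta>) \<subseteq> pt n (act h \<eta>)" if "h \<in> carrier (FG n)" for h \<eta>
    using that by (auto simp: translate_bpoint_def pt_def conv_translate)
  show ?thesis
  proof
    show "pt n (act g \<omega>) \<subseteq> translate_bpoint n g (pt n \<omega>)"
    proof
      fix y assume y: "y \<in> pt n (act g \<omega>)"
      let ?x = "\<lambda>k. inv\<^bsub>FG n\<^esub> g \<otimes>\<^bsub>FG n\<^esub> y k"
      have "?x \<in> translate_bpoint n (inv\<^bsub>FG n\<^esub> g) (pt n (act g \<omega>))"
        unfolding translate_bpoint_def using y by (rule imageI)
      then have x: "?x \<in> pt n \<omega>"
        using sub [of "inv\<^bsub>FG n\<^esub> g" "act g \<omega>"] g act_inv_act(1) [OF g \<omega>] by auto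
      have "y k = g \<otimes>\<^bsub>FG n\<^esub> ?x k" for k
      proof -
        have "y k \<in> carrier (FG n)" using y by (auto simp: pt_def)
        then show ?thesis using g by (simp add: fg.m_assoc [symmetric])
      qed
      then have y': "y = (\<lambda>x k. g \<otimes>\<^bsub>FG n\<^esub> x k) ?x" by auto
      show "y \<in> translate_bpoint n g (pt n \<omega>)"
        unfolding translate_bpoint_def by (rule image_eqI [where x = ?x, OF _ x]) (rule y')
    qed
  qed (rule sub [OF g])
qed

lemma translate_in_topspace:
  assumes "g \<in> carrier (FG n)" "\<xi> \<in> topspace (free_boundary n)"
  shows "translate_bpoint n g \<xi> \<in> topspace (free_boundary n)"
  using assms act_ends [of g n] by (auto simp: topspace_free_boundary translate_pt carrier_free_group)

lemma pre_act1:
  assumes "pre \<omega> (Suc N) = pre \<eta> (Suc N)"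
  shows "pre (act1 a \<omega>) N = pre (act1 a \<eta>) N"
proof -
  have "\<omega> 0 = \<eta> 0" "pre (\<lambda>k. \<omega> (Suc k)) N = pre (\<lambda>k. \<eta> (Suc k)) N"
    using assms by (auto simp: pre_Suc_Cons)
  moreover have "pre (case_nat a \<omega>) N = pre (case_nat a \<eta>) N"
    using pre_eq_mono [OF assms, of "N - 1"] by (cases N) (auto simp: pre_case_nat)
  ultimately show ?thesis by (simp add: act1_def)
qed

text \<open>Each letter of \<open>g\<close> cancels at most one letter, which makes the action
  uniformly continuous with an explicit modulus.\<close>

lemma pre_act: "pre \<omega> (N + length g) = pre \<eta> (N + length g) \<Longrightarrow> pre (act g \<omega>) N = pre (act g \<eta>) N"
proof (induction g arbitrary: N)
  case (Cons a g)
  then have "pre (act g \<omega>) (Suc N) = pre (act g \<eta>) (Suc N)" by simp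
  from pre_act1 [OF this] show ?case by (simp add: act_def)
qed simp

lemma continuous_map_translate:
  assumes g: "g \<in> carrier (FG n)"
  shows "continuous_map (free_boundary n) (free_boundary n) (translate_bpoint n g)"
  unfolding continuous_map
proof (intro conjI allI impI)
  show "translate_bpoint n g ` topspace (free_boundary n) \<subseteq> topspace (free_boundary n)"
    using translate_in_topspace [OF g] by blast
  fix U assume U: "openin (free_boundary n) U"
  show "openin (free_boundary n) {\<xi> \<in> topspace (free_boundary n). translate_bpoint n g \<xi> \<in> U}"
    unfolding openin_free_boundary
  proof (intro conjI ballI impI)
    show "{\<xi> \<in> topspace (free_boundary n). translate_bpoint n g \<xi> \<in> U} \<subseteq> pt n ` ends n"
      by (auto simp: topspace_free_boundary)
    fix \<omega> assume \<omega>: "\<omega> \<in> ends n" "pt n \<omega> \<in> {\<xi> \<in> topspace (free_boundary n). translate_bpoint n g \<xi> \<in> U}"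
    have a: "act g \<eta> \<in> ends n" if "\<eta> \<in> ends n" for \<eta>
      using that g by (auto simp: carrier_free_group intro: act_ends)
    from \<omega> have "pt n (act g \<omega>) \<in> U" by (simp add: translate_pt g)
    from openin_free_boundary_cyl [OF U a [OF \<omega>(1)] this]
    obtain N where sub: "cyl n (pre (act g \<omega>) N) \<subseteq> U" ..
    have N: "pt n \<eta> \<in> U" if "\<eta> \<in> ends n" "pre \<eta> N = pre (act g \<omega>) N" for \<eta>
      by (rule subsetD [OF sub]) (simp only: pt_in_cyl that length_pre)
    have "pt n \<eta> \<in> {\<xi> \<in> topspace (free_boundary n). translate_bpoint n g \<xi> \<in> U}"
      if "\<eta> \<in> ends n" "pre \<eta> (N + length g) = pre \<omega> (N + length g)" for \<eta>
      using N [OF a [OF that(1)] pre_act [OF that(2)]] that(1) g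
      by (simp add: topspace_free_boundary translate_pt)
    then show "\<exists>N. \<forall>\<eta>\<in>ends n. pre \<eta> N = pre \<omega> N \<longrightarrow>
        pt n \<eta> \<in> {\<xi> \<in> topspace (free_boundary n). translate_bpoint n g \<xi> \<in> U}" by blast
  qed
qed

text \<open>All cancellation happens in a bounded initial segment; beyond it, multiplication by
  \<open>g\<close> only renumbers the prefixes of a ray. This carries periodicity from the ray of a
  cyclically reduced word to its translates.\<close>

lemma act_shift: "\<exists>d e. \<forall>N. foldr cancel_cons g (pre \<omega> (d + N)) = pre (act g \<omega>) (e + N)"
proof (induction g)
  case Nil
  show ?case by (rule exI [of _ 0], rule exI [of _ 0]) simp
next
  case (Cons a g)
  then obtain d e where de: "\<And>N. foldr cancel_cons g (pre \<omega> (d + N)) = pre (act g \<omega>) (e + N)"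
    by blast
  show ?case
  proof (cases "act g \<omega> 0 = inv_letter a")
    case True
    have "foldr cancel_cons (a # g) (pre \<omega> (Suc d + N)) = pre (act (a # g) \<omega>) (e + N)" for N
      using de [of "Suc N"] True by (simp add: pre_Suc_Cons act_def act1_def)
    then show ?thesis by blast
  next
    case False
    have "foldr cancel_cons (a # g) (pre \<omega> (d + N)) = pre (act (a # g) \<omega>) (Suc e + N)" for N
    proof -
      have "cancel_cons a (pre (act g \<omega>) m) = a # pre (act g \<omega>) m" for m
        using False by (cases m) (auto simp: pre_Suc_Cons)
      then show ?thesis using de [of N] False by (simp add: act_def act1_def pre_case_nat)
    qed
    then show ?thesis by blast
  qed
qed


section \<open>Axes of group elements\<close>

lemma reduced_rev_inv: "reduced (map inv_letter (rev w)) \<longleftrightarrow> reduced w"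
proof -
  have "(\<lambda>x y. inv_letter x \<noteq> inv_letter (inv_letter y)) = (\<lambda>x y. y \<noteq> inv_letter x)"
    by (auto simp: fun_eq_iff)
  then show ?thesis by (simp only: reduced_def successively_map successively_rev)
qed

lemma words_iff: "w \<in> words n \<longleftrightarrow> (\<forall>a\<in>set w. fst a < n)"
  by (auto simp: words_def in_lists_conv_set mem_Times_iff)

lemma inv_free_group:
  assumes "x \<in> carrier (FG n)"
  shows "inv\<^bsub>FG n\<^esub> x = map inv_letter (rev x)"
proof (rule fg.inv_equality)
  show "map inv_letter (rev x) \<otimes>\<^bsub>FG n\<^esub> x = \<one>\<^bsub>FG n\<^esub>"
    by (simp add: mult_free_group one_free_group reduce_inv_append)
  show "map inv_letter (rev x) \<in> carrier (FG n)"
    using assms unfolding carrier_free_group reduced_rev_inv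
    by (simp add: words_iff)
qed (rule assms)

text \<open>As long as the last letter is the inverse of the first, both are stripped off. What
  remains can be followed by itself without cancellation.\<close>

lemma cyclic_reduction:
  assumes "reduced w" "w \<noteq> []"
  shows "\<exists>c v. v \<noteq> [] \<and> reduced (v @ v) \<and> w = c @ v @ map inv_letter (rev c)"
  using assms
proof (induction w rule: length_induct)
  case (1 w)
  show ?case
  proof (cases "last w = inv_letter (hd w)")
    case False
    then have "hd w \<noteq> inv_letter (last w)" by auto
    then have "reduced (w @ w)" using 1 by (simp add: reduced_def successively_append_iff)
    then show ?thesis using 1 by (intro exI [of _ "[]"] exI [of _ w]) simp
  next
    case True
    obtain a u where w: "w = a # u" using 1 by (cases w) auto
    have u: "u \<noteq> []" using True w inv_letter_neq by fastforce
    then obtain y b where y: "u = y @ [b]" by (cases u rule: rev_cases) auto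
    have b: "b = inv_letter a" using True w y by simp
    \<comment> \<open>A reduced word cannot be a letter followed by its inverse, so the core never
      becomes empty.\<close>
    have "y \<noteq> []" using 1 w y b by (auto simp: reduced_Cons_Cons)
    moreover have "reduced y" using 1 w y reduced_appendD [of "[a]" "y @ [b]"] reduced_appendD(1) [of y "[b]"] by simp
    ultimately obtain c v where "v \<noteq> []" "reduced (v @ v)" "y = c @ v @ map inv_letter (rev c)"
      using 1 w y by (metis length_Cons length_append_singleton less_SucI lessI)
    then show ?thesis
      by (intro exI [of _ "a # c"] exI [of _ v]) (simp add: w y b)
  qed
qed

definition periodic :: "'a list \<Rightarrow> nat \<Rightarrow> 'a" where
  "periodic v k = v ! (k mod length v)"

lemma pre_periodic:
  assumes "v \<noteq> []"
  shows "pre (periodic v) (length v + N) = v @ pre (periodic v) N"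
proof (rule nth_equalityI)
  fix i assume "i < length (pre (periodic v) (length v + N))"
  then show "pre (periodic v) (length v + N) ! i = (v @ pre (periodic v) N) ! i"
    using le_mod_geq [of "length v" i] by (auto simp: nth_append periodic_def)
qed simp

text \<open>Two consecutive letters of the infinite power lie in one copy of \<open>v\<close> or
  across a seam, and \<open>v @ v\<close> contains both situations.\<close>

lemma periodic_in_ends:
  assumes "v \<in> words n" "v \<noteq> []" "reduced (v @ v)"
  shows "periodic v \<in> ends n"
  unfolding ends_def
proof safe
  fix k
  have lt: "i mod length v < length v" for i using assms(2) by simp
  have "reduced (pre (periodic v) k)"
    unfolding reduced_def successively_conv_nth
  proof safe
    fix i assume i: "Suc i < length (pre (periodic v) k)"
      and eq: "pre (periodic v) k ! Suc i = inv_letter (pre (periodic v) k ! i)"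
    let ?j = "i mod length v"
    have "Suc ?j < length (v @ v)" using lt [of i] by simp
    then have "(v @ v) ! Suc ?j \<noteq> inv_letter ((v @ v) ! ?j)"
      using assms(3) unfolding reduced_def successively_conv_nth by blast
    moreover have "(v @ v) ! ?j = periodic v i" using lt [of i] by (simp add: nth_append periodic_def)
    moreover have "(v @ v) ! Suc ?j = periodic v (Suc i)"
      using lt [of i] by (auto simp: nth_append periodic_def mod_Suc)
    ultimately show False using eq i by simp
  qed
  moreover have "pre (periodic v) k \<in> words n"
    using assms(1) lt by (auto simp: words_def pre_def periodic_def mem_Times_iff in_lists_conv_set)
  ultimately show "pre (periodic v) k \<in> carrier (FG n)" by (simp add: carrier_free_group)
qed

text \<open>Each letter of \<open>z\<close> can cancel at most one letter of \<open>x\<close>, so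
  the first \<open>N\<close> letters are out of reach.\<close>

lemma take_reduce_append:
  assumes "reduced x" "N + length z \<le> length x"
  shows "take N (reduce (x @ z)) = take N x"
  using assms
proof (induction z arbitrary: x)
  case (Cons b z)
  let ?y = "reduce (x @ [b])"
  have y: "?y = butlast x \<or> ?y = x @ [b]" using Cons.prems(1) by (auto simp: reduce_snoc)
  have "reduce (x @ b # z) = reduce (?y @ z)" using reduce_append_left [of "x @ [b]" z] by simp
  also have "take N \<dots> = take N ?y"
    by (rule Cons.IH) (use y Cons.prems(2) reduced_reduce in auto)
  also have "\<dots> = take N x" using y Cons.prems(2) by (auto simp: take_butlast)
  finally show ?case .
qed (simp add: reduce_reduced)

lemma (in group) inv_cancel:
  assumes "g \<in> carrier G" "y \<in> carrier G"
  shows "inv g \<otimes> (g \<otimes> y) = y" "g \<otimes> (inv g \<otimes> y) = y"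
  using assms by (simp_all add: m_assoc [symmetric])

lemma (in group) conj_pow:
  fixes k :: nat
  assumes "g \<in> carrier G" "w \<in> carrier G"
  shows "(g \<otimes> w \<otimes> inv g) [^] k = g \<otimes> w [^] k \<otimes> inv g"
proof (induction k)
  case (Suc k)
  then show ?case using assms by (simp add: m_assoc inv_cancel)
qed (use assms in simp)

text \<open>Write w as the conjugate by c of a cyclically reduced word v. Then the elements g w^k
  tend to the translate by g c of the ray v v v ..., and the conjugate of w by g pushes far vertices
  of this ray forward by the length of v, which is \<open>P\<close>. The forward shift is what later
  recognises elements with a common end.\<close>

lemma axis_limit:
  assumes w: "w \<in> carrier (FG n)" "w \<noteq> []" and g: "g \<in> carrier (FG n)"
  obtains \<omega> P t0 where "\<omega> \<in> ends n" "conv (\<lambda>k. g \<otimes>\<^bsub>FG n\<^esub> w [^]\<^bsub>FG n\<^esub> (k :: nat)) \<omega>"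
    "P \<ge> 1" "\<And>t. t \<ge> t0 \<Longrightarrow> g \<otimes>\<^bsub>FG n\<^esub> w \<otimes>\<^bsub>FG n\<^esub> inv\<^bsub>FG n\<^esub> g \<otimes>\<^bsub>FG n\<^esub> pre \<omega> t = pre \<omega> (t + P)"
proof -
  from cyclic_reduction [of w] w obtain c v
    where v: "v \<noteq> []" "reduced (v @ v)" and weq: "w = c @ v @ map inv_letter (rev c)"
    by (auto simp: carrier_free_group)
  have words: "c \<in> words n" "v \<in> words n" using w(1) weq by (auto simp: carrier_free_group)
  have red: "reduced c" "reduced v"
    using w(1) weq reduced_appendD(1) [of c] v(2) reduced_appendD(1) [of v v]
    by (auto simp: carrier_free_group)
  have c: "c \<in> carrier (FG n)" and vc: "v \<in> carrier (FG n)" using words red by (auto simp: carrier_free_group)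
  have wc: "w = c \<otimes>\<^bsub>FG n\<^esub> v \<otimes>\<^bsub>FG n\<^esub> inv\<^bsub>FG n\<^esub> c"
    unfolding inv_free_group [OF c] mult_free_group reduce_append_left
    using w(1) weq reduce_reduced [of w] by (simp add: carrier_free_group)
  let ?\<omega> = "periodic v" and ?m = "length v"
  define h where "h = g \<otimes>\<^bsub>FG n\<^esub> c"
  have h: "h \<in> carrier (FG n)" using g c by (simp add: h_def)
  have e: "?\<omega> \<in> ends n" by (rule periodic_in_ends [OF words(2) v])
  have mul_v: "v \<otimes>\<^bsub>FG n\<^esub> pre ?\<omega> N = pre ?\<omega> (?m + N)" for N
    using ends_pre [OF e, of "?m + N"]
    by (simp add: mult_free_group pre_periodic [OF v(1)] carrier_free_group reduce_reduced)
  have pow_v: "v [^]\<^bsub>FG n\<^esub> k = pre ?\<omega> (k * ?m)" for k :: nat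
  proof (induction k)
    case (Suc k)
    have "v [^]\<^bsub>FG n\<^esub> Suc k = v \<otimes>\<^bsub>FG n\<^esub> v [^]\<^bsub>FG n\<^esub> k" using vc by (rule fg.nat_pow_Suc2)
    then show ?case using Suc mul_v by simp
  qed (simp add: one_free_group)
  have conv_v: "conv (\<lambda>k. v [^]\<^bsub>FG n\<^esub> (k :: nat) \<otimes>\<^bsub>FG n\<^esub> inv\<^bsub>FG n\<^esub> c) ?\<omega>"
    unfolding conv_def
  proof
    fix N
    show "\<forall>\<^sub>F k in sequentially. take N (v [^]\<^bsub>FG n\<^esub> (k :: nat) \<otimes>\<^bsub>FG n\<^esub> inv\<^bsub>FG n\<^esub> c) = pre ?\<omega> N"
    proof (rule eventually_sequentiallyI)
      \<comment> \<open>The factor from the conjugation cancels at most \<open>length c\<close>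
        letters, and the power has at least k of them.\<close>
      fix k assume k: "N + length c \<le> k"
      have "k \<le> k * ?m" using v(1) by (cases v) auto
      with k have le: "N + length c \<le> k * ?m" by (rule order_trans)
      have "take N (reduce (pre ?\<omega> (k * ?m) @ map inv_letter (rev c))) = take N (pre ?\<omega> (k * ?m))"
        by (rule take_reduce_append)
          (use le ends_pre [OF e, of "k * ?m"] in \<open>auto simp: carrier_free_group\<close>)
      also have "\<dots> = pre ?\<omega> N" using le by (simp add: take_pre)
      finally show "take N (v [^]\<^bsub>FG n\<^esub> k \<otimes>\<^bsub>FG n\<^esub> inv\<^bsub>FG n\<^esub> c) = pre ?\<omega> N"
        by (simp add: pow_v mult_free_group inv_free_group [OF c])
    qed
  qed
  have "conv (\<lambda>k. h \<otimes>\<^bsub>FG n\<^esub> (v [^]\<^bsub>FG n\<^esub> (k :: nat) \<otimes>\<^bsub>FG n\<^esub> inv\<^bsub>FG n\<^esub> c)) (act h ?\<omega>)"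
    by (rule conv_translate [OF _ conv_v]) (use vc c in auto)
  moreover have "h \<otimes>\<^bsub>FG n\<^esub> (v [^]\<^bsub>FG n\<^esub> k \<otimes>\<^bsub>FG n\<^esub> inv\<^bsub>FG n\<^esub> c) = g \<otimes>\<^bsub>FG n\<^esub> w [^]\<^bsub>FG n\<^esub> k" for k :: nat
    using g c vc unfolding h_def wc fg.conj_pow [OF c vc] by (simp add: fg.m_assoc)
  ultimately have lim: "conv (\<lambda>k. g \<otimes>\<^bsub>FG n\<^esub> w [^]\<^bsub>FG n\<^esub> (k :: nat)) (act h ?\<omega>)" by simp
  obtain d t0 where dt: "\<And>N. foldr cancel_cons h (pre ?\<omega> (d + N)) = pre (act h ?\<omega>) (t0 + N)"
    using act_shift by blast
  have hd: "h \<otimes>\<^bsub>FG n\<^esub> pre ?\<omega> (d + N) = pre (act h ?\<omega>) (t0 + N)" for N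
    using dt [of N] ends_pre [OF e, of "d + N"]
    by (simp add: mult_free_group reduce_append_foldr carrier_free_group)
  have "g \<otimes>\<^bsub>FG n\<^esub> w \<otimes>\<^bsub>FG n\<^esub> inv\<^bsub>FG n\<^esub> g \<otimes>\<^bsub>FG n\<^esub> h = h \<otimes>\<^bsub>FG n\<^esub> v"
    using g c vc by (simp add: h_def wc fg.m_assoc fg.inv_cancel)
  then have gh: "g \<otimes>\<^bsub>FG n\<^esub> w \<otimes>\<^bsub>FG n\<^esub> inv\<^bsub>FG n\<^esub> g \<otimes>\<^bsub>FG n\<^esub> (h \<otimes>\<^bsub>FG n\<^esub> pre ?\<omega> (d + N))
      = h \<otimes>\<^bsub>FG n\<^esub> (v \<otimes>\<^bsub>FG n\<^esub> pre ?\<omega> (d + N))" for N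
    using g w(1) h vc ends_pre [OF e] by (metis fg.m_assoc fg.m_closed fg.inv_closed)
  have per: "g \<otimes>\<^bsub>FG n\<^esub> w \<otimes>\<^bsub>FG n\<^esub> inv\<^bsub>FG n\<^esub> g \<otimes>\<^bsub>FG n\<^esub> pre (act h ?\<omega>) (t0 + N)
      = pre (act h ?\<omega>) (t0 + N + ?m)" for N
    using gh [of N] hd [of N] hd [of "N + ?m"] mul_v [of "d + N"]
    by (metis add.assoc add.commute)
  show thesis
  proof (rule that)
    show "act h ?\<omega> \<in> ends n" using h e act_ends by (auto simp: carrier_free_group)
    show "1 \<le> ?m" using v(1) by (cases v) auto
    show "g \<otimes>\<^bsub>FG n\<^esub> w \<otimes>\<^bsub>FG n\<^esub> inv\<^bsub>FG n\<^esub> g \<otimes>\<^bsub>FG n\<^esub> pre (act h ?\<omega>) t = pre (act h ?\<omega>) (t + ?m)"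
      if "t0 \<le> t" for t
      using per [of "t - t0"] that by simp
  qed (rule lim)
qed

definition axis_end :: "nat \<Rightarrow> word \<Rightarrow> word \<Rightarrow> bpoint" where
  "axis_end n g w = free_limit n (\<lambda>k. g \<otimes>\<^bsub>FG n\<^esub> w [^]\<^bsub>FG n\<^esub> k)"

lemma free_limit_conv:
  "range x \<subseteq> carrier (FG n) \<Longrightarrow> conv x \<omega> \<Longrightarrow> free_limit n x = pt n \<omega>"
  unfolding free_limit_def one_free_group by (rule limit_at_infinity_free)

lemma axis_end_pt:
  assumes "w \<in> carrier (FG n)" "w \<noteq> []" "g \<in> carrier (FG n)"
  shows "\<exists>\<omega> P t0. \<omega> \<in> ends n \<and> axis_end n g w = pt n \<omega> \<and>
    conv (\<lambda>k. g \<otimes>\<^bsub>FG n\<^esub> w [^]\<^bsub>FG n\<^esub> (k :: nat)) \<omega> \<and> P \<ge> 1 \<and>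
    (\<forall>t j. t \<ge> t0 \<longrightarrow>
      (g \<otimes>\<^bsub>FG n\<^esub> w \<otimes>\<^bsub>FG n\<^esub> inv\<^bsub>FG n\<^esub> g) [^]\<^bsub>FG n\<^esub> (j :: nat) \<otimes>\<^bsub>FG n\<^esub> pre \<omega> t = pre \<omega> (t + j * P))"
proof -
  from axis_limit [OF assms] obtain \<omega> P t0 where \<omega>: "\<omega> \<in> ends n"
      and lim: "conv (\<lambda>k. g \<otimes>\<^bsub>FG n\<^esub> w [^]\<^bsub>FG n\<^esub> (k :: nat)) \<omega>" and P: "P \<ge> 1"
      and per: "\<And>t. t \<ge> t0 \<Longrightarrow> g \<otimes>\<^bsub>FG n\<^esub> w \<otimes>\<^bsub>FG n\<^esub> inv\<^bsub>FG n\<^esub> g \<otimes>\<^bsub>FG n\<^esub> pre \<omega> t = pre \<omega> (t + P)"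
    by blast
  have "range (\<lambda>k. g \<otimes>\<^bsub>FG n\<^esub> w [^]\<^bsub>FG n\<^esub> (k :: nat)) \<subseteq> carrier (FG n)" using assms by auto
  from free_limit_conv [OF this lim] have "axis_end n g w = pt n \<omega>" by (simp add: axis_end_def)
  moreover have "(g \<otimes>\<^bsub>FG n\<^esub> w \<otimes>\<^bsub>FG n\<^esub> inv\<^bsub>FG n\<^esub> g) [^]\<^bsub>FG n\<^esub> j \<otimes>\<^bsub>FG n\<^esub> pre \<omega> t = pre \<omega> (t + j * P)"
    if "t \<ge> t0" for t and j :: nat
  proof (induction j)
    case 0
    then show ?case using ends_pre [OF \<omega>] by simp
  next
    case (Suc j)
    let ?a = "g \<otimes>\<^bsub>FG n\<^esub> w \<otimes>\<^bsub>FG n\<^esub> inv\<^bsub>FG n\<^esub> g"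
    have a: "?a \<in> carrier (FG n)" using assms by simp
    have "?a [^]\<^bsub>FG n\<^esub> Suc j \<otimes>\<^bsub>FG n\<^esub> pre \<omega> t = ?a \<otimes>\<^bsub>FG n\<^esub> (?a [^]\<^bsub>FG n\<^esub> j \<otimes>\<^bsub>FG n\<^esub> pre \<omega> t)"
      using a ends_pre [OF \<omega>] fg.nat_pow_Suc2 [OF a] by (simp add: fg.m_assoc del: fg.nat_pow_Suc)
    also have "\<dots> = pre \<omega> (t + Suc j * P)"
      using Suc per [of "t + j * P"] that by (simp add: ac_simps)
    finally show ?case .
  qed
  ultimately show ?thesis using \<omega> lim P by blast
qed

lemma axis_end_in_topspace:
  assumes "w \<in> carrier (FG n)" "w \<noteq> []" "g \<in> carrier (FG n)"
  shows "axis_end n g w \<in> topspace (free_boundary n)"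
  using axis_end_pt [OF assms] by (metis imageI topspace_free_boundary)

text \<open>A nontrivial element shifts far vertices of its own ray by a positive amount, so no
  nonzero power fixes them.\<close>

lemma torsion_free:
  assumes w: "w \<in> carrier (FG n)" "w \<noteq> []" and m: "m \<noteq> (0 :: int)"
  shows "w [^]\<^bsub>FG n\<^esub> m \<noteq> []"
proof -
  have one: "\<one>\<^bsub>FG n\<^esub> \<in> carrier (FG n)" by simp
  have nat: "w [^]\<^bsub>FG n\<^esub> j \<noteq> []" if "j \<noteq> 0" for j :: nat
  proof
    assume j: "w [^]\<^bsub>FG n\<^esub> j = []"
    obtain \<omega> P t0 where \<omega>: "\<omega> \<in> ends n" and P: "P \<ge> 1"
      and per: "\<forall>t j. t \<ge> t0 \<longrightarrow> (\<one>\<^bsub>FG n\<^esub> \<otimes>\<^bsub>FG n\<^esub> w \<otimes>\<^bsub>FG n\<^esub> inv\<^bsub>FG n\<^esub> \<one>\<^bsub>FG n\<^esub>) [^]\<^bsub>FG n\<^esub> (j :: nat) \<otimes>\<^bsub>FG n\<^esub> pre \<omega> t = pre \<omega> (t + j * P)"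
      using axis_end_pt [OF w one] by blast
    have "[] \<otimes>\<^bsub>FG n\<^esub> pre \<omega> t0 = pre \<omega> (t0 + j * P)"
      using per [rule_format, of t0 j] w(1) j by simp
    moreover have "[] \<otimes>\<^bsub>FG n\<^esub> pre \<omega> t0 = pre \<omega> t0"
      using ends_pre [OF \<omega>, of t0] fg.l_one [of "pre \<omega> t0" n] by (simp add: one_free_group)
    ultimately have "length (pre \<omega> t0) = length (pre \<omega> (t0 + j * P))" by simp
    then show False using that P by simp
  qed
  show ?thesis
  proof
    assume eq: "w [^]\<^bsub>FG n\<^esub> m = []"
    have "w [^]\<^bsub>FG n\<^esub> int (nat \<bar>m\<bar>) = []"
    proof (cases "m < 0")
      case True
      have "w [^]\<^bsub>FG n\<^esub> (- m) = \<one>\<^bsub>FG n\<^esub>"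
        unfolding fg.int_pow_neg [OF w(1)] eq one_free_group [symmetric, of n] by simp
      then show ?thesis using True by (simp add: one_free_group)
    qed (use eq in simp)
    then show False using nat [of "nat \<bar>m\<bar>"] m by (simp only: int_pow_int)
  qed
qed

text \<open>Both conjugates push the vertices of the common ray forward, one by \<open>P\<close> and
  the other by \<open>Q\<close>. The \<open>Q\<close>-th power of the first and the
  \<open>P\<close>-th power of the second therefore agree on a vertex, and right cancellation makes
  them equal.\<close>

lemma axis_end_eq_imp_commensurable:
  assumes w: "w \<in> carrier (FG n)" "w \<noteq> []" and w': "w' \<in> carrier (FG n)" "w' \<noteq> []"
    and g: "g \<in> carrier (FG n)" "g' \<in> carrier (FG n)" and eq: "axis_end n g w = axis_end n g' w'"
  obtains p q :: nat where "p > 0" "q > 0"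
    "g \<otimes>\<^bsub>FG n\<^esub> w [^]\<^bsub>FG n\<^esub> q \<otimes>\<^bsub>FG n\<^esub> inv\<^bsub>FG n\<^esub> g = g' \<otimes>\<^bsub>FG n\<^esub> w' [^]\<^bsub>FG n\<^esub> p \<otimes>\<^bsub>FG n\<^esub> inv\<^bsub>FG n\<^esub> g'"
proof -
  let ?a = "g \<otimes>\<^bsub>FG n\<^esub> w \<otimes>\<^bsub>FG n\<^esub> inv\<^bsub>FG n\<^esub> g" and ?b = "g' \<otimes>\<^bsub>FG n\<^esub> w' \<otimes>\<^bsub>FG n\<^esub> inv\<^bsub>FG n\<^esub> g'"
  obtain \<omega> P t0 where \<omega>: "\<omega> \<in> ends n" "axis_end n g w = pt n \<omega>" "P \<ge> 1"
    and per: "\<forall>t j. t \<ge> t0 \<longrightarrow> ?a [^]\<^bsub>FG n\<^esub> (j :: nat) \<otimes>\<^bsub>FG n\<^esub> pre \<omega> t = pre \<omega> (t + j * P)"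
    using axis_end_pt [OF w g(1)] by blast
  obtain \<eta> Q s0 where \<eta>: "\<eta> \<in> ends n" "axis_end n g' w' = pt n \<eta>" "Q \<ge> 1"
    and per': "\<forall>t j. t \<ge> s0 \<longrightarrow> ?b [^]\<^bsub>FG n\<^esub> (j :: nat) \<otimes>\<^bsub>FG n\<^esub> pre \<eta> t = pre \<eta> (t + j * Q)"
    using axis_end_pt [OF w' g(2)] by blast
  have [simp]: "\<eta> = \<omega>" using eq \<omega> \<eta> by (simp add: pt_eq_iff)
  define t where "t = max t0 s0"
  have "?a [^]\<^bsub>FG n\<^esub> Q \<otimes>\<^bsub>FG n\<^esub> pre \<omega> t = ?b [^]\<^bsub>FG n\<^esub> P \<otimes>\<^bsub>FG n\<^esub> pre \<omega> t"
    using per [rule_format, of t Q] per' [rule_format, of t P] by (simp add: t_def mult.commute)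
  moreover have "?a [^]\<^bsub>FG n\<^esub> Q \<in> carrier (FG n)" "?b [^]\<^bsub>FG n\<^esub> P \<in> carrier (FG n)"
    using g w w' by (auto intro!: fg.nat_pow_closed)
  ultimately have "?a [^]\<^bsub>FG n\<^esub> Q = ?b [^]\<^bsub>FG n\<^esub> P"
    using ends_pre [OF \<omega>(1), of t] by simp
  then show thesis
    using that [of P Q] \<omega>(3) \<eta>(3) fg.conj_pow [OF g(1) w(1)] fg.conj_pow [OF g(2) w'(1)] by simp
qed


section \<open>Lines of a malnormal family\<close>

lemma conv_subseq_shift: "conv x \<omega> \<Longrightarrow> conv (\<lambda>k. x (k + m)) \<omega>"
  unfolding conv_def using eventually_sequentially_seg [of "\<lambda>i. take N (x i) = pre \<omega> N" m for N] by simp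

lemma axis_end_shift_nat:
  assumes w: "w \<in> carrier (FG n)" "w \<noteq> []" and g: "g \<in> carrier (FG n)"
  shows "axis_end n (g \<otimes>\<^bsub>FG n\<^esub> w [^]\<^bsub>FG n\<^esub> (m :: nat)) w = axis_end n g w"
proof -
  obtain \<omega> where \<omega>: "axis_end n g w = pt n \<omega>"
    and lim: "conv (\<lambda>k. g \<otimes>\<^bsub>FG n\<^esub> w [^]\<^bsub>FG n\<^esub> (k :: nat)) \<omega>"
    using axis_end_pt [OF w g] by blast
  have "g \<otimes>\<^bsub>FG n\<^esub> w [^]\<^bsub>FG n\<^esub> m \<otimes>\<^bsub>FG n\<^esub> w [^]\<^bsub>FG n\<^esub> k = g \<otimes>\<^bsub>FG n\<^esub> w [^]\<^bsub>FG n\<^esub> (k + m)" for k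
    using w(1) g by (simp add: fg.m_assoc fg.nat_pow_mult add.commute)
  then have "conv (\<lambda>k. g \<otimes>\<^bsub>FG n\<^esub> w [^]\<^bsub>FG n\<^esub> m \<otimes>\<^bsub>FG n\<^esub> w [^]\<^bsub>FG n\<^esub> k) \<omega>"
    using conv_subseq_shift [OF lim, of m] by simp
  then have "axis_end n (g \<otimes>\<^bsub>FG n\<^esub> w [^]\<^bsub>FG n\<^esub> m) w = pt n \<omega>"
    unfolding axis_end_def using w g by (intro free_limit_conv) auto
  then show ?thesis using \<omega> by simp
qed

lemma axis_end_shift:
  assumes w: "w \<in> carrier (FG n)" "w \<noteq> []" and g: "g \<in> carrier (FG n)"
  shows "axis_end n (g \<otimes>\<^bsub>FG n\<^esub> w [^]\<^bsub>FG n\<^esub> (z :: int)) w = axis_end n g w"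
proof (cases "z \<ge> 0")
  case True
  then show ?thesis using axis_end_shift_nat [OF assms, of "nat z"]
    by (simp add: int_pow_int [symmetric])
next
  case False
  let ?g = "g \<otimes>\<^bsub>FG n\<^esub> w [^]\<^bsub>FG n\<^esub> z"
  \<comment> \<open>A negative shift is undone by a positive one, so the case of natural exponents
    applies at the shifted base point.\<close>
  have "?g \<otimes>\<^bsub>FG n\<^esub> w [^]\<^bsub>FG n\<^esub> (- z) = g"
    using w g by (simp add: fg.m_assoc fg.int_pow_neg)
  then have "?g \<otimes>\<^bsub>FG n\<^esub> w [^]\<^bsub>FG n\<^esub> nat (- z) = g"
    using False by (simp add: int_pow_int [symmetric])
  moreover have "axis_end n (?g \<otimes>\<^bsub>FG n\<^esub> w [^]\<^bsub>FG n\<^esub> nat (- z)) w = axis_end n ?g w"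
    using w g by (intro axis_end_shift_nat) auto
  ultimately show ?thesis by simp
qed

lemma translate_axis_end:
  assumes w: "w \<in> carrier (FG n)" "w \<noteq> []" and g: "g \<in> carrier (FG n)" and h: "h \<in> carrier (FG n)"
  shows "translate_bpoint n h (axis_end n g w) = axis_end n (h \<otimes>\<^bsub>FG n\<^esub> g) w"
proof -
  obtain \<omega> where \<omega>: "\<omega> \<in> ends n" "axis_end n g w = pt n \<omega>"
    and lim: "conv (\<lambda>k. g \<otimes>\<^bsub>FG n\<^esub> w [^]\<^bsub>FG n\<^esub> (k :: nat)) \<omega>"
    using axis_end_pt [OF w g] by blast
  have "conv (\<lambda>k. h \<otimes>\<^bsub>FG n\<^esub> (g \<otimes>\<^bsub>FG n\<^esub> w [^]\<^bsub>FG n\<^esub> (k :: nat))) (act h \<omega>)"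
    by (rule conv_translate [OF _ lim]) (use w g in auto)
  then have "conv (\<lambda>k. h \<otimes>\<^bsub>FG n\<^esub> g \<otimes>\<^bsub>FG n\<^esub> w [^]\<^bsub>FG n\<^esub> (k :: nat)) (act h \<omega>)"
    using w g h by (simp add: fg.m_assoc)
  then have "axis_end n (h \<otimes>\<^bsub>FG n\<^esub> g) w = pt n (act h \<omega>)"
    unfolding axis_end_def using w g h by (intro free_limit_conv) auto
  then show ?thesis using \<omega> by (simp add: translate_pt h)
qed

lemma inv_eq_Nil_iff: "w \<in> carrier (FG n) \<Longrightarrow> inv\<^bsub>FG n\<^esub> w = [] \<longleftrightarrow> w = []"
  using fg.inv_eq_1_iff [of w n] by (simp add: one_free_group)

text \<open>The limit of positive powers comes first; this orientation fixes the sign of every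
  jump.\<close>

definition line :: "nat \<Rightarrow> word \<Rightarrow> word \<Rightarrow> bpoint \<times> bpoint" where
  "line n g w = (axis_end n g w, axis_end n g (inv\<^bsub>FG n\<^esub> w))"

lemma line_pattern_eq:
  assumes "set ws \<subseteq> carrier (FG n)"
  shows "line_pattern n ws = {line n g w | g w. g \<in> carrier (FG n) \<and> w \<in> set ws}"
proof -
  have "free_limit n (\<lambda>k. g \<otimes>\<^bsub>FG n\<^esub> w [^]\<^bsub>FG n\<^esub> int k) = axis_end n g w"
       "free_limit n (\<lambda>k. g \<otimes>\<^bsub>FG n\<^esub> w [^]\<^bsub>FG n\<^esub> (- int k)) = axis_end n g (inv\<^bsub>FG n\<^esub> w)"
    if "w \<in> set ws" for g w
    using that assms by (auto simp: axis_end_def int_pow_int fg.int_pow_neg fg.nat_pow_inv subset_iff)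
  then show ?thesis unfolding line_pattern_def line_def by (intro Collect_cong) (metis (no_types, lifting))
qed

lemma line_shift:
  assumes w: "w \<in> carrier (FG n)" "w \<noteq> []" and g: "g \<in> carrier (FG n)"
  shows "line n (g \<otimes>\<^bsub>FG n\<^esub> w [^]\<^bsub>FG n\<^esub> (z :: int)) w = line n g w"
proof -
  have "w [^]\<^bsub>FG n\<^esub> z = (inv\<^bsub>FG n\<^esub> w) [^]\<^bsub>FG n\<^esub> (- z)"
    using w by (simp add: fg.int_pow_inv fg.int_pow_neg)
  then have "axis_end n (g \<otimes>\<^bsub>FG n\<^esub> w [^]\<^bsub>FG n\<^esub> z) (inv\<^bsub>FG n\<^esub> w) = axis_end n g (inv\<^bsub>FG n\<^esub> w)"
    using axis_end_shift [of "inv\<^bsub>FG n\<^esub> w" n g "- z"] w g by (simp add: inv_eq_Nil_iff)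
  then show ?thesis using axis_end_shift [OF assms] by (simp add: line_def)
qed

lemma translate_line:
  assumes "w \<in> carrier (FG n)" "w \<noteq> []" "g \<in> carrier (FG n)" "h \<in> carrier (FG n)"
  shows "map_prod (translate_bpoint n h) (translate_bpoint n h) (line n g w) = line n (h \<otimes>\<^bsub>FG n\<^esub> g) w"
  using assms translate_axis_end [of w n g h] translate_axis_end [of "inv\<^bsub>FG n\<^esub> w" n g h]
  by (simp add: line_def inv_eq_Nil_iff)

locale malnormal_words =
  fixes n :: nat and vs :: "word list"
  assumes malnormal: "malnormal_family (FG n) vs"
begin

lemma in_carrier: "i < length vs \<Longrightarrow> vs ! i \<in> carrier (FG n)"
  and nontrivial: "i < length vs \<Longrightarrow> vs ! i \<noteq> []"
  using malnormal nth_mem [of i vs] unfolding malnormal_family_def one_free_group by blast+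

text \<open>The common power is an element of the intersection in the definition of malnormality,
  and \<open>torsion_free\<close> keeps it from being trivial.\<close>

lemma conj_pow_malnormal:
  assumes i: "i < length vs" and j: "j < length vs" and k: "k \<in> carrier (FG n)"
    and eq: "k \<otimes>\<^bsub>FG n\<^esub> vs ! i [^]\<^bsub>FG n\<^esub> (a :: int) \<otimes>\<^bsub>FG n\<^esub> inv\<^bsub>FG n\<^esub> k = vs ! j [^]\<^bsub>FG n\<^esub> (b :: int)"
    and b: "b \<noteq> 0"
  shows "i = j" "k \<in> generate (FG n) {vs ! i}"
proof -
  let ?x = "vs ! j [^]\<^bsub>FG n\<^esub> b"
  have "?x \<in> generate (FG n) {vs ! j}"
    unfolding fg.generate_pow [OF in_carrier [OF j]] by blast
  moreover have "vs ! i [^]\<^bsub>FG n\<^esub> a \<in> generate (FG n) {vs ! i}"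
    unfolding fg.generate_pow [OF in_carrier [OF i]] by blast
  then have "?x \<in> (k <#\<^bsub>FG n\<^esub> generate (FG n) {vs ! i}) #>\<^bsub>FG n\<^esub> inv\<^bsub>FG n\<^esub> k"
    unfolding l_coset_def r_coset_def eq [symmetric] by blast
  moreover have "?x \<noteq> \<one>\<^bsub>FG n\<^esub>"
    using torsion_free [OF in_carrier [OF j] nontrivial [OF j] b] by (simp add: one_free_group)
  ultimately have "((k <#\<^bsub>FG n\<^esub> generate (FG n) {vs ! i}) #>\<^bsub>FG n\<^esub> inv\<^bsub>FG n\<^esub> k) \<inter> generate (FG n) {vs ! j} \<noteq> {\<one>\<^bsub>FG n\<^esub>}"
    by blast
  then show "i = j" "k \<in> generate (FG n) {vs ! i}"
    using malnormal i j k unfolding malnormal_family_def by blast+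
qed

text \<open>A common end makes powers of the two conjugates coincide, with exponents of signs
  \<open>s\<close> and \<open>s'\<close>. Malnormality then forces the same word and the same coset,
  and torsion-freeness the same sign. It follows that a line has two different ends and that
  different lines share none.\<close>

lemma axis_end_inj:
  assumes i: "i < length vs" and j: "j < length vs" and g: "g \<in> carrier (FG n)" "g' \<in> carrier (FG n)"
    and s: "s = 1 \<or> s = (-1 :: int)" "s' = 1 \<or> s' = (-1 :: int)"
    and eq: "axis_end n g (vs ! i [^]\<^bsub>FG n\<^esub> s) = axis_end n g' (vs ! j [^]\<^bsub>FG n\<^esub> s')"
  shows "i = j" "inv\<^bsub>FG n\<^esub> g' \<otimes>\<^bsub>FG n\<^esub> g \<in> generate (FG n) {vs ! i}" "s = s'"
proof -
  let ?u = "vs ! i" and ?v = "vs ! j" and ?k = "inv\<^bsub>FG n\<^esub> g' \<otimes>\<^bsub>FG n\<^esub> g"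
  have u: "?u \<in> carrier (FG n)" "?u \<noteq> []" and v: "?v \<in> carrier (FG n)" "?v \<noteq> []"
    using i j in_carrier nontrivial by auto
  have s0: "s \<noteq> 0" "s' \<noteq> 0" using s by auto
  obtain p q :: nat where pq: "p > 0" "q > 0"
    and "g \<otimes>\<^bsub>FG n\<^esub> (?u [^]\<^bsub>FG n\<^esub> s) [^]\<^bsub>FG n\<^esub> q \<otimes>\<^bsub>FG n\<^esub> inv\<^bsub>FG n\<^esub> g =
      g' \<otimes>\<^bsub>FG n\<^esub> (?v [^]\<^bsub>FG n\<^esub> s') [^]\<^bsub>FG n\<^esub> p \<otimes>\<^bsub>FG n\<^esub> inv\<^bsub>FG n\<^esub> g'"
    using axis_end_eq_imp_commensurable [OF _ _ _ _ g eq] torsion_free [OF u s0(1)] torsion_free [OF v s0(2)] u v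
    by blast
  then have eq': "g \<otimes>\<^bsub>FG n\<^esub> ?u [^]\<^bsub>FG n\<^esub> (s * int q) \<otimes>\<^bsub>FG n\<^esub> inv\<^bsub>FG n\<^esub> g =
      g' \<otimes>\<^bsub>FG n\<^esub> ?v [^]\<^bsub>FG n\<^esub> (s' * int p) \<otimes>\<^bsub>FG n\<^esub> inv\<^bsub>FG n\<^esub> g'"
    using u v by (simp add: int_pow_int [symmetric] fg.int_pow_pow)
  have "?k \<otimes>\<^bsub>FG n\<^esub> ?u [^]\<^bsub>FG n\<^esub> (s * int q) \<otimes>\<^bsub>FG n\<^esub> inv\<^bsub>FG n\<^esub> ?k =
      inv\<^bsub>FG n\<^esub> g' \<otimes>\<^bsub>FG n\<^esub> (g \<otimes>\<^bsub>FG n\<^esub> ?u [^]\<^bsub>FG n\<^esub> (s * int q) \<otimes>\<^bsub>FG n\<^esub> inv\<^bsub>FG n\<^esub> g) \<otimes>\<^bsub>FG n\<^esub> g'"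
    using g u by (simp add: fg.m_assoc fg.inv_mult_group)
  also have "\<dots> = ?v [^]\<^bsub>FG n\<^esub> (s' * int p)"
    unfolding eq' using g v by (simp add: fg.m_assoc fg.inv_cancel)
  finally have conj: "?k \<otimes>\<^bsub>FG n\<^esub> ?u [^]\<^bsub>FG n\<^esub> (s * int q) \<otimes>\<^bsub>FG n\<^esub> inv\<^bsub>FG n\<^esub> ?k = ?v [^]\<^bsub>FG n\<^esub> (s' * int p)" .
  have k: "?k \<in> carrier (FG n)" using g by simp
  have nz: "s' * int p \<noteq> 0" using s0 pq by simp
  show ij: "i = j" and gen: "?k \<in> generate (FG n) {?u}"
    using conj_pow_malnormal [OF i j k conj nz] .
  from gen obtain z :: int where z: "?k = ?u [^]\<^bsub>FG n\<^esub> z" unfolding fg.generate_pow [OF u(1)] by blast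
  \<comment> \<open>The conjugator is itself a power of \<open>?u\<close>, so conjugation changes
    nothing and the exponents can be compared.\<close>
  have "?k \<otimes>\<^bsub>FG n\<^esub> ?u [^]\<^bsub>FG n\<^esub> (s * int q) \<otimes>\<^bsub>FG n\<^esub> inv\<^bsub>FG n\<^esub> ?k = ?u [^]\<^bsub>FG n\<^esub> (z + s * int q - z)"
    unfolding z using u by (simp only: fg.int_pow_mult fg.int_pow_diff)
  then have "?u [^]\<^bsub>FG n\<^esub> (s * int q) = ?u [^]\<^bsub>FG n\<^esub> (s' * int p)" using conj ij by simp
  then have "?u [^]\<^bsub>FG n\<^esub> (s * int q - s' * int p) = []"
    using u by (simp add: fg.int_pow_diff one_free_group)
  then have "s * int q = s' * int p" using torsion_free [OF u, of "s * int q - s' * int p"] by auto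
  then show "s = s'" using s pq by auto
qed

lemma line_eq_axis_ends:
  "i < length vs \<Longrightarrow> line n g (vs ! i) = (axis_end n g (vs ! i [^]\<^bsub>FG n\<^esub> (1 :: int)), axis_end n g (vs ! i [^]\<^bsub>FG n\<^esub> (-1 :: int)))"
  using in_carrier [of i] by (simp add: line_def fg.int_pow_neg)

lemma line_eq_iff:
  assumes i: "i < length vs" and j: "j < length vs" and g: "g \<in> carrier (FG n)" "g' \<in> carrier (FG n)"
  shows "line n g (vs ! i) = line n g' (vs ! j) \<longleftrightarrow> i = j \<and> (\<exists>z :: int. g = g' \<otimes>\<^bsub>FG n\<^esub> vs ! i [^]\<^bsub>FG n\<^esub> z)"
proof
  assume "line n g (vs ! i) = line n g' (vs ! j)"
  then have "axis_end n g (vs ! i [^]\<^bsub>FG n\<^esub> (1 :: int)) = axis_end n g' (vs ! j [^]\<^bsub>FG n\<^esub> (1 :: int))"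
    using i j by (simp add: line_eq_axis_ends)
  from axis_end_inj [OF i j g _ _ this] have "i = j" "inv\<^bsub>FG n\<^esub> g' \<otimes>\<^bsub>FG n\<^esub> g \<in> generate (FG n) {vs ! i}"
    by auto
  then obtain z :: int where "inv\<^bsub>FG n\<^esub> g' \<otimes>\<^bsub>FG n\<^esub> g = vs ! i [^]\<^bsub>FG n\<^esub> z"
    unfolding fg.generate_pow [OF in_carrier [OF i]] by blast
  then have "g = g' \<otimes>\<^bsub>FG n\<^esub> vs ! i [^]\<^bsub>FG n\<^esub> z" using g fg.inv_cancel(2) [of g' n g] by simp
  with \<open>i = j\<close> show "i = j \<and> (\<exists>z :: int. g = g' \<otimes>\<^bsub>FG n\<^esub> vs ! i [^]\<^bsub>FG n\<^esub> z)" by blast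
next
  assume "i = j \<and> (\<exists>z :: int. g = g' \<otimes>\<^bsub>FG n\<^esub> vs ! i [^]\<^bsub>FG n\<^esub> z)"
  then show "line n g (vs ! i) = line n g' (vs ! j)"
    using line_shift [OF in_carrier [OF i] nontrivial [OF i] g(2)] by auto
qed

lemma line_patternE:
  assumes "l \<in> line_pattern n vs"
  obtains g i where "g \<in> carrier (FG n)" "i < length vs" "l = line n g (vs ! i)"
proof -
  have "set vs \<subseteq> carrier (FG n)" using malnormal by (auto simp: malnormal_family_def)
  from assms [unfolded line_pattern_eq [OF this]] show thesis
    using that by (auto simp: in_set_conv_nth)
qed

lemma line_in_pattern:
  assumes "g \<in> carrier (FG n)" "i < length vs"
  shows "line n g (vs ! i) \<in> line_pattern n vs"
proof -
  have "set vs \<subseteq> carrier (FG n)" using malnormal by (auto simp: malnormal_family_def)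
  then show ?thesis
    using assms nth_mem [OF assms(2)] unfolding line_pattern_eq [OF \<open>set vs \<subseteq> carrier (FG n)\<close>] by blast
qed

lemma line_pattern_neq: "(a, b) \<in> line_pattern n vs \<Longrightarrow> a \<noteq> b"
proof
  assume l: "(a, b) \<in> line_pattern n vs" and ab: "a = b"
  from l obtain g i where g: "g \<in> carrier (FG n)" "i < length vs" "(a, b) = line n g (vs ! i)"
    by (rule line_patternE)
  then have "axis_end n g (vs ! i [^]\<^bsub>FG n\<^esub> (1 :: int)) = axis_end n g (vs ! i [^]\<^bsub>FG n\<^esub> (- 1 :: int))"
    using ab by (metis line_eq_axis_ends prod.inject)
  from axis_end_inj(3) [OF g(2,2,1,1) _ _ this] show False by simp
qed

text \<open>Equality of the signs in \<open>axis_end_inj\<close> excludes that the head of one line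
  is the tail of another; hence no point of the decomposition space identifies more than two
  ends.\<close>

lemma line_pattern_disjoint:
  assumes l: "(a, b) \<in> line_pattern n vs" "(c, d) \<in> line_pattern n vs" and int: "{a, b} \<inter> {c, d} \<noteq> {}"
  shows "(a, b) = (c, d)"
proof -
  from l(1) obtain g i where g: "g \<in> carrier (FG n)" "i < length vs" "(a, b) = line n g (vs ! i)"
    by (rule line_patternE)
  from l(2) obtain h j where h: "h \<in> carrier (FG n)" "j < length vs" "(c, d) = line n h (vs ! j)"
    by (rule line_patternE)
  have ab: "a = axis_end n g (vs ! i [^]\<^bsub>FG n\<^esub> (1 :: int))" "b = axis_end n g (vs ! i [^]\<^bsub>FG n\<^esub> (- 1 :: int))"
    and cd: "c = axis_end n h (vs ! j [^]\<^bsub>FG n\<^esub> (1 :: int))" "d = axis_end n h (vs ! j [^]\<^bsub>FG n\<^esub> (- 1 :: int))"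
    using g(2,3) h(2,3) by (simp_all only: line_eq_axis_ends prod.inject)
  have "\<exists>s s'. (s = 1 \<or> s = (-1 :: int)) \<and> (s' = 1 \<or> s' = (-1 :: int)) \<and>
      axis_end n g (vs ! i [^]\<^bsub>FG n\<^esub> s) = axis_end n h (vs ! j [^]\<^bsub>FG n\<^esub> s')"
    using int ab cd by blast
  then obtain s s' where s: "s = 1 \<or> s = (-1 :: int)" "s' = 1 \<or> s' = (-1 :: int)"
      "axis_end n g (vs ! i [^]\<^bsub>FG n\<^esub> s) = axis_end n h (vs ! j [^]\<^bsub>FG n\<^esub> s')" by blast
  note inj = axis_end_inj [OF g(2) h(2) g(1) h(1) s]
  from inj(2) obtain z :: int where "inv\<^bsub>FG n\<^esub> h \<otimes>\<^bsub>FG n\<^esub> g = vs ! i [^]\<^bsub>FG n\<^esub> z"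
    unfolding fg.generate_pow [OF in_carrier [OF g(2)]] by blast
  then have "g = h \<otimes>\<^bsub>FG n\<^esub> vs ! i [^]\<^bsub>FG n\<^esub> z"
    using g h fg.inv_cancel(2) [of h n g] by simp
  then show ?thesis
    unfolding g(3) h(3) line_eq_iff [OF g(2) h(2) g(1) h(1)] using inj(1) by blast
qed

lemma line_pattern_subset: "line_pattern n vs \<subseteq> topspace (free_boundary n) \<times> topspace (free_boundary n)"
proof
  fix l assume "l \<in> line_pattern n vs"
  then obtain g i where "g \<in> carrier (FG n)" "i < length vs" "l = line n g (vs ! i)"
    by (rule line_patternE)
  then show "l \<in> topspace (free_boundary n) \<times> topspace (free_boundary n)"
    using in_carrier [of i] nontrivial [of i] by (auto simp: line_def inv_eq_Nil_iff intro: axis_end_in_topspace)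
qed

lemma line_pattern_translate:
  assumes "l \<in> line_pattern n vs" "h \<in> carrier (FG n)"
  shows "map_prod (translate_bpoint n h) (translate_bpoint n h) l \<in> line_pattern n vs"
proof -
  from assms(1) obtain g i where "g \<in> carrier (FG n)" "i < length vs" "l = line n g (vs ! i)"
    by (rule line_patternE)
  then show ?thesis
    using assms(2) in_carrier [of i] nontrivial [of i]
    by (simp add: translate_line line_in_pattern)
qed

end


section \<open>Crossings and Fox derivatives\<close>

text \<open>The indicator of the cylinder of \<open>x\<close>, evaluated at a vertex of the tree in
  place of an end.\<close>

definition starts :: "letter \<Rightarrow> word \<Rightarrow> int" where
  "starts x h = of_bool (h \<noteq> [] \<and> hd h = x)"

lemma eval_sum_append: "eval_sum (s @ t) = eval_sum s + eval_sum t"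
  and eval_sum_Nil [simp]: "eval_sum [] = 0"
  and eval_sum_Cons: "eval_sum (p # s) = frag_cmul (fst p) (frag_of (reduce (snd p))) + eval_sum s"
  by (auto simp: eval_sum_def case_prod_beta)

text \<open>Removing the edge between 1 and x splits the tree into two halves, and
  \<open>starts x\<close> tells them apart. A step changes it only by running through this edge:
  from \<open>[]\<close> by the letter \<open>x\<close>, or back to \<open>[]\<close> by its
  inverse.\<close>

lemma starts_step:
  assumes "reduced v"
  shows "starts x (reduce (v @ [y])) - starts x v =
    of_bool (y = x \<and> v = []) - of_bool (y = inv_letter x \<and> reduce (v @ [y]) = [])"
proof (cases "v \<noteq> [] \<and> last v = inv_letter y")
  case True
  then obtain u where v: "v = u @ [inv_letter y]" by (metis append_butlast_last_id)
  then show ?thesis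
    using True reduce_snoc [OF assms, of y]
    by (cases u) (auto simp: starts_def inv_letter_eq_iff)
next
  case False
  have "reduce (v @ [y]) = v @ [y]" using reduce_snoc [OF assms, of y] False by (simp only: if_False)
  then show ?thesis by (cases v) (auto simp: starts_def)
qed

text \<open>The term that the letter y contributes after the prefix w has the inverse of h as its
  group element exactly if the path from h labelled by the word runs through the edge between 1 and
  x at this moment. The coefficient is thus the signed number of passages, which only depends on the
  two endpoints of the path.\<close>

lemma fox_lookup:
  assumes "w \<in> words n" "h \<in> carrier (FG n)"
  shows "poly_mapping.lookup (eval_sum (fox x w)) (inv\<^bsub>FG n\<^esub> h) = starts x (h \<otimes>\<^bsub>FG n\<^esub> reduce w) - starts x h"
  using assms(1)
proof (induction w rule: rev_induct)
  case Nil
  have "h \<otimes>\<^bsub>FG n\<^esub> [] = h" using assms(2) fg.r_one [of h n] by (simp add: one_free_group)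
  then show ?case by (simp add: fox_Nil)
next
  case (snoc y w)
  let ?v = "h \<otimes>\<^bsub>FG n\<^esub> reduce w"
  have w: "w \<in> words n" "fst y < n" using snoc.prems by auto
  have v: "reduced ?v" by (simp add: mult_free_group reduced_reduce)
  have step: "h \<otimes>\<^bsub>FG n\<^esub> reduce (w @ [y]) = reduce (?v @ [y])"
    by (simp add: mult_free_group reduce_append_right reduce_append_left)
  have one_iff: "reduce u = inv\<^bsub>FG n\<^esub> h \<longleftrightarrow> h \<otimes>\<^bsub>FG n\<^esub> reduce u = []" if "u \<in> words n" for u
  proof
    assume "reduce u = inv\<^bsub>FG n\<^esub> h"
    then show "h \<otimes>\<^bsub>FG n\<^esub> reduce u = []"
      using fg.r_inv [OF assms(2)] by (simp add: one_free_group)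
  next
    assume e: "h \<otimes>\<^bsub>FG n\<^esub> reduce u = []"
    have "reduce u = inv\<^bsub>FG n\<^esub> h \<otimes>\<^bsub>FG n\<^esub> (h \<otimes>\<^bsub>FG n\<^esub> reduce u)"
      using fg.inv_cancel(1) [OF assms(2) reduce_in_carrier [OF that]] by simp
    also have "\<dots> = inv\<^bsub>FG n\<^esub> h \<otimes>\<^bsub>FG n\<^esub> \<one>\<^bsub>FG n\<^esub>" by (simp only: e one_free_group)
    also have "\<dots> = inv\<^bsub>FG n\<^esub> h" using assms(2) by simp
    finally show "reduce u = inv\<^bsub>FG n\<^esub> h" .
  qed
  have "poly_mapping.lookup (eval_sum (fox_step x w y)) (inv\<^bsub>FG n\<^esub> h) =
      of_bool (y = x \<and> ?v = []) - of_bool (y = inv_letter x \<and> reduce (?v @ [y]) = [])"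
  proof -
    have 1: "inv\<^bsub>FG n\<^esub> h = reduce w \<longleftrightarrow> ?v = []"
      and 2: "inv\<^bsub>FG n\<^esub> h = reduce (w @ [y]) \<longleftrightarrow> reduce (?v @ [y]) = []"
      using one_iff [of w] one_iff [of "w @ [y]"] w step eq_commute [of "inv\<^bsub>FG n\<^esub> h"] by simp_all
    consider "y = x" | "y \<noteq> x" "y = inv_letter x" | "y \<noteq> x" "y \<noteq> inv_letter x" by blast
    then show ?thesis
    proof cases
      case 1
      then show ?thesis using \<open>inv\<^bsub>FG n\<^esub> h = reduce w \<longleftrightarrow> ?v = []\<close>
        by (simp add: fox_step_def eval_sum_Cons)
    next
      case 2
      then show ?thesis using \<open>inv\<^bsub>FG n\<^esub> h = reduce (w @ [y]) \<longleftrightarrow> reduce (?v @ [y]) = []\<close>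
        by (simp add: fox_step_def eval_sum_Cons)
    qed (simp add: fox_step_def)
  qed
  also have "\<dots> = starts x (reduce (?v @ [y])) - starts x ?v" by (rule starts_step [OF v, symmetric])
  finally show ?case
    using snoc.IH [OF w(1)] by (simp add: fox_snoc eval_sum_append lookup_add step)
qed

lemma fox_telescope:
  assumes w: "w \<in> words n" and g: "g \<in> carrier (FG n)"
  shows "(\<Sum>k<M. poly_mapping.lookup (eval_sum (fox x w)) (inv\<^bsub>FG n\<^esub> (g \<otimes>\<^bsub>FG n\<^esub> reduce w [^]\<^bsub>FG n\<^esub> k))) =
    starts x (g \<otimes>\<^bsub>FG n\<^esub> reduce w [^]\<^bsub>FG n\<^esub> (M :: nat)) - starts x g"
proof (induction M)
  case (Suc M)
  have c: "reduce w \<in> carrier (FG n)" by (rule reduce_in_carrier [OF w])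
  then have "poly_mapping.lookup (eval_sum (fox x w)) (inv\<^bsub>FG n\<^esub> (g \<otimes>\<^bsub>FG n\<^esub> reduce w [^]\<^bsub>FG n\<^esub> M)) =
      starts x (g \<otimes>\<^bsub>FG n\<^esub> reduce w [^]\<^bsub>FG n\<^esub> Suc M) - starts x (g \<otimes>\<^bsub>FG n\<^esub> reduce w [^]\<^bsub>FG n\<^esub> M)"
    using g fox_lookup [OF w, of "g \<otimes>\<^bsub>FG n\<^esub> reduce w [^]\<^bsub>FG n\<^esub> M" x] by (simp add: fg.m_assoc)
  then show ?case using Suc by simp
qed (use g in simp)

lemma starts_limit:
  assumes w: "w \<in> carrier (FG n)" "w \<noteq> []" and g: "g \<in> carrier (FG n)"
  shows "\<forall>\<^sub>F K in sequentially. starts x (g \<otimes>\<^bsub>FG n\<^esub> w [^]\<^bsub>FG n\<^esub> (K :: nat)) = of_bool (axis_end n g w \<in> cyl n [x])"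
proof -
  obtain \<omega> where \<omega>: "\<omega> \<in> ends n" "axis_end n g w = pt n \<omega>"
    and lim: "conv (\<lambda>k. g \<otimes>\<^bsub>FG n\<^esub> w [^]\<^bsub>FG n\<^esub> (k :: nat)) \<omega>"
    using axis_end_pt [OF w g] by blast
  from lim have "\<forall>\<^sub>F K in sequentially. take 1 (g \<otimes>\<^bsub>FG n\<^esub> w [^]\<^bsub>FG n\<^esub> (K :: nat)) = pre \<omega> 1"
    unfolding conv_def by blast
  then show ?thesis
  proof (rule eventually_mono)
    fix K assume "take 1 (g \<otimes>\<^bsub>FG n\<^esub> w [^]\<^bsub>FG n\<^esub> (K :: nat)) = pre \<omega> 1"
    then have "starts x (g \<otimes>\<^bsub>FG n\<^esub> w [^]\<^bsub>FG n\<^esub> K) = of_bool (\<omega> 0 = x)"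
      by (cases "g \<otimes>\<^bsub>FG n\<^esub> w [^]\<^bsub>FG n\<^esub> K") (auto simp: starts_def pre_Suc)
    then show "starts x (g \<otimes>\<^bsub>FG n\<^esub> w [^]\<^bsub>FG n\<^esub> K) = of_bool (axis_end n g w \<in> cyl n [x])"
      using \<omega> by (simp add: pt_in_cyl pre_Suc)
  qed
qed

text \<open>The sum collects the passages of the whole axis through the edge between 1 and x. Finite
  support truncates it to the segment from g w^-K to g w^K, where it telescopes; for large K the
  endpoints of the segment lie in the same half-trees as the ends of the line.\<close>

lemma crossing_formula:
  assumes w: "w \<in> words n" "reduce w \<noteq> []" and g: "g \<in> carrier (FG n)"
  shows "of_bool (fst (line n g (reduce w)) \<in> cyl n [x]) - of_bool (snd (line n g (reduce w)) \<in> cyl n [x]) =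
    (\<Sum>h | h \<in> Poly_Mapping.keys (eval_sum (fox x w)) \<and> (\<exists>z :: int. h = inv\<^bsub>FG n\<^esub> (g \<otimes>\<^bsub>FG n\<^esub> reduce w [^]\<^bsub>FG n\<^esub> z)).
      poly_mapping.lookup (eval_sum (fox x w)) h)"
proof -
  let ?w = "reduce w" and ?f = "eval_sum (fox x w)"
  have c: "?w \<in> carrier (FG n)" by (rule reduce_in_carrier [OF w(1)])
  define e where "e z = inv\<^bsub>FG n\<^esub> (g \<otimes>\<^bsub>FG n\<^esub> ?w [^]\<^bsub>FG n\<^esub> z)" for z :: int
  have inj: "inj e"
  proof (rule injI)
    fix y z assume "e y = e z"
    then have "g \<otimes>\<^bsub>FG n\<^esub> ?w [^]\<^bsub>FG n\<^esub> y = g \<otimes>\<^bsub>FG n\<^esub> ?w [^]\<^bsub>FG n\<^esub> z"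
      unfolding e_def using g c by (metis fg.inv_inv fg.m_closed fg.int_pow_closed)
    then have "?w [^]\<^bsub>FG n\<^esub> y = ?w [^]\<^bsub>FG n\<^esub> z" using g c by simp
    then have "?w [^]\<^bsub>FG n\<^esub> (y - z) = []" using c by (simp add: fg.int_pow_diff one_free_group)
    then show "y = z" using torsion_free [OF c w(2), of "y - z"] by auto
  qed
  let ?S = "{h. h \<in> Poly_Mapping.keys ?f \<and> (\<exists>z. h = e z)}"
  have "finite (e -` Poly_Mapping.keys ?f)"
    by (rule finite_vimageI [OF _ inj]) simp
  then have "finite ((\<lambda>z. nat \<bar>z\<bar>) ` (e -` Poly_Mapping.keys ?f))" by simp
  \<comment> \<open>By injectivity of \<open>e\<close> only finitely many exponents meet the
    support; \<open>B\<close> exceeds their absolute values.\<close>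
  then obtain B where B: "\<And>z. e z \<in> Poly_Mapping.keys ?f \<Longrightarrow> nat \<bar>z\<bar> < B"
    unfolding finite_nat_set_iff_bounded by blast
  have "\<forall>\<^sub>F K in sequentially. B \<le> K \<and>
      starts x (g \<otimes>\<^bsub>FG n\<^esub> ?w [^]\<^bsub>FG n\<^esub> (K :: nat)) = of_bool (axis_end n g ?w \<in> cyl n [x]) \<and>
      starts x (g \<otimes>\<^bsub>FG n\<^esub> (inv\<^bsub>FG n\<^esub> ?w) [^]\<^bsub>FG n\<^esub> (K :: nat)) = of_bool (axis_end n g (inv\<^bsub>FG n\<^esub> ?w) \<in> cyl n [x])"
    using starts_limit [OF c w(2) g] starts_limit [of "inv\<^bsub>FG n\<^esub> ?w" n g] c w(2) g
    by (intro eventually_conj eventually_ge_at_top) (auto simp: inv_eq_Nil_iff)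
  then obtain K :: nat where K: "B \<le> K"
    "starts x (g \<otimes>\<^bsub>FG n\<^esub> ?w [^]\<^bsub>FG n\<^esub> K) = of_bool (axis_end n g ?w \<in> cyl n [x])"
    "starts x (g \<otimes>\<^bsub>FG n\<^esub> (inv\<^bsub>FG n\<^esub> ?w) [^]\<^bsub>FG n\<^esub> K) = of_bool (axis_end n g (inv\<^bsub>FG n\<^esub> ?w) \<in> cyl n [x])"
    unfolding eventually_sequentially by blast
  \<comment> \<open>The segment is started at its negative extreme, so that
    \<open>fox_telescope\<close> with natural exponents covers all of it.\<close>
  let ?g = "g \<otimes>\<^bsub>FG n\<^esub> (inv\<^bsub>FG n\<^esub> ?w) [^]\<^bsub>FG n\<^esub> K"
  have g': "?g \<in> carrier (FG n)" using g c by simp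
  have gz: "?g \<otimes>\<^bsub>FG n\<^esub> ?w [^]\<^bsub>FG n\<^esub> k = g \<otimes>\<^bsub>FG n\<^esub> ?w [^]\<^bsub>FG n\<^esub> (int k - int K)" for k :: nat
  proof -
    have "(inv\<^bsub>FG n\<^esub> ?w) [^]\<^bsub>FG n\<^esub> K = ?w [^]\<^bsub>FG n\<^esub> (- int K)"
      using c by (simp add: fg.int_pow_neg_int fg.nat_pow_inv)
    then have "?g \<otimes>\<^bsub>FG n\<^esub> ?w [^]\<^bsub>FG n\<^esub> k = g \<otimes>\<^bsub>FG n\<^esub> (?w [^]\<^bsub>FG n\<^esub> (- int K) \<otimes>\<^bsub>FG n\<^esub> ?w [^]\<^bsub>FG n\<^esub> int k)"
      using g c by (simp add: fg.m_assoc int_pow_int)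
    also have "\<dots> = g \<otimes>\<^bsub>FG n\<^esub> ?w [^]\<^bsub>FG n\<^esub> (- int K + int k)"
      by (simp only: fg.int_pow_mult [OF c])
    finally show ?thesis by simp
  qed
  have "(\<Sum>h\<in>?S. poly_mapping.lookup ?f h) =
      (\<Sum>h\<in>(\<lambda>k. e (int k - int K)) ` {..<2 * K}. poly_mapping.lookup ?f h)"
  proof (rule sum.mono_neutral_left)
    show "?S \<subseteq> (\<lambda>k. e (int k - int K)) ` {..<2 * K}"
    proof
      fix h assume "h \<in> ?S"
      then obtain z where z: "h \<in> Poly_Mapping.keys ?f" "h = e z" by blast
      with B [of z] K(1) have "\<bar>z\<bar> < int K" by simp
      then show "h \<in> (\<lambda>k. e (int k - int K)) ` {..<2 * K}"
        by (intro image_eqI [where x = "nat (z + int K)"]) (auto simp: z)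
    qed
    show "\<forall>h\<in>(\<lambda>k. e (int k - int K)) ` {..<2 * K} - ?S. poly_mapping.lookup ?f h = 0"
      by (auto simp: in_keys_iff)
  qed simp
  also have "\<dots> = (\<Sum>k<2 * K. poly_mapping.lookup ?f (e (int k - int K)))"
    by (subst sum.reindex) (auto intro!: inj_onI dest: injD [OF inj])
  also have "\<dots> = (\<Sum>k<2 * K. poly_mapping.lookup ?f (inv\<^bsub>FG n\<^esub> (?g \<otimes>\<^bsub>FG n\<^esub> ?w [^]\<^bsub>FG n\<^esub> k)))"
    by (simp only: gz e_def)
  also have "\<dots> = starts x (?g \<otimes>\<^bsub>FG n\<^esub> ?w [^]\<^bsub>FG n\<^esub> (2 * K)) - starts x ?g"
    by (rule fox_telescope [OF w(1) g'])
  also have "?g \<otimes>\<^bsub>FG n\<^esub> ?w [^]\<^bsub>FG n\<^esub> (2 * K) = g \<otimes>\<^bsub>FG n\<^esub> ?w [^]\<^bsub>FG n\<^esub> K"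
    unfolding gz by (simp add: int_pow_int [symmetric])
  finally show ?thesis using K(2,3) by (simp add: line_def e_def)
qed


section \<open>Simplicial cohomology in degree one\<close>

definition down_closed :: "'v set set \<Rightarrow> bool" where
  "down_closed K \<longleftrightarrow> (\<forall>\<sigma>\<in>K. \<forall>\<tau>. \<tau> \<subseteq> \<sigma> \<longrightarrow> \<tau> \<noteq> {} \<longrightarrow> \<tau> \<in> K)"

lemma down_closedD: "down_closed K \<Longrightarrow> \<sigma> \<in> K \<Longrightarrow> \<tau> \<subseteq> \<sigma> \<Longrightarrow> \<tau> \<noteq> {} \<Longrightarrow> \<tau> \<in> K"
  unfolding down_closed_def by simp

lemma down_closed_nerve: "down_closed (nerve \<U>)"
proof -
  have "\<Inter>\<tau> \<noteq> {}" if "\<Inter>\<sigma> \<noteq> {}" "\<tau> \<subseteq> \<sigma>" for \<sigma> \<tau> :: "'a set set"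
    using that by blast
  then show ?thesis
    unfolding down_closed_def nerve_def mem_Collect_eq Ball_def
    by (meson finite_subset subset_trans)
qed

lemma carrier_cocycle_group:
  "c \<in> carrier (cocycle_group K p) \<longleftrightarrow> c \<in> cochains K p \<and> coboundary K c = (\<lambda>_. 0)"
  and mult_cocycle_group: "c \<otimes>\<^bsub>cocycle_group K p\<^esub> d = (\<lambda>vs. c vs + d vs)"
  and one_cocycle_group: "\<one>\<^bsub>cocycle_group K p\<^esub> = (\<lambda>_. 0)"
  by (simp_all add: cocycle_group_def)

lemma cochains_1_iff: "c \<in> cochains K 1 \<longleftrightarrow> (\<forall>vs. c vs \<noteq> 0 \<longrightarrow> (\<exists>u v. vs = [u, v] \<and> {u, v} \<in> K))"
proof
  assume c: "c \<in> cochains K 1"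
  show "\<forall>vs. c vs \<noteq> 0 \<longrightarrow> (\<exists>u v. vs = [u, v] \<and> {u, v} \<in> K)"
  proof (intro allI impI)
    fix vs assume "c vs \<noteq> 0"
    with c have "length vs = Suc 1" "set vs \<in> K" unfolding cochains_def by blast+
    then show "\<exists>u v. vs = [u, v] \<and> {u, v} \<in> K" by (auto simp: length_Suc_conv)
  qed
next
  assume *: "\<forall>vs. c vs \<noteq> 0 \<longrightarrow> (\<exists>u v. vs = [u, v] \<and> {u, v} \<in> K)"
  have "c vs = 0" if "\<not> (length vs = Suc 1 \<and> set vs \<in> K)" for vs
  proof (rule ccontr)
    assume "c vs \<noteq> 0"
    with * obtain u v where "vs = [u, v]" "{u, v} \<in> K" by blast
    then show False using that by simp
  qed
  then show "c \<in> cochains K 1" unfolding cochains_def by blast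
qed

lemma cocycle_iff:
  assumes "c \<in> cochains K 1"
  shows "c \<in> carrier (cocycle_group K 1) \<longleftrightarrow> (\<forall>u v w. {u, v, w} \<in> K \<longrightarrow> c [u, w] = c [u, v] + c [v, w])"
proof -
  have 1: "coboundary K c vs = 0" if "\<And>u v w. vs = [u, v, w] \<Longrightarrow> {u, v, w} \<in> K \<Longrightarrow> c [u, w] = c [u, v] + c [v, w]" for vs
  proof (cases "length vs = 3")
    case True
    then obtain u v w where vs: "vs = [u, v, w]"
      by (auto simp: numeral_3_eq_3 length_Suc_conv)
    then show ?thesis using that [OF vs] by (simp add: coboundary_def lessThan_Suc numeral_3_eq_3)
  next
    case False
    have "c (take i vs @ drop (Suc i) vs) = 0" if "i < length vs" for i
    proof (rule ccontr)
      assume "c (take i vs @ drop (Suc i) vs) \<noteq> 0"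
      then obtain u v where "take i vs @ drop (Suc i) vs = [u, v]" using assms cochains_1_iff by blast
      then have "length (take i vs @ drop (Suc i) vs) = 2" by simp
      then show False using that False by simp
    qed
    then show ?thesis by (simp add: coboundary_def)
  qed
  have 2: "c [u, w] = c [u, v] + c [v, w]" if "coboundary K c [u, v, w] = 0" "{u, v, w} \<in> K" for u v w
    using that by (simp add: coboundary_def lessThan_Suc)
  show ?thesis
  proof
    assume "c \<in> carrier (cocycle_group K 1)"
    then have "coboundary K c vs = 0" for vs by (simp add: carrier_cocycle_group)
    then show "\<forall>u v w. {u, v, w} \<in> K \<longrightarrow> c [u, w] = c [u, v] + c [v, w]" using 2 by blast
  next
    assume "\<forall>u v w. {u, v, w} \<in> K \<longrightarrow> c [u, w] = c [u, v] + c [v, w]"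
    then have "coboundary K c vs = 0" for vs by (intro 1) blast
    then show "c \<in> carrier (cocycle_group K 1)" using assms by (simp add: carrier_cocycle_group fun_eq_iff)
  qed
qed

lemma cocycleD:
  assumes "c \<in> carrier (cocycle_group K 1)"
  shows "c \<in> cochains K 1" "{u, v, w} \<in> K \<Longrightarrow> c [u, w] = c [u, v] + c [v, w]"
  using assms cocycle_iff [of c K] by (auto simp: carrier_cocycle_group)

text \<open>Ordered simplices may repeat vertices, so the cocycle identity holds for u, u, u and
  normalises the cocycle.\<close>

lemma cocycle_refl:
  assumes "c \<in> carrier (cocycle_group K 1)"
  shows "c [u, u] = 0"
proof (rule ccontr)
  assume "c [u, u] \<noteq> 0"
  with cocycleD(1) [OF assms] have "{u, u, u} \<in> K" unfolding cochains_1_iff by auto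
  from cocycleD(2) [OF assms this] \<open>c [u, u] \<noteq> 0\<close> show False by simp
qed

lemma coboundaries_iff:
  assumes K: "down_closed K"
  shows "d \<in> coboundaries K 1 \<longleftrightarrow> d \<in> cochains K 1 \<and> (\<exists>\<beta>. \<forall>u v. {u, v} \<in> K \<longrightarrow> d [u, v] = \<beta> v - \<beta> u)"
proof
  assume "d \<in> coboundaries K 1"
  then obtain b where b: "b \<in> cochains K 0" "d = coboundary K b" by (auto simp: coboundaries_def)
  have nz: "\<exists>u. vs = [u]" if "b vs \<noteq> 0" for vs
  proof -
    have "length vs = Suc 0" using that b(1) unfolding cochains_def by blast
    then show ?thesis by (auto simp: length_Suc_conv)
  qed
  have "d \<in> cochains K 1"
    unfolding cochains_1_iff
  proof (intro allI impI)
    fix vs assume "d vs \<noteq> 0"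
    then have "set vs \<in> K" and "(\<Sum>i<length vs. (- 1) ^ i * b (take i vs @ drop (Suc i) vs)) \<noteq> 0"
      by (auto simp: b(2) coboundary_def split: if_splits)
    then obtain i where i: "i < length vs" "b (take i vs @ drop (Suc i) vs) \<noteq> 0"
      by (metis (no_types, lifting) lessThan_iff mult_zero_right sum.neutral)
    then obtain u where "take i vs @ drop (Suc i) vs = [u]" using nz by blast
    then have "length (take i vs @ drop (Suc i) vs) = 1" by simp
    then have "length vs = Suc (Suc 0)" using i by simp
    then show "\<exists>u v. vs = [u, v] \<and> {u, v} \<in> K" using \<open>set vs \<in> K\<close> by (auto simp: length_Suc_conv)
  qed
  moreover have "\<forall>u v. {u, v} \<in> K \<longrightarrow> d [u, v] = b [v] - b [u]"
    by (simp add: b(2) coboundary_def lessThan_Suc)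
  ultimately show "d \<in> cochains K 1 \<and> (\<exists>\<beta>. \<forall>u v. {u, v} \<in> K \<longrightarrow> d [u, v] = \<beta> v - \<beta> u)"
    by (intro conjI exI [of _ "\<lambda>u. b [u]"])
next
  assume "d \<in> cochains K 1 \<and> (\<exists>\<beta>. \<forall>u v. {u, v} \<in> K \<longrightarrow> d [u, v] = \<beta> v - \<beta> u)"
  then obtain \<beta> where d: "d \<in> cochains K 1" and \<beta>: "\<And>u v. {u, v} \<in> K \<Longrightarrow> d [u, v] = \<beta> v - \<beta> u" by blast
  \<comment> \<open>A cochain has to vanish off the vertices of \<open>K\<close>, so the potential
    is cut off there. Both vertices of an edge belong to \<open>K\<close> by
    \<open>down_closed\<close>, so nothing is lost on edges.\<close>
  define b where "b vs = (if length vs = Suc 0 \<and> set vs \<in> K then \<beta> (hd vs) else 0)" for vs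
  have b: "b \<in> cochains K 0" by (auto simp: cochains_def b_def)
  have sub: "{u} \<in> K" "{v} \<in> K" if "{u, v} \<in> K" for u v
    by (rule down_closedD [OF K that]; simp)+
  have "d vs = coboundary K b vs" for vs
  proof (cases "\<exists>u v. vs = [u, v] \<and> {u, v} \<in> K")
    case True
    then obtain u v where "vs = [u, v]" "{u, v} \<in> K" by blast
    then show ?thesis using \<beta> [of u v] sub [of u v] by (simp add: coboundary_def lessThan_Suc b_def)
  next
    case False
    then have "d vs = 0" using d unfolding cochains_1_iff by blast
    moreover have "coboundary K b vs = 0"
    proof (cases "set vs \<in> K")
      case True
      have "b (take i vs @ drop (Suc i) vs) = 0" if "i < length vs" for i
      proof -
        have "length vs \<noteq> Suc (Suc 0)" using False True by (auto simp: length_Suc_conv)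
        then have "length (take i vs @ drop (Suc i) vs) \<noteq> Suc 0" using that by simp
        then show ?thesis unfolding b_def by (simp only: simp_thms if_False)
      qed
      then show ?thesis by (simp add: coboundary_def)
    qed (simp add: coboundary_def)
    ultimately show ?thesis by simp
  qed
  then show "d \<in> coboundaries K 1" using b by (auto simp: coboundaries_def)
qed

declare One_nat_def [simp del]

lemma cochains_1_add:
  assumes "c \<in> cochains K 1" "d \<in> cochains K 1"
  shows "(\<lambda>vs. c vs + d vs) \<in> cochains K 1" "(\<lambda>vs. c vs - d vs) \<in> cochains K 1"
  using assms by (auto simp: cochains_def)

lemma cocycle_add:
  assumes "c \<in> carrier (cocycle_group K 1)" "d \<in> carrier (cocycle_group K 1)"
  shows "(\<lambda>vs. c vs + d vs) \<in> carrier (cocycle_group K 1)" "(\<lambda>vs. c vs - d vs) \<in> carrier (cocycle_group K 1)"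
  using cocycleD [OF assms(1)] cocycleD [OF assms(2)] cochains_1_add [of c K d]
  by (auto simp: cocycle_iff)

lemma cocycle_zero: "(\<lambda>_. 0) \<in> carrier (cocycle_group K 1)"
  by (subst cocycle_iff) (auto simp: cochains_def)

lemma coboundary_add:
  assumes K: "down_closed K" and "c \<in> coboundaries K 1" "d \<in> coboundaries K 1"
  shows "(\<lambda>vs. c vs + d vs) \<in> coboundaries K 1" "(\<lambda>vs. c vs - d vs) \<in> coboundaries K 1"
proof -
  from assms obtain \<beta> \<gamma> where c: "c \<in> cochains K 1" "\<And>u v. {u, v} \<in> K \<Longrightarrow> c [u, v] = \<beta> v - \<beta> u"
    and d: "d \<in> cochains K 1" "\<And>u v. {u, v} \<in> K \<Longrightarrow> d [u, v] = \<gamma> v - \<gamma> u"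
    unfolding coboundaries_iff [OF K] by metis
  show "(\<lambda>vs. c vs + d vs) \<in> coboundaries K 1"
    unfolding coboundaries_iff [OF K] using c d cochains_1_add [OF c(1) d(1)]
    by (intro conjI exI [of _ "\<lambda>u. \<beta> u + \<gamma> u"]) auto
  show "(\<lambda>vs. c vs - d vs) \<in> coboundaries K 1"
    unfolding coboundaries_iff [OF K] using c d cochains_1_add [OF c(1) d(1)]
    by (intro conjI exI [of _ "\<lambda>u. \<beta> u - \<gamma> u"]) auto
qed

lemma coboundary_zero: "down_closed K \<Longrightarrow> (\<lambda>_. 0) \<in> coboundaries K 1"
  by (auto simp: coboundaries_iff cochains_def)

lemma coboundary_cocycle:
  assumes K: "down_closed K" and d: "d \<in> coboundaries K 1"
  shows "d \<in> carrier (cocycle_group K 1)"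
proof -
  from d obtain \<beta> where d': "d \<in> cochains K 1" and \<beta>: "\<And>u v. {u, v} \<in> K \<Longrightarrow> d [u, v] = \<beta> v - \<beta> u"
    unfolding coboundaries_iff [OF K] by blast
  have "{u, w} \<in> K \<and> {u, v} \<in> K \<and> {v, w} \<in> K" if "{u, v, w} \<in> K" for u v w
    by (intro conjI; rule down_closedD [OF K that]; simp)
  then show ?thesis using d' \<beta> by (simp add: cocycle_iff)
qed

definition coset :: "'v set set \<Rightarrow> ('v list \<Rightarrow> int) \<Rightarrow> ('v list \<Rightarrow> int) set" where
  "coset K c = coboundaries K 1 #>\<^bsub>cocycle_group K 1\<^esub> c"

lemma mem_coset: "d \<in> coset K c \<longleftrightarrow> (\<lambda>vs. d vs - c vs) \<in> coboundaries K 1"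
proof
  assume "d \<in> coset K c"
  then obtain b where "b \<in> coboundaries K 1" "d = (\<lambda>vs. b vs + c vs)"
    by (auto simp: coset_def r_coset_def mult_cocycle_group)
  then show "(\<lambda>vs. d vs - c vs) \<in> coboundaries K 1" by simp
next
  assume "(\<lambda>vs. d vs - c vs) \<in> coboundaries K 1"
  then show "d \<in> coset K c"
    unfolding coset_def r_coset_def mult_cocycle_group
    by (intro UN_I [of "\<lambda>vs. d vs - c vs"]) auto
qed

lemma coset_self: "down_closed K \<Longrightarrow> c \<in> coset K c"
  by (simp add: mem_coset coboundary_zero)

lemma coset_eq_iff:
  assumes K: "down_closed K"
  shows "coset K c = coset K d \<longleftrightarrow> (\<lambda>vs. c vs - d vs) \<in> coboundaries K 1"
proof
  assume "coset K c = coset K d"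
  then show "(\<lambda>vs. c vs - d vs) \<in> coboundaries K 1" using coset_self [OF K, of c] by (simp add: mem_coset)
next
  assume cd: "(\<lambda>vs. c vs - d vs) \<in> coboundaries K 1"
  show "coset K c = coset K d"
  proof safe
    fix e assume "e \<in> coset K c"
    then have "(\<lambda>vs. e vs - c vs) \<in> coboundaries K 1" by (simp add: mem_coset)
    from coboundary_add(1) [OF K this cd] show "e \<in> coset K d" by (simp add: mem_coset algebra_simps)
  next
    fix e assume "e \<in> coset K d"
    then have "(\<lambda>vs. e vs - d vs) \<in> coboundaries K 1" by (simp add: mem_coset)
    from coboundary_add(2) [OF K this cd] show "e \<in> coset K c" by (simp add: mem_coset algebra_simps)
  qed
qed

lemma carrier_cohomology: "carrier (cohomology K 1) = coset K ` carrier (cocycle_group K 1)"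
  by (auto simp: cohomology_def FactGroup_def RCOSETS_def coset_def)

lemma one_cohomology: "down_closed K \<Longrightarrow> \<one>\<^bsub>cohomology K 1\<^esub> = coset K (\<lambda>_. 0)"
  by (auto simp: cohomology_def FactGroup_def mem_coset)

lemma mult_cohomology:
  assumes K: "down_closed K"
  shows "coset K c \<otimes>\<^bsub>cohomology K 1\<^esub> coset K d = coset K (\<lambda>vs. c vs + d vs)"
proof -
  have "coset K c \<otimes>\<^bsub>cohomology K 1\<^esub> coset K d = {\<lambda>vs. x vs + y vs |x y. x \<in> coset K c \<and> y \<in> coset K d}"
    by (auto simp: cohomology_def FactGroup_def set_mult_def mult_cocycle_group)
  also have "\<dots> = coset K (\<lambda>vs. c vs + d vs)"
  proof safe
    fix x y assume "x \<in> coset K c" "y \<in> coset K d"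
    then show "(\<lambda>vs. x vs + y vs) \<in> coset K (\<lambda>vs. c vs + d vs)"
      using coboundary_add(1) [OF K, of "\<lambda>vs. x vs - c vs" "\<lambda>vs. y vs - d vs"]
      by (simp add: mem_coset algebra_simps)
  next
    fix e assume "e \<in> coset K (\<lambda>vs. c vs + d vs)"
    then have "(\<lambda>vs. e vs - d vs) \<in> coset K c" by (simp add: mem_coset algebra_simps)
    then show "\<exists>x y. e = (\<lambda>vs. x vs + y vs) \<and> x \<in> coset K c \<and> y \<in> coset K d"
      using coset_self [OF K, of d] by (intro exI [of _ "\<lambda>vs. e vs - d vs"] exI [of _ d]) auto
  qed
  finally show ?thesis .
qed

definition simplicial_map :: "'v set set \<Rightarrow> 'u set set \<Rightarrow> ('v \<Rightarrow> 'u) \<Rightarrow> bool" where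
  "simplicial_map K K' \<phi> \<longleftrightarrow> (\<forall>\<sigma>\<in>K. \<phi> ` \<sigma> \<in> K')"

lemma simplicial_map_nerve:
  assumes "refines_along f \<V> \<U> \<phi>"
  shows "simplicial_map (nerve \<V>) (nerve \<U>) \<phi>"
  unfolding simplicial_map_def
proof
  fix \<sigma> assume s: "\<sigma> \<in> nerve \<V>"
  then obtain x where x: "\<And>V. V \<in> \<sigma> \<Longrightarrow> x \<in> V" by (auto simp: nerve_def)
  have "f x \<in> \<Inter>(\<phi> ` \<sigma>)"
    using assms s x unfolding refines_along_def nerve_def by blast
  then show "\<phi> ` \<sigma> \<in> nerve \<U>"
    using assms s unfolding nerve_def refines_along_def by auto
qed

lemma pullback_cochain:
  assumes "simplicial_map K K' \<phi>" "c \<in> cochains K' 1"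
  shows "cochain_pullback K \<phi> c \<in> cochains K 1"
    and "{u, v} \<in> K \<Longrightarrow> cochain_pullback K \<phi> c [u, v] = c [\<phi> u, \<phi> v]"
  using assms by (auto simp: cochain_pullback_def cochains_def)

lemma pullback_cocycle:
  assumes "down_closed K" and "simplicial_map K K' \<phi>" and "c \<in> carrier (cocycle_group K' 1)"
  shows "cochain_pullback K \<phi> c \<in> carrier (cocycle_group K 1)"
proof -
  note c = cocycleD [OF assms(3)]
  have "cochain_pullback K \<phi> c [u, w] = cochain_pullback K \<phi> c [u, v] + cochain_pullback K \<phi> c [v, w]"
    if "{u, v, w} \<in> K" for u v w
  proof -
    have "{u, w} \<in> K" "{u, v} \<in> K" "{v, w} \<in> K"
      by (rule down_closedD [OF assms(1) that]; simp)+
    moreover have "\<phi> ` {u, v, w} \<in> K'" using assms(2) that unfolding simplicial_map_def by blast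
    then have "c [\<phi> u, \<phi> w] = c [\<phi> u, \<phi> v] + c [\<phi> v, \<phi> w]" using c(2) [of "\<phi> u" "\<phi> v" "\<phi> w"] by simp
    ultimately show ?thesis using pullback_cochain(2) [OF assms(2) c(1)] by simp
  qed
  then show ?thesis using cocycle_iff pullback_cochain(1) [OF assms(2) c(1)] by blast
qed

lemma pullback_coboundary:
  assumes K: "down_closed K" "down_closed K'" and s: "simplicial_map K K' \<phi>" and d: "d \<in> coboundaries K' 1"
  shows "cochain_pullback K \<phi> d \<in> coboundaries K 1"
proof -
  from d obtain \<beta> where d': "d \<in> cochains K' 1" and \<beta>: "\<And>u v. {u, v} \<in> K' \<Longrightarrow> d [u, v] = \<beta> v - \<beta> u"
    unfolding coboundaries_iff [OF K(2)] by blast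
  have "cochain_pullback K \<phi> d [u, v] = \<beta> (\<phi> v) - \<beta> (\<phi> u)" if "{u, v} \<in> K" for u v
  proof -
    have "\<phi> ` {u, v} \<in> K'" using s that unfolding simplicial_map_def by blast
    then show ?thesis using \<beta> [of "\<phi> u" "\<phi> v"] pullback_cochain(2) [OF s d' that] by simp
  qed
  then show ?thesis
    unfolding coboundaries_iff [OF K(1)] using pullback_cochain(1) [OF s d']
    by (intro conjI exI [of _ "\<lambda>u. \<beta> (\<phi> u)"]) auto
qed

lemma pullback_diff:
  "cochain_pullback K \<phi> (\<lambda>vs. c vs - d vs) = (\<lambda>vs. cochain_pullback K \<phi> c vs - cochain_pullback K \<phi> d vs)"
  by (auto simp: cochain_pullback_def)

lemma pullback_compose:
  assumes "simplicial_map K K' \<phi>"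
  shows "cochain_pullback K \<phi> (cochain_pullback K' \<psi> c) = cochain_pullback K (\<lambda>v. \<psi> (\<phi> v)) c"
  using assms by (auto simp: cochain_pullback_def simplicial_map_def fun_eq_iff comp_def)

lemma cohomology_pullback_coset:
  assumes K: "down_closed K" "down_closed K'" and s: "simplicial_map K K' \<phi>"
  shows "cohomology_pullback K 1 \<phi> (coset K' c) = coset K (cochain_pullback K \<phi> c)"
proof -
  have "coset K (cochain_pullback K \<phi> d) = coset K (cochain_pullback K \<phi> c)" if "d \<in> coset K' c" for d
    using pullback_coboundary [OF K s] that
    by (simp add: coset_eq_iff [OF K(1)] mem_coset pullback_diff [symmetric])
  then have "cohomology_pullback K 1 \<phi> (coset K' c) = (\<Union>d\<in>coset K' c. coset K (cochain_pullback K \<phi> c))"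
    unfolding cohomology_pullback_def coset_def [symmetric] by (intro SUP_cong refl) simp
  then show ?thesis using coset_self [OF K(2), of c] by auto
qed


section \<open>Zero-dimensional spaces with a pattern of lines\<close>

text \<open>What the first Cech cohomology of the quotient depends on, detached from words and
  groups. The assumption \<open>crossing\<close> is the source of finite supports, and
  \<open>L_disjoint\<close> keeps the classes at two points.\<close>

locale line_space =
  fixes X :: "'a topology" and L :: "('a \<times> 'a) set"
  assumes compact: "compact_space X"
    and clopen_base: "openin X U \<Longrightarrow> \<xi> \<in> U \<Longrightarrow> \<exists>A. openin X A \<and> closedin X A \<and> \<xi> \<in> A \<and> A \<subseteq> U"
    and t1: "\<xi> \<in> topspace X \<Longrightarrow> closedin X {\<xi>}"
    and L_subset: "L \<subseteq> topspace X \<times> topspace X"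
    and L_neq: "(a, b) \<in> L \<Longrightarrow> a \<noteq> b"
    and L_disjoint: "(a, b) \<in> L \<Longrightarrow> (c, d) \<in> L \<Longrightarrow> {a, b} \<inter> {c, d} \<noteq> {} \<Longrightarrow> (a, b) = (c, d)"
    and crossing: "openin X A \<Longrightarrow> closedin X A \<Longrightarrow> finite {l \<in> L. (fst l \<in> A) \<noteq> (snd l \<in> A)}"
begin

definition rel :: "('a \<times> 'a) set" where
  "rel = Restr ((L \<union> L\<inverse>)\<^sup>*) (topspace X)"

definition D :: "'a set topology" where
  "D = quotient_topology X rel"

definition q :: "'a \<Rightarrow> 'a set" where
  "q \<xi> = rel `` {\<xi>}"

text \<open>By \<open>L_disjoint\<close> a chain of identifications can only run back and forth
  along one line, so the transitive closure adds nothing.\<close>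

lemma rel_iff: "(\<xi>, \<eta>) \<in> rel \<longleftrightarrow>
  \<xi> \<in> topspace X \<and> \<eta> \<in> topspace X \<and> (\<xi> = \<eta> \<or> (\<xi>, \<eta>) \<in> L \<or> (\<eta>, \<xi>) \<in> L)"
proof -
  have "(\<xi>, \<eta>) \<in> (L \<union> L\<inverse>)\<^sup>* \<longleftrightarrow> \<xi> = \<eta> \<or> (\<xi>, \<eta>) \<in> L \<or> (\<eta>, \<xi>) \<in> L"
  proof
    assume "(\<xi>, \<eta>) \<in> (L \<union> L\<inverse>)\<^sup>*"
    then show "\<xi> = \<eta> \<or> (\<xi>, \<eta>) \<in> L \<or> (\<eta>, \<xi>) \<in> L"
    proof induction
      case (step \<eta> \<zeta>)
      then show ?case
        using L_disjoint [of \<xi> \<eta> \<eta> \<zeta>] L_disjoint [of \<xi> \<eta> \<zeta> \<eta>] L_disjoint [of \<eta> \<xi> \<eta> \<zeta>] L_disjoint [of \<eta> \<xi> \<zeta> \<eta>]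
        by auto
    qed simp
  qed auto
  then show ?thesis by (auto simp: rel_def)
qed

lemma equiv_rel: "equiv (topspace X) rel"
proof (rule equivI)
  have "sym ((L \<union> L\<inverse>)\<^sup>*)"
    by (intro sym_rtrancl sym_Un_converse)
  then show "sym rel"
    unfolding rel_def by (auto simp: sym_def)
  show "trans rel"
    unfolding rel_def by (auto intro!: transI intro: rtrancl_trans)
qed (auto simp: rel_def refl_on_def)

lemma q_eq_iff: "\<xi> \<in> topspace X \<Longrightarrow> \<eta> \<in> topspace X \<Longrightarrow> q \<xi> = q \<eta> \<longleftrightarrow> \<xi> = \<eta> \<or> (\<xi>, \<eta>) \<in> L \<or> (\<eta>, \<xi>) \<in> L"
  unfolding q_def using eq_equiv_class_iff [OF equiv_rel] rel_iff by blast

lemma in_q_iff: "\<xi> \<in> topspace X \<Longrightarrow> \<eta> \<in> q \<xi> \<longleftrightarrow> \<eta> \<in> topspace X \<and> q \<eta> = q \<xi>"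
  unfolding q_def using eq_equiv_class_iff [OF equiv_rel] rel_iff by auto

lemma self_in_q: "\<xi> \<in> topspace X \<Longrightarrow> \<xi> \<in> q \<xi>"
  by (simp add: in_q_iff)

lemma L_topspace: "l \<in> L \<Longrightarrow> fst l \<in> topspace X" "l \<in> L \<Longrightarrow> snd l \<in> topspace X"
  using L_subset by auto

lemma q_line: "l \<in> L \<Longrightarrow> q (fst l) = q (snd l)"
  using q_eq_iff L_topspace by fastforce

lemma topspace_D: "topspace D = q ` topspace X"
  by (auto simp: D_def q_def quotient_def)

lemma openin_D: "openin D U \<longleftrightarrow> U \<subseteq> q ` topspace X \<and> openin X {\<xi> \<in> topspace X. q \<xi> \<in> U}"
  unfolding D_def openin_quotient_topology q_def quotient_def by (simp add: UNION_singleton_eq_range)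

section \<open>Locally constant functions and selections\<close>

definition lc :: "('a \<Rightarrow> 'c) \<Rightarrow> bool" where
  "lc f \<longleftrightarrow> (\<forall>c. openin X {\<xi> \<in> topspace X. f \<xi> = c})"

lemma lc_const: "lc (\<lambda>_. c)"
proof -
  have "openin X {\<xi> \<in> topspace X. c = d}" for d by (cases "c = d") auto
  then show ?thesis by (simp add: lc_def)
qed

lemma lc_openin:
  assumes "lc f"
  shows "openin X {\<xi> \<in> topspace X. P (f \<xi>)}"
proof -
  have "{\<xi> \<in> topspace X. P (f \<xi>)} = (\<Union>c\<in>{c. P c}. {\<xi> \<in> topspace X. f \<xi> = c})" by auto
  then show ?thesis using assms by (simp only:) (auto intro: openin_Union simp: lc_def)
qed

lemma lc_comp: "lc f \<Longrightarrow> lc (\<lambda>\<xi>. h (f \<xi>))"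
  using lc_openin [of f "\<lambda>y. h y = c" for c] by (simp add: lc_def)

lemma lc_Pair:
  assumes "lc f" "lc g"
  shows "lc (\<lambda>\<xi>. (f \<xi>, g \<xi>))"
  unfolding lc_def
proof
  fix c
  have "{\<xi> \<in> topspace X. (f \<xi>, g \<xi>) = c} = {\<xi> \<in> topspace X. f \<xi> = fst c} \<inter> {\<xi> \<in> topspace X. g \<xi> = snd c}"
    by auto
  then show "openin X {\<xi> \<in> topspace X. (f \<xi>, g \<xi>) = c}" using assms by (simp add: lc_def openin_Int)
qed

lemma lc_comp2: "lc f \<Longrightarrow> lc g \<Longrightarrow> lc (\<lambda>\<xi>. h (f \<xi>) (g \<xi>))"
  using lc_comp [OF lc_Pair, of f g "\<lambda>p. h (fst p) (snd p)"] by simp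

lemma lc_clopen:
  assumes "lc f"
  shows "openin X {\<xi> \<in> topspace X. P (f \<xi>)}" "closedin X {\<xi> \<in> topspace X. P (f \<xi>)}"
proof -
  show "openin X {\<xi> \<in> topspace X. P (f \<xi>)}" by (rule lc_openin [OF assms])
  have "topspace X - {\<xi> \<in> topspace X. P (f \<xi>)} = {\<xi> \<in> topspace X. \<not> P (f \<xi>)}" by auto
  then show "closedin X {\<xi> \<in> topspace X. P (f \<xi>)}"
    using lc_openin [OF assms, of "\<lambda>y. \<not> P y"] by (auto simp: closedin_def)
qed

lemma lc_indicator:
  assumes "openin X A" "closedin X A"
  shows "lc (\<lambda>\<xi>. \<xi> \<in> A)"
  unfolding lc_def
proof
  fix c
  have "{\<xi> \<in> topspace X. (\<xi> \<in> A) = c} = (if c then A else topspace X - A)"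
    using openin_subset [OF assms(1)] by auto
  then show "openin X {\<xi> \<in> topspace X. (\<xi> \<in> A) = c}" using assms by auto
qed

lemma lc_finite_range: "lc f \<Longrightarrow> finite (f ` topspace X)"
proof -
  assume f: "lc f"
  let ?S = "\<lambda>c. {\<xi> \<in> topspace X. f \<xi> = c}"
  have "\<forall>U\<in>range ?S. openin X U" "topspace X \<subseteq> \<Union>(range ?S)"
    using f by (auto simp: lc_def)
  then obtain \<F> where "finite \<F>" "\<F> \<subseteq> range ?S" "topspace X \<subseteq> \<Union>\<F>"
    using compact unfolding compact_space_alt by meson
  then obtain C where C: "finite C" "\<F> = ?S ` C" by (meson finite_subset_image)
  then have "f ` topspace X \<subseteq> C" using \<open>topspace X \<subseteq> \<Union>\<F>\<close> by auto
  then show ?thesis using C(1) by (rule finite_subset)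
qed

text \<open>A line along which \<open>f\<close> changes crosses the clopen level set through its
  first end, and by compactness there are finitely many level sets.\<close>

lemma lc_crossing:
  assumes "lc f"
  shows "finite {l \<in> L. f (fst l) \<noteq> f (snd l)}"
proof (rule finite_subset)
  let ?C = "\<lambda>c. {\<xi> \<in> topspace X. f \<xi> = c}"
  show "{l \<in> L. f (fst l) \<noteq> f (snd l)} \<subseteq> (\<Union>c\<in>f ` topspace X. {l \<in> L. (fst l \<in> ?C c) \<noteq> (snd l \<in> ?C c)})"
  proof
    fix l assume l: "l \<in> {l \<in> L. f (fst l) \<noteq> f (snd l)}"
    then have "fst l \<in> topspace X" "snd l \<in> topspace X" using L_topspace by auto
    then show "l \<in> (\<Union>c\<in>f ` topspace X. {l \<in> L. (fst l \<in> ?C c) \<noteq> (snd l \<in> ?C c)})"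
      using l by (intro UN_I [of "f (fst l)"]) auto
  qed
  show "finite (\<Union>c\<in>f ` topspace X. {l \<in> L. (fst l \<in> ?C c) \<noteq> (snd l \<in> ?C c)})"
    by (intro finite_UN_I lc_finite_range [OF assms] crossing lc_clopen [OF assms])
qed

text \<open>A selection lives upstairs on \<open>X\<close> and need not take equal values on the two
  ends of a line; this failure is what a jump measures.\<close>

definition sel :: "'a set set set \<Rightarrow> ('a \<Rightarrow> 'a set set) \<Rightarrow> bool" where
  "sel \<U> u \<longleftrightarrow> lc u \<and> (\<forall>\<xi>\<in>topspace X. u \<xi> \<in> \<U> \<and> q \<xi> \<in> u \<xi>)"

text \<open>Every point has a clopen neighbourhood whose image lies in one member of the cover.
  Finitely many of these cover \<open>X\<close>, and the selection is built by running through
  them.\<close>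

lemma sel_exists:
  assumes "open_cover D \<U>"
  shows "\<exists>u. sel \<U> u"
proof -
  define good where "good A \<longleftrightarrow> openin X A \<and> closedin X A \<and> (\<exists>U\<in>\<U>. \<forall>\<xi>\<in>A. q \<xi> \<in> U)" for A
  have "\<exists>A. good A \<and> \<xi> \<in> A" if "\<xi> \<in> topspace X" for \<xi>
  proof -
    have "q \<xi> \<in> \<Union>\<U>" using assms that by (auto simp: open_cover_def topspace_D)
    then obtain U where U: "U \<in> \<U>" "q \<xi> \<in> U" by blast
    then have "openin X {\<xi> \<in> topspace X. q \<xi> \<in> U}" using assms by (simp add: open_cover_def openin_D)
    from clopen_base [OF this, of \<xi>] U(2) that obtain A where
      A: "openin X A" "closedin X A" "\<xi> \<in> A" "A \<subseteq> {\<xi> \<in> topspace X. q \<xi> \<in> U}" by blast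
    then have "\<forall>\<xi>\<in>A. q \<xi> \<in> U" by blast
    then show ?thesis using U(1) A(1-3) unfolding good_def by blast
  qed
  then have "topspace X \<subseteq> \<Union>{A. good A}" by blast
  moreover have "\<forall>A\<in>{A. good A}. openin X A" by (auto simp: good_def)
  ultimately obtain \<F> where \<F>: "finite \<F>" "\<F> \<subseteq> {A. good A}" "topspace X \<subseteq> \<Union>\<F>"
    using compact unfolding compact_space_alt by meson
  have "\<exists>u. (\<forall>c. openin X {\<xi> \<in> \<Union>\<F>. u \<xi> = c}) \<and> (\<forall>\<xi>\<in>\<Union>\<F>. u \<xi> \<in> \<U> \<and> q \<xi> \<in> u \<xi>)"
    using \<F>(1,2)
  proof (induction \<F>)
    case (insert A \<F>)
    from insert.prems have "\<F> \<subseteq> {A. good A}" by simp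
    from insert.IH [OF this] obtain u where u: "\<forall>c. openin X {\<xi> \<in> \<Union>\<F>. u \<xi> = c}"
      "\<forall>\<xi>\<in>\<Union>\<F>. u \<xi> \<in> \<U> \<and> q \<xi> \<in> u \<xi>" by blast
    from insert.prems have "good A" by simp
    then obtain U where U: "U \<in> \<U>" "\<And>\<xi>. \<xi> \<in> A \<Longrightarrow> q \<xi> \<in> U" and A: "openin X A" "closedin X A"
      unfolding good_def by blast
    \<comment> \<open>The new set takes precedence over the earlier choices; being closed, it can be
      removed from their level sets without destroying openness.\<close>
    let ?u = "\<lambda>\<xi>. if \<xi> \<in> A then U else u \<xi>"
    have "openin X {\<xi> \<in> \<Union>(insert A \<F>). ?u \<xi> = c}" for c
    proof -
      have "{\<xi> \<in> \<Union>(insert A \<F>). ?u \<xi> = c} = (if c = U then A else {}) \<union> ({\<xi> \<in> \<Union>\<F>. u \<xi> = c} - A)" by auto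
      moreover have "openin X ({\<xi> \<in> \<Union>\<F>. u \<xi> = c} - A)"
        using u(1) A(2) by (intro openin_diff) blast+
      moreover have "openin X (if c = U then A else {})" using A(1) by simp
      ultimately show ?thesis by (simp only: openin_Un)
    qed
    moreover have "?u \<xi> \<in> \<U> \<and> q \<xi> \<in> ?u \<xi>" if "\<xi> \<in> \<Union>(insert A \<F>)" for \<xi>
      using that U u(2) by auto
    ultimately show ?case by (intro exI [of _ ?u]) blast
  qed auto
  then obtain u where u: "\<And>c. openin X {\<xi> \<in> \<Union>\<F>. u \<xi> = c}" "\<And>\<xi>. \<xi> \<in> \<Union>\<F> \<Longrightarrow> u \<xi> \<in> \<U> \<and> q \<xi> \<in> u \<xi>"
    by blast
  have "A \<subseteq> topspace X" if "A \<in> \<F>" for A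
    using \<F>(2) that openin_subset [of X A] by (auto simp: good_def)
  then have "\<Union>\<F> = topspace X" using \<F>(3) by blast
  then have "sel \<U> u" using u by (simp add: sel_def lc_def)
  then show ?thesis by blast
qed

end


section \<open>Jumps of cocycles\<close>

context line_space
begin

abbreviation Z :: "'a set set set \<Rightarrow> ('a set set list \<Rightarrow> int) set" where
  "Z \<U> \<equiv> carrier (cocycle_group (nerve \<U>) 1)"

lemma nerve3: "U \<in> \<U> \<Longrightarrow> V \<in> \<U> \<Longrightarrow> W \<in> \<U> \<Longrightarrow> P \<in> U \<Longrightarrow> P \<in> V \<Longrightarrow> P \<in> W \<Longrightarrow> {U, V, W} \<in> nerve \<U>"
  by (auto simp: nerve_def)

lemma nerve2: "U \<in> \<U> \<Longrightarrow> V \<in> \<U> \<Longrightarrow> P \<in> U \<Longrightarrow> P \<in> V \<Longrightarrow> {U, V} \<in> nerve \<U>"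
  by (auto simp: nerve_def)

definition FL :: "('a \<times> 'a \<Rightarrow>\<^sub>0 int) set" where
  "FL = {\<phi>. Poly_Mapping.keys \<phi> \<subseteq> L}"

definition bdry :: "('a \<times> 'a \<Rightarrow>\<^sub>0 int) \<Rightarrow> bool" where
  "bdry \<phi> \<longleftrightarrow> \<phi> \<in> FL \<and>
    (\<exists>f. lc f \<and> (\<forall>l\<in>L. poly_mapping.lookup \<phi> l = f (fst l) - f (snd l)))"

text \<open>A relation, since neither the selection nor the locally constant correction
  \<open>f\<close> is canonical. A cocycle is thereby related to a whole class modulo
  \<open>bdry\<close>.\<close>

definition rep :: "'a set set set \<Rightarrow> ('a set set list \<Rightarrow> int) \<Rightarrow> ('a \<times> 'a \<Rightarrow>\<^sub>0 int) \<Rightarrow> bool" where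
  "rep \<U> c \<phi> \<longleftrightarrow> \<phi> \<in> FL \<and> (\<exists>u f. sel \<U> u \<and> lc f \<and>
    (\<forall>l\<in>L. poly_mapping.lookup \<phi> l = c [u (snd l), u (fst l)] + f (fst l) - f (snd l)))"

lemma FL_add: "\<phi> \<in> FL \<Longrightarrow> \<psi> \<in> FL \<Longrightarrow> \<phi> + \<psi> \<in> FL"
  and FL_diff: "\<phi> \<in> FL \<Longrightarrow> \<psi> \<in> FL \<Longrightarrow> \<phi> - \<psi> \<in> FL"
  and FL_0: "0 \<in> FL"
  using keys_add [of \<phi> \<psi>] keys_diff [of \<phi> \<psi>] by (auto simp: FL_def)

lemma FL_exists:
  assumes "finite {l \<in> L. h l \<noteq> 0}"
  shows "\<exists>\<phi>\<in>FL. \<forall>l\<in>L. poly_mapping.lookup \<phi> l = h l"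
proof -
  let ?h = "\<lambda>l. if l \<in> L then h l else 0"
  have "{l. ?h l \<noteq> 0} = {l \<in> L. h l \<noteq> 0}" by auto
  then have "poly_mapping.lookup (Abs_poly_mapping ?h) = ?h" using assms by (intro Abs_poly_mapping_inverse) simp
  moreover from this have "Abs_poly_mapping ?h \<in> FL" by (auto simp: FL_def in_keys_iff split: if_splits)
  ultimately show ?thesis by (intro bexI [of _ "Abs_poly_mapping ?h"]) auto
qed

lemma FL_eqI:
  assumes "\<phi> \<in> FL" "\<psi> \<in> FL" "\<And>l. l \<in> L \<Longrightarrow> poly_mapping.lookup \<phi> l = poly_mapping.lookup \<psi> l"
  shows "\<phi> = \<psi>"
proof (rule poly_mapping_eqI)
  fix l
  show "poly_mapping.lookup \<phi> l = poly_mapping.lookup \<psi> l"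
  proof (cases "l \<in> L")
    case False
    then have "l \<notin> Poly_Mapping.keys \<phi>" "l \<notin> Poly_Mapping.keys \<psi>" using assms(1,2) unfolding FL_def by blast+
    then show ?thesis by (simp add: not_in_keys_iff_lookup_eq_zero)
  qed (rule assms(3))
qed

lemma bdry_FL: "bdry \<phi> \<Longrightarrow> \<phi> \<in> FL"
  by (simp add: bdry_def)

lemma bdryI: "\<phi> \<in> FL \<Longrightarrow> lc f \<Longrightarrow> (\<And>l. l \<in> L \<Longrightarrow> poly_mapping.lookup \<phi> l = f (fst l) - f (snd l)) \<Longrightarrow> bdry \<phi>"
  unfolding bdry_def by blast

lemma repI: "\<phi> \<in> FL \<Longrightarrow> sel \<U> u \<Longrightarrow> lc f \<Longrightarrow>
  (\<And>l. l \<in> L \<Longrightarrow> poly_mapping.lookup \<phi> l = c [u (snd l), u (fst l)] + f (fst l) - f (snd l)) \<Longrightarrow> rep \<U> c \<phi>"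
  unfolding rep_def by blast

lemma rep_FL: "rep \<U> c \<phi> \<Longrightarrow> \<phi> \<in> FL"
  by (simp add: rep_def)

lemma bdry_diff:
  assumes "bdry \<phi>" "bdry \<psi>"
  shows "bdry (\<phi> - \<psi>)"
proof -
  from assms obtain f g where f: "lc f" "\<forall>l\<in>L. poly_mapping.lookup \<phi> l = f (fst l) - f (snd l)"
    and g: "lc g" "\<forall>l\<in>L. poly_mapping.lookup \<psi> l = g (fst l) - g (snd l)" unfolding bdry_def by blast
  show ?thesis
    by (rule bdryI [OF FL_diff lc_comp2 [OF f(1) g(1), of "(-)"]])
      (use assms f g in \<open>auto simp: bdry_FL lookup_minus\<close>)
qed

lemma bdry_0: "bdry 0"
  by (rule bdryI [OF FL_0 lc_const [of 0]]) simp

lemma bdry_minus: "bdry \<phi> \<Longrightarrow> bdry (- \<phi>)"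
  using bdry_diff [OF bdry_0, of \<phi>] by simp

lemma bdry_add: "bdry \<phi> \<Longrightarrow> bdry \<psi> \<Longrightarrow> bdry (\<phi> + \<psi>)"
  using bdry_diff [OF _ bdry_minus, of \<phi> \<psi>] by simp

lemma selD: "sel \<U> u \<Longrightarrow> lc u" "sel \<U> u \<Longrightarrow> \<xi> \<in> topspace X \<Longrightarrow> u \<xi> \<in> \<U>"
  "sel \<U> u \<Longrightarrow> \<xi> \<in> topspace X \<Longrightarrow> q \<xi> \<in> u \<xi>"
  by (auto simp: sel_def)

lemma sel_line:
  assumes "sel \<U> u" "l \<in> L"
  shows "u (fst l) \<in> \<U>" "u (snd l) \<in> \<U>" "q (fst l) \<in> u (fst l)" "q (fst l) \<in> u (snd l)"
  using selD(2,3) [OF assms(1)] L_topspace [OF assms(2)] q_line [OF assms(2)] by metis+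

text \<open>Passing from \<open>u\<close> to \<open>v\<close> changes the jumps by the differences
  of the locally constant function \<open>c [u \<xi>, v \<xi>]\<close>. For each line the four
  members involved contain the common image of its ends, so every triple needed is a simplex of the
  nerve.\<close>

lemma rep_sel:
  assumes c: "c \<in> Z \<U>" and r: "rep \<U> c \<phi>" and v: "sel \<U> v"
  shows "\<exists>f. lc f \<and> (\<forall>l\<in>L. poly_mapping.lookup \<phi> l = c [v (snd l), v (fst l)] + f (fst l) - f (snd l))"
proof -
  from r obtain u f where u: "sel \<U> u" and f: "lc f"
    "\<And>l. l \<in> L \<Longrightarrow> poly_mapping.lookup \<phi> l = c [u (snd l), u (fst l)] + f (fst l) - f (snd l)"
    unfolding rep_def by blast
  have k: "lc (\<lambda>\<xi>. c [u \<xi>, v \<xi>])" by (rule lc_comp2 [OF selD(1) [OF u] selD(1) [OF v]])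
  have "poly_mapping.lookup \<phi> l = c [v (snd l), v (fst l)]
      + (f (fst l) - c [u (fst l), v (fst l)]) - (f (snd l) - c [u (snd l), v (snd l)])" if l: "l \<in> L" for l
  proof -
    note su = sel_line [OF u l] and sv = sel_line [OF v l]
    have "c [u (snd l), u (fst l)] = c [u (snd l), v (snd l)] + c [v (snd l), u (fst l)]"
      by (rule cocycleD(2) [OF c]) (rule nerve3, (rule su sv)+)
    moreover have "c [v (snd l), u (fst l)] = c [v (snd l), v (fst l)] + c [v (fst l), u (fst l)]"
      by (rule cocycleD(2) [OF c]) (rule nerve3, (rule su sv)+)
    moreover have "c [u (fst l), u (fst l)] = c [u (fst l), v (fst l)] + c [v (fst l), u (fst l)]"
      by (rule cocycleD(2) [OF c]) (rule nerve3, (rule su sv)+)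
    ultimately show ?thesis using f(2) [OF l] cocycle_refl [OF c] by simp
  qed
  then show ?thesis using lc_comp2 [OF f(1) k, of "(-)"] by blast
qed

lemma rep_exists:
  assumes "open_cover D \<U>" "c \<in> Z \<U>"
  shows "\<exists>\<phi>. rep \<U> c \<phi>"
proof -
  from sel_exists [OF assms(1)] obtain u where u: "sel \<U> u" ..
  have "{l \<in> L. c [u (snd l), u (fst l)] \<noteq> 0} \<subseteq> {l \<in> L. u (fst l) \<noteq> u (snd l)}"
    using cocycle_refl [OF assms(2)] by auto
  then have "finite {l \<in> L. c [u (snd l), u (fst l)] \<noteq> 0}"
    using lc_crossing [OF selD(1) [OF u]] by (rule finite_subset)
  from FL_exists [OF this] obtain \<phi> where "\<phi> \<in> FL" "\<forall>l\<in>L. poly_mapping.lookup \<phi> l = c [u (snd l), u (fst l)]"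
    by blast
  then have "rep \<U> c \<phi>" by (intro repI [OF _ u lc_const [of 0]]) auto
  then show ?thesis by blast
qed

lemma rep_diff:
  assumes "c \<in> Z \<U>" "rep \<U> c \<phi>" "c' \<in> Z \<U>" "rep \<U> c' \<phi>'"
  shows "rep \<U> (\<lambda>vs. c vs - c' vs) (\<phi> - \<phi>')"
proof -
  from assms(2) obtain u where u: "sel \<U> u" unfolding rep_def by blast
  from rep_sel [OF assms(1,2) u] obtain f where
    f: "lc f" "\<And>l. l \<in> L \<Longrightarrow> poly_mapping.lookup \<phi> l = c [u (snd l), u (fst l)] + f (fst l) - f (snd l)" by blast
  from rep_sel [OF assms(3,4) u] obtain g where
    g: "lc g" "\<And>l. l \<in> L \<Longrightarrow> poly_mapping.lookup \<phi>' l = c' [u (snd l), u (fst l)] + g (fst l) - g (snd l)" by blast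
  show ?thesis
    by (rule repI [OF FL_diff u lc_comp2 [OF f(1) g(1), of "(-)"]])
      (use assms f g in \<open>auto simp: rep_FL lookup_minus\<close>)
qed

lemma rep_add:
  assumes "c \<in> Z \<U>" "rep \<U> c \<phi>" "c' \<in> Z \<U>" "rep \<U> c' \<phi>'"
  shows "rep \<U> (\<lambda>vs. c vs + c' vs) (\<phi> + \<phi>')"
proof -
  from assms(2) obtain u where u: "sel \<U> u" unfolding rep_def by blast
  from rep_sel [OF assms(1,2) u] obtain f where
    f: "lc f" "\<And>l. l \<in> L \<Longrightarrow> poly_mapping.lookup \<phi> l = c [u (snd l), u (fst l)] + f (fst l) - f (snd l)" by blast
  from rep_sel [OF assms(3,4) u] obtain g where
    g: "lc g" "\<And>l. l \<in> L \<Longrightarrow> poly_mapping.lookup \<phi>' l = c' [u (snd l), u (fst l)] + g (fst l) - g (snd l)" by blast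
  show ?thesis
    by (rule repI [OF FL_add u lc_comp2 [OF f(1) g(1), of "(+)"]])
      (use assms f g in \<open>auto simp: rep_FL lookup_add\<close>)
qed

lemma rep_unique:
  assumes "c \<in> Z \<U>" "rep \<U> c \<phi>" "rep \<U> c \<phi>'"
  shows "bdry (\<phi> - \<phi>')"
proof -
  from rep_diff [OF assms(1,2,1,3)] obtain u f where "lc f"
    "\<forall>l\<in>L. poly_mapping.lookup (\<phi> - \<phi>') l = f (fst l) - f (snd l)" "\<phi> - \<phi>' \<in> FL"
    unfolding rep_def by auto
  then show ?thesis by (intro bdryI) auto
qed

lemma rep_bdry:
  assumes "rep \<U> c \<phi>" "bdry \<psi>"
  shows "rep \<U> c (\<phi> + \<psi>)"
proof -
  from assms(1) obtain u f where u: "sel \<U> u" and f: "lc f"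
    "\<And>l. l \<in> L \<Longrightarrow> poly_mapping.lookup \<phi> l = c [u (snd l), u (fst l)] + f (fst l) - f (snd l)"
    unfolding rep_def by blast
  from assms(2) obtain g where g: "lc g" "\<forall>l\<in>L. poly_mapping.lookup \<psi> l = g (fst l) - g (snd l)"
    unfolding bdry_def by blast
  show ?thesis
    by (rule repI [OF FL_add u lc_comp2 [OF f(1) g(1), of "(+)"]])
      (use assms f g in \<open>auto simp: rep_FL bdry_FL lookup_add\<close>)
qed

text \<open>The jump of the coboundary of \<beta> is the difference of \<beta> composed with the
  selection, which the correction term absorbs.\<close>

lemma rep_coboundary:
  assumes "open_cover D \<U>" "d \<in> coboundaries (nerve \<U>) 1"
  shows "rep \<U> d 0"
proof -
  from sel_exists [OF assms(1)] obtain u where u: "sel \<U> u" ..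
  from assms(2) obtain \<beta> where \<beta>: "\<And>U V. {U, V} \<in> nerve \<U> \<Longrightarrow> d [U, V] = \<beta> V - \<beta> U"
    unfolding coboundaries_iff [OF down_closed_nerve] by blast
  have "d [u (snd l), u (fst l)] = \<beta> (u (fst l)) - \<beta> (u (snd l))" if "l \<in> L" for l
    using sel_line [OF u that] by (intro \<beta> nerve2) auto
  then show ?thesis
    by (intro repI [OF FL_0 u lc_comp [OF selD(1) [OF u], of "\<lambda>U. - \<beta> U"]]) simp
qed

lemma rep_coset_cong:
  assumes "open_cover D \<U>" "c \<in> Z \<U>" "d \<in> Z \<U>" "coset (nerve \<U>) c = coset (nerve \<U>) d" "rep \<U> c \<phi>"
  shows "rep \<U> d \<phi>"
proof -
  have b: "(\<lambda>vs. c vs - d vs) \<in> coboundaries (nerve \<U>) 1"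
    using assms(4) by (simp add: coset_eq_iff [OF down_closed_nerve])
  from rep_diff [OF assms(2,5) coboundary_cocycle [OF down_closed_nerve b] rep_coboundary [OF assms(1) b]]
  show ?thesis by simp
qed

text \<open>Translations are the intended instances. The identity is another, through which
  refinement becomes a special case of pullback.\<close>

definition line_sym :: "('a \<Rightarrow> 'a) \<Rightarrow> ('a \<Rightarrow> 'a) \<Rightarrow> bool" where
  "line_sym T T' \<longleftrightarrow> continuous_map X X T \<and> continuous_map X X T' \<and>
    (\<forall>\<xi>\<in>topspace X. T' (T \<xi>) = \<xi> \<and> T (T' \<xi>) = \<xi>) \<and>
    (\<forall>l\<in>L. map_prod T T l \<in> L \<and> map_prod T' T' l \<in> L)"

lemma line_sym_commute: "line_sym T T' \<Longrightarrow> line_sym T' T"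
  by (auto simp: line_sym_def)

lemma line_sym_id: "line_sym (\<lambda>\<xi>. \<xi>) (\<lambda>\<xi>. \<xi>)"
  by (simp add: line_sym_def map_prod_def case_prod_beta)

lemma line_sym_topspace: "line_sym T T' \<Longrightarrow> \<xi> \<in> topspace X \<Longrightarrow> T \<xi> \<in> topspace X"
  unfolding line_sym_def continuous_map_def by blast

lemma line_sym_q_subset:
  assumes "line_sym T T'" "\<xi> \<in> topspace X"
  shows "T ` q \<xi> \<subseteq> q (T \<xi>)"
proof
  fix \<zeta> assume "\<zeta> \<in> T ` q \<xi>"
  then obtain \<eta> where \<eta>: "\<eta> \<in> q \<xi>" "\<zeta> = T \<eta>" by blast
  then have "(\<xi>, \<eta>) \<in> rel" by (simp add: q_def)
  then have "(T \<xi>, T \<eta>) \<in> rel"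
    using line_sym_topspace [OF assms(1)] assms(1) unfolding rel_iff line_sym_def by fastforce
  then show "\<zeta> \<in> q (T \<xi>)" by (simp add: q_def \<eta>)
qed

lemma line_sym_q:
  assumes s: "line_sym T T'" and \<xi>: "\<xi> \<in> topspace X"
  shows "T ` q \<xi> = q (T \<xi>)"
proof
  show "q (T \<xi>) \<subseteq> T ` q \<xi>"
  proof
    fix \<zeta> assume \<zeta>: "\<zeta> \<in> q (T \<xi>)"
    have T: "T \<xi> \<in> topspace X" by (rule line_sym_topspace [OF s \<xi>])
    then have z: "\<zeta> \<in> topspace X" using \<zeta> by (simp add: in_q_iff)
    have "T' \<zeta> \<in> q (T' (T \<xi>))"
      using line_sym_q_subset [OF line_sym_commute [OF s] T] \<zeta> by blast
    then have "T' \<zeta> \<in> q \<xi>" using s \<xi> by (simp add: line_sym_def)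
    moreover have "\<zeta> = T (T' \<zeta>)" using s z by (simp add: line_sym_def)
    ultimately show "\<zeta> \<in> T ` q \<xi>" by blast
  qed
qed (rule line_sym_q_subset [OF assms])

lemma lc_compose:
  assumes "lc f" "continuous_map X X T"
  shows "lc (\<lambda>\<xi>. f (T \<xi>))"
  unfolding lc_def
proof
  fix c
  have "T \<xi> \<in> topspace X" if "\<xi> \<in> topspace X" for \<xi>
    using assms(2) that unfolding continuous_map_def by blast
  then have "{\<xi> \<in> topspace X. f (T \<xi>) = c} = {\<xi> \<in> topspace X. T \<xi> \<in> {\<eta> \<in> topspace X. f \<eta> = c}}" by blast
  then show "openin X {\<xi> \<in> topspace X. f (T \<xi>) = c}"
    using assms openin_continuous_map_preimage [OF assms(2)] by (simp only: lc_def)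
qed

text \<open>A selection \<open>v\<close> of the finer cover is transported along \<open>T'\<close>
  to a selection of \<U>. At T \<xi> its value is \<tau> (v \<xi>), so the jump of the pulled back
  cocycle across l is the jump of \<open>c\<close> across the image of l.\<close>

lemma rep_pullback:
  assumes s: "line_sym T T'" and r: "refines_along (\<lambda>P. T ` P) \<V> \<U> \<tau>" and \<V>: "open_cover D \<V>"
    and c: "c \<in> Z \<U>" and \<phi>: "rep \<U> c \<phi>"
    and \<psi>: "\<psi> \<in> FL" "\<And>l. l \<in> L \<Longrightarrow> poly_mapping.lookup \<psi> l = poly_mapping.lookup \<phi> (map_prod T T l)"
  shows "rep \<V> (cochain_pullback (nerve \<V>) \<tau> c) \<psi>"
proof -
  from sel_exists [OF \<V>] obtain v where v: "sel \<V> v" ..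
  define u where "u \<eta> = \<tau> (v (T' \<eta>))" for \<eta>
  have cT: "continuous_map X X T" "continuous_map X X T'" using s by (auto simp: line_sym_def)
  have u: "sel \<U> u"
    unfolding sel_def
  proof (intro conjI ballI)
    have "lc (\<lambda>\<xi>. v (T' \<xi>))" by (rule lc_compose [OF selD(1) [OF v] cT(2)])
    then show "lc u" unfolding u_def by (rule lc_comp)
    fix \<eta> assume \<eta>: "\<eta> \<in> topspace X"
    then have T': "T' \<eta> \<in> topspace X" by (rule line_sym_topspace [OF line_sym_commute [OF s]])
    have V: "v (T' \<eta>) \<in> \<V>" "q (T' \<eta>) \<in> v (T' \<eta>)" using selD(2,3) [OF v T'] .
    then show "u \<eta> \<in> \<U>" using r by (simp add: u_def refines_along_def)
    have "T ` q (T' \<eta>) \<in> \<tau> (v (T' \<eta>))" using V r unfolding refines_along_def by blast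
    then show "q \<eta> \<in> u \<eta>" using s \<eta> line_sym_q [OF s T'] by (simp add: u_def line_sym_def)
  qed
  from rep_sel [OF c \<phi> u] obtain f where f: "lc f"
    "\<And>l. l \<in> L \<Longrightarrow> poly_mapping.lookup \<phi> l = c [u (snd l), u (fst l)] + f (fst l) - f (snd l)" by blast
  show ?thesis
  proof (rule repI [OF \<psi>(1) v lc_compose [OF f(1) cT(1)]])
    fix l assume l: "l \<in> L"
    have uT: "u (T \<xi>) = \<tau> (v \<xi>)" if "\<xi> \<in> topspace X" for \<xi> using s that by (simp add: u_def line_sym_def)
    have "map_prod T T l \<in> L" using s l by (simp add: line_sym_def)
    from f(2) [OF this] have "poly_mapping.lookup \<psi> l = c [u (T (snd l)), u (T (fst l))] + f (T (fst l)) - f (T (snd l))"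
      using \<psi>(2) [OF l] by simp
    moreover have "{v (snd l), v (fst l)} \<in> nerve \<V>"
      using sel_line [OF v l] by (intro nerve2) auto
    from pullback_cochain(2) [OF simplicial_map_nerve [OF r] cocycleD(1) [OF c] this]
    have "cochain_pullback (nerve \<V>) \<tau> c [v (snd l), v (fst l)] = c [u (T (snd l)), u (T (fst l))]"
      using L_topspace [OF l] by (simp add: uT)
    ultimately show "poly_mapping.lookup \<psi> l = cochain_pullback (nerve \<V>) \<tau> c [v (snd l), v (fst l)]
        + f (T (fst l)) - f (T (snd l))" by simp
  qed
qed

lemma rep_refine:
  assumes "refines_along id \<V> \<U> \<tau>" "open_cover D \<V>" "c \<in> Z \<U>" "rep \<U> c \<phi>"
  shows "rep \<V> (cochain_pullback (nerve \<V>) \<tau> c) \<phi>"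
proof -
  have "refines_along (\<lambda>P. (\<lambda>\<xi>. \<xi>) ` P) \<V> \<U> \<tau>" using assms(1) by (simp add: refines_along_def)
  from rep_pullback [OF line_sym_id this assms(2-4) rep_FL [OF assms(4)]] show ?thesis
    by (simp add: map_prod_def case_prod_beta)
qed

lemma Z_refine: "refines_along f \<V> \<U> \<tau> \<Longrightarrow> c \<in> Z \<U> \<Longrightarrow> cochain_pullback (nerve \<V>) \<tau> c \<in> Z \<V>"
  by (rule pullback_cocycle [OF down_closed_nerve simplicial_map_nerve])

lemma open_cover_preimage:
  assumes s: "line_sym T T'" and \<U>: "open_cover D \<U>"
  shows "\<exists>\<V> \<tau>. open_cover D \<V> \<and> refines_along (\<lambda>P. T ` P) \<V> \<U> \<tau>"
proof -
  define pb where "pb U = {P \<in> topspace D. T ` P \<in> U}" for U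
  have opn: "openin D (pb U)" if "U \<in> \<U>" for U
  proof -
    have U: "openin X {\<xi> \<in> topspace X. q \<xi> \<in> U}" using that \<U> by (simp add: open_cover_def openin_D)
    have "{\<xi> \<in> topspace X. q \<xi> \<in> pb U} = {\<xi> \<in> topspace X. T \<xi> \<in> {\<eta> \<in> topspace X. q \<eta> \<in> U}}"
      using line_sym_q [OF s] line_sym_topspace [OF s] by (auto simp: pb_def topspace_D)
    moreover have "continuous_map X X T" using s by (simp add: line_sym_def)
    note openin_continuous_map_preimage [OF this U]
    ultimately have "openin X {\<xi> \<in> topspace X. q \<xi> \<in> pb U}" by (simp only:)
    then show ?thesis by (auto simp: openin_D pb_def topspace_D)
  qed
  have "open_cover D (pb ` \<U>)"
    unfolding open_cover_def
  proof (intro conjI)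
    show "\<forall>V\<in>pb ` \<U>. openin D V" using opn by blast
    show "\<Union>(pb ` \<U>) = topspace D"
    proof
      show "topspace D \<subseteq> \<Union>(pb ` \<U>)"
      proof
        fix P assume P: "P \<in> topspace D"
        then obtain \<xi> where \<xi>: "\<xi> \<in> topspace X" "P = q \<xi>" by (auto simp: topspace_D)
        then have "T ` P \<in> topspace D" using line_sym_q [OF s] line_sym_topspace [OF s] by (auto simp: topspace_D)
        then show "P \<in> \<Union>(pb ` \<U>)" using \<U> P by (auto simp: open_cover_def pb_def)
      qed
    qed (auto simp: pb_def)
  qed
  \<comment> \<open>Different members may have the same preimage, so the refinement projection has
    to choose one of them.\<close>
  moreover have "\<forall>V\<in>pb ` \<U>. \<exists>U. U \<in> \<U> \<and> V = pb U" by blast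
  from bchoice [OF this] obtain \<tau> where \<tau>: "\<forall>V\<in>pb ` \<U>. \<tau> V \<in> \<U> \<and> V = pb (\<tau> V)" ..
  have "refines_along (\<lambda>P. T ` P) (pb ` \<U>) \<U> \<tau>"
    unfolding refines_along_def
  proof (intro ballI conjI)
    fix V assume V: "V \<in> pb ` \<U>"
    show "\<tau> V \<in> \<U>" using \<tau> V by blast
    have "T ` P \<in> \<tau> V" if "P \<in> pb (\<tau> V)" for P using that by (simp add: pb_def)
    moreover have "V = pb (\<tau> V)" using \<tau> V by blast
    ultimately show "(\<lambda>P. T ` P) ` V \<subseteq> \<tau> V" by blast
  qed
  ultimately show ?thesis by blast
qed

lemma common_refinement:
  assumes "open_cover D \<U>" "open_cover D \<V>"
  shows "\<exists>\<W> \<tau> \<sigma>. open_cover D \<W> \<and> refines_along id \<W> \<U> \<tau> \<and> refines_along id \<W> \<V> \<sigma>"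
proof -
  define \<W> where "\<W> = (\<lambda>p. fst p \<inter> snd p) ` (\<U> \<times> \<V>)"
  have "open_cover D \<W>"
    unfolding open_cover_def
  proof
    show "\<forall>W\<in>\<W>. openin D W" using assms by (auto simp: open_cover_def \<W>_def intro: openin_Int)
    have "\<Union>\<W> = \<Union>\<U> \<inter> \<Union>\<V>" by (auto simp: \<W>_def)
    then show "\<Union>\<W> = topspace D" using assms by (simp add: open_cover_def)
  qed
  moreover have "\<forall>W\<in>\<W>. \<exists>p. p \<in> \<U> \<times> \<V> \<and> W = fst p \<inter> snd p" by (auto simp: \<W>_def)
  from bchoice [OF this] obtain \<rho> where
    \<rho>: "\<forall>W\<in>\<W>. \<rho> W \<in> \<U> \<times> \<V> \<and> W = fst (\<rho> W) \<inter> snd (\<rho> W)" ..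
  have "fst (\<rho> W) \<in> \<U> \<and> W \<subseteq> fst (\<rho> W)" "snd (\<rho> W) \<in> \<V> \<and> W \<subseteq> snd (\<rho> W)" if "W \<in> \<W>" for W
    using bspec [OF \<rho> that] by (auto simp only: mem_Times_iff)
  then have "refines_along id \<W> \<U> (\<lambda>W. fst (\<rho> W))" "refines_along id \<W> \<V> (\<lambda>W. snd (\<rho> W))"
    unfolding refines_along_def by simp_all
  ultimately show ?thesis by blast
qed

text \<open>A cocycle with vanishing jumps has, on each member \<open>U\<close> of the cover, the primitive
  \<open>\<xi> \<mapsto> c(u \<xi>, U) - f \<xi>\<close>, which descends to \<open>U\<close>; on the level sets of these primitives the
  cocycle becomes a coboundary.\<close>

lemma rep_0_imp_coboundary:
  assumes \<U>: "open_cover D \<U>" and c: "c \<in> Z \<U>" and r: "rep \<U> c 0"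
  shows "\<exists>\<W> \<tau>. open_cover D \<W> \<and> refines_along id \<W> \<U> \<tau> \<and>
    cochain_pullback (nerve \<W>) \<tau> c \<in> coboundaries (nerve \<W>) 1"
proof -
  from r obtain u f where u: "sel \<U> u" and f: "lc f"
    and uf: "\<And>l. l \<in> L \<Longrightarrow> c [u (snd l), u (fst l)] + f (fst l) - f (snd l) = 0"
    unfolding rep_def by auto
  define k where "k U \<xi> = c [u \<xi>, U] - f \<xi>" for U \<xi>
  have k_line: "k U (fst l) = k U (snd l)" if U: "U \<in> \<U>" "q (fst l) \<in> U" and l: "l \<in> L" for U l
  proof -
    have "c [u (snd l), U] = c [u (snd l), u (fst l)] + c [u (fst l), U]"
      by (rule cocycleD(2) [OF c]) (rule nerve3, (rule sel_line [OF u l] U)+)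
    then show ?thesis using uf [OF l] by (simp add: k_def)
  qed
  have k_q: "k U \<xi> = k U \<eta>" if "U \<in> \<U>" "\<xi> \<in> topspace X" "\<eta> \<in> topspace X" "q \<xi> = q \<eta>" "q \<xi> \<in> U" for U \<xi> \<eta>
    using k_line [of U "(\<xi>, \<eta>)"] k_line [of U "(\<eta>, \<xi>)"] that q_eq_iff [of \<xi> \<eta>] by auto
  \<comment> \<open>Quantifying over all points above \<open>P\<close> makes this a set of points of
    the quotient without choosing representatives; by \<open>k_q\<close> one representative
    decides.\<close>
  define lev where "lev U m = {P \<in> U. \<forall>\<xi>\<in>topspace X. q \<xi> = P \<longrightarrow> k U \<xi> = m}" for U and m :: int
  define \<W> where "\<W> = (\<lambda>p. lev (fst p) (snd p)) ` (\<U> \<times> UNIV)"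
  have lev: "q \<xi> \<in> lev U m \<longleftrightarrow> q \<xi> \<in> U \<and> k U \<xi> = m" if "U \<in> \<U>" "\<xi> \<in> topspace X" for U \<xi> m
  proof
    assume "q \<xi> \<in> lev U m"
    then show "q \<xi> \<in> U \<and> k U \<xi> = m" using that(2) unfolding lev_def by simp
  next
    assume a: "q \<xi> \<in> U \<and> k U \<xi> = m"
    have "k U \<eta> = m" if \<eta>: "\<eta> \<in> topspace X" "q \<eta> = q \<xi>" for \<eta>
    proof -
      have "q \<eta> \<in> U" using a \<eta>(2) by simp
      from k_q [OF \<open>U \<in> \<U>\<close> \<eta>(1) \<open>\<xi> \<in> topspace X\<close> \<eta>(2) this] show ?thesis using a by simp
    qed
    then show "q \<xi> \<in> lev U m" unfolding lev_def using a by simp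
  qed
  have opn: "openin D (lev U m)" if U: "U \<in> \<U>" for U m
  proof -
    have UD: "openin D U" using \<U> U by (simp add: open_cover_def)
    have "lc (k U)" unfolding k_def
      by (rule lc_comp2 [OF selD(1) [OF u] f, of "\<lambda>V x. c [V, U] - x"])
    then have "openin X ({\<xi> \<in> topspace X. q \<xi> \<in> U} \<inter> {\<xi> \<in> topspace X. k U \<xi> = m})"
      using UD by (intro openin_Int) (simp_all add: openin_D lc_def)
    moreover have "{\<xi> \<in> topspace X. q \<xi> \<in> lev U m} = {\<xi> \<in> topspace X. q \<xi> \<in> U} \<inter> {\<xi> \<in> topspace X. k U \<xi> = m}"
      using lev [OF U] by auto
    moreover have "lev U m \<subseteq> q ` topspace X" using UD by (auto simp: openin_D lev_def)
    ultimately show ?thesis by (simp add: openin_D)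
  qed
  have cov: "open_cover D \<W>"
    unfolding open_cover_def
  proof
    show ops: "\<forall>W\<in>\<W>. openin D W" using opn by (auto simp: \<W>_def)
    show "\<Union>\<W> = topspace D"
    proof
      show "\<Union>\<W> \<subseteq> topspace D" using ops openin_subset by blast
      show "topspace D \<subseteq> \<Union>\<W>"
      proof
        fix P assume P: "P \<in> topspace D"
        then obtain \<xi> where \<xi>: "\<xi> \<in> topspace X" "P = q \<xi>" by (auto simp: topspace_D)
        from P \<U> obtain U where U: "U \<in> \<U>" "P \<in> U" by (auto simp: open_cover_def)
        then have "P \<in> lev U (k U \<xi>)" using lev [OF U(1) \<xi>(1)] \<xi>(2) by simp
        then show "P \<in> \<Union>\<W>" using U(1) by (auto simp: \<W>_def)
      qed
    qed
  qed
  have "\<forall>W\<in>\<W>. \<exists>p. fst p \<in> \<U> \<and> W = lev (fst p) (snd p)" by (auto simp: \<W>_def)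
  from bchoice [OF this] obtain \<rho> where
    \<rho>': "\<forall>W\<in>\<W>. fst (\<rho> W) \<in> \<U> \<and> W = lev (fst (\<rho> W)) (snd (\<rho> W))" ..
  have \<rho>: "fst (\<rho> W) \<in> \<U>" "W = lev (fst (\<rho> W)) (snd (\<rho> W))" if "W \<in> \<W>" for W
    using \<rho>' that by blast+
  have ref: "refines_along id \<W> \<U> (\<lambda>W. fst (\<rho> W))"
    unfolding refines_along_def
  proof (intro ballI conjI)
    fix W assume W: "W \<in> \<W>"
    show "fst (\<rho> W) \<in> \<U>" by (rule \<rho> [OF W])
    have "lev U m \<subseteq> U" for U m by (auto simp: lev_def)
    then have "lev (fst (\<rho> W)) (snd (\<rho> W)) \<subseteq> fst (\<rho> W)" .
    then show "id ` W \<subseteq> fst (\<rho> W)" unfolding \<rho>(2) [OF W, symmetric] by simp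
  qed
  have "cochain_pullback (nerve \<W>) (\<lambda>W. fst (\<rho> W)) c [V, W] = snd (\<rho> W) - snd (\<rho> V)"
    if n: "{V, W} \<in> nerve \<W>" for V W
  proof -
    from n obtain P where VW: "V \<in> \<W>" "W \<in> \<W>" "P \<in> V" "P \<in> W" by (auto simp: nerve_def)
    then have "P \<in> topspace D" using cov by (auto simp: open_cover_def)
    then obtain \<xi> where \<xi>: "\<xi> \<in> topspace X" "P = q \<xi>" by (auto simp: topspace_D)
    let ?A = "fst (\<rho> V)" and ?B = "fst (\<rho> W)"
    have A: "?A \<in> \<U>" "?B \<in> \<U>" by (rule \<rho>, rule VW)+
    have "q \<xi> \<in> lev ?A (snd (\<rho> V))" "q \<xi> \<in> lev ?B (snd (\<rho> W))"
      unfolding \<rho>(2) [OF VW(1), symmetric] \<rho>(2) [OF VW(2), symmetric] using VW \<xi>(2) by simp_all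
    then have q: "q \<xi> \<in> ?A" "q \<xi> \<in> ?B" and k: "k ?A \<xi> = snd (\<rho> V)" "k ?B \<xi> = snd (\<rho> W)"
      using lev A \<xi>(1) by auto
    \<comment> \<open>On the overlap the two primitives differ by \<open>c [?A, ?B]\<close>, as
      \<open>f\<close> cancels, and each is constant on its level set. The levels therefore form the
      potential.\<close>
    have "c [u \<xi>, ?B] = c [u \<xi>, ?A] + c [?A, ?B]"
      by (rule cocycleD(2) [OF c]) (rule nerve3, (rule selD(2,3) [OF u \<xi>(1)] A q)+)
    moreover have "cochain_pullback (nerve \<W>) (\<lambda>W. fst (\<rho> W)) c [V, W] = c [?A, ?B]"
      by (rule pullback_cochain(2) [OF simplicial_map_nerve [OF ref] cocycleD(1) [OF c] n])
    ultimately show ?thesis using k by (simp add: k_def)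
  qed
  then have "cochain_pullback (nerve \<W>) (\<lambda>W. fst (\<rho> W)) c \<in> coboundaries (nerve \<W>) 1"
    unfolding coboundaries_iff [OF down_closed_nerve]
    using pullback_cochain(1) [OF simplicial_map_nerve [OF ref] cocycleD(1) [OF c]]
    by (intro conjI exI [of _ "\<lambda>W. snd (\<rho> W)"]) auto
  then show ?thesis using cov ref by blast
qed

lemma refines_along_compose:
  assumes "refines_along id \<W> \<V> \<rho>" "refines_along id \<V> \<U> \<tau>"
  shows "refines_along id \<W> \<U> (\<lambda>W. \<tau> (\<rho> W))"
  unfolding refines_along_def image_id id_apply
proof
  fix W assume "W \<in> \<W>"
  then have W: "\<rho> W \<in> \<V>" "W \<subseteq> \<rho> W" using assms(1) by (auto simp: refines_along_def)
  then have "\<tau> (\<rho> W) \<in> \<U>" "\<rho> W \<subseteq> \<tau> (\<rho> W)" using assms(2) by (auto simp: refines_along_def)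
  then show "\<tau> (\<rho> W) \<in> \<U> \<and> W \<subseteq> \<tau> (\<rho> W)" using W(2) by blast
qed

text \<open>On a common refinement the difference of the two cocycles has jump 0, and by
  \<open>rep_0_imp_coboundary\<close> it becomes a coboundary on a further refinement.\<close>

lemma rep_eq_imp_equal_pullbacks:
  assumes \<U>: "open_cover D \<U>" "c \<in> Z \<U>" "rep \<U> c \<phi>" and \<V>: "open_cover D \<V>" "d \<in> Z \<V>" "rep \<V> d \<phi>"
  shows "\<exists>\<W> \<tau> \<sigma>. open_cover D \<W> \<and> refines_along id \<W> \<U> \<tau> \<and> refines_along id \<W> \<V> \<sigma> \<and>
    coset (nerve \<W>) (cochain_pullback (nerve \<W>) \<tau> c) = coset (nerve \<W>) (cochain_pullback (nerve \<W>) \<sigma> d)"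
proof -
  from common_refinement [OF \<U>(1) \<V>(1)] obtain \<W> \<tau> \<sigma> where
    \<W>: "open_cover D \<W>" and \<tau>: "refines_along id \<W> \<U> \<tau>" and \<sigma>: "refines_along id \<W> \<V> \<sigma>" by blast
  let ?c = "cochain_pullback (nerve \<W>) \<tau> c" and ?d = "cochain_pullback (nerve \<W>) \<sigma> d"
  have Zcd: "?c \<in> Z \<W>" "?d \<in> Z \<W>" using Z_refine \<tau> \<sigma> \<U>(2) \<V>(2) by blast+
  have "rep \<W> (\<lambda>vs. ?c vs - ?d vs) (\<phi> - \<phi>)"
    by (rule rep_diff [OF Zcd(1) rep_refine [OF \<tau> \<W> \<U>(2,3)] Zcd(2) rep_refine [OF \<sigma> \<W> \<V>(2,3)]])
  then have "rep \<W> (\<lambda>vs. ?c vs - ?d vs) 0" by simp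
  from rep_0_imp_coboundary [OF \<W> cocycle_add(2) [OF Zcd] this] obtain \<W>' \<rho> where
    \<W>': "open_cover D \<W>'" and \<rho>: "refines_along id \<W>' \<W> \<rho>"
    and cob: "cochain_pullback (nerve \<W>') \<rho> (\<lambda>vs. ?c vs - ?d vs) \<in> coboundaries (nerve \<W>') 1" by blast
  have "refines_along id \<W>' \<U> (\<lambda>W. \<tau> (\<rho> W))" "refines_along id \<W>' \<V> (\<lambda>W. \<sigma> (\<rho> W))"
    by (rule refines_along_compose [OF \<rho> \<tau>], rule refines_along_compose [OF \<rho> \<sigma>])
  moreover have "coset (nerve \<W>') (cochain_pullback (nerve \<W>') (\<lambda>W. \<tau> (\<rho> W)) c) =
      coset (nerve \<W>') (cochain_pullback (nerve \<W>') (\<lambda>W. \<sigma> (\<rho> W)) d)"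
    using cob unfolding coset_eq_iff [OF down_closed_nerve] pullback_diff
    by (simp only: pullback_compose [OF simplicial_map_nerve [OF \<rho>]])
  ultimately show ?thesis using \<W>' by blast
qed

end


section \<open>Realising finitely supported functions as jumps\<close>

context line_space
begin

text \<open>Builds a cocycle from functions \<open>h U\<close> above the members of a cover. The
  nerve allows only one integer per pair of members, so the differences of these functions have to
  be constant on overlaps; the jump common to all \<open>h U\<close> is then the jump of the
  cocycle.\<close>

lemma rep_of_primitives:
  assumes \<U>: "open_cover D \<U>" and \<phi>: "\<phi> \<in> FL"
    and opn: "\<And>U k. U \<in> \<U> \<Longrightarrow> openin X {\<xi> \<in> topspace X. q \<xi> \<in> U \<and> h U \<xi> = k}"
    and const: "\<And>U V \<xi> \<eta>. U \<in> \<U> \<Longrightarrow> V \<in> \<U> \<Longrightarrow> \<xi> \<in> topspace X \<Longrightarrow> \<eta> \<in> topspace X \<Longrightarrow>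
      q \<xi> \<in> U \<Longrightarrow> q \<xi> \<in> V \<Longrightarrow> q \<eta> \<in> U \<Longrightarrow> q \<eta> \<in> V \<Longrightarrow> h U \<xi> - h V \<xi> = h U \<eta> - h V \<eta>"
    and jump: "\<And>U l. U \<in> \<U> \<Longrightarrow> l \<in> L \<Longrightarrow> q (fst l) \<in> U \<Longrightarrow>
      h U (fst l) - h U (snd l) = poly_mapping.lookup \<phi> l"
  shows "\<exists>c\<in>Z \<U>. rep \<U> c \<phi>"
proof -
  define e where "e U V = (let \<xi> = SOME \<xi>. \<xi> \<in> topspace X \<and> q \<xi> \<in> U \<and> q \<xi> \<in> V in h U \<xi> - h V \<xi>)" for U V
  have e: "e U V = h U \<xi> - h V \<xi>"
    if "U \<in> \<U>" "V \<in> \<U>" "\<xi> \<in> topspace X" "q \<xi> \<in> U" "q \<xi> \<in> V" for U V \<xi>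
  proof -
    let ?P = "\<lambda>\<xi>. \<xi> \<in> topspace X \<and> q \<xi> \<in> U \<and> q \<xi> \<in> V"
    have "?P (Eps ?P)" by (rule someI [of ?P \<xi>]) (use that in simp)
    then show ?thesis unfolding e_def Let_def using that by (intro const) auto
  qed
  define c where "c vs = (if length vs = 2 \<and> set vs \<in> nerve \<U> then e (vs ! 0) (vs ! 1) else 0)" for vs
  have c2: "c [U, V] = e U V" if "{U, V} \<in> nerve \<U>" for U V
    using that by (simp add: c_def One_nat_def)
  have "c \<in> cochains (nerve \<U>) 1" by (simp add: cochains_def c_def numeral_2_eq_2 One_nat_def)
  moreover have "c [U, W] = c [U, V] + c [V, W]" if n: "{U, V, W} \<in> nerve \<U>" for U V W
  proof -
    from n obtain P where P: "P \<in> U" "P \<in> V" "P \<in> W" and UVW: "U \<in> \<U>" "V \<in> \<U>" "W \<in> \<U>"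
      by (auto simp: nerve_def)
    then have "P \<in> topspace D" using \<U> by (auto simp: open_cover_def)
    then obtain \<xi> where \<xi>: "\<xi> \<in> topspace X" "P = q \<xi>" by (auto simp: topspace_D)
    have "{U, W} \<in> nerve \<U>" "{U, V} \<in> nerve \<U>" "{V, W} \<in> nerve \<U>"
      by (rule nerve2, (rule P UVW)+)+
    then show ?thesis using e [of _ _ \<xi>] P UVW \<xi> by (simp add: c2)
  qed
  ultimately have c: "c \<in> Z \<U>" using cocycle_iff by blast
  from sel_exists [OF \<U>] obtain u where u: "sel \<U> u" ..
  have H: "lc (\<lambda>\<xi>. h (u \<xi>) \<xi>)"
    unfolding lc_def
  proof
    fix k
    have "{\<xi> \<in> topspace X. h (u \<xi>) \<xi> = k} =
        (\<Union>U\<in>\<U>. {\<xi> \<in> topspace X. u \<xi> = U} \<inter> {\<xi> \<in> topspace X. q \<xi> \<in> U \<and> h U \<xi> = k})"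
      using selD(2,3) [OF u] by auto
    moreover have "openin X ({\<xi> \<in> topspace X. u \<xi> = U} \<inter> {\<xi> \<in> topspace X. q \<xi> \<in> U \<and> h U \<xi> = k})"
      if "U \<in> \<U>" for U
      using selD(1) [OF u] opn [OF that] by (intro openin_Int) (simp_all add: lc_def)
    ultimately show "openin X {\<xi> \<in> topspace X. h (u \<xi>) \<xi> = k}" by (simp only:) (rule openin_Union, blast)
  qed
  have "rep \<U> c \<phi>"
  proof (rule repI [OF \<phi> u H])
    fix l assume l: "l \<in> L"
    note s = sel_line [OF u l] and t = L_topspace [OF l]
    have "c [u (snd l), u (fst l)] = h (u (snd l)) (fst l) - h (u (fst l)) (fst l)"
      unfolding c2 [OF nerve2 [OF s(2,1,4,3)]] by (rule e [OF s(2,1) t(1) s(4,3)])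
    then show "poly_mapping.lookup \<phi> l = c [u (snd l), u (fst l)] + h (u (fst l)) (fst l) - h (u (snd l)) (snd l)"
      using jump [OF s(2) l s(4)] by simp
  qed
  with c show ?thesis by blast
qed

lemma finite_closedin: "finite E \<Longrightarrow> E \<subseteq> topspace X \<Longrightarrow> closedin X E"
proof (induction E rule: finite_induct)
  case (insert x E)
  then have "closedin X ({x} \<union> E)" by (intro closedin_Un t1) auto
  then show ?case by simp
qed simp

definition inside :: "'a set \<Rightarrow> 'a set set" where
  "inside W = {P \<in> topspace D. P \<subseteq> W}"

text \<open>The points whose class lies in \<open>W\<close> form \<open>W\<close> without the ends
  of the lines crossing \<open>W\<close>. These are finitely many points, and finite sets are
  closed.\<close>

lemma openin_inside:
  assumes "openin X W" "closedin X W"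
  shows "openin D (inside W)"
proof -
  let ?C = "{l \<in> L. (fst l \<in> W) \<noteq> (snd l \<in> W)}"
  let ?E = "fst ` ?C \<union> snd ` ?C"
  have "closedin X ?E"
    using crossing [OF assms] L_topspace by (intro finite_closedin) auto
  then have "openin X (W - ?E)" using assms(1) by (rule openin_diff [rotated])
  moreover have "{\<xi> \<in> topspace X. q \<xi> \<subseteq> W} = W - ?E"
  proof
    show "{\<xi> \<in> topspace X. q \<xi> \<subseteq> W} \<subseteq> W - ?E"
    proof
      fix \<xi> assume "\<xi> \<in> {\<xi> \<in> topspace X. q \<xi> \<subseteq> W}"
      then have \<xi>: "\<xi> \<in> topspace X" "q \<xi> \<subseteq> W" by auto
      have "\<xi> \<notin> ?E"
      proof
        assume "\<xi> \<in> ?E"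
        then obtain l where l: "l \<in> L" "(fst l \<in> W) \<noteq> (snd l \<in> W)" "\<xi> = fst l \<or> \<xi> = snd l" by auto
        have "q \<xi> = q (fst l)" using l(3) q_line [OF l(1)] by metis
        then have "fst l \<in> q \<xi>" "snd l \<in> q \<xi>"
          using L_topspace [OF l(1)] q_line [OF l(1)] by (simp_all add: in_q_iff)
        then show False using \<xi>(2) l(2) by blast
      qed
      then show "\<xi> \<in> W - ?E" using self_in_q [OF \<xi>(1)] \<xi>(2) by blast
    qed
    show "W - ?E \<subseteq> {\<xi> \<in> topspace X. q \<xi> \<subseteq> W}"
    proof
      fix \<xi> assume \<xi>: "\<xi> \<in> W - ?E"
      then have t: "\<xi> \<in> topspace X" using openin_subset [OF assms(1)] by blast
      have "\<eta> \<in> W" if "\<eta> \<in> q \<xi>" for \<eta>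
      proof (rule ccontr)
        assume \<eta>: "\<eta> \<notin> W"
        have "(\<xi>, \<eta>) \<in> L \<or> (\<eta>, \<xi>) \<in> L" using that \<eta> \<xi> rel_iff by (auto simp: q_def)
        then have "(\<xi>, \<eta>) \<in> ?C \<or> (\<eta>, \<xi>) \<in> ?C" using \<xi> \<eta> by auto
        then have "\<xi> \<in> ?E" by force
        then show False using \<xi> by blast
      qed
      then show "\<xi> \<in> {\<xi> \<in> topspace X. q \<xi> \<subseteq> W}" using t by blast
    qed
  qed
  moreover have "{\<xi> \<in> topspace X. q \<xi> \<in> inside W} = {\<xi> \<in> topspace X. q \<xi> \<subseteq> W}"
    by (auto simp: inside_def topspace_D)
  ultimately show ?thesis by (auto simp: openin_D inside_def topspace_D)
qed

lemma q_in_inside: "\<xi> \<in> topspace X \<Longrightarrow> q \<xi> \<in> inside W \<longleftrightarrow> q \<xi> \<subseteq> W"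
  by (auto simp: inside_def topspace_D)

text \<open>The class of a single line \<open>(a, b)\<close>: choose clopen sets \<open>A1 \<subseteq> A0\<close> with \<open>a \<in> A1\<close> and
  \<open>b \<notin> A0\<close> such that \<open>(a, b)\<close> is the only line joining \<open>A1\<close> to the complement of \<open>A0\<close>. The
  points of the quotient inside \<open>A1 \<union> (X - A0)\<close>, inside \<open>X - A1\<close>, and inside \<open>A0\<close> form an open cover;
  the primitive is the indicator of \<open>A1\<close> on the first set and \<open>0\<close> on the others.\<close>

lemma rep_line:
  assumes ab: "(a, b) \<in> L"
  shows "\<exists>\<U>. open_cover D \<U> \<and> (\<exists>c\<in>Z \<U>. rep \<U> c (frag_of (a, b)))"
proof -
  have a: "a \<in> topspace X" and b: "b \<in> topspace X" using L_topspace [OF ab] by auto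
  have "openin X (topspace X - {b})" using t1 [OF b] by blast
  from clopen_base [OF this, of a] a L_neq [OF ab] obtain A0 where
    A0: "openin X A0" "closedin X A0" "a \<in> A0" "b \<notin> A0" by blast
  \<comment> \<open>The other lines crossing \<open>A0\<close>. None of them ends in
    \<open>a\<close>, so a clopen neighbourhood of \<open>a\<close> inside \<open>A0\<close> can
    avoid their finitely many ends.\<close>
  let ?S = "{l \<in> L. (fst l \<in> A0) \<noteq> (snd l \<in> A0)} - {(a, b)}"
  let ?E = "fst ` ?S \<union> snd ` ?S"
  have "closedin X ?E"
    using crossing [OF A0(1,2)] L_topspace by (intro finite_closedin) auto
  then have "openin X (A0 - ?E)" using A0(1) by (rule openin_diff [rotated])
  moreover have "a \<notin> ?E"
  proof
    assume "a \<in> ?E"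
    then obtain l where "l \<in> L" "l \<noteq> (a, b)" "a = fst l \<or> a = snd l" by auto
    then show False using L_disjoint [OF _ ab, of "fst l" "snd l"] by auto
  qed
  ultimately obtain A1 where A1: "openin X A1" "closedin X A1" "a \<in> A1" "A1 \<subseteq> A0 - ?E"
    using clopen_base [of "A0 - ?E" a] A0(3) by blast
  have only: "l = (a, b)" if l: "l \<in> L" and x: "fst l \<in> A1 \<and> snd l \<notin> A0 \<or> snd l \<in> A1 \<and> fst l \<notin> A0" for l
  proof (rule ccontr)
    assume "l \<noteq> (a, b)"
    then have "l \<in> ?S" using l x A1(4) by auto
    then have "fst l \<in> ?E" "snd l \<in> ?E" by blast+
    then show False using x A1(4) by blast
  qed
  define V where "V = inside (A1 \<union> (topspace X - A0))"
  define U1 where "U1 = inside (topspace X - A1)"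
  define U2 where "U2 = inside A0"
  have opn: "openin D V" "openin D U1" "openin D U2"
    unfolding V_def U1_def U2_def using A0 A1 by (auto intro!: openin_inside)
  \<comment> \<open>A class with two different points has no third one.\<close>
  have ends: "\<theta> = \<eta> \<or> \<theta> = \<zeta>" if "\<eta> \<in> q \<xi>" "\<zeta> \<in> q \<xi>" "\<theta> \<in> q \<xi>" "\<eta> \<noteq> \<zeta>" "\<xi> \<in> topspace X" for \<xi> \<eta> \<zeta> \<theta>
  proof (rule ccontr)
    assume n: "\<not> (\<theta> = \<eta> \<or> \<theta> = \<zeta>)"
    have "\<eta> \<in> topspace X" "\<zeta> \<in> topspace X" "\<theta> \<in> topspace X" "q \<eta> = q \<zeta>" "q \<eta> = q \<theta>"
      using that by (auto simp: in_q_iff)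
    then have "(\<eta>, \<zeta>) \<in> L \<or> (\<zeta>, \<eta>) \<in> L" "(\<eta>, \<theta>) \<in> L \<or> (\<theta>, \<eta>) \<in> L"
      using q_eq_iff that(4) n by blast+
    then show False
      using n L_disjoint [of \<eta> \<zeta> \<eta> \<theta>] L_disjoint [of \<eta> \<zeta> \<theta> \<eta>] L_disjoint [of \<zeta> \<eta> \<eta> \<theta>] L_disjoint [of \<zeta> \<eta> \<theta> \<eta>]
      by auto
  qed
  have cov: "open_cover D {V, U1, U2}"
    unfolding open_cover_def
  proof
    show "\<forall>U\<in>{V, U1, U2}. openin D U" using opn by blast
    have "P \<in> V \<union> U1 \<union> U2" if "P \<in> topspace D" for P
    proof (rule ccontr)
      assume n: "P \<notin> V \<union> U1 \<union> U2"
      from that obtain \<xi> where \<xi>: "\<xi> \<in> topspace X" "P = q \<xi>" by (auto simp: topspace_D)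
      have "q \<xi> \<subseteq> topspace X" using \<xi>(1) by (auto simp: in_q_iff)
      \<comment> \<open>Missing \<open>U1\<close> gives a representative in \<open>A1\<close>,
        missing \<open>U2\<close> one outside \<open>A0\<close>. They exhaust the class, which puts
        it into \<open>V\<close>.\<close>
      then obtain \<eta> \<zeta> where \<eta>: "\<eta> \<in> q \<xi>" "\<eta> \<in> A1" and \<zeta>: "\<zeta> \<in> q \<xi>" "\<zeta> \<notin> A0"
        using n \<xi> by (auto simp: U1_def U2_def q_in_inside)
      have "q \<xi> \<subseteq> A1 \<union> (topspace X - A0)"
      proof
        fix \<theta> assume \<theta>: "\<theta> \<in> q \<xi>"
        have "\<eta> \<noteq> \<zeta>" using \<eta> \<zeta> A1(4) by blast
        from ends [OF \<eta>(1) \<zeta>(1) \<theta> this \<xi>(1)] show "\<theta> \<in> A1 \<union> (topspace X - A0)"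
          using \<eta> \<zeta> \<theta> \<open>q \<xi> \<subseteq> topspace X\<close> by blast
      qed
      then show False using n \<xi> by (simp add: V_def q_in_inside)
    qed
    moreover have "V \<union> U1 \<union> U2 \<subseteq> topspace D" by (auto simp: V_def U1_def U2_def inside_def)
    ultimately show "\<Union>{V, U1, U2} = topspace D" by blast
  qed
  define h :: "'a set set \<Rightarrow> 'a \<Rightarrow> int" where "h U \<xi> = of_bool (U = V \<and> \<xi> \<in> A1)" for U \<xi>
  have V: "\<xi> \<in> A1 \<or> \<xi> \<notin> A0" if "\<xi> \<in> topspace X" "q \<xi> \<in> V" for \<xi>
    using that self_in_q [OF that(1)] by (auto simp: V_def q_in_inside)
  have U1: "\<xi> \<notin> A1" if "\<xi> \<in> topspace X" "q \<xi> \<in> U1" for \<xi>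
    using that self_in_q [OF that(1)] by (auto simp: U1_def q_in_inside)
  have U2: "\<xi> \<in> A0" if "\<xi> \<in> topspace X" "q \<xi> \<in> U2" for \<xi>
    using that self_in_q [OF that(1)] by (auto simp: U2_def q_in_inside)
  have FL: "frag_of (a, b) \<in> FL" using ab by (simp add: FL_def keys_frag_of)
  have "\<exists>c\<in>Z {V, U1, U2}. rep {V, U1, U2} c (frag_of (a, b))"
  proof (rule rep_of_primitives [where h = h, OF cov FL])
    fix U k assume U: "U \<in> {V, U1, U2}"
    then have "openin D U" using opn by blast
    then have oU: "openin X {\<xi> \<in> topspace X. q \<xi> \<in> U}" by (simp add: openin_D)
    have "lc (h U)" unfolding h_def
      by (rule lc_comp [OF lc_indicator [OF A1(1,2)], of "\<lambda>p. of_bool (U = V \<and> p)"])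
    then have "openin X ({\<xi> \<in> topspace X. q \<xi> \<in> U} \<inter> {\<xi> \<in> topspace X. h U \<xi> = k})"
      using oU by (intro openin_Int) (simp_all add: lc_def)
    moreover have "{\<xi> \<in> topspace X. q \<xi> \<in> U} \<inter> {\<xi> \<in> topspace X. h U \<xi> = k} =
        {\<xi> \<in> topspace X. q \<xi> \<in> U \<and> h U \<xi> = k}" by auto
    ultimately show "openin X {\<xi> \<in> topspace X. q \<xi> \<in> U \<and> h U \<xi> = k}" by simp
  next
    fix U W \<xi> \<eta>
    assume UW: "U \<in> {V, U1, U2}" "W \<in> {V, U1, U2}" and t: "\<xi> \<in> topspace X" "\<eta> \<in> topspace X"
      and q: "q \<xi> \<in> U" "q \<xi> \<in> W" "q \<eta> \<in> U" "q \<eta> \<in> W"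
    \<comment> \<open>Above \<open>V\<close> and \<open>U1\<close> there are no points of
      \<open>A1\<close>; above \<open>V\<close> and \<open>U2\<close> all points lie in
      \<open>A0\<close>, hence in \<open>A1\<close>. So the indicator is constantly 0 on the first
      overlap and constantly 1 on the second.\<close>
    have *: "h V \<xi> = h V \<eta>" if "U' = U1 \<or> U' = U2" "q \<xi> \<in> V" "q \<eta> \<in> V" "q \<xi> \<in> U'" "q \<eta> \<in> U'" for U'
      using that t V [of \<xi>] V [of \<eta>] U1 [of \<xi>] U1 [of \<eta>] U2 [of \<xi>] U2 [of \<eta>] by (auto simp: h_def)
    consider "U = V" "W = V" | "U = V" "W \<noteq> V" "W = U1 \<or> W = U2" | "U \<noteq> V" "W = V" "U = U1 \<or> U = U2" | "U \<noteq> V" "W \<noteq> V"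
      using UW by blast
    then show "h U \<xi> - h W \<xi> = h U \<eta> - h W \<eta>"
    proof cases
      case 2
      then show ?thesis using * [of W] q by (simp add: h_def)
    next
      case 3
      then show ?thesis using * [of U] q by (simp add: h_def)
    qed (simp_all add: h_def)
  next
    fix U l assume U: "U \<in> {V, U1, U2}" and l: "l \<in> L" and ql: "q (fst l) \<in> U"
    note t = L_topspace [OF l]
    have ql2: "q (snd l) \<in> U" using ql q_line [OF l] by simp
    show "h U (fst l) - h U (snd l) = poly_mapping.lookup (frag_of (a, b)) l"
    proof (cases "U = V")
      case True
      have v: "fst l \<in> A1 \<or> fst l \<notin> A0" "snd l \<in> A1 \<or> snd l \<notin> A0"
        using V [OF t(1)] V [OF t(2)] ql ql2 True by auto
      show ?thesis
      proof (cases "l = (a, b)")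
        case True
        then show ?thesis using \<open>U = V\<close> A1 A0 by (auto simp: h_def)
      next
        case False
        then have "fst l \<in> A1 \<longleftrightarrow> snd l \<in> A1" using only [OF l] v by blast
        then show ?thesis using False by (simp add: h_def)
      qed
    next
      case False
      then have "U = U1 \<or> U = U2" using U by blast
      have "l \<noteq> (a, b)"
      proof
        assume "l = (a, b)"
        then show False
          using \<open>U = U1 \<or> U = U2\<close> U1 [OF t(1)] U2 [OF t(2)] ql ql2 A1(3) A0(4) by auto
      qed
      then show ?thesis using False by (simp add: h_def)
    qed
  qed
  then show ?thesis using cov by blast
qed

lemma rep_surj:
  assumes "\<phi> \<in> FL"
  shows "\<exists>\<U>. open_cover D \<U> \<and> (\<exists>c\<in>Z \<U>. rep \<U> c \<phi>)"
proof -
  have "Poly_Mapping.keys \<phi> \<subseteq> L" using assms by (simp add: FL_def)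
  then show ?thesis
  proof (induction \<phi> rule: frag_induction)
    case zero
    have cov: "open_cover D {topspace D}" by (simp add: open_cover_def)
    then show ?case
      using rep_coboundary [OF cov coboundary_zero [OF down_closed_nerve]] cocycle_zero by blast
  next
    case (one l)
    then show ?case using rep_line [of "fst l" "snd l"] by simp
  next
    case (diff \<phi> \<psi>)
    then obtain \<U> \<V> c d where \<U>: "open_cover D \<U>" "c \<in> Z \<U>" "rep \<U> c \<phi>" and \<V>: "open_cover D \<V>" "d \<in> Z \<V>" "rep \<V> d \<psi>"
      by blast
    from common_refinement [OF \<U>(1) \<V>(1)] obtain \<W> \<tau> \<sigma> where
      \<W>: "open_cover D \<W>" and \<tau>: "refines_along id \<W> \<U> \<tau>" and \<sigma>: "refines_along id \<W> \<V> \<sigma>" by blast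
    have "rep \<W> (\<lambda>vs. cochain_pullback (nerve \<W>) \<tau> c vs - cochain_pullback (nerve \<W>) \<sigma> d vs) (\<phi> - \<psi>)"
      by (rule rep_diff [OF Z_refine [OF \<tau> \<U>(2)] rep_refine [OF \<tau> \<W> \<U>(2,3)]
            Z_refine [OF \<sigma> \<V>(2)] rep_refine [OF \<sigma> \<W> \<V>(2,3)]])
    then show ?case
      using \<W> cocycle_add(2) [OF Z_refine [OF \<tau> \<U>(2)] Z_refine [OF \<sigma> \<V>(2)]] by blast
  qed
qed


section \<open>First Cech cohomology of the quotient\<close>

text \<open>The element of the direct limit with jump function \<phi>, as a set of representatives.
  Describing the limit by jumps lets its product, unit and pullbacks be computed in
  \<open>FL\<close>.\<close>

definition cls :: "('a \<times> 'a \<Rightarrow>\<^sub>0 int) \<Rightarrow> 'a set cech_elem set" where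
  "cls \<phi> = {(\<U>, A). open_cover D \<U> \<and> (\<exists>c\<in>Z \<U>. A = coset (nerve \<U>) c \<and> rep \<U> c \<phi>)}"

lemma clsE:
  assumes "(\<U>, A) \<in> cls \<phi>"
  obtains c where "open_cover D \<U>" "c \<in> Z \<U>" "A = coset (nerve \<U>) c" "rep \<U> c \<phi>"
proof -
  from assms have "open_cover D \<U> \<and> (\<exists>c\<in>Z \<U>. A = coset (nerve \<U>) c \<and> rep \<U> c \<phi>)"
    unfolding cls_def by simp
  then show thesis using that by (elim conjE bexE) (rule that)
qed

lemma in_cls_coset:
  assumes "c \<in> Z \<U>"
  shows "(\<U>, coset (nerve \<U>) c) \<in> cls \<phi> \<longleftrightarrow> open_cover D \<U> \<and> rep \<U> c \<phi>"
proof
  assume "(\<U>, coset (nerve \<U>) c) \<in> cls \<phi>"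
  then obtain d where "open_cover D \<U>" "d \<in> Z \<U>" "coset (nerve \<U>) c = coset (nerve \<U>) d" "rep \<U> d \<phi>"
    by (rule clsE)
  then show "open_cover D \<U> \<and> rep \<U> c \<phi>"
    using rep_coset_cong [of \<U> d c \<phi>] assms by simp
next
  assume "open_cover D \<U> \<and> rep \<U> c \<phi>"
  then show "(\<U>, coset (nerve \<U>) c) \<in> cls \<phi>" using assms unfolding cls_def by blast
qed

lemma cech_elems_iff: "(\<U>, A) \<in> cech_elems 1 D \<longleftrightarrow> open_cover D \<U> \<and> (\<exists>c\<in>Z \<U>. A = coset (nerve \<U>) c)"
  by (auto simp: cech_elems_def carrier_cohomology)

lemma cls_subset: "cls \<phi> \<subseteq> cech_elems 1 D"
  by (auto simp: cech_elems_iff cls_def)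

lemma cech_elems_in_cls: "p \<in> cech_elems 1 D \<Longrightarrow> \<exists>\<phi>\<in>FL. p \<in> cls \<phi>"
proof -
  assume "p \<in> cech_elems 1 D"
  then obtain \<U> c where p: "p = (\<U>, coset (nerve \<U>) c)" and \<U>: "open_cover D \<U>" and c: "c \<in> Z \<U>"
    by (cases p) (auto simp: cech_elems_iff)
  from rep_exists [OF \<U> c] obtain \<phi> where "rep \<U> c \<phi>" ..
  then show ?thesis using \<U> c rep_FL by (auto simp: p in_cls_coset)
qed

lemma cls_nonempty: "\<phi> \<in> FL \<Longrightarrow> \<exists>p. p \<in> cls \<phi>"
  using rep_surj [of \<phi>] in_cls_coset by blast

lemma cls_unique:
  assumes "p \<in> cls \<phi>" "p \<in> cls \<psi>"
  shows "bdry (\<phi> - \<psi>)"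
proof -
  obtain \<U> A where p: "p = (\<U>, A)" by fastforce
  with assms(1) obtain c where c: "open_cover D \<U>" "c \<in> Z \<U>" "A = coset (nerve \<U>) c" "rep \<U> c \<phi>"
    by (auto elim: clsE)
  have "rep \<U> c \<psi>" using assms(2) unfolding p c(3) in_cls_coset [OF c(2)] by blast
  then show ?thesis using rep_unique c by blast
qed

lemma cls_cong:
  assumes "bdry (\<phi> - \<psi>)"
  shows "cls \<phi> = cls \<psi>"
proof -
  have "rep \<U> c \<phi> \<longleftrightarrow> rep \<U> c \<psi>" for \<U> c
    using rep_bdry [of \<U> c \<phi> "- (\<phi> - \<psi>)"] rep_bdry [of \<U> c \<psi> "\<phi> - \<psi>"] bdry_minus [OF assms] assms by auto
  then show ?thesis by (simp add: cls_def)
qed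

lemma cls_eq_iff: "\<phi> \<in> FL \<Longrightarrow> cls \<phi> = cls \<psi> \<longleftrightarrow> bdry (\<phi> - \<psi>)"
proof
  assume "\<phi> \<in> FL" and eq: "cls \<phi> = cls \<psi>"
  then obtain p where p: "p \<in> cls \<phi>" using cls_nonempty by fast
  show "bdry (\<phi> - \<psi>)" by (rule cls_unique [OF p]) (use p eq in simp)
qed (rule cls_cong)

text \<open>Refinement preserves jumps, so equal pullbacks force jump functions that differ by a
  \<open>bdry\<close>, which \<open>rep_bdry\<close> absorbs. The converse is
  \<open>rep_eq_imp_equal_pullbacks\<close>.\<close>

lemma cech_rel_iff:
  "(p, r) \<in> cech_rel 1 D \<longleftrightarrow> (\<exists>\<phi>\<in>FL. p \<in> cls \<phi> \<and> r \<in> cls \<phi>)"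
proof -
  obtain \<U> A \<V> B where p: "p = (\<U>, A)" and r: "r = (\<V>, B)" by fastforce
  show ?thesis
  proof
    assume "(p, r) \<in> cech_rel 1 D"
    then obtain \<W> \<tau> \<sigma> where el: "p \<in> cech_elems 1 D" "r \<in> cech_elems 1 D"
      and \<W>: "open_cover D \<W>" and \<tau>: "refines_along id \<W> \<U> \<tau>" and \<sigma>: "refines_along id \<W> \<V> \<sigma>"
      and eq: "cohomology_pullback (nerve \<W>) 1 \<tau> A = cohomology_pullback (nerve \<W>) 1 \<sigma> B"
      by (auto simp: cech_rel_def p r)
    from el obtain c d where c: "open_cover D \<U>" "c \<in> Z \<U>" "A = coset (nerve \<U>) c"
      and d: "open_cover D \<V>" "d \<in> Z \<V>" "B = coset (nerve \<V>) d" by (auto simp: p r cech_elems_iff)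
    from rep_exists [OF c(1,2)] obtain \<phi> where \<phi>: "rep \<U> c \<phi>" ..
    from rep_exists [OF d(1,2)] obtain \<psi> where \<psi>: "rep \<V> d \<psi>" ..
    let ?c = "cochain_pullback (nerve \<W>) \<tau> c" and ?d = "cochain_pullback (nerve \<W>) \<sigma> d"
    have "coset (nerve \<W>) ?c = coset (nerve \<W>) ?d"
      using eq unfolding c(3) d(3) cohomology_pullback_coset [OF down_closed_nerve down_closed_nerve simplicial_map_nerve [OF \<tau>]]
        cohomology_pullback_coset [OF down_closed_nerve down_closed_nerve simplicial_map_nerve [OF \<sigma>]] .
    from rep_coset_cong [OF \<W> Z_refine [OF \<tau> c(2)] Z_refine [OF \<sigma> d(2)] this rep_refine [OF \<tau> \<W> c(2) \<phi>]]
    have "bdry (\<phi> - \<psi>)"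
      using rep_unique [OF Z_refine [OF \<sigma> d(2)]] rep_refine [OF \<sigma> \<W> d(2) \<psi>] by blast
    then have "rep \<V> d \<phi>" using rep_bdry [OF \<psi>, of "\<phi> - \<psi>"] by simp
    then show "\<exists>\<phi>\<in>FL. p \<in> cls \<phi> \<and> r \<in> cls \<phi>"
      using \<phi> c d rep_FL by (auto simp: p r in_cls_coset)
  next
    assume "\<exists>\<phi>\<in>FL. p \<in> cls \<phi> \<and> r \<in> cls \<phi>"
    then obtain \<phi> where pr: "p \<in> cls \<phi>" "r \<in> cls \<phi>" by blast
    from pr(1) obtain c where c: "open_cover D \<U>" "c \<in> Z \<U>" "A = coset (nerve \<U>) c" "rep \<U> c \<phi>"
      unfolding p by (rule clsE)
    from pr(2) obtain d where d: "open_cover D \<V>" "d \<in> Z \<V>" "B = coset (nerve \<V>) d" "rep \<V> d \<phi>"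
      unfolding r by (rule clsE)
    from rep_eq_imp_equal_pullbacks [OF c(1,2,4) d(1,2,4)] obtain \<W> \<tau> \<sigma> where
      \<W>: "open_cover D \<W>" and \<tau>: "refines_along id \<W> \<U> \<tau>" and \<sigma>: "refines_along id \<W> \<V> \<sigma>"
      and eq: "coset (nerve \<W>) (cochain_pullback (nerve \<W>) \<tau> c) = coset (nerve \<W>) (cochain_pullback (nerve \<W>) \<sigma> d)"
      by blast
    have "cohomology_pullback (nerve \<W>) 1 \<tau> A = cohomology_pullback (nerve \<W>) 1 \<sigma> B"
      unfolding c(3) d(3) cohomology_pullback_coset [OF down_closed_nerve down_closed_nerve simplicial_map_nerve [OF \<tau>]]
        cohomology_pullback_coset [OF down_closed_nerve down_closed_nerve simplicial_map_nerve [OF \<sigma>]] by (rule eq)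
    moreover have "p \<in> cech_elems 1 D" "r \<in> cech_elems 1 D" using pr cls_subset by blast+
    ultimately show "(p, r) \<in> cech_rel 1 D" using \<W> \<tau> \<sigma> unfolding cech_rel_def p r by blast
  qed
qed

text \<open>Product, unit and pullback are defined as images of sets of representatives under
  \<open>cech_rel\<close>. Such an image is a full class as soon as the set is nonempty and has one
  jump function.\<close>

lemma cech_rel_Image:
  assumes "\<phi> \<in> FL" "S \<subseteq> cls \<phi>" "S \<noteq> {}"
  shows "cech_rel 1 D `` S = cls \<phi>"
proof
  show "cech_rel 1 D `` S \<subseteq> cls \<phi>"
  proof
    fix r assume "r \<in> cech_rel 1 D `` S"
    then obtain p where "p \<in> S" "(p, r) \<in> cech_rel 1 D" by blast
    then obtain \<psi> where p: "p \<in> cls \<phi>" "p \<in> cls \<psi>" and "r \<in> cls \<psi>"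
      using assms(2) unfolding cech_rel_iff by blast
    then show "r \<in> cls \<phi>" using cls_cong [OF cls_unique [OF p]] by simp
  qed
  show "cls \<phi> \<subseteq> cech_rel 1 D `` S"
  proof
    fix r assume r: "r \<in> cls \<phi>"
    from assms(3) obtain p where "p \<in> S" by blast
    then have "(p, r) \<in> cech_rel 1 D" unfolding cech_rel_iff using assms(1,2) r by blast
    then show "r \<in> cech_rel 1 D `` S" using \<open>p \<in> S\<close> by blast
  qed
qed

lemma carrier_cech: "carrier (cech_cohomology 1 D) = cls ` FL"
proof -
  have "carrier (cech_cohomology 1 D) = (\<Union>p\<in>cech_elems 1 D. {cech_rel 1 D `` {p}})"
    by (simp add: cech_cohomology_def quotient_def)
  also have "\<dots> = cls ` FL"
  proof safe
    fix p assume "p \<in> cech_elems 1 D"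
    from cech_elems_in_cls [OF this] obtain \<phi> where "\<phi> \<in> FL" "p \<in> cls \<phi>" by blast
    then show "cech_rel 1 D `` {p} \<in> cls ` FL" using cech_rel_Image [of \<phi> "{p}"] by blast
  next
    fix \<phi> assume \<phi>: "\<phi> \<in> FL"
    from cls_nonempty [OF \<phi>] obtain p where p: "p \<in> cls \<phi>" ..
    then have "cech_rel 1 D `` {p} = cls \<phi>" using cech_rel_Image [OF \<phi>, of "{p}"] by blast
    then show "cls \<phi> \<in> (\<Union>p\<in>cech_elems 1 D. {cech_rel 1 D `` {p}})" using p cls_subset by blast
  qed
  finally show ?thesis .
qed

lemma mult_cech:
  assumes "\<phi> \<in> FL" "\<psi> \<in> FL"
  shows "cls \<phi> \<otimes>\<^bsub>cech_cohomology 1 D\<^esub> cls \<psi> = cls (\<phi> + \<psi>)"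
proof -
  let ?S = "{(\<U>, a \<otimes>\<^bsub>cohomology (nerve \<U>) 1\<^esub> b) | \<U> a b. (\<U>, a) \<in> cls \<phi> \<and> (\<U>, b) \<in> cls \<psi>}"
  have sum: "(\<U>, a \<otimes>\<^bsub>cohomology (nerve \<U>) 1\<^esub> b) \<in> cls (\<phi> + \<psi>)"
    if a: "(\<U>, a) \<in> cls \<phi>" and b: "(\<U>, b) \<in> cls \<psi>" for \<U> a b
  proof -
    from a obtain c where c: "open_cover D \<U>" "c \<in> Z \<U>" "a = coset (nerve \<U>) c" "rep \<U> c \<phi>" by (rule clsE)
    from b obtain d where d: "open_cover D \<U>" "d \<in> Z \<U>" "b = coset (nerve \<U>) d" "rep \<U> d \<psi>" by (rule clsE)
    show ?thesis
      unfolding c(3) d(3) mult_cohomology [OF down_closed_nerve] in_cls_coset [OF cocycle_add(1) [OF c(2) d(2)]]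
      using c d rep_add by blast
  qed
  \<comment> \<open>The product only multiplies representatives over the same cover, so both classes
    have to be moved to a common refinement.\<close>
  have ne: "?S \<noteq> {}"
  proof -
    from cls_nonempty [OF assms(1)] obtain \<U> A where 1: "(\<U>, A) \<in> cls \<phi>" by fastforce
    from cls_nonempty [OF assms(2)] obtain \<V> B where 2: "(\<V>, B) \<in> cls \<psi>" by fastforce
    from 1 obtain c where c: "open_cover D \<U>" "c \<in> Z \<U>" "A = coset (nerve \<U>) c" "rep \<U> c \<phi>" by (rule clsE)
    from 2 obtain d where d: "open_cover D \<V>" "d \<in> Z \<V>" "B = coset (nerve \<V>) d" "rep \<V> d \<psi>" by (rule clsE)
    from common_refinement [OF c(1) d(1)] obtain \<W> \<tau> \<sigma> where
      \<W>: "open_cover D \<W>" and \<tau>: "refines_along id \<W> \<U> \<tau>" and \<sigma>: "refines_along id \<W> \<V> \<sigma>" by blast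
    have "(\<W>, coset (nerve \<W>) (cochain_pullback (nerve \<W>) \<tau> c)) \<in> cls \<phi>"
      using in_cls_coset [OF Z_refine [OF \<tau> c(2)]] \<W> rep_refine [OF \<tau> \<W> c(2,4)] by blast
    moreover have "(\<W>, coset (nerve \<W>) (cochain_pullback (nerve \<W>) \<sigma> d)) \<in> cls \<psi>"
      using in_cls_coset [OF Z_refine [OF \<sigma> d(2)]] \<W> rep_refine [OF \<sigma> \<W> d(2,4)] by blast
    ultimately show ?thesis by blast
  qed
  have "?S \<subseteq> cls (\<phi> + \<psi>)" using sum by blast
  from cech_rel_Image [OF FL_add [OF assms] this ne]
  have "cech_rel 1 D `` ?S = cls (\<phi> + \<psi>)" .
  then show ?thesis by (simp add: cech_cohomology_def)
qed

lemma one_cech: "\<one>\<^bsub>cech_cohomology 1 D\<^esub> = cls 0"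
proof -
  let ?S = "{(\<U>, \<one>\<^bsub>cohomology (nerve \<U>) 1\<^esub>) | \<U>. open_cover D \<U>}"
  have "(\<U>, \<one>\<^bsub>cohomology (nerve \<U>) 1\<^esub>) \<in> cls 0" if "open_cover D \<U>" for \<U>
    unfolding one_cohomology [OF down_closed_nerve] in_cls_coset [OF cocycle_zero]
    using that rep_coboundary [OF that coboundary_zero [OF down_closed_nerve]] by blast
  then have sub: "?S \<subseteq> cls 0" by blast
  have "open_cover D {topspace D}" by (simp add: open_cover_def)
  then have "?S \<noteq> {}" by blast
  from cech_rel_Image [OF FL_0 sub this] have "cech_rel 1 D `` ?S = cls 0" .
  then show ?thesis by (simp add: cech_cohomology_def)
qed

lemma cech_pullback_cls:
  assumes s: "line_sym T T'" and \<phi>: "\<phi> \<in> FL"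
    and \<psi>: "\<psi> \<in> FL" "\<And>l. l \<in> L \<Longrightarrow> poly_mapping.lookup \<psi> l = poly_mapping.lookup \<phi> (map_prod T T l)"
  shows "cech_pullback 1 D (\<lambda>P. T ` P) (cls \<phi>) = cls \<psi>"
proof -
  let ?S = "{(\<V>, cohomology_pullback (nerve \<V>) 1 \<tau> a) | \<V> \<tau> \<U> a.
      (\<U>, a) \<in> cls \<phi> \<and> open_cover D \<V> \<and> refines_along (\<lambda>P. T ` P) \<V> \<U> \<tau>}"
  have "(\<V>, cohomology_pullback (nerve \<V>) 1 \<tau> a) \<in> cls \<psi>"
    if a: "(\<U>, a) \<in> cls \<phi>" and \<V>: "open_cover D \<V>" and \<tau>: "refines_along (\<lambda>P. T ` P) \<V> \<U> \<tau>" for \<V> \<tau> \<U> a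
  proof -
    from a obtain c where c: "open_cover D \<U>" "c \<in> Z \<U>" "a = coset (nerve \<U>) c" "rep \<U> c \<phi>" by (rule clsE)
    show ?thesis
      unfolding c(3) cohomology_pullback_coset [OF down_closed_nerve down_closed_nerve simplicial_map_nerve [OF \<tau>]]
        in_cls_coset [OF Z_refine [OF \<tau> c(2)]]
      using \<V> rep_pullback [OF s \<tau> \<V> c(2,4) \<psi>] by blast
  qed
  then have sub: "?S \<subseteq> cls \<psi>" by blast
  have "?S \<noteq> {}"
  proof -
    from cls_nonempty [OF \<phi>] obtain \<U> a where a: "(\<U>, a) \<in> cls \<phi>" by fastforce
    then have "open_cover D \<U>" by (rule clsE)
    from open_cover_preimage [OF s this] show ?thesis using a by blast
  qed
  from cech_rel_Image [OF \<psi>(1) sub this] show ?thesis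
    unfolding cech_pullback_def .
qed

end


section \<open>The decomposition space\<close>

lemma act_inv_prefix:
  "pre \<omega> (length p) = p \<Longrightarrow> act (map inv_letter (rev p)) \<omega> = (\<lambda>k. \<omega> (k + length p))"
proof (induction p arbitrary: \<omega>)
  case (Cons a p)
  then have a: "\<omega> 0 = a" and p: "pre (\<lambda>k. \<omega> (Suc k)) (length p) = p" by (auto simp: pre_Suc_Cons)
  have "act (map inv_letter (rev (a # p))) \<omega> = act (map inv_letter (rev p)) (act1 (inv_letter a) \<omega>)"
    by (simp add: act_def)
  also have "act1 (inv_letter a) \<omega> = (\<lambda>k. \<omega> (Suc k))" by (simp add: act1_def a)
  also have "act (map inv_letter (rev p)) (\<lambda>k. \<omega> (Suc k)) = (\<lambda>k. \<omega> (k + length (a # p)))"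
    using Cons.IH [OF p] by simp
  finally show ?case .
qed simp

lemma pre_act_reduced:
  "reduced (p @ [\<eta> 0]) \<Longrightarrow> pre (act p \<eta>) (Suc (length p)) = p @ [\<eta> 0]"
proof (induction p)
  case Nil
  show ?case by (simp add: pre_Suc)
next
  case (Cons a p)
  have "reduced (p @ [\<eta> 0])" using Cons.prems reduced_appendD(2) [of "[a]" "p @ [\<eta> 0]"] by simp
  from Cons.IH [OF this] have IH: "pre (act p \<eta>) (Suc (length p)) = p @ [\<eta> 0]" .
  then have "act p \<eta> 0 = hd (p @ [\<eta> 0])" by (simp add: pre_Suc_Cons) (metis list.sel(1))
  moreover have "hd (p @ [\<eta> 0]) \<noteq> inv_letter a"
    using Cons.prems by (cases "p @ [\<eta> 0]") (auto simp: reduced_Cons_Cons)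
  ultimately have "act (a # p) \<eta> = case_nat a (act p \<eta>)" by (simp add: act_def act1_def)
  then show ?case using IH by (simp add: pre_case_nat)
qed

text \<open>The inverse of \<open>p\<close> strips \<open>p\<close> from a ray beginning with it.
  Conversely, no letter is cancelled when \<open>p\<close> is put before a ray starting with
  \<open>x\<close>, because \<open>p @ [x]\<close> is reduced. Up to translation the cylinders of
  single letters are thus all cylinders of nonempty words.\<close>

lemma translate_cyl:
  assumes p: "p @ [x] \<in> carrier (FG n)" and \<xi>: "\<xi> \<in> topspace (free_boundary n)"
  shows "\<xi> \<in> cyl n (p @ [x]) \<longleftrightarrow> translate_bpoint n (inv\<^bsub>FG n\<^esub> p) \<xi> \<in> cyl n [x]"
proof -
  from \<xi> obtain \<omega> where \<omega>: "\<omega> \<in> ends n" "\<xi> = pt n \<omega>" by (auto simp: topspace_free_boundary)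
  have pc: "p \<in> carrier (FG n)" using carrier_prefix [OF p] .
  then have ip: "inv\<^bsub>FG n\<^esub> p \<in> carrier (FG n)" by simp
  let ?\<eta> = "act (inv\<^bsub>FG n\<^esub> p) \<omega>"
  have \<eta>: "?\<eta> \<in> ends n" using ip \<omega>(1) by (intro act_ends) (auto simp: carrier_free_group)
  have "pre \<omega> (Suc (length p)) = p @ [x] \<longleftrightarrow> ?\<eta> 0 = x"
  proof
    assume *: "pre \<omega> (Suc (length p)) = p @ [x]"
    then have "pre \<omega> (length p) = p" "\<omega> (length p) = x" by (simp_all add: pre_Suc)
    then show "?\<eta> 0 = x" using act_inv_prefix [of \<omega> p] by (simp add: inv_free_group [OF pc])
  next
    assume "?\<eta> 0 = x"
    then have "pre (act p ?\<eta>) (Suc (length p)) = p @ [x]"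
      using pre_act_reduced [of p ?\<eta>] p by (simp add: carrier_free_group)
    then show "pre \<omega> (Suc (length p)) = p @ [x]" using act_inv_act(2) [OF pc \<omega>(1)] by simp
  qed
  then show ?thesis
    using \<omega> \<eta> ip by (simp add: translate_pt pt_in_cyl pre_Suc)
qed

definition trans_line :: "nat \<Rightarrow> word \<Rightarrow> bpoint \<times> bpoint \<Rightarrow> bpoint \<times> bpoint" where
  "trans_line n g = map_prod (translate_bpoint n g) (translate_bpoint n g)"

lemma finite_carrier_length: "finite {p \<in> carrier (FG n). length p = N}"
proof (rule finite_subset)
  show "{p \<in> carrier (FG n). length p = N} \<subseteq> {xs. set xs \<subseteq> {a. fst a < n} \<and> length xs = N}"
    by (auto simp: carrier_free_group words_iff)
  show "finite {xs. set xs \<subseteq> {a :: letter. fst a < n} \<and> length xs = N}"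
    by (rule finite_lists_length_eq [OF finite_letters])
qed

text \<open>The pattern belongs to the reduced words, whereas the relations are computed from
  \<open>ws\<close> itself.\<close>

locale word_pattern = malnormal_words n "map reduce ws" for n ws +
  assumes ws: "set ws \<subseteq> words n"
begin

abbreviation L :: "(bpoint \<times> bpoint) set" where "L \<equiv> line_pattern n (map reduce ws)"

lemma ws_words: "i < length ws \<Longrightarrow> ws ! i \<in> words n"
  using ws nth_mem by blast

lemma line_cases:
  assumes "l \<in> L"
  obtains g i where "g \<in> carrier (FG n)" "i < length ws" "l = line n g (reduce (ws ! i))"
  using line_patternE [OF assms] by (metis length_map nth_map)

lemma vs_props:
  assumes "i < length ws"
  shows "reduce (ws ! i) \<in> carrier (FG n)" "reduce (ws ! i) \<noteq> []"
  using in_carrier [of i] nontrivial [of i] assms by simp_all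

lemma lines_eq_iff:
  assumes "i < length ws" "j < length ws" "g \<in> carrier (FG n)" "g' \<in> carrier (FG n)"
  shows "line n g (reduce (ws ! i)) = line n g' (reduce (ws ! j)) \<longleftrightarrow>
    i = j \<and> (\<exists>z :: int. g = g' \<otimes>\<^bsub>FG n\<^esub> reduce (ws ! i) [^]\<^bsub>FG n\<^esub> z)"
  using line_eq_iff [of i j g g'] assms by simp

lemma line_in_L: "g \<in> carrier (FG n) \<Longrightarrow> i < length ws \<Longrightarrow> line n g (reduce (ws ! i)) \<in> L"
  using line_in_pattern [of g i] by simp

lemma trans_line_L: "l \<in> L \<Longrightarrow> h \<in> carrier (FG n) \<Longrightarrow> trans_line n h l \<in> L"
  unfolding trans_line_def by (rule line_pattern_translate)

lemma L_topspace': "l \<in> L \<Longrightarrow> fst l \<in> topspace (free_boundary n)" "l \<in> L \<Longrightarrow> snd l \<in> topspace (free_boundary n)"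
  using line_pattern_subset by auto

lemma trans_line_inv:
  assumes "l \<in> L" "h \<in> carrier (FG n)"
  shows "trans_line n h (trans_line n (inv\<^bsub>FG n\<^esub> h) l) = l" "trans_line n (inv\<^bsub>FG n\<^esub> h) (trans_line n h l) = l"
proof -
  have *: "trans_line n a (trans_line n b l) = l"
    if "a \<in> carrier (FG n)" "b \<in> carrier (FG n)" "a \<otimes>\<^bsub>FG n\<^esub> b = \<one>\<^bsub>FG n\<^esub>" for a b
  proof -
    have "translate_bpoint n a (translate_bpoint n b \<xi>) = \<xi>" if "\<xi> \<in> topspace (free_boundary n)" for \<xi>
      using translate_mult [of a n b \<xi>] translate_one [of \<xi> n] that \<open>a \<in> carrier (FG n)\<close> \<open>b \<in> carrier (FG n)\<close>
        \<open>a \<otimes>\<^bsub>FG n\<^esub> b = \<one>\<^bsub>FG n\<^esub>\<close> by (simp add: one_free_group)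
    then show ?thesis using L_topspace' [OF assms(1)] by (simp add: trans_line_def prod_eq_iff)
  qed
  show "trans_line n h (trans_line n (inv\<^bsub>FG n\<^esub> h) l) = l" "trans_line n (inv\<^bsub>FG n\<^esub> h) (trans_line n h l) = l"
    using assms(2) by (intro *; simp)+
qed

text \<open>For a crossing line the sum in \<open>crossing_formula\<close> is nonzero, hence not
  empty. The line therefore comes from an element of the support of one of finitely many Fox
  derivatives.\<close>

lemma finite_crossing_letter:
  "finite {l \<in> L. (fst l \<in> cyl n [x]) \<noteq> (snd l \<in> cyl n [x])}"
proof (rule finite_subset)
  let ?K = "\<lambda>i. Poly_Mapping.keys (eval_sum (fox x (ws ! i)))"
  show "{l \<in> L. (fst l \<in> cyl n [x]) \<noteq> (snd l \<in> cyl n [x])} \<subseteq>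
      (\<Union>i<length ws. (\<lambda>h. line n (inv\<^bsub>FG n\<^esub> h) (reduce (ws ! i))) ` ?K i)"
  proof
    fix l assume "l \<in> {l \<in> L. (fst l \<in> cyl n [x]) \<noteq> (snd l \<in> cyl n [x])}"
    then have l: "l \<in> L" "(fst l \<in> cyl n [x]) \<noteq> (snd l \<in> cyl n [x])" by auto
    from l(1) obtain g i where g: "g \<in> carrier (FG n)" and i: "i < length ws" and leq: "l = line n g (reduce (ws ! i))"
      by (rule line_cases)
    let ?S = "{h. h \<in> ?K i \<and> (\<exists>z :: int. h = inv\<^bsub>FG n\<^esub> (g \<otimes>\<^bsub>FG n\<^esub> reduce (ws ! i) [^]\<^bsub>FG n\<^esub> z))}"
    have "?S \<noteq> {}"
    proof
      assume "?S = {}"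
      then have "(of_bool (fst l \<in> cyl n [x]) :: int) - of_bool (snd l \<in> cyl n [x]) = 0"
        unfolding leq crossing_formula [OF ws_words [OF i] vs_props(2) [OF i] g] by (simp only: sum.empty)
      then show False using l(2) by (auto split: if_splits)
    qed
    then obtain h and z :: int where h: "h \<in> ?K i" "h = inv\<^bsub>FG n\<^esub> (g \<otimes>\<^bsub>FG n\<^esub> reduce (ws ! i) [^]\<^bsub>FG n\<^esub> z)" by blast
    then have "line n (inv\<^bsub>FG n\<^esub> h) (reduce (ws ! i)) = line n (g \<otimes>\<^bsub>FG n\<^esub> reduce (ws ! i) [^]\<^bsub>FG n\<^esub> z) (reduce (ws ! i))"
      using g vs_props [OF i] by simp
    also have "\<dots> = l" unfolding leq by (rule line_shift [OF vs_props [OF i] g])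
    finally show "l \<in> (\<Union>i<length ws. (\<lambda>h. line n (inv\<^bsub>FG n\<^esub> h) (reduce (ws ! i))) ` ?K i)"
      using i h(1) by blast
  qed
qed simp

lemma finite_crossing_cyl:
  assumes "p \<in> carrier (FG n)"
  shows "finite {l \<in> L. (fst l \<in> cyl n p) \<noteq> (snd l \<in> cyl n p)}"
proof (cases p rule: rev_cases)
  case Nil
  then have "{l \<in> L. (fst l \<in> cyl n p) \<noteq> (snd l \<in> cyl n p)} = {}"
    using L_topspace' by (auto simp: cyl_Nil)
  then show ?thesis by (simp only: finite.emptyI)
next
  case (snoc p' x)
  have p': "p' \<in> carrier (FG n)" using carrier_prefix assms snoc by blast
  have "{l \<in> L. (fst l \<in> cyl n p) \<noteq> (snd l \<in> cyl n p)} \<subseteq>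
      trans_line n p' ` {l \<in> L. (fst l \<in> cyl n [x]) \<noteq> (snd l \<in> cyl n [x])}"
  proof
    fix l assume "l \<in> {l \<in> L. (fst l \<in> cyl n p) \<noteq> (snd l \<in> cyl n p)}"
    then have l: "l \<in> L" "(fst l \<in> cyl n p) \<noteq> (snd l \<in> cyl n p)" by auto
    let ?l = "trans_line n (inv\<^bsub>FG n\<^esub> p') l"
    have "?l \<in> L" using trans_line_L [OF l(1)] p' by simp
    moreover have "(fst ?l \<in> cyl n [x]) \<noteq> (snd ?l \<in> cyl n [x])"
      using l(2) translate_cyl [of p' x n "fst l"] translate_cyl [of p' x n "snd l"] assms L_topspace' [OF l(1)]
      by (simp add: snoc trans_line_def)
    moreover have "l = trans_line n p' ?l" using trans_line_inv(1) [OF l(1) p'] by simp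
    ultimately show "l \<in> trans_line n p' ` {l \<in> L. (fst l \<in> cyl n [x]) \<noteq> (snd l \<in> cyl n [x])}" by blast
  qed
  then show ?thesis by (rule finite_subset) (intro finite_imageI finite_crossing_letter)
qed

text \<open>Membership in a clopen set depends on a prefix of fixed length N, so a line crossing the
  set also crosses one of the finitely many cylinders of that length.\<close>

lemma finite_crossing:
  assumes "openin (free_boundary n) A" "closedin (free_boundary n) A"
  shows "finite {l \<in> L. (fst l \<in> A) \<noteq> (snd l \<in> A)}"
proof -
  let ?X = "free_boundary n"
  have "openin ?X {\<xi> \<in> topspace ?X. (\<xi> \<in> A) = c}" for c
  proof -
    have "{\<xi> \<in> topspace ?X. (\<xi> \<in> A) = c} = (if c then A else topspace ?X - A)"
      using openin_subset [OF assms(1)] by auto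
    then show ?thesis using assms by auto
  qed
  from locally_constant_depth [of n "\<lambda>\<xi>. \<xi> \<in> A", OF this] obtain N where
    N: "\<And>\<omega> \<eta>. \<omega> \<in> ends n \<Longrightarrow> \<eta> \<in> ends n \<Longrightarrow> pre \<omega> N = pre \<eta> N \<Longrightarrow> (pt n \<omega> \<in> A) = (pt n \<eta> \<in> A)"
    by blast
  let ?P = "{p \<in> carrier (FG n). length p = N}"
  have "{l \<in> L. (fst l \<in> A) \<noteq> (snd l \<in> A)} \<subseteq> (\<Union>p\<in>?P. {l \<in> L. (fst l \<in> cyl n p) \<noteq> (snd l \<in> cyl n p)})"
  proof
    fix l assume "l \<in> {l \<in> L. (fst l \<in> A) \<noteq> (snd l \<in> A)}"
    then have l: "l \<in> L" "(fst l \<in> A) \<noteq> (snd l \<in> A)" by auto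
    from L_topspace' [OF l(1)] obtain \<omega> \<eta> where \<omega>: "\<omega> \<in> ends n" "fst l = pt n \<omega>" and \<eta>: "\<eta> \<in> ends n" "snd l = pt n \<eta>"
      by (auto simp: topspace_free_boundary)
    have "pre \<omega> N \<noteq> pre \<eta> N" using N [OF \<omega>(1) \<eta>(1)] l(2) \<omega>(2) \<eta>(2) by auto
    then have "fst l \<in> cyl n (pre \<omega> N)" "snd l \<notin> cyl n (pre \<omega> N)"
      using \<omega> \<eta> by (auto simp: pt_in_cyl)
    moreover have "pre \<omega> N \<in> ?P" using ends_pre [OF \<omega>(1)] by simp
    ultimately show "l \<in> (\<Union>p\<in>?P. {l \<in> L. (fst l \<in> cyl n p) \<noteq> (snd l \<in> cyl n p)})" using l(1) by blast
  qed
  moreover have "finite (\<Union>p\<in>?P. {l \<in> L. (fst l \<in> cyl n p) \<noteq> (snd l \<in> cyl n p)})"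
    by (intro finite_UN_I finite_carrier_length finite_crossing_cyl) simp
  ultimately show ?thesis by (rule finite_subset)
qed

sublocale line_space "free_boundary n" "line_pattern n (map reduce ws)"
proof
  show "compact_space (free_boundary n)" by (rule compact_free_boundary)
  show "\<exists>A. openin (free_boundary n) A \<and> closedin (free_boundary n) A \<and> \<xi> \<in> A \<and> A \<subseteq> U"
    if U: "openin (free_boundary n) U" and \<xi>: "\<xi> \<in> U" for U \<xi>
  proof -
    have "\<xi> \<in> topspace (free_boundary n)" using openin_subset [OF U] \<xi> by blast
    then obtain \<omega> where \<omega>: "\<omega> \<in> ends n" "\<xi> = pt n \<omega>" by (auto simp: topspace_free_boundary)
    with openin_free_boundary_cyl [OF U] \<xi> obtain N where sub: "cyl n (pre \<omega> N) \<subseteq> U" by blast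
    have "\<xi> \<in> cyl n (pre \<omega> N)" using \<omega> by (simp add: pt_in_cyl)
    then show ?thesis
      by (intro exI [of _ "cyl n (pre \<omega> N)"] conjI openin_cyl closedin_cyl sub)
  qed
  show "closedin (free_boundary n) {\<xi>}" if "\<xi> \<in> topspace (free_boundary n)" for \<xi>
  proof -
    from that obtain \<omega> where \<omega>: "\<omega> \<in> ends n" "\<xi> = pt n \<omega>" by (auto simp: topspace_free_boundary)
    \<comment> \<open>The cylinders of its prefixes intersect in \<xi> alone, and they are
      closed.\<close>
    have "topspace (free_boundary n) - {\<xi>} = (\<Union>N. topspace (free_boundary n) - cyl n (pre \<omega> N))"
    proof
      show "topspace (free_boundary n) - {\<xi>} \<subseteq> (\<Union>N. topspace (free_boundary n) - cyl n (pre \<omega> N))"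
      proof
        fix \<zeta> assume \<zeta>: "\<zeta> \<in> topspace (free_boundary n) - {\<xi>}"
        then obtain \<eta> where \<eta>: "\<eta> \<in> ends n" "\<zeta> = pt n \<eta>" by (auto simp: topspace_free_boundary)
        then have "\<omega> \<noteq> \<eta>" using \<zeta> \<omega> by auto
        then obtain N where "pre \<eta> N \<noteq> pre \<omega> N" using pre_eqI by metis
        then have "\<zeta> \<notin> cyl n (pre \<omega> N)" using \<eta> by (simp add: pt_in_cyl)
        then show "\<zeta> \<in> (\<Union>N. topspace (free_boundary n) - cyl n (pre \<omega> N))" using \<zeta> by blast
      qed
      have "\<xi> \<in> cyl n (pre \<omega> N)" for N using \<omega> by (simp add: pt_in_cyl)
      then show "(\<Union>N. topspace (free_boundary n) - cyl n (pre \<omega> N)) \<subseteq> topspace (free_boundary n) - {\<xi>}" by blast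
    qed
    moreover have "openin (free_boundary n) (\<Union>N. topspace (free_boundary n) - cyl n (pre \<omega> N))"
      by (intro openin_Union) (auto intro: openin_diff closedin_cyl)
    ultimately show ?thesis using that by (simp add: closedin_def)
  qed
  show "line_pattern n (map reduce ws) \<subseteq> topspace (free_boundary n) \<times> topspace (free_boundary n)"
    by (rule line_pattern_subset)
qed (rule line_pattern_neq line_pattern_disjoint finite_crossing; assumption)+

lemma D_eq: "D = decomposition_space n (map reduce ws)"
  unfolding D_def decomposition_space_def rel_def decomposition_rel_def ..

lemma line_sym_translate:
  assumes "g \<in> carrier (FG n)"
  shows "line_sym (translate_bpoint n g) (translate_bpoint n (inv\<^bsub>FG n\<^esub> g))"
proof -
  have ig: "inv\<^bsub>FG n\<^esub> g \<in> carrier (FG n)" using assms by simp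
  have "translate_bpoint n a (translate_bpoint n b \<xi>) = \<xi>"
    if "\<xi> \<in> topspace (free_boundary n)" "a \<in> carrier (FG n)" "b \<in> carrier (FG n)" "a \<otimes>\<^bsub>FG n\<^esub> b = \<one>\<^bsub>FG n\<^esub>" for \<xi> a b
    using translate_mult [of a n b \<xi>] translate_one [of \<xi> n] that by (simp add: one_free_group)
  then show ?thesis
    unfolding line_sym_def
    using assms ig continuous_map_translate [OF assms] continuous_map_translate [OF ig]
      line_pattern_translate [OF _ assms] line_pattern_translate [OF _ ig] by simp
qed

text \<open>Composition of functions on the lines with translation by \<open>g\<close>. On a single
  line it is translation by the inverse, whence a right action.\<close>

definition ract :: "(bpoint \<times> bpoint \<Rightarrow>\<^sub>0 int) \<Rightarrow> word \<Rightarrow> (bpoint \<times> bpoint \<Rightarrow>\<^sub>0 int)" where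
  "ract \<phi> g = frag_extend (\<lambda>l. frag_of (trans_line n (inv\<^bsub>FG n\<^esub> g) l)) \<phi>"

lemma ract_FL:
  assumes "\<phi> \<in> FL" "g \<in> carrier (FG n)"
  shows "ract \<phi> g \<in> FL"
proof -
  have "trans_line n (inv\<^bsub>FG n\<^esub> g) l \<in> L" if "l \<in> L" for l
    using trans_line_L [OF that] assms(2) by simp
  then show ?thesis
    using assms(1) keys_frag_extend [of "\<lambda>l. frag_of (trans_line n (inv\<^bsub>FG n\<^esub> g) l)" \<phi>]
    unfolding FL_def ract_def keys_frag_of by blast
qed

lemma lookup_ract:
  assumes \<phi>: "\<phi> \<in> FL" and g: "g \<in> carrier (FG n)" and l: "l \<in> L"
  shows "poly_mapping.lookup (ract \<phi> g) l = poly_mapping.lookup \<phi> (trans_line n g l)"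
proof -
  have "Poly_Mapping.keys \<phi> \<subseteq> L" using \<phi> by (simp add: FL_def)
  then show ?thesis
  proof (induction \<phi> rule: frag_induction)
    case zero
    show ?case by (simp add: ract_def)
  next
    case (one k)
    have "l = trans_line n (inv\<^bsub>FG n\<^esub> g) k \<longleftrightarrow> trans_line n g l = k"
      using trans_line_inv(1) [OF one g] trans_line_inv(2) [OF l g] by metis
    then show ?case by (simp add: ract_def)
  next
    case (diff \<phi> \<psi>)
    then show ?case by (simp add: ract_def frag_extend_diff lookup_minus)
  qed
qed

lemma cech_pullback_translate:
  assumes "\<phi> \<in> FL" "g \<in> carrier (FG n)"
  shows "cech_pullback 1 D (translate n g) (cls \<phi>) = cls (ract \<phi> g)"
proof -
  have "translate n g = (\<lambda>P. translate_bpoint n g ` P)" by (simp add: translate_def fun_eq_iff)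
  then show ?thesis
    using cech_pullback_cls [OF line_sym_translate [OF assms(2)] assms(1) ract_FL [OF assms]]
      lookup_ract [OF assms] by (simp add: trans_line_def)
qed

definition smul :: "(bpoint \<times> bpoint \<Rightarrow>\<^sub>0 int) \<Rightarrow> (word \<Rightarrow>\<^sub>0 int) \<Rightarrow> (bpoint \<times> bpoint \<Rightarrow>\<^sub>0 int)" where
  "smul \<phi> a = frag_extend (ract \<phi>) a"

end


section \<open>Vectors over the group ring\<close>

abbreviation gmul :: "nat \<Rightarrow> (word \<Rightarrow>\<^sub>0 int) \<Rightarrow> (word \<Rightarrow>\<^sub>0 int) \<Rightarrow> (word \<Rightarrow>\<^sub>0 int)" where
  "gmul n y a \<equiv> y \<otimes>\<^bsub>group_ring (FG n)\<^esub> a"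

lemma gmul_def: "gmul n y a = frag_extend (\<lambda>g. frag_extend (\<lambda>h. frag_of (g \<otimes>\<^bsub>FG n\<^esub> h)) a) y"
  and carrier_group_ring: "a \<in> carrier (group_ring (FG n)) \<longleftrightarrow> Poly_Mapping.keys a \<subseteq> carrier (FG n)"
  by (simp_all add: group_ring_def)

lemma keys_frag_extend_subset:
  "(\<And>x. x \<in> Poly_Mapping.keys c \<Longrightarrow> Poly_Mapping.keys (f x) \<subseteq> S) \<Longrightarrow> Poly_Mapping.keys (frag_extend f c) \<subseteq> S"
  by (rule subset_trans [OF keys_frag_extend UN_least])

lemma gmul_keys:
  assumes "Poly_Mapping.keys y \<subseteq> carrier (FG n)" "Poly_Mapping.keys a \<subseteq> carrier (FG n)"
  shows "Poly_Mapping.keys (gmul n y a) \<subseteq> carrier (FG n)"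
  unfolding gmul_def
proof (intro keys_frag_extend_subset)
  fix g h assume "g \<in> Poly_Mapping.keys y" "h \<in> Poly_Mapping.keys a"
  then have "g \<in> carrier (FG n)" "h \<in> carrier (FG n)" using assms by blast+
  then show "Poly_Mapping.keys (frag_of (g \<otimes>\<^bsub>FG n\<^esub> h)) \<subseteq> carrier (FG n)" by (simp add: keys_frag_of)
qed

lemma gmul_diff_left: "gmul n (x - y) a = gmul n x a - gmul n y a"
  and gmul_0_left: "gmul n 0 a = 0"
  and gmul_of_of: "gmul n (frag_of g) (frag_of h) = frag_of (g \<otimes>\<^bsub>FG n\<^esub> h)"
  by (simp_all add: gmul_def frag_extend_diff)

lemma frag_extend_fun_diff: "frag_extend (\<lambda>x. f x - h x) a = frag_extend f a - frag_extend h a"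
proof -
  have "Poly_Mapping.keys a \<subseteq> UNIV" by simp
  then show ?thesis by (induction a rule: frag_induction) (auto simp: frag_extend_diff)
qed

abbreviation FM :: "nat \<Rightarrow> nat \<Rightarrow> (word \<Rightarrow>\<^sub>0 int, nat \<Rightarrow> word \<Rightarrow>\<^sub>0 int) right_module" where
  "FM n k \<equiv> free_right_module (group_ring (FG n)) k"

lemma carrier_FM: "carrier (FM n k) = {..<k} \<rightarrow>\<^sub>E {a. Poly_Mapping.keys a \<subseteq> carrier (FG n)}"
  and add_FM: "x \<oplus>\<^bsub>FM n k\<^esub> y = (\<lambda>i\<in>{..<k}. x i + y i)"
  and zero_FM: "\<zero>\<^bsub>FM n k\<^esub> = (\<lambda>i\<in>{..<k}. 0)"
  and rsmult_FM: "x \<odot>\<^sub>r\<^bsub>FM n k\<^esub> a = (\<lambda>i\<in>{..<k}. gmul n (x i) a)"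
  by (simp_all add: free_right_module_def group_ring_def)

lemma restrict_in_FM: "(\<lambda>i\<in>{..<k}. x i) \<in> carrier (FM n k) \<longleftrightarrow> (\<forall>i<k. Poly_Mapping.keys (x i) \<subseteq> carrier (FG n))"
  by (auto simp: carrier_FM PiE_iff)

lemma in_FM_restrict: "x \<in> carrier (FM n k) \<Longrightarrow> (\<lambda>i\<in>{..<k}. x i) = x"
  by (auto simp: carrier_FM PiE_iff extensional_def fun_eq_iff)

lemma in_FM_keys: "x \<in> carrier (FM n k) \<Longrightarrow> i < k \<Longrightarrow> Poly_Mapping.keys (x i) \<subseteq> carrier (FG n)"
  by (auto simp: carrier_FM PiE_iff)

lemma keys_add_subset: "Poly_Mapping.keys x \<subseteq> S \<Longrightarrow> Poly_Mapping.keys y \<subseteq> S \<Longrightarrow> Poly_Mapping.keys (x + y) \<subseteq> S"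
  and keys_diff_subset: "Poly_Mapping.keys x \<subseteq> S \<Longrightarrow> Poly_Mapping.keys (y :: _ \<Rightarrow>\<^sub>0 int) \<subseteq> S \<Longrightarrow> Poly_Mapping.keys (x - y) \<subseteq> S"
  using keys_add [of x y] keys_diff [of x y] by auto

lemma group_FM: "group (add_monoid (FM n k))"
proof (rule groupI)
  fix x y z assume "x \<in> carrier (add_monoid (FM n k))" "y \<in> carrier (add_monoid (FM n k))" "z \<in> carrier (add_monoid (FM n k))"
  then show "x \<otimes>\<^bsub>add_monoid (FM n k)\<^esub> y \<otimes>\<^bsub>add_monoid (FM n k)\<^esub> z =
      x \<otimes>\<^bsub>add_monoid (FM n k)\<^esub> (y \<otimes>\<^bsub>add_monoid (FM n k)\<^esub> z)"
    by (auto simp: add_FM fun_eq_iff add.assoc)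
next
  fix x y assume xy: "x \<in> carrier (add_monoid (FM n k))" "y \<in> carrier (add_monoid (FM n k))"
  show "x \<otimes>\<^bsub>add_monoid (FM n k)\<^esub> y \<in> carrier (add_monoid (FM n k))"
    using xy in_FM_keys keys_add_subset unfolding monoid.simps partial_object.simps add_FM restrict_in_FM by metis
next
  show "\<one>\<^bsub>add_monoid (FM n k)\<^esub> \<in> carrier (add_monoid (FM n k))"
    by (simp add: zero_FM restrict_in_FM)
next
  fix x assume x: "x \<in> carrier (add_monoid (FM n k))"
  have "(\<lambda>i\<in>{..<k}. (\<lambda>i\<in>{..<k}. 0) i + x i) = (\<lambda>i\<in>{..<k}. x i)" by (auto simp: fun_eq_iff)
  with x show "\<one>\<^bsub>add_monoid (FM n k)\<^esub> \<otimes>\<^bsub>add_monoid (FM n k)\<^esub> x = x"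
    using in_FM_restrict [of x n k] by (simp add: add_FM zero_FM)
  let ?y = "\<lambda>i\<in>{..<k}. - x i"
  have "?y \<in> carrier (add_monoid (FM n k))" using x by (simp add: restrict_in_FM in_FM_keys)
  moreover have "?y \<otimes>\<^bsub>add_monoid (FM n k)\<^esub> x = \<one>\<^bsub>add_monoid (FM n k)\<^esub>"
    by (auto simp: add_FM zero_FM fun_eq_iff)
  ultimately show "\<exists>y\<in>carrier (add_monoid (FM n k)). y \<otimes>\<^bsub>add_monoid (FM n k)\<^esub> x = \<one>\<^bsub>add_monoid (FM n k)\<^esub>"
    by blast
qed

lemma inv_FM:
  assumes "x \<in> carrier (FM n k)"
  shows "inv\<^bsub>add_monoid (FM n k)\<^esub> x = (\<lambda>i\<in>{..<k}. - x i)"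
proof (rule group.inv_equality [OF group_FM])
  show "(\<lambda>i\<in>{..<k}. - x i) \<otimes>\<^bsub>add_monoid (FM n k)\<^esub> x = \<one>\<^bsub>add_monoid (FM n k)\<^esub>"
    by (auto simp: add_FM zero_FM fun_eq_iff)
  show "(\<lambda>i\<in>{..<k}. - x i) \<in> carrier (add_monoid (FM n k))"
    using assms by (simp add: restrict_in_FM in_FM_keys)
qed (use assms in simp)

lemma right_submodule_FM_iff:
  "right_submodule (group_ring (FG n)) (FM n k) T \<longleftrightarrow>
    T \<subseteq> carrier (FM n k) \<and> (\<lambda>i\<in>{..<k}. 0) \<in> T \<and>
    (\<forall>x\<in>T. \<forall>y\<in>T. (\<lambda>i\<in>{..<k}. x i - y i) \<in> T) \<and>
    (\<forall>x\<in>T. \<forall>a. Poly_Mapping.keys a \<subseteq> carrier (FG n) \<longrightarrow> (\<lambda>i\<in>{..<k}. gmul n (x i) a) \<in> T)"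
  (is "?L \<longleftrightarrow> ?R")
proof
  assume ?L
  then have sg: "subgroup T (add_monoid (FM n k))"
    and act: "\<forall>x\<in>T. \<forall>a. Poly_Mapping.keys a \<subseteq> carrier (FG n) \<longrightarrow> (\<lambda>i\<in>{..<k}. gmul n (x i) a) \<in> T"
    by (auto simp: right_submodule_def additive_subgroup_def rsmult_FM carrier_group_ring)
  have sub: "T \<subseteq> carrier (FM n k)" using subgroup.subset [OF sg] by simp
  have zero: "(\<lambda>i\<in>{..<k}. 0) \<in> T" using subgroup.one_closed [OF sg] by (simp add: zero_FM)
  have "(\<lambda>i\<in>{..<k}. x i - y i) \<in> T" if "x \<in> T" "y \<in> T" for x y
  proof -
    have "x \<otimes>\<^bsub>add_monoid (FM n k)\<^esub> inv\<^bsub>add_monoid (FM n k)\<^esub> y \<in> T"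
      using that by (intro subgroup.m_closed [OF sg] subgroup.m_inv_closed [OF sg])
    moreover have "x \<otimes>\<^bsub>add_monoid (FM n k)\<^esub> inv\<^bsub>add_monoid (FM n k)\<^esub> y = (\<lambda>i\<in>{..<k}. x i - y i)"
      using inv_FM [of y n k] sub that by (auto simp: add_FM fun_eq_iff)
    ultimately show ?thesis by simp
  qed
  then show ?R using sub zero act by blast
next
  assume R: ?R
  have neg: "(\<lambda>i\<in>{..<k}. - x i) \<in> T" if "x \<in> T" for x
  proof -
    have "(\<lambda>i\<in>{..<k}. (\<lambda>i\<in>{..<k}. 0) i - x i) \<in> T" using R that by blast
    moreover have "(\<lambda>i\<in>{..<k}. (\<lambda>i\<in>{..<k}. 0) i - x i) = (\<lambda>i\<in>{..<k}. - x i)" by (auto simp: fun_eq_iff)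
    ultimately show ?thesis by simp
  qed
  have "subgroup T (add_monoid (FM n k))"
  proof (rule group.subgroupI [OF group_FM])
    show "T \<subseteq> carrier (add_monoid (FM n k))" using R by simp
    show "T \<noteq> {}" using R by blast
    show "inv\<^bsub>add_monoid (FM n k)\<^esub> x \<in> T" if "x \<in> T" for x
      using neg [OF that] inv_FM [of x n k] R that by auto
    show "x \<otimes>\<^bsub>add_monoid (FM n k)\<^esub> y \<in> T" if "x \<in> T" "y \<in> T" for x y
    proof -
      have "(\<lambda>i\<in>{..<k}. x i - (\<lambda>i\<in>{..<k}. - y i) i) \<in> T" using R that neg by blast
      moreover have "(\<lambda>i\<in>{..<k}. x i - (\<lambda>i\<in>{..<k}. - y i) i) = (\<lambda>i\<in>{..<k}. x i + y i)" by (auto simp: fun_eq_iff)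
      ultimately show ?thesis by (simp add: add_FM)
    qed
  qed
  then show ?L
    using R by (auto simp: right_submodule_def additive_subgroup_def rsmult_FM carrier_group_ring)
qed

lemma eval_sum_keys: "snd ` set s \<subseteq> words n \<Longrightarrow> Poly_Mapping.keys (eval_sum s) \<subseteq> carrier (FG n)"
proof (induction s)
  case (Cons p s)
  then have "Poly_Mapping.keys (frag_cmul (fst p) (frag_of (reduce (snd p)))) \<subseteq> carrier (FG n)"
    using keys_cmul [of "fst p" "frag_of (reduce (snd p))"] by (auto simp: keys_frag_of intro: reduce_in_carrier)
  then show ?case using Cons by (simp add: eval_sum_Cons keys_add_subset)
qed simp

lemma fox_words: "w \<in> words n \<Longrightarrow> snd ` set (fox x w) \<subseteq> words n"
proof (induction w rule: rev_induct)
  case (snoc y w)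
  then show ?case by (auto simp: fox_snoc fox_step_def split: if_splits)
qed (simp add: fox_Nil)

lemma h1_relations_cases:
  assumes "v \<in> set (h1_relations n ws)"
  obtains (diag) i where "i < length ws"
      "v = map (\<lambda>p. if fst p = i then [(1, snd p), (-1, [])] else []) (List.enumerate 0 ws)"
    | (fox) x where "v = map (fox x) ws"
  using assms unfolding h1_relations_def set_append set_map Un_iff image_iff by auto

lemma h1_relations_words:
  assumes "set ws \<subseteq> words n" "v \<in> set (h1_relations n ws)"
  shows "length v = length ws" "s \<in> set v \<Longrightarrow> snd ` set s \<subseteq> words n"
proof -
  have e: "snd p \<in> words n" if "p \<in> set (List.enumerate 0 ws)" for p
  proof -
    from that have "fst p < length ws" "snd p = ws ! fst p" by (auto simp: in_set_enumerate_eq)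
    then have "snd p \<in> set ws" by simp
    then show ?thesis using assms(1) by blast
  qed
  show "length v = length ws" using assms(2) by (auto simp: h1_relations_def)
  show "snd ` set s \<subseteq> words n" if s: "s \<in> set v"
    using assms(2)
  proof (cases rule: h1_relations_cases)
    case (diag i)
    with s obtain p where p: "p \<in> set (List.enumerate 0 ws)"
      and "s = (if fst p = i then [(1, snd p), (-1, [])] else [])" by auto
    then show ?thesis using e [OF p] by (auto split: if_splits)
  next
    case (fox x)
    with s obtain w where "w \<in> set ws" "s = fox x w" by auto
    then show ?thesis using fox_words assms(1) by blast
  qed
qed

context word_pattern
begin

abbreviation k :: nat where "k \<equiv> length ws"

text \<open>The inverse turns right multiplication in the group ring into \<open>ract\<close>;
  without it \<open>ract_line\<close> would fail.\<close>

definition base_line :: "nat \<Rightarrow> word \<Rightarrow> (bpoint \<times> bpoint \<Rightarrow>\<^sub>0 int)" where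
  "base_line i h = frag_of (line n (inv\<^bsub>FG n\<^esub> h) (reduce (ws ! i)))"

text \<open>The homomorphism from the free right module onto the free abelian group on the lines
  that sends the i-th basis vector to the axis of the i-th word.\<close>

definition Th :: "(nat \<Rightarrow> word \<Rightarrow>\<^sub>0 int) \<Rightarrow> (bpoint \<times> bpoint \<Rightarrow>\<^sub>0 int)" where
  "Th v = (\<Sum>i<k. frag_extend (base_line i) (v i))"

lemma Th_cong: "(\<And>i. i < k \<Longrightarrow> x i = y i) \<Longrightarrow> Th x = Th y"
  by (simp add: Th_def)

lemma Th_restrict: "Th (\<lambda>i\<in>{..<k}. x i) = Th x"
  by (rule Th_cong) simp

lemma Th_diff: "Th (\<lambda>i. x i - y i) = Th x - Th y"
  and Th_add: "Th (\<lambda>i. x i + y i) = Th x + Th y"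
  and Th_zero: "Th (\<lambda>i. 0) = 0"
  by (simp_all add: Th_def frag_extend_diff frag_extend_add sum_subtractf sum.distrib)

lemma Th_single: "i < k \<Longrightarrow> Th (\<lambda>j. if j = i then y else 0) = frag_extend (base_line i) y"
proof -
  assume i: "i < k"
  have "frag_extend (base_line j) (if j = i then y else 0) = (if j = i then frag_extend (base_line i) y else 0)" for j by simp
  then show ?thesis using i by (simp add: Th_def)
qed

lemma FL_sum: "finite I \<Longrightarrow> (\<And>i. i \<in> I \<Longrightarrow> \<phi> i \<in> FL) \<Longrightarrow> (\<Sum>i\<in>I. \<phi> i) \<in> FL"
  by (induction I rule: finite_induct) (auto simp: FL_0 FL_add)

lemma base_line_FL: "i < k \<Longrightarrow> Poly_Mapping.keys y \<subseteq> carrier (FG n) \<Longrightarrow> frag_extend (base_line i) y \<in> FL"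
proof -
  assume i: "i < k" and y: "Poly_Mapping.keys y \<subseteq> carrier (FG n)"
  have "Poly_Mapping.keys (base_line i h) \<subseteq> L" if "h \<in> carrier (FG n)" for h
    using line_in_L [OF _ i, of "inv\<^bsub>FG n\<^esub> h"] that by (simp add: base_line_def keys_frag_of)
  then have "Poly_Mapping.keys (frag_extend (base_line i) y) \<subseteq> L"
    using y by (intro keys_frag_extend_subset) blast
  then show ?thesis by (simp add: FL_def)
qed

lemma Th_FL: "(\<And>i. i < k \<Longrightarrow> Poly_Mapping.keys (v i) \<subseteq> carrier (FG n)) \<Longrightarrow> Th v \<in> FL"
  unfolding Th_def by (intro FL_sum base_line_FL) auto

lemma Th_surj:
  assumes "\<phi> \<in> FL"
  shows "\<exists>v. (\<forall>i<k. Poly_Mapping.keys (v i) \<subseteq> carrier (FG n)) \<and> Th v = \<phi>"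
proof -
  have "Poly_Mapping.keys \<phi> \<subseteq> L" using assms by (simp add: FL_def)
  then show ?thesis
  proof (induction \<phi> rule: frag_induction)
    case zero
    show ?case by (rule exI [of _ "\<lambda>_. 0"]) (simp add: Th_zero)
  next
    case (one l)
    then obtain g i where g: "g \<in> carrier (FG n)" "i < k" "l = line n g (reduce (ws ! i))" by (rule line_cases)
    show ?case
      by (rule exI [of _ "\<lambda>j. if j = i then frag_of (inv\<^bsub>FG n\<^esub> g) else 0"])
        (use g in \<open>simp add: Th_single base_line_def keys_frag_of\<close>)
  next
    case (diff \<phi> \<psi>)
    then obtain v w where "\<forall>i<k. Poly_Mapping.keys (v i) \<subseteq> carrier (FG n)" "Th v = \<phi>"
      "\<forall>i<k. Poly_Mapping.keys (w i) \<subseteq> carrier (FG n)" "Th w = \<psi>" by blast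
    then show ?case by (intro exI [of _ "\<lambda>i. v i - w i"]) (simp add: Th_diff keys_diff_subset)
  qed
qed

lemma ract_line:
  assumes "g \<in> carrier (FG n)" "h \<in> carrier (FG n)" "i < k"
  shows "ract (base_line i g) h = base_line i (g \<otimes>\<^bsub>FG n\<^esub> h)"
  using assms translate_line [of "reduce (ws ! i)" n "inv\<^bsub>FG n\<^esub> g" "inv\<^bsub>FG n\<^esub> h"] vs_props [of i]
  by (simp add: ract_def base_line_def trans_line_def fg.inv_mult_group)

lemma smul_diff_left: "smul (\<phi> - \<psi>) a = smul \<phi> a - smul \<psi> a"
proof -
  have "ract (\<phi> - \<psi>) = (\<lambda>g. ract \<phi> g - ract \<psi> g)" by (simp add: ract_def frag_extend_diff fun_eq_iff)
  then show ?thesis by (simp add: smul_def frag_extend_fun_diff)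
qed

lemma smul_0_left: "smul 0 a = 0"
  using smul_diff_left [of 0 0 a] by simp

lemma smul_add_left: "smul (\<phi> + \<psi>) a = smul \<phi> a + smul \<psi> a"
  using smul_diff_left [of "\<phi> + \<psi>" \<psi> a] by simp

lemma frag_extend_base_line_gmul:
  assumes i: "i < k" and y: "Poly_Mapping.keys y \<subseteq> carrier (FG n)" and a: "Poly_Mapping.keys a \<subseteq> carrier (FG n)"
  shows "frag_extend (base_line i) (gmul n y a) = smul (frag_extend (base_line i) y) a"
  using y
proof (induction y rule: frag_induction)
  case zero
  show ?case by (simp add: gmul_0_left smul_0_left)
next
  case (one g)
  have "frag_extend (base_line i) (gmul n (frag_of g) a) = frag_extend (\<lambda>h. base_line i (g \<otimes>\<^bsub>FG n\<^esub> h)) a"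
    using frag_extend_compose [of "base_line i" "\<lambda>h. g \<otimes>\<^bsub>FG n\<^esub> h" a] by (simp add: gmul_def comp_def)
  also have "\<dots> = frag_extend (ract (base_line i g)) a"
    using a one i by (intro frag_extend_eq) (auto simp: ract_line)
  finally show ?case by (simp add: smul_def)
next
  case (diff y z)
  then show ?case by (simp add: gmul_diff_left frag_extend_diff smul_diff_left)
qed

lemma Th_gmul:
  assumes x: "\<And>i. i < k \<Longrightarrow> Poly_Mapping.keys (x i) \<subseteq> carrier (FG n)" and a: "Poly_Mapping.keys a \<subseteq> carrier (FG n)"
  shows "Th (\<lambda>i. gmul n (x i) a) = smul (Th x) a"
proof -
  have "Th (\<lambda>i. gmul n (x i) a) = (\<Sum>i<k. smul (frag_extend (base_line i) (x i)) a)"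
    unfolding Th_def by (intro sum.cong refl frag_extend_base_line_gmul x a) simp_all
  also have "(\<Sum>i<m. smul (frag_extend (base_line i) (x i)) a) = smul (\<Sum>i<m. frag_extend (base_line i) (x i)) a" for m
    by (induction m) (simp_all add: smul_0_left smul_add_left)
  finally show ?thesis by (simp add: Th_def)
qed

lemma bdry_ract:
  assumes "bdry \<phi>" "g \<in> carrier (FG n)"
  shows "bdry (ract \<phi> g)"
proof -
  from assms(1) obtain f where f: "lc f" "\<And>l. l \<in> L \<Longrightarrow> poly_mapping.lookup \<phi> l = f (fst l) - f (snd l)"
    unfolding bdry_def by blast
  show ?thesis
  proof (rule bdryI [OF ract_FL [OF bdry_FL [OF assms(1)] assms(2)] lc_compose [OF f(1) continuous_map_translate [OF assms(2)]]])
    fix l assume l: "l \<in> L"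
    show "poly_mapping.lookup (ract \<phi> g) l = f (translate_bpoint n g (fst l)) - f (translate_bpoint n g (snd l))"
      using lookup_ract [OF bdry_FL [OF assms(1)] assms(2) l] f(2) [OF trans_line_L [OF l assms(2)]]
      by (simp add: trans_line_def)
  qed
qed

lemma bdry_smul:
  assumes "bdry \<phi>" "Poly_Mapping.keys a \<subseteq> carrier (FG n)"
  shows "bdry (smul \<phi> a)"
  using assms(2)
  by (induction a rule: frag_induction) (auto simp: smul_def frag_extend_diff bdry_0 bdry_diff bdry_ract assms(1))

lemma lookup_frag_extend_base_line:
  "poly_mapping.lookup (frag_extend (base_line i) y) l =
    (\<Sum>h | h \<in> Poly_Mapping.keys y \<and> l = line n (inv\<^bsub>FG n\<^esub> h) (reduce (ws ! i)). poly_mapping.lookup y h)"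
proof -
  have "poly_mapping.lookup (frag_extend (base_line i) y) l =
      (\<Sum>h\<in>Poly_Mapping.keys y. if l = line n (inv\<^bsub>FG n\<^esub> h) (reduce (ws ! i)) then poly_mapping.lookup y h else 0)"
    unfolding frag_extend_def lookup_sum by (intro sum.cong refl) (simp add: base_line_def)
  then show ?thesis by (simp add: sum.If_cases Int_def)
qed

text \<open>A basis vector with coordinate \<open>i\<close> and element \<open>h\<close> maps to
  \<open>l\<close> only if \<open>i = j\<close> and the inverse of \<open>h\<close> lies in the
  coset of \<open>g\<close>. The coefficient at \<open>l\<close> is therefore the coset sum of
  \<open>crossing_formula\<close>.\<close>

lemma Th_fox_lookup:
  assumes l: "l \<in> L"
  shows "poly_mapping.lookup (Th (\<lambda>i. eval_sum (fox x (ws ! i)))) l =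
    of_bool (fst l \<in> cyl n [x]) - of_bool (snd l \<in> cyl n [x])"
proof -
  from l obtain g j where g: "g \<in> carrier (FG n)" and j: "j < k" and leq: "l = line n g (reduce (ws ! j))"
    by (rule line_cases)
  let ?y = "\<lambda>i. eval_sum (fox x (ws ! i))"
  have keys: "Poly_Mapping.keys (?y i) \<subseteq> carrier (FG n)" if "i < k" for i
    using that by (intro eval_sum_keys fox_words ws_words)
  have iff: "l = line n (inv\<^bsub>FG n\<^esub> h) (reduce (ws ! i)) \<longleftrightarrow>
      i = j \<and> (\<exists>z :: int. h = inv\<^bsub>FG n\<^esub> (g \<otimes>\<^bsub>FG n\<^esub> reduce (ws ! j) [^]\<^bsub>FG n\<^esub> z))"
    if i: "i < k" and h: "h \<in> Poly_Mapping.keys (?y i)" for i h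
  proof -
    have hc: "h \<in> carrier (FG n)" using keys [OF i] h by blast
    have "inv\<^bsub>FG n\<^esub> h = a \<longleftrightarrow> h = inv\<^bsub>FG n\<^esub> a" if "a \<in> carrier (FG n)" for a
      using hc that by auto
    then have "inv\<^bsub>FG n\<^esub> h = g \<otimes>\<^bsub>FG n\<^esub> reduce (ws ! j) [^]\<^bsub>FG n\<^esub> z \<longleftrightarrow>
        h = inv\<^bsub>FG n\<^esub> (g \<otimes>\<^bsub>FG n\<^esub> reduce (ws ! j) [^]\<^bsub>FG n\<^esub> z)" for z :: int
      using g vs_props [OF j] by simp
    then show ?thesis
      using lines_eq_iff [OF i j fg.inv_closed [OF hc] g] unfolding leq by (auto simp: eq_commute)
  qed
  have "poly_mapping.lookup (frag_extend (base_line i) (?y i)) l = (if i = j then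
      (\<Sum>h | h \<in> Poly_Mapping.keys (?y j) \<and> (\<exists>z :: int. h = inv\<^bsub>FG n\<^esub> (g \<otimes>\<^bsub>FG n\<^esub> reduce (ws ! j) [^]\<^bsub>FG n\<^esub> z)).
        poly_mapping.lookup (?y j) h) else 0)" if i: "i < k" for i
  proof -
    have "{h. h \<in> Poly_Mapping.keys (?y i) \<and> l = line n (inv\<^bsub>FG n\<^esub> h) (reduce (ws ! i))} =
      (if i = j then {h. h \<in> Poly_Mapping.keys (?y j) \<and> (\<exists>z :: int. h = inv\<^bsub>FG n\<^esub> (g \<otimes>\<^bsub>FG n\<^esub> reduce (ws ! j) [^]\<^bsub>FG n\<^esub> z))} else {})"
      using iff [OF i] by auto
    then show ?thesis unfolding lookup_frag_extend_base_line by (simp split: if_splits)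
  qed
  then have "poly_mapping.lookup (Th ?y) l =
      (\<Sum>h | h \<in> Poly_Mapping.keys (?y j) \<and> (\<exists>z :: int. h = inv\<^bsub>FG n\<^esub> (g \<otimes>\<^bsub>FG n\<^esub> reduce (ws ! j) [^]\<^bsub>FG n\<^esub> z)).
        poly_mapping.lookup (?y j) h)"
    using j by (simp add: Th_def lookup_sum)
  also have "\<dots> = of_bool (fst l \<in> cyl n [x]) - of_bool (snd l \<in> cyl n [x])"
    unfolding leq by (rule crossing_formula [OF ws_words [OF j] vs_props(2) [OF j] g, symmetric])
  finally show ?thesis .
qed

section \<open>The relations generate all jump vectors\<close>

definition N :: "(nat \<Rightarrow> word \<Rightarrow>\<^sub>0 int) set" where
  "N = generated_submodule (group_ring (FG n)) (FM n k) (eval_vector ` set (h1_relations n ws))"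

text \<open>Membership of the truncated function, so that coordinates can be computed on arbitrary
  functions without restricting at every step.\<close>

definition inN :: "(nat \<Rightarrow> word \<Rightarrow>\<^sub>0 int) \<Rightarrow> bool" where
  "inN x \<longleftrightarrow> (\<lambda>i\<in>{..<k}. x i) \<in> N"

text \<open>The vectors that vanish in cohomology. It contains the relations, and
  \<open>N_iff\<close> shows that it is no larger than \<open>N\<close>.\<close>

definition B :: "(nat \<Rightarrow> word \<Rightarrow>\<^sub>0 int) set" where
  "B = {v \<in> carrier (FM n k). bdry (Th v)}"

lemma right_submodule_B: "right_submodule (group_ring (FG n)) (FM n k) B"
  unfolding right_submodule_FM_iff
proof (intro conjI ballI allI impI)
  show "B \<subseteq> carrier (FM n k)" by (auto simp: B_def)
  show "(\<lambda>i\<in>{..<k}. 0) \<in> B" by (simp add: B_def restrict_in_FM Th_restrict Th_zero bdry_0)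
  show "(\<lambda>i\<in>{..<k}. x i - y i) \<in> B" if "x \<in> B" "y \<in> B" for x y
    using that in_FM_keys [of x n k] in_FM_keys [of y n k]
    by (simp add: B_def restrict_in_FM Th_restrict Th_diff bdry_diff keys_diff_subset)
  show "(\<lambda>i\<in>{..<k}. gmul n (x i) a) \<in> B" if "x \<in> B" "Poly_Mapping.keys a \<subseteq> carrier (FG n)" for x a
    using that in_FM_keys [of x n k]
    by (simp add: B_def restrict_in_FM Th_restrict Th_gmul bdry_smul gmul_keys)
qed

lemma eval_vector_restrict: "length v = k \<Longrightarrow> eval_vector v = (\<lambda>i\<in>{..<k}. eval_sum (v ! i))"
  by (simp add: eval_vector_def)

lemma relations_in_B: "eval_vector ` set (h1_relations n ws) \<subseteq> B"
proof
  fix y assume "y \<in> eval_vector ` set (h1_relations n ws)"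
  then obtain v where v: "v \<in> set (h1_relations n ws)" and y: "y = eval_vector v" by blast
  note vw = h1_relations_words [OF ws v]
  have y': "y = (\<lambda>i\<in>{..<k}. eval_sum (v ! i))" unfolding y by (rule eval_vector_restrict [OF vw(1)])
  have "y \<in> carrier (FM n k)"
    unfolding y' restrict_in_FM using vw by (simp add: eval_sum_keys)
  moreover have "bdry (Th (\<lambda>i. eval_sum (v ! i)))"
  proof -
    show ?thesis
      using v
    proof (cases rule: h1_relations_cases)
      case (diag i)
      have "eval_sum (v ! j) = (if j = i then frag_of (reduce (ws ! i)) - frag_of [] else 0)" if "j < k" for j
        using that by (simp add: diag nth_enumerate_eq eval_sum_Cons)
      then have "Th (\<lambda>i. eval_sum (v ! i)) = Th (\<lambda>j. if j = i then frag_of (reduce (ws ! i)) - frag_of [] else 0)"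
        by (intro Th_cong)
      also have "\<dots> = base_line i (reduce (ws ! i)) - base_line i []"
        using diag(1) by (simp add: Th_single frag_extend_diff)
      also have "\<dots> = 0"
      proof -
        \<comment> \<open>Moving the base point by one period leaves the axis fixed; this is the
          relation w_i - 1.\<close>
        have "line n (\<one>\<^bsub>FG n\<^esub> \<otimes>\<^bsub>FG n\<^esub> reduce (ws ! i) [^]\<^bsub>FG n\<^esub> (-1 :: int)) (reduce (ws ! i)) = line n \<one>\<^bsub>FG n\<^esub> (reduce (ws ! i))"
          using vs_props [OF diag(1)] by (intro line_shift) auto
        moreover have "inv\<^bsub>FG n\<^esub> [] = \<one>\<^bsub>FG n\<^esub>" using fg.inv_one [of n] by (simp add: one_free_group)
        ultimately show ?thesis using vs_props [OF diag(1)] by (simp add: base_line_def fg.int_pow_neg)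
      qed
      finally show ?thesis by (simp add: bdry_0)
    next
      case (fox x)
      have "Th (\<lambda>i. eval_sum (v ! i)) = Th (\<lambda>i. eval_sum (fox x (ws ! i)))"
        by (rule Th_cong) (simp add: fox)
      moreover have "Th (\<lambda>i. eval_sum (fox x (ws ! i))) \<in> FL"
        by (intro Th_FL eval_sum_keys fox_words ws_words)
      then have "bdry (Th (\<lambda>i. eval_sum (fox x (ws ! i))))"
        by (rule bdryI [OF _ lc_comp [OF lc_indicator [OF openin_cyl closedin_cyl], of of_bool]]) (rule Th_fox_lookup)
      ultimately show ?thesis by simp
    qed
  qed
  then have "bdry (Th y)" by (simp add: y' Th_restrict)
  ultimately show "y \<in> B" by (simp add: B_def)
qed

lemma N_subset_B: "N \<subseteq> B"
  unfolding N_def generated_submodule_def by (rule hull_minimal [where S = "right_submodule (group_ring (FG n)) (FM n k)", OF relations_in_B right_submodule_B])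

lemma right_submodule_N: "right_submodule (group_ring (FG n)) (FM n k) N"
proof -
  let ?T = "{T. right_submodule (group_ring (FG n)) (FM n k) T \<and> eval_vector ` set (h1_relations n ws) \<subseteq> T}"
  have N: "N = \<Inter>?T" by (simp add: N_def generated_submodule_def hull_def)
  have sub': "T \<subseteq> carrier (FM n k) \<and> (\<lambda>i\<in>{..<k}. 0) \<in> T \<and>
    (\<forall>x\<in>T. \<forall>y\<in>T. (\<lambda>i\<in>{..<k}. x i - y i) \<in> T) \<and>
    (\<forall>x\<in>T. \<forall>a. Poly_Mapping.keys a \<subseteq> carrier (FG n) \<longrightarrow> (\<lambda>i\<in>{..<k}. gmul n (x i) a) \<in> T)"
    if "T \<in> ?T" for T
    using that unfolding mem_Collect_eq right_submodule_FM_iff by (rule conjunct1)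
  show ?thesis
    unfolding right_submodule_FM_iff
  proof (intro conjI ballI allI impI)
    show "N \<subseteq> carrier (FM n k)" using N_subset_B by (auto simp: B_def)
    show "(\<lambda>i\<in>{..<k}. 0) \<in> N"
      unfolding N
    proof (rule InterI)
      fix T assume T: "T \<in> ?T"
      show "(\<lambda>i\<in>{..<k}. 0) \<in> T" using sub' [OF T] by simp
    qed
    show "(\<lambda>i\<in>{..<k}. x i - y i) \<in> N" if "x \<in> N" "y \<in> N" for x y
      unfolding N
    proof (rule InterI)
      fix T assume T: "T \<in> ?T"
      then have "x \<in> T" "y \<in> T" using that unfolding N by blast+
      then show "(\<lambda>i\<in>{..<k}. x i - y i) \<in> T" using sub' [OF T] by simp
    qed
    show "(\<lambda>i\<in>{..<k}. gmul n (x i) a) \<in> N" if "x \<in> N" "Poly_Mapping.keys a \<subseteq> carrier (FG n)" for x a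
      unfolding N
    proof (rule InterI)
      fix T assume T: "T \<in> ?T"
      then have "x \<in> T" using that(1) unfolding N by blast
      then show "(\<lambda>i\<in>{..<k}. gmul n (x i) a) \<in> T" using sub' [OF T] that(2) by simp
    qed
  qed
qed

lemma N_diff: "x \<in> N \<Longrightarrow> y \<in> N \<Longrightarrow> (\<lambda>i\<in>{..<k}. x i - y i) \<in> N"
  and N_gmul: "x \<in> N \<Longrightarrow> Poly_Mapping.keys a \<subseteq> carrier (FG n) \<Longrightarrow> (\<lambda>i\<in>{..<k}. gmul n (x i) a) \<in> N"
  using right_submodule_N unfolding right_submodule_FM_iff by simp_all

lemma inN_zero: "inN (\<lambda>i. 0)"
  using right_submodule_N by (simp add: inN_def right_submodule_FM_iff)

lemma inN_diff:
  assumes "inN x" "inN y"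
  shows "inN (\<lambda>i. x i - y i)"
proof -
  have "(\<lambda>i\<in>{..<k}. (\<lambda>i\<in>{..<k}. x i) i - (\<lambda>i\<in>{..<k}. y i) i) \<in> N"
    using assms unfolding inN_def by (rule N_diff)
  moreover have "(\<lambda>i\<in>{..<k}. (\<lambda>i\<in>{..<k}. x i) i - (\<lambda>i\<in>{..<k}. y i) i) = (\<lambda>i\<in>{..<k}. x i - y i)"
    by (auto simp: fun_eq_iff)
  ultimately show ?thesis by (simp add: inN_def)
qed

lemma inN_add: "inN x \<Longrightarrow> inN y \<Longrightarrow> inN (\<lambda>i. x i + y i)"
  using inN_diff [of x "\<lambda>i. 0 - y i"] inN_diff [OF inN_zero, of y] by simp

lemma inN_gmul:
  assumes "inN x" "Poly_Mapping.keys a \<subseteq> carrier (FG n)"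
  shows "inN (\<lambda>i. gmul n (x i) a)"
proof -
  have "(\<lambda>i\<in>{..<k}. gmul n ((\<lambda>i\<in>{..<k}. x i) i) a) \<in> N"
    using assms unfolding inN_def by (rule N_gmul)
  moreover have "(\<lambda>i\<in>{..<k}. gmul n ((\<lambda>i\<in>{..<k}. x i) i) a) = (\<lambda>i\<in>{..<k}. gmul n (x i) a)"
    by (auto simp: fun_eq_iff)
  ultimately show ?thesis by (simp add: inN_def)
qed

lemma inN_cong: "inN x \<Longrightarrow> (\<And>i. i < k \<Longrightarrow> x i = y i) \<Longrightarrow> inN y"
proof -
  assume "inN x" and eq: "\<And>i. i < k \<Longrightarrow> x i = y i"
  moreover have "(\<lambda>i\<in>{..<k}. x i) = (\<lambda>i\<in>{..<k}. y i)" using eq by (auto simp: fun_eq_iff)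
  ultimately show ?thesis by (simp add: inN_def)
qed

lemma inN_relation:
  assumes "v \<in> set (h1_relations n ws)"
  shows "inN (\<lambda>i. eval_sum (v ! i))"
proof -
  have "eval_vector v \<in> N"
    unfolding N_def generated_submodule_def using assms by (intro hull_inc) blast
  then show ?thesis
    using eval_vector_restrict [OF h1_relations_words(1) [OF ws assms]] by (simp add: inN_def)
qed

lemma inN_fox:
  assumes "fst x < n"
  shows "inN (\<lambda>i. eval_sum (fox x (ws ! i)))"
proof -
  have "map (fox x) ws \<in> set (h1_relations n ws)"
    using assms by (cases x; cases "snd x") (auto simp: h1_relations_def)
  from inN_relation [OF this] show ?thesis by (rule inN_cong) simp
qed

text \<open>w^z - 1 is a multiple of w - 1 from the right; the induction telescopes away from 0 in
  both directions.\<close>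

lemma inN_stabilizer:
  assumes i: "i < k" and h: "h \<in> carrier (FG n)"
  shows "inN (\<lambda>j. if j = i then frag_of (reduce (ws ! i) [^]\<^bsub>FG n\<^esub> (z :: int) \<otimes>\<^bsub>FG n\<^esub> h) - frag_of h else 0)"
proof -
  let ?w = "reduce (ws ! i)"
  note w = vs_props(1) [OF i]
  let ?v = "map (\<lambda>p. if fst p = i then [(1, snd p), (-1, [])] else []) (List.enumerate 0 ws)"
  have "?v \<in> set (h1_relations n ws)" using i by (auto simp: h1_relations_def)
  from inN_relation [OF this]
  have base: "inN (\<lambda>j. if j = i then frag_of ?w - frag_of [] else 0)"
    by (rule inN_cong) (simp add: nth_enumerate_eq eval_sum_Cons)
  have step: "inN (\<lambda>j. if j = i then frag_of (?w \<otimes>\<^bsub>FG n\<^esub> g) - frag_of g else 0)" if g: "g \<in> carrier (FG n)" for g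
  proof -
    have "[] \<otimes>\<^bsub>FG n\<^esub> g = g" using fg.l_one [OF g] by (simp add: one_free_group)
    then have "gmul n (if j = i then frag_of ?w - frag_of [] else 0) (frag_of g) =
        (if j = i then frag_of (?w \<otimes>\<^bsub>FG n\<^esub> g) - frag_of g else 0)" for j
      by (simp add: gmul_diff_left gmul_of_of gmul_0_left)
    then show ?thesis using inN_gmul [OF base, of "frag_of g"] g by (simp add: keys_frag_of)
  qed
  show ?thesis
  proof (induction z rule: int_induct [where k = 0])
    case base
    show ?case using h by (intro inN_cong [OF inN_zero]) simp
  next
    case (step1 z)
    have "?w [^]\<^bsub>FG n\<^esub> (z + 1) \<otimes>\<^bsub>FG n\<^esub> h = ?w \<otimes>\<^bsub>FG n\<^esub> (?w [^]\<^bsub>FG n\<^esub> z \<otimes>\<^bsub>FG n\<^esub> h)"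
      using w h fg.int_pow_mult [OF w, of 1 z] by (simp add: fg.m_assoc add.commute)
    then show ?case
      using w h by (intro inN_cong [OF inN_add [OF step [of "?w [^]\<^bsub>FG n\<^esub> z \<otimes>\<^bsub>FG n\<^esub> h"] step1(2)]]) auto
  next
    case (step2 z)
    have "?w [^]\<^bsub>FG n\<^esub> z \<otimes>\<^bsub>FG n\<^esub> h = ?w \<otimes>\<^bsub>FG n\<^esub> (?w [^]\<^bsub>FG n\<^esub> (z - 1) \<otimes>\<^bsub>FG n\<^esub> h)"
      using w h fg.int_pow_mult [OF w, of 1 "z - 1"] by (simp add: fg.m_assoc)
    then show ?case
      using w h by (intro inN_cong [OF inN_diff [OF step2(2) step [of "?w [^]\<^bsub>FG n\<^esub> (z - 1) \<otimes>\<^bsub>FG n\<^esub> h"]]]) auto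
  qed
qed

text \<open>Choosing one representative for each line gives a linear section of \<open>Th\<close>, and every basis
  vector is congruent to the chosen representative of its line.\<close>

lemma Th_eq_0_imp_inN:
  assumes v: "\<And>i. i < k \<Longrightarrow> Poly_Mapping.keys (v i) \<subseteq> carrier (FG n)" and 0: "Th v = 0"
  shows "inN v"
proof -
  have "\<forall>l\<in>L. \<exists>p. fst p < k \<and> snd p \<in> carrier (FG n) \<and> l = line n (inv\<^bsub>FG n\<^esub> (snd p)) (reduce (ws ! fst p))"
  proof
    fix l assume "l \<in> L"
    then obtain g i where "g \<in> carrier (FG n)" "i < k" "l = line n g (reduce (ws ! i))" by (rule line_cases)
    then show "\<exists>p. fst p < k \<and> snd p \<in> carrier (FG n) \<and> l = line n (inv\<^bsub>FG n\<^esub> (snd p)) (reduce (ws ! fst p))"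
      by (intro exI [of _ "(i, inv\<^bsub>FG n\<^esub> g)"]) simp
  qed
  from bchoice [OF this] obtain P where
    P: "\<forall>l\<in>L. fst (P l) < k \<and> snd (P l) \<in> carrier (FG n) \<and> l = line n (inv\<^bsub>FG n\<^esub> (snd (P l))) (reduce (ws ! fst (P l)))" ..
  define S where "S \<phi> j = frag_extend (\<lambda>l. if j = fst (P l) then frag_of (snd (P l)) else 0) \<phi>" for \<phi> :: "bpoint \<times> bpoint \<Rightarrow>\<^sub>0 int" and j
  have one: "inN (\<lambda>j. (if j = i then y else 0) - S (frag_extend (base_line i) y) j)"
    if i: "i < k" and y: "Poly_Mapping.keys y \<subseteq> carrier (FG n)" for i y
    using y
  proof (induction y rule: frag_induction)
    case zero
    show ?case using inN_zero by (simp add: S_def)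
  next
    case (one h)
    let ?l = "line n (inv\<^bsub>FG n\<^esub> h) (reduce (ws ! i))"
    have l: "?l \<in> L" using one i by (intro line_in_L) auto
    obtain i' h' where p: "P ?l = (i', h')" by fastforce
    with P l have P': "i' < k" "h' \<in> carrier (FG n)" "?l = line n (inv\<^bsub>FG n\<^esub> h') (reduce (ws ! i'))" by auto
    with lines_eq_iff [OF i P'(1), of "inv\<^bsub>FG n\<^esub> h" "inv\<^bsub>FG n\<^esub> h'"] one obtain z :: int where
      "i = i'" and z: "inv\<^bsub>FG n\<^esub> h = inv\<^bsub>FG n\<^esub> h' \<otimes>\<^bsub>FG n\<^esub> reduce (ws ! i) [^]\<^bsub>FG n\<^esub> z" by auto
    have "h = inv\<^bsub>FG n\<^esub> (inv\<^bsub>FG n\<^esub> h)" using one by simp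
    also have "\<dots> = reduce (ws ! i) [^]\<^bsub>FG n\<^esub> (- z) \<otimes>\<^bsub>FG n\<^esub> h'"
      unfolding z using vs_props [OF i] P'(2) by (simp add: fg.inv_mult_group fg.int_pow_neg)
    finally have h: "h = reduce (ws ! i) [^]\<^bsub>FG n\<^esub> (- z) \<otimes>\<^bsub>FG n\<^esub> h'" .
    have "S (frag_extend (base_line i) (frag_of h)) j = (if j = i then frag_of h' else 0)" for j
      using p \<open>i = i'\<close> by (simp add: S_def base_line_def)
    then show ?case
      using inN_stabilizer [OF i P'(2), of "- z"] h by (intro inN_cong [OF inN_stabilizer [OF i P'(2), of "- z"]]) simp
  next
    case (diff y y')
    show ?case
      by (rule inN_cong [OF inN_diff [OF diff]]) (simp add: S_def frag_extend_diff)
  qed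
  \<comment> \<open>Coordinates are added one at a time. At \<open>m = k\<close> the section is
    applied to \<open>Th v\<close>, which is 0, and only \<open>v\<close> remains.\<close>
  have "inN (\<lambda>j. (if j < m then v j else 0) - S (\<Sum>i<m. frag_extend (base_line i) (v i)) j)" if "m \<le> k" for m
    using that
  proof (induction m)
    case 0
    show ?case using inN_zero by (simp add: S_def)
  next
    case (Suc m)
    then have "inN (\<lambda>j. (if j < m then v j else 0) - S (\<Sum>i<m. frag_extend (base_line i) (v i)) j)" "m < k" by auto
    from inN_add [OF this(1) one [OF this(2) v [OF this(2)]]] show ?case
      by (rule inN_cong) (auto simp: S_def frag_extend_add less_Suc_eq)
  qed
  from this [of k] have "inN (\<lambda>j. (if j < k then v j else 0) - S (Th v) j)" by (simp add: Th_def)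
  then show ?thesis by (rule inN_cong) (simp add: 0 S_def)
qed

text \<open>The jumps of \<open>f\<close> come from a vector generated by the relations. The goal is
  \<open>hit_lc\<close>: this holds for every locally constant \<open>f\<close>.\<close>

definition hit :: "(bpoint \<Rightarrow> int) \<Rightarrow> bool" where
  "hit f \<longleftrightarrow> (\<exists>v. (\<forall>i<k. Poly_Mapping.keys (v i) \<subseteq> carrier (FG n)) \<and> inN v \<and>
    (\<forall>l\<in>L. poly_mapping.lookup (Th v) l = f (fst l) - f (snd l)))"

lemma hitI: "(\<And>i. i < k \<Longrightarrow> Poly_Mapping.keys (v i) \<subseteq> carrier (FG n)) \<Longrightarrow> inN v \<Longrightarrow>
  (\<And>l. l \<in> L \<Longrightarrow> poly_mapping.lookup (Th v) l = f (fst l) - f (snd l)) \<Longrightarrow> hit f"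
  unfolding hit_def by blast

lemma hitE:
  assumes "hit f"
  obtains v where "\<And>i. i < k \<Longrightarrow> Poly_Mapping.keys (v i) \<subseteq> carrier (FG n)" "inN v"
    "\<And>l. l \<in> L \<Longrightarrow> poly_mapping.lookup (Th v) l = f (fst l) - f (snd l)"
  using assms unfolding hit_def by blast

lemma hit_zero: "hit (\<lambda>_. 0)"
  by (rule hitI [OF _ inN_zero]) (simp_all add: Th_zero)

lemma hit_diff:
  assumes "hit f" "hit g"
  shows "hit (\<lambda>\<xi>. f \<xi> - g \<xi>)"
proof -
  from assms(1) obtain v where v: "\<And>i. i < k \<Longrightarrow> Poly_Mapping.keys (v i) \<subseteq> carrier (FG n)" "inN v"
    "\<And>l. l \<in> L \<Longrightarrow> poly_mapping.lookup (Th v) l = f (fst l) - f (snd l)" by (rule hitE) blast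
  from assms(2) obtain w where w: "\<And>i. i < k \<Longrightarrow> Poly_Mapping.keys (w i) \<subseteq> carrier (FG n)" "inN w"
    "\<And>l. l \<in> L \<Longrightarrow> poly_mapping.lookup (Th w) l = g (fst l) - g (snd l)" by (rule hitE) blast
  show ?thesis
    by (rule hitI [OF _ inN_diff [OF v(2) w(2)]]) (simp_all add: keys_diff_subset v w Th_diff lookup_minus)
qed

lemma hit_add: "hit f \<Longrightarrow> hit g \<Longrightarrow> hit (\<lambda>\<xi>. f \<xi> + g \<xi>)"
  using hit_diff [of f "\<lambda>\<xi>. 0 - g \<xi>"] hit_diff [OF hit_zero, of g] by simp

lemma hit_mult:
  assumes "hit f"
  shows "hit (\<lambda>\<xi>. c * f \<xi>)"
proof (induction c rule: int_induct [where k = 0])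
  case base
  show ?case using hit_zero by simp
next
  case (step1 i)
  from hit_add [OF step1(2) assms] show ?case by (simp add: algebra_simps)
next
  case (step2 i)
  from hit_diff [OF step2(2) assms] show ?case by (simp add: algebra_simps)
qed

lemma hit_sum: "finite I \<Longrightarrow> (\<And>i. i \<in> I \<Longrightarrow> hit (f i)) \<Longrightarrow> hit (\<lambda>\<xi>. \<Sum>i\<in>I. f i \<xi>)"
  by (induction I rule: finite_induct) (auto simp: hit_zero hit_add)

lemma hit_cong:
  assumes "hit f" "\<And>\<xi>. \<xi> \<in> topspace (free_boundary n) \<Longrightarrow> f \<xi> = g \<xi>"
  shows "hit g"
proof -
  from assms(1) obtain v where v: "\<And>i. i < k \<Longrightarrow> Poly_Mapping.keys (v i) \<subseteq> carrier (FG n)" "inN v"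
    "\<And>l. l \<in> L \<Longrightarrow> poly_mapping.lookup (Th v) l = f (fst l) - f (snd l)" by (rule hitE) blast
  show ?thesis
    by (rule hitI [OF v(1,2)]) (use v(3) assms(2) L_topspace' in auto)
qed

text \<open>Translating the function corresponds to multiplying the vector by \<open>g\<close>,
  under which the relations are closed.\<close>

lemma hit_translate:
  assumes "hit f" "g \<in> carrier (FG n)"
  shows "hit (\<lambda>\<xi>. f (translate_bpoint n g \<xi>))"
proof -
  from assms(1) obtain v where v: "\<And>i. i < k \<Longrightarrow> Poly_Mapping.keys (v i) \<subseteq> carrier (FG n)" "inN v"
    "\<And>l. l \<in> L \<Longrightarrow> poly_mapping.lookup (Th v) l = f (fst l) - f (snd l)" by (rule hitE) blast
  have kg: "Poly_Mapping.keys (frag_of g) \<subseteq> carrier (FG n)" using assms(2) by (simp add: keys_frag_of)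
  show ?thesis
  proof (rule hitI [OF _ inN_gmul [OF v(2) kg]])
    show "Poly_Mapping.keys (gmul n (v i) (frag_of g)) \<subseteq> carrier (FG n)" if "i < k" for i
      using v(1) [OF that] kg by (rule gmul_keys)
    fix l assume l: "l \<in> L"
    have "Th (\<lambda>i. gmul n (v i) (frag_of g)) = ract (Th v) g"
      using Th_gmul [OF v(1) kg] by (simp add: smul_def)
    then show "poly_mapping.lookup (Th (\<lambda>i. gmul n (v i) (frag_of g))) l =
        f (translate_bpoint n g (fst l)) - f (translate_bpoint n g (snd l))"
      using lookup_ract [OF Th_FL [OF v(1)] assms(2) l] v(3) [OF trans_line_L [OF l assms(2)]]
      by (simp add: trans_line_def)
  qed
qed

lemma hit_cyl:
  assumes p: "p @ [x] \<in> carrier (FG n)"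
  shows "hit (\<lambda>\<xi>. of_bool (\<xi> \<in> cyl n (p @ [x])))"
proof -
  have x: "fst x < n" using p by (simp add: carrier_free_group)
  have "hit (\<lambda>\<xi>. of_bool (\<xi> \<in> cyl n [x]))"
    by (rule hitI [OF _ inN_fox [OF x]])
      (simp_all add: eval_sum_keys fox_words ws_words Th_fox_lookup)
  from hit_translate [OF this, of "inv\<^bsub>FG n\<^esub> p"] carrier_prefix [OF p]
  have "hit (\<lambda>\<xi>. of_bool (translate_bpoint n (inv\<^bsub>FG n\<^esub> p) \<xi> \<in> cyl n [x]))" by simp
  then show ?thesis by (rule hit_cong) (simp add: translate_cyl [OF p])
qed

text \<open>At a fixed depth \<open>f\<close> is a finite integral combination of indicators of
  cylinders, each of which is hit by translation from a single letter.\<close>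

lemma hit_lc:
  assumes "lc f"
  shows "hit f"
proof -
  from locally_constant_depth [of n f] assms obtain N where
    N: "\<And>\<omega> \<eta>. \<omega> \<in> ends n \<Longrightarrow> \<eta> \<in> ends n \<Longrightarrow> pre \<omega> N = pre \<eta> N \<Longrightarrow> f (pt n \<omega>) = f (pt n \<eta>)"
    unfolding lc_def by blast
  \<comment> \<open>One letter beyond the depth of \<open>f\<close>, so that every word has a last
    letter to which \<open>hit_cyl\<close> applies.\<close>
  let ?P = "{p \<in> carrier (FG n). length p = Suc N}"
  define c where "c p = f (pt n (SOME \<omega>. \<omega> \<in> ends n \<and> pre \<omega> (Suc N) = p))" for p
  have "hit (\<lambda>\<xi>. \<Sum>p\<in>?P. c p * of_bool (\<xi> \<in> cyl n p))"
  proof (intro hit_sum hit_mult finite_carrier_length)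
    fix p assume p: "p \<in> ?P"
    then obtain p' x where "p = p' @ [x]" by (cases p rule: rev_cases) auto
    then show "hit (\<lambda>\<xi>. of_bool (\<xi> \<in> cyl n p))" using p hit_cyl by simp
  qed
  then show ?thesis
  proof (rule hit_cong)
    fix \<xi> assume "\<xi> \<in> topspace (free_boundary n)"
    then obtain \<omega> where \<omega>: "\<omega> \<in> ends n" "\<xi> = pt n \<omega>" by (auto simp: topspace_free_boundary)
    let ?p = "pre \<omega> (Suc N)"
    have "(\<Sum>p\<in>?P. c p * of_bool (\<xi> \<in> cyl n p)) = (\<Sum>p\<in>?P. if p = ?p then c p else 0)"
      using \<omega> by (intro sum.cong refl) (auto simp: pt_in_cyl)
    also have "\<dots> = c ?p" using ends_pre [OF \<omega>(1)] by (simp add: finite_carrier_length)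
    also have "c ?p = f \<xi>"
    proof -
      let ?Q = "\<lambda>\<eta>. \<eta> \<in> ends n \<and> pre \<eta> (Suc N) = ?p"
      have "?Q (Eps ?Q)" by (rule someI [of ?Q \<omega>]) (simp add: \<omega>)
      then have \<eta>: "Eps ?Q \<in> ends n" "pre (Eps ?Q) (Suc N) = pre \<omega> (Suc N)" by (rule conjunct1, rule conjunct2)
      have "pre (Eps ?Q) N = pre \<omega> N" by (rule pre_eq_mono [OF \<eta>(2)]) simp
      from N [OF \<eta>(1) \<omega>(1) this] show ?thesis by (simp only: c_def \<omega>(2))
    qed
    finally show "(\<Sum>p\<in>?P. c p * of_bool (\<xi> \<in> cyl n p)) = f \<xi>" .
  qed
qed

text \<open>Completeness of the relations. If the image of \<open>v\<close> consists of the jumps of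
  \<open>f\<close>, a vector generated by the relations has the same image; the difference lies in
  the kernel of \<open>Th\<close>, which the relations w_i - 1 generate.\<close>

lemma inN_iff:
  assumes v: "\<And>i. i < k \<Longrightarrow> Poly_Mapping.keys (v i) \<subseteq> carrier (FG n)"
  shows "inN v \<longleftrightarrow> bdry (Th v)"
proof
  assume "inN v"
  then show "bdry (Th v)" using N_subset_B by (auto simp: inN_def B_def Th_restrict)
next
  assume "bdry (Th v)"
  then obtain f where f: "lc f" "\<forall>l\<in>L. poly_mapping.lookup (Th v) l = f (fst l) - f (snd l)"
    unfolding bdry_def by blast
  from hit_lc [OF f(1)] obtain w where w: "\<And>i. i < k \<Longrightarrow> Poly_Mapping.keys (w i) \<subseteq> carrier (FG n)" "inN w"
    "\<And>l. l \<in> L \<Longrightarrow> poly_mapping.lookup (Th w) l = f (fst l) - f (snd l)" by (rule hitE) blast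
  have "Th v = Th w"
    by (rule FL_eqI [OF Th_FL [OF v] Th_FL [OF w(1)]]) (use f(2) w(3) in auto)
  then have "inN (\<lambda>i. v i - w i)"
    using v w(1) by (intro Th_eq_0_imp_inN) (simp_all add: Th_diff keys_diff_subset)
  from inN_add [OF this w(2)] show "inN v" by simp
qed

end


section \<open>The presentation\<close>

context word_pattern
begin

abbreviation H1 :: "bpoint set cech_elem set monoid" where
  "H1 \<equiv> cech_cohomology 1 D"

lemma cls_in_H1: "\<phi> \<in> FL \<Longrightarrow> cls \<phi> \<in> carrier H1"
  by (simp add: carrier_cech)

lemma H1E:
  assumes "A \<in> carrier H1"
  obtains \<phi> where "\<phi> \<in> FL" "A = cls \<phi>"
  using assms by (auto simp: carrier_cech)

lemma comm_group_H1: "comm_group H1"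
proof (rule comm_groupI)
  fix A B C assume "A \<in> carrier H1" "B \<in> carrier H1" "C \<in> carrier H1"
  then obtain \<phi> \<psi> \<chi> where "\<phi> \<in> FL" "A = cls \<phi>" "\<psi> \<in> FL" "B = cls \<psi>" "\<chi> \<in> FL" "C = cls \<chi>"
    by (metis H1E)
  then show "A \<otimes>\<^bsub>H1\<^esub> B \<otimes>\<^bsub>H1\<^esub> C = A \<otimes>\<^bsub>H1\<^esub> (B \<otimes>\<^bsub>H1\<^esub> C)"
    by (simp add: mult_cech FL_add add.assoc)
next
  fix A B assume "A \<in> carrier H1" "B \<in> carrier H1"
  then obtain \<phi> \<psi> where *: "\<phi> \<in> FL" "A = cls \<phi>" "\<psi> \<in> FL" "B = cls \<psi>" by (metis H1E)
  then show "A \<otimes>\<^bsub>H1\<^esub> B \<in> carrier H1" by (simp add: mult_cech FL_add cls_in_H1)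
  show "A \<otimes>\<^bsub>H1\<^esub> B = B \<otimes>\<^bsub>H1\<^esub> A" using * by (simp add: mult_cech add.commute)
next
  show "\<one>\<^bsub>H1\<^esub> \<in> carrier H1" by (simp add: one_cech cls_in_H1 FL_0)
next
  fix A assume "A \<in> carrier H1"
  then obtain \<phi> where \<phi>: "\<phi> \<in> FL" "A = cls \<phi>" by (rule H1E)
  then show "\<one>\<^bsub>H1\<^esub> \<otimes>\<^bsub>H1\<^esub> A = A" by (simp add: one_cech mult_cech FL_0)
  have n: "- \<phi> \<in> FL" using FL_diff [OF FL_0 \<phi>(1)] by simp
  have "cls (- \<phi>) \<otimes>\<^bsub>H1\<^esub> A = \<one>\<^bsub>H1\<^esub>" using n \<phi> by (simp add: one_cech mult_cech)
  then show "\<exists>B\<in>carrier H1. B \<otimes>\<^bsub>H1\<^esub> A = \<one>\<^bsub>H1\<^esub>" using cls_in_H1 [OF n] by blast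
qed

lemma FL_cmul: "\<phi> \<in> FL \<Longrightarrow> frag_cmul c \<phi> \<in> FL"
  using keys_cmul [of c \<phi>] by (auto simp: FL_def)

lemma nat_pow_cls: "\<phi> \<in> FL \<Longrightarrow> cls \<phi> [^]\<^bsub>H1\<^esub> (m :: nat) = cls (frag_cmul (int m) \<phi>)"
  by (induction m) (auto simp: one_cech mult_cech FL_cmul frag_cmul_distrib add.commute)

lemma int_pow_cls:
  assumes "\<phi> \<in> FL"
  shows "cls \<phi> [^]\<^bsub>H1\<^esub> (z :: int) = cls (frag_cmul z \<phi>)"
proof -
  interpret comm_group H1 by (rule comm_group_H1)
  show ?thesis
  proof (cases "z < 0")
    case True
    have "inv\<^bsub>H1\<^esub> (cls (frag_cmul (- z) \<phi>)) = cls (frag_cmul z \<phi>)"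
      by (rule inv_equality)
        (use assms in \<open>simp_all add: mult_cech FL_cmul one_cech cls_in_H1 frag_cmul_distrib [symmetric] del: minus_frag_cmul\<close>)
    then show ?thesis using True by (simp add: int_pow_def2 nat_pow_cls [OF assms])
  next
    case False
    then show ?thesis by (simp add: int_pow_def2 nat_pow_cls [OF assms])
  qed
qed

lemma finprod_cls:
  assumes "finite I" "\<And>i. i \<in> I \<Longrightarrow> \<phi> i \<in> FL"
  shows "finprod H1 (\<lambda>i. cls (\<phi> i)) I = cls (\<Sum>i\<in>I. \<phi> i)"
proof -
  interpret comm_group H1 by (rule comm_group_H1)
  show ?thesis
    using assms
  proof (induction I rule: finite_induct)
    case empty
    show ?case by (simp add: one_cech)
  next
    case (insert i I)
    then have "finprod H1 (\<lambda>i. cls (\<phi> i)) (insert i I) = cls (\<phi> i) \<otimes>\<^bsub>H1\<^esub> finprod H1 (\<lambda>i. cls (\<phi> i)) I"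
      by (intro finprod_insert) (auto intro: cls_in_H1)
    also have "\<dots> = cls (\<phi> i + (\<Sum>i\<in>I. \<phi> i))"
      using insert by (simp add: mult_cech FL_sum)
    finally show ?case using insert by simp
  qed
qed

lemma decomposition_H1_eq:
  "decomposition_H1 n (map reduce ws) = group_ring_module H1 (\<lambda>x g. cech_pullback 1 D (translate n g) x)"
  by (simp add: decomposition_H1_def D_eq)

lemma rsmult_cls:
  assumes \<phi>: "\<phi> \<in> FL" and a: "Poly_Mapping.keys a \<subseteq> carrier (FG n)"
  shows "cls \<phi> \<odot>\<^sub>r\<^bsub>decomposition_H1 n (map reduce ws)\<^esub> a = cls (smul \<phi> a)"
proof -
  interpret comm_group H1 by (rule comm_group_H1)
  have "cls \<phi> \<odot>\<^sub>r\<^bsub>decomposition_H1 n (map reduce ws)\<^esub> a =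
      finprod H1 (\<lambda>g. cech_pullback 1 D (translate n g) (cls \<phi>) [^]\<^bsub>H1\<^esub> poly_mapping.lookup a g) (Poly_Mapping.keys a)"
    by (simp add: decomposition_H1_eq group_ring_module_def)
  also have "\<dots> = finprod H1 (\<lambda>g. cls (frag_cmul (poly_mapping.lookup a g) (ract \<phi> g))) (Poly_Mapping.keys a)"
  proof (rule finprod_cong')
    show "(\<lambda>g. cls (frag_cmul (poly_mapping.lookup a g) (ract \<phi> g))) \<in> Poly_Mapping.keys a \<rightarrow> carrier H1"
      using a by (auto intro!: cls_in_H1 FL_cmul ract_FL \<phi>)
    fix g assume "g \<in> Poly_Mapping.keys a"
    then have g: "g \<in> carrier (FG n)" using a by blast
    show "cech_pullback 1 D (translate n g) (cls \<phi>) [^]\<^bsub>H1\<^esub> poly_mapping.lookup a g =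
        cls (frag_cmul (poly_mapping.lookup a g) (ract \<phi> g))"
      unfolding cech_pullback_translate [OF \<phi> g] by (rule int_pow_cls [OF ract_FL [OF \<phi> g]])
  qed simp
  also have "\<dots> = cls (\<Sum>g\<in>Poly_Mapping.keys a. frag_cmul (poly_mapping.lookup a g) (ract \<phi> g))"
    using a by (intro finprod_cls FL_cmul ract_FL \<phi>) auto
  finally show ?thesis by (simp add: smul_def frag_extend_def)
qed

text \<open>The coset of \<open>v\<close> modulo \<open>N\<close>, described through
  \<open>Th\<close> so that arithmetic in the quotient is reduced to \<open>bdry\<close>.\<close>

definition residue :: "(nat \<Rightarrow> word \<Rightarrow>\<^sub>0 int) \<Rightarrow> (nat \<Rightarrow> word \<Rightarrow>\<^sub>0 int) set" where
  "residue v = {x \<in> carrier (FM n k). bdry (Th x - Th v)}"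

lemma FM_Th_FL: "v \<in> carrier (FM n k) \<Longrightarrow> Th v \<in> FL"
  using in_FM_keys by (intro Th_FL)

lemma N_iff: "v \<in> N \<longleftrightarrow> v \<in> carrier (FM n k) \<and> bdry (Th v)"
proof
  assume "v \<in> N"
  then show "v \<in> carrier (FM n k) \<and> bdry (Th v)" using N_subset_B by (auto simp: B_def)
next
  assume v: "v \<in> carrier (FM n k) \<and> bdry (Th v)"
  then have "inN v" using inN_iff [of v] in_FM_keys [of v n k] by simp
  then show "v \<in> N" using v in_FM_restrict [of v n k] by (simp add: inN_def)
qed

lemma in_residueI:
  assumes "v \<in> carrier (FM n k)" "x \<in> carrier (FM n k)" "y \<in> N" "\<And>i. i < k \<Longrightarrow> x i = y i + v i"
  shows "x \<in> residue v"
proof -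
  have "Th x = Th (\<lambda>i. y i + v i)" using assms(4) by (rule Th_cong)
  then show ?thesis using assms(2,3) by (simp add: residue_def N_iff Th_add)
qed

lemma residue_decomp:
  assumes v: "v \<in> carrier (FM n k)" and x: "x \<in> residue v"
  shows "(\<lambda>i\<in>{..<k}. x i - v i) \<in> N"
  using assms in_FM_keys [of v n k] in_FM_keys [of x n k]
  by (simp add: residue_def N_iff restrict_in_FM Th_restrict Th_diff keys_diff_subset)

lemma add_in_FM: "x \<in> carrier (FM n k) \<Longrightarrow> y \<in> carrier (FM n k) \<Longrightarrow> (\<lambda>i\<in>{..<k}. x i + y i) \<in> carrier (FM n k)"
  using in_FM_keys [of x n k] in_FM_keys [of y n k] by (simp add: restrict_in_FM keys_add_subset)

lemma gmul_in_FM: "x \<in> carrier (FM n k) \<Longrightarrow> Poly_Mapping.keys a \<subseteq> carrier (FG n) \<Longrightarrow>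
    (\<lambda>i\<in>{..<k}. gmul n (x i) a) \<in> carrier (FM n k)"
  using in_FM_keys [of x n k] by (simp add: restrict_in_FM gmul_keys)

lemma coset_N:
  assumes v: "v \<in> carrier (FM n k)"
  shows "N +>\<^bsub>FM n k\<^esub> v = residue v"
proof -
  have "N +>\<^bsub>FM n k\<^esub> v = (\<Union>y\<in>N. {\<lambda>i\<in>{..<k}. y i + v i})"
    by (simp add: a_r_coset_def' add_FM)
  also have "\<dots> = residue v"
  proof
    show "(\<Union>y\<in>N. {\<lambda>i\<in>{..<k}. y i + v i}) \<subseteq> residue v"
      using v add_in_FM N_iff by (auto intro!: in_residueI [OF v])
    show "residue v \<subseteq> (\<Union>y\<in>N. {\<lambda>i\<in>{..<k}. y i + v i})"
    proof
      fix x assume x: "x \<in> residue v"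
      let ?y = "\<lambda>i\<in>{..<k}. x i - v i"
      have "?y \<in> N" by (rule residue_decomp [OF v x])
      moreover have "(\<lambda>i\<in>{..<k}. ?y i + v i) = (\<lambda>i\<in>{..<k}. x i)" by (auto simp: fun_eq_iff)
      then have "x = (\<lambda>i\<in>{..<k}. ?y i + v i)" using x in_FM_restrict [of x n k] by (simp add: residue_def)
      ultimately show "x \<in> (\<Union>y\<in>N. {\<lambda>i\<in>{..<k}. y i + v i})" by (intro UN_I [of ?y]) simp_all
    qed
  qed
  finally show ?thesis .
qed

abbreviation QM :: "(word \<Rightarrow>\<^sub>0 int, (nat \<Rightarrow> word \<Rightarrow>\<^sub>0 int) set) right_module" where
  "QM \<equiv> quotient_module (FM n k) N"

lemma carrier_QM: "carrier QM = residue ` carrier (FM n k)"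
  by (auto simp: quotient_module_def A_RCOSETS_def' coset_N)

text \<open>Multiplying a coset by a ring element yields only part of a coset; adding
  \<open>N\<close>, as the definition of the quotient module does, completes it.\<close>

lemma residue_add_N:
  assumes v: "v \<in> carrier (FM n k)"
    and sub: "\<And>x. x \<in> S \<Longrightarrow> x \<in> residue v" and mem: "v \<in> S"
  shows "N <+>\<^bsub>FM n k\<^esub> S = residue v"
proof
  show "N <+>\<^bsub>FM n k\<^esub> S \<subseteq> residue v"
  proof
    fix z assume "z \<in> N <+>\<^bsub>FM n k\<^esub> S"
    then obtain y x where y: "y \<in> N" and x: "x \<in> S" and z: "z = (\<lambda>i\<in>{..<k}. y i + x i)"
      by (auto simp: set_add_def' add_FM)
    have xr: "x \<in> carrier (FM n k)" "bdry (Th x - Th v)" using sub [OF x] by (auto simp: residue_def)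
    have yr: "y \<in> carrier (FM n k)" "bdry (Th y)" using y by (auto simp: N_iff)
    have eq: "Th z - Th v = Th y + (Th x - Th v)" by (simp add: z Th_restrict Th_add)
    have "bdry (Th z - Th v)" unfolding eq by (rule bdry_add [OF yr(2) xr(2)])
    then show "z \<in> residue v" using add_in_FM [OF yr(1) xr(1)] by (simp add: residue_def z)
  qed
  have "residue v = N +>\<^bsub>FM n k\<^esub> v" by (rule coset_N [OF v, symmetric])
  then show "residue v \<subseteq> N <+>\<^bsub>FM n k\<^esub> S"
    using mem by (auto simp: a_r_coset_def' set_add_def')
qed

lemma add_QM:
  assumes v: "v \<in> carrier (FM n k)" and w: "w \<in> carrier (FM n k)"
  shows "residue v \<oplus>\<^bsub>QM\<^esub> residue w = residue (\<lambda>i\<in>{..<k}. v i + w i)"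
proof -
  have "residue v \<oplus>\<^bsub>QM\<^esub> residue w = residue v <+>\<^bsub>FM n k\<^esub> residue w" by (simp add: quotient_module_def)
  also have "\<dots> = residue (\<lambda>i\<in>{..<k}. v i + w i)"
  proof
    show "residue v <+>\<^bsub>FM n k\<^esub> residue w \<subseteq> residue (\<lambda>i\<in>{..<k}. v i + w i)"
    proof
      fix z assume "z \<in> residue v <+>\<^bsub>FM n k\<^esub> residue w"
      then obtain x y where x: "x \<in> residue v" and y: "y \<in> residue w" and z: "z = (\<lambda>i\<in>{..<k}. x i + y i)"
        by (auto simp: set_add_def' add_FM)
      have "Th z - Th (\<lambda>i\<in>{..<k}. v i + w i) = (Th x - Th v) + (Th y - Th w)"
        by (simp add: z Th_restrict Th_add)
      then have "bdry (Th z - Th (\<lambda>i\<in>{..<k}. v i + w i))" using x y by (simp add: residue_def bdry_add)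
      then show "z \<in> residue (\<lambda>i\<in>{..<k}. v i + w i)"
        using x y add_in_FM [of x y] by (simp add: residue_def z)
    qed
    show "residue (\<lambda>i\<in>{..<k}. v i + w i) \<subseteq> residue v <+>\<^bsub>FM n k\<^esub> residue w"
    proof
      fix z assume z: "z \<in> residue (\<lambda>i\<in>{..<k}. v i + w i)"
      let ?x = "\<lambda>i\<in>{..<k}. z i - w i"
      have zc: "z \<in> carrier (FM n k)" using z by (simp add: residue_def)
      have "Th ?x - Th v = Th z - Th (\<lambda>i\<in>{..<k}. v i + w i)" by (simp add: Th_restrict Th_add Th_diff)
      then have "?x \<in> residue v"
        using z zc in_FM_keys [of z n k] in_FM_keys [OF w]
        by (simp add: residue_def restrict_in_FM keys_diff_subset)
      moreover have "w \<in> residue w" using w by (simp add: residue_def bdry_0)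
      moreover have "(\<lambda>i\<in>{..<k}. ?x i + w i) = (\<lambda>i\<in>{..<k}. z i)" by (auto simp: fun_eq_iff)
      then have "z = ?x \<oplus>\<^bsub>FM n k\<^esub> w" using in_FM_restrict [OF zc] by (simp add: add_FM)
      ultimately show "z \<in> residue v <+>\<^bsub>FM n k\<^esub> residue w" unfolding set_add_def' by blast
    qed
  qed
  finally show ?thesis .
qed

lemma rsmult_QM:
  assumes v: "v \<in> carrier (FM n k)" and a: "Poly_Mapping.keys a \<subseteq> carrier (FG n)"
  shows "residue v \<odot>\<^sub>r\<^bsub>QM\<^esub> a = residue (\<lambda>i\<in>{..<k}. gmul n (v i) a)"
proof -
  have "residue v \<odot>\<^sub>r\<^bsub>QM\<^esub> a = N <+>\<^bsub>FM n k\<^esub> ((\<lambda>x. x \<odot>\<^sub>r\<^bsub>FM n k\<^esub> a) ` residue v)" by (simp add: quotient_module_def)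
  also have "\<dots> = residue (\<lambda>i\<in>{..<k}. gmul n (v i) a)"
  proof (rule residue_add_N [OF gmul_in_FM [OF v a]])
    have "v \<in> residue v" using v by (simp add: residue_def bdry_0)
    then show "(\<lambda>i\<in>{..<k}. gmul n (v i) a) \<in> (\<lambda>x. x \<odot>\<^sub>r\<^bsub>FM n k\<^esub> a) ` residue v"
      by (rule rev_image_eqI) (simp add: rsmult_FM)
    fix z assume "z \<in> (\<lambda>x. x \<odot>\<^sub>r\<^bsub>FM n k\<^esub> a) ` residue v"
    then obtain x where x: "x \<in> residue v" and z: "z = (\<lambda>i\<in>{..<k}. gmul n (x i) a)" by (auto simp: rsmult_FM)
    have xc: "x \<in> carrier (FM n k)" using x by (simp add: residue_def)
    have "Th z - Th (\<lambda>i\<in>{..<k}. gmul n (v i) a) = smul (Th x - Th v) a"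
      using Th_gmul [OF in_FM_keys [OF xc] a] Th_gmul [OF in_FM_keys [OF v] a]
      by (simp add: z Th_restrict smul_diff_left)
    then show "z \<in> residue (\<lambda>i\<in>{..<k}. gmul n (v i) a)"
      using x gmul_in_FM [OF xc a] bdry_smul [OF _ a] by (simp add: residue_def z)
  qed
  finally show ?thesis .
qed

lemma isomorphic: "right_module_isomorphic (group_ring (FG n)) (decomposition_H1 n (map reduce ws)) QM"
proof -
  let ?M = "decomposition_H1 n (map reduce ws)"
  have carrier: "carrier ?M = carrier H1" by (simp add: decomposition_H1_eq group_ring_module_def)
  have add: "x \<oplus>\<^bsub>?M\<^esub> y = x \<otimes>\<^bsub>H1\<^esub> y" for x y by (simp add: decomposition_H1_eq group_ring_module_def)
  \<comment> \<open>The inverse of the map induced by \<open>cls\<close> and \<open>Th\<close>.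
    Taking the full fibre over \<open>A\<close>, which is a coset, avoids choosing a
    preimage.\<close>
  define h where "h A = {v \<in> carrier (FM n k). cls (Th v) = A}" for A
  have h: "h (cls (Th v)) = residue v" if "v \<in> carrier (FM n k)" for v
    using cls_eq_iff [OF FM_Th_FL] by (auto simp: h_def residue_def)
  have lift: "\<exists>v\<in>carrier (FM n k). A = cls (Th v)" if "A \<in> carrier ?M" for A
  proof -
    from that obtain \<phi> where \<phi>: "\<phi> \<in> FL" "A = cls \<phi>" unfolding carrier by (rule H1E)
    from Th_surj [OF \<phi>(1)] obtain v where "\<forall>i<k. Poly_Mapping.keys (v i) \<subseteq> carrier (FG n)" "Th v = \<phi>" by blast
    then show ?thesis using \<phi>(2) by (intro bexI [of _ "\<lambda>i\<in>{..<k}. v i"]) (simp_all add: Th_restrict restrict_in_FM)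
  qed
  show ?thesis
    unfolding right_module_isomorphic_def
  proof (intro exI [of _ h] conjI ballI)
    show "bij_betw h (carrier ?M) (carrier QM)"
      unfolding bij_betw_def
    proof
      show "inj_on h (carrier ?M)"
      proof (rule inj_onI)
        fix A B assume A: "A \<in> carrier ?M" and "B \<in> carrier ?M" and eq: "h A = h B"
        from lift [OF A] obtain v where v: "v \<in> carrier (FM n k)" "A = cls (Th v)" by blast
        then have "v \<in> h A" by (simp add: h_def)
        then have "v \<in> h B" using eq by simp
        then show "A = B" using v(2) by (simp add: h_def)
      qed
      show "h ` carrier ?M = carrier QM"
      proof
        show "h ` carrier ?M \<subseteq> carrier QM" using lift h unfolding carrier_QM by fastforce
        show "carrier QM \<subseteq> h ` carrier ?M"
        proof
          fix Q assume "Q \<in> carrier QM"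
          then obtain v where v: "v \<in> carrier (FM n k)" "Q = residue v" unfolding carrier_QM by blast
          then have "Q = h (cls (Th v))" by (simp add: h)
          moreover have "cls (Th v) \<in> carrier ?M" unfolding carrier by (rule cls_in_H1 [OF FM_Th_FL [OF v(1)]])
          ultimately show "Q \<in> h ` carrier ?M" by (rule image_eqI)
        qed
      qed
    qed
  next
    fix A B assume "A \<in> carrier ?M" "B \<in> carrier ?M"
    then obtain v w where v: "v \<in> carrier (FM n k)" "A = cls (Th v)" and w: "w \<in> carrier (FM n k)" "B = cls (Th w)"
      using lift by blast
    have "A \<oplus>\<^bsub>?M\<^esub> B = cls (Th (\<lambda>i\<in>{..<k}. v i + w i))"
      unfolding add v(2) w(2) mult_cech [OF FM_Th_FL [OF v(1)] FM_Th_FL [OF w(1)]] Th_restrict Th_add ..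
    then show "h (A \<oplus>\<^bsub>?M\<^esub> B) = h A \<oplus>\<^bsub>QM\<^esub> h B"
      using v w add_in_FM [OF v(1) w(1)] by (simp add: h add_QM)
  next
    fix A a assume "A \<in> carrier ?M" and "a \<in> carrier (group_ring (FG n))"
    then obtain v where v: "v \<in> carrier (FM n k)" "A = cls (Th v)" and a: "Poly_Mapping.keys a \<subseteq> carrier (FG n)"
      using lift by (auto simp: carrier_group_ring)
    have "A \<odot>\<^sub>r\<^bsub>?M\<^esub> a = cls (Th (\<lambda>i\<in>{..<k}. gmul n (v i) a))"
      unfolding v(2) rsmult_cls [OF FM_Th_FL [OF v(1)] a] Th_restrict using Th_gmul [OF in_FM_keys [OF v(1)] a] by simp
    then show "h (A \<odot>\<^sub>r\<^bsub>?M\<^esub> a) = h A \<odot>\<^sub>r\<^bsub>QM\<^esub> a"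
      using v gmul_in_FM [OF v(1) a] by (simp add: h rsmult_QM [OF v(1) a])
  qed
qed

lemma presentation: "is_presentation n k (h1_relations n ws) (decomposition_H1 n (map reduce ws))"
  using isomorphic h1_relations_words [OF ws] unfolding is_presentation_def Let_def N_def by blast

end

theorem theorem5:
  shows "\<exists>A :: recfn. \<forall>(n :: nat) (ws :: word list). set ws \<subseteq> words n \<longrightarrow>
    malnormal_family (free_group n) (map reduce ws) \<longrightarrow>
    (\<exists>k rels. computes A [encode_input n ws] (encode_presentation k rels) \<and>
      is_presentation n k rels (decomposition_H1 n (map reduce ws)))"
proof -
  obtain A where A: "\<forall>n ws. computes A [encode_input n ws]
      (encode_presentation (length ws) (h1_relations n ws))"
    using computes_h1_relations by blast
  have "is_presentation n (length ws) (h1_relations n ws) (decomposition_H1 n (map reduce ws))"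
    if "set ws \<subseteq> words n" "malnormal_family (free_group n) (map reduce ws)" for n ws
  proof -
    interpret word_pattern n ws
      by unfold_locales (rule that)+
    show ?thesis by (rule presentation)
  qed
  with A show ?thesis by blast
qed

end
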